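(* Let $U$ be an $r\times r$ unitary-valued matrix function on $\mathbb T$ such that $\|H_U\|_{\mathrm e}<1$. The following are equivalent: (i) $U$ is very badly approximable; (ii) the Toeplitz operator $T_{zU}:H^2(\mathbb C^r)\to H^2(\mathbb C^r)$ has dense range in $H^2(\mathbb C^r)$; (iii) the Toeplitz operator $T_{\bar zU^*}:H^2(\mathbb C^r)\to H^2(\mathbb C^r)$ has trivial kernel.
   Context: $\mathbb T$ is the unit circle. $\mathbb M_{r,r}$ is the space of complex $r\times r$ matrices with the operator norm; $L^\infty(\mathbb M_{r,r})$ is the space of essentially bounded (measurable) $\mathbb M_{r,r}$-valued functions on $\mathbb T$, and $H^\infty(\mathbb M_{r,r})$ its subspace of bounded analytic matrix functions in the unit disk. $H^2_-(\mathbb C^r)=L^2(\mathbb C^r)\ominus H^2(\mathbb C^r)$; $\mathbb P_+,\mathbb P_-$ are the orthogonal projections of $L^2(\mathbb C^r)$ onto $H^2(\mathbb C^r)$, $H^2_-(\mathbb C^r)$. For $\Phi\in L^\infty(\mathbb M_{r,r})$: $H_\Phi f=\mathbb P_-\Phi f$ (Hankel operator $H^2(\mathbb C^r)\to H^2_-(\mathbb C^r)$) and $T_\Phi f=\mathbb P_+\Phi f$ (Toeplitz operator on $H^2(\mathbb C^r)$). $\|\cdot\|_{\mathrm e}$ is the essential norm (distance to the compact operators). $U^*$ is the pointwise adjoint. For a matrix $A$, $s_j(A)$ is the distance from $A$ to the set of matrices of rank at most $j$. For $\Phi\in L^\infty(\mathbb M_{r,r})$ let $\Omega_0=\{F\in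 H^\infty(\mathbb M_{r,r}): F\text{ minimizes } \operatorname{ess\,sup}_{\zeta\in\mathbb T}\|\Phi(\zeta)-F(\zeta)\|\}$ and, for $1\le j\le r-1$, $\Omega_j=\{F\in\Omega_{j-1}: F\text{ minimizes } \operatorname{ess\,sup}_{\zeta\in\mathbb T}s_j(\Phi(\zeta)-F(\zeta))\}$. Elements of $\Omega_{r-1}$ are superoptimal approximations of $\Phi$; $\Phi$ is very badly approximable if the zero function is a superoptimal approximation of $\Phi$. *)

theory Defs
  imports "HOL-Analysis.Analysis" "HOL-Probability.Essential_Supremum"
begin

text \<open>
  Elements of the Lebesgue spaces on the circle are represented by Borel functions; no quotient
  by almost everywhere equality is formed. All notions below are invariant under changes on null
  sets, and equality of elements of a Lebesgue space is equality almost everywhere.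
\<close>

definition circle_measure :: "complex measure" where
  "circle_measure =
     distr (uniform_measure lborel {0..2 * pi}) (restrict_space borel (sphere 0 1)) cis"


subsection \<open>Matrices\<close>

definition op_norm :: "complex ^ 'n ^ 'm \<Rightarrow> real" where
  "op_norm A = onorm (\<lambda>x. A *v x)"

definition sing_val :: "nat \<Rightarrow> complex ^ 'n ^ 'm \<Rightarrow> real" where
  "sing_val j A = Inf {op_norm (A - B) |B. rank B \<le> j}"

definition adjoint_matrix :: "complex ^ 'n ^ 'm \<Rightarrow> complex ^ 'm ^ 'n" where
  "adjoint_matrix A = map_matrix cnj (transpose A)"

definition unitary_matrix :: "complex ^ 'n ^ 'n \<Rightarrow> bool" where
  "unitary_matrix A \<longleftrightarrow>
     adjoint_matrix A ** A = mat 1 \<and> A ** adjoint_matrix A = mat 1"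


subsection \<open>Vector functions\<close>

definition L2 :: "(complex \<Rightarrow> complex ^ 'r) set" where
  "L2 = {f \<in> borel_measurable circle_measure.
           integrable circle_measure (\<lambda>\<zeta>. (norm (f \<zeta>))\<^sup>2)}"

definition L2_norm :: "(complex \<Rightarrow> complex ^ 'r) \<Rightarrow> real" where
  "L2_norm f = sqrt (LINT \<zeta>|circle_measure. (norm (f \<zeta>))\<^sup>2)"

definition L2_inner :: "(complex \<Rightarrow> complex ^ 'r) \<Rightarrow> (complex \<Rightarrow> complex ^ 'r) \<Rightarrow> complex" where
  "L2_inner f g = (LINT \<zeta>|circle_measure. (\<Sum>i\<in>UNIV. f \<zeta> $ i * cnj (g \<zeta> $ i)))"

definition fourier_coeff :: "(complex \<Rightarrow> complex ^ 'r) \<Rightarrow> int \<Rightarrow> complex ^ 'r" where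
  "fourier_coeff f n = (LINT \<zeta>|circle_measure. (\<zeta> powi (- n)) *s f \<zeta>)"

definition H2 :: "(complex \<Rightarrow> complex ^ 'r) set" where
  "H2 = {f \<in> L2. \<forall>n<0. fourier_coeff f n = 0}"

definition H2_minus :: "(complex \<Rightarrow> complex ^ 'r) set" where
  "H2_minus = {f \<in> L2. \<forall>g\<in>H2. L2_inner f g = 0}"

text \<open>
  The value of an orthogonal projection is determined only up to a null set;
  the choice operator picks a representative.
\<close>

definition orth_proj ::
    "(complex \<Rightarrow> complex ^ 'r) set \<Rightarrow> (complex \<Rightarrow> complex ^ 'r) \<Rightarrow> (complex \<Rightarrow> complex ^ 'r)" where
  "orth_proj S f = (SOME g. g \<in> S \<and> (\<forall>h\<in>S. L2_inner (\<lambda>\<zeta>. f \<zeta> - g \<zeta>) h = 0))"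

definition P_plus :: "(complex \<Rightarrow> complex ^ 'r) \<Rightarrow> (complex \<Rightarrow> complex ^ 'r)" where
  "P_plus = orth_proj H2"

definition P_minus :: "(complex \<Rightarrow> complex ^ 'r) \<Rightarrow> (complex \<Rightarrow> complex ^ 'r)" where
  "P_minus = orth_proj H2_minus"


subsection \<open>Matrix functions\<close>

definition Linf :: "(complex \<Rightarrow> complex ^ 'r ^ 'r) set" where
  "Linf = {F \<in> borel_measurable circle_measure.
             \<exists>C. AE \<zeta> in circle_measure. op_norm (F \<zeta>) \<le> C}"

text \<open>
  A bounded analytic matrix function \<open>G\<close> in the disk is identified with the function of its
  radial boundary values.
\<close>

definition Hinf :: "(complex \<Rightarrow> complex ^ 'r ^ 'r) set" where
  "Hinf = {F \<in> Linf. \<exists>G.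
             (\<forall>i j. (\<lambda>z. G z $ i $ j) holomorphic_on ball 0 1) \<and>
             bounded (G ` ball 0 1) \<and>
             (AE \<zeta> in circle_measure. ((\<lambda>t. G (of_real t * \<zeta>)) \<longlongrightarrow> F \<zeta>) (at_left 1))}"

definition hankel ::
    "(complex \<Rightarrow> complex ^ 'r ^ 'r) \<Rightarrow> (complex \<Rightarrow> complex ^ 'r) \<Rightarrow> (complex \<Rightarrow> complex ^ 'r)" where
  "hankel \<Phi> f = P_minus (\<lambda>\<zeta>. \<Phi> \<zeta> *v f \<zeta>)"

definition toeplitz ::
    "(complex \<Rightarrow> complex ^ 'r ^ 'r) \<Rightarrow> (complex \<Rightarrow> complex ^ 'r) \<Rightarrow> (complex \<Rightarrow> complex ^ 'r)" where
  "toeplitz \<Phi> f = P_plus (\<lambda>\<zeta>. \<Phi> \<zeta> *v f \<zeta>)"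


subsection \<open>Operators between subspaces of \<open>L2\<close>\<close>

definition linear_op ::
    "(complex \<Rightarrow> complex ^ 'r) set \<Rightarrow> (complex \<Rightarrow> complex ^ 'r) set \<Rightarrow>
     ((complex \<Rightarrow> complex ^ 'r) \<Rightarrow> (complex \<Rightarrow> complex ^ 'r)) \<Rightarrow> bool" where
  "linear_op S S' T \<longleftrightarrow>
     (\<forall>f\<in>S. T f \<in> S') \<and>
     (\<forall>f\<in>S. \<forall>g\<in>S. AE \<zeta> in circle_measure. T (\<lambda>\<zeta>. f \<zeta> + g \<zeta>) \<zeta> = T f \<zeta> + T g \<zeta>) \<and>
     (\<forall>c. \<forall>f\<in>S. AE \<zeta> in circle_measure. T (\<lambda>\<zeta>. c *s f \<zeta>) \<zeta> = c *s T f \<zeta>)"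

text \<open>
  Boundedness, and hence compatibility with almost everywhere equality, follows from the
  sequential compactness condition.
\<close>

definition compact_op ::
    "(complex \<Rightarrow> complex ^ 'r) set \<Rightarrow> (complex \<Rightarrow> complex ^ 'r) set \<Rightarrow>
     ((complex \<Rightarrow> complex ^ 'r) \<Rightarrow> (complex \<Rightarrow> complex ^ 'r)) \<Rightarrow> bool" where
  "compact_op S S' K \<longleftrightarrow>
     linear_op S S' K \<and>
     (\<forall>f :: nat \<Rightarrow> complex \<Rightarrow> complex ^ 'r. (\<forall>n. f n \<in> S \<and> L2_norm (f n) \<le> 1) \<longrightarrow>
        (\<exists>\<rho> :: nat \<Rightarrow> nat. \<exists>g\<in>S'. strict_mono \<rho> \<and>
           (\<lambda>n. L2_norm (\<lambda>\<zeta>. K (f (\<rho> n)) \<zeta> - g \<zeta>)) \<longlonglongrightarrow> 0))"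

definition L2_op_norm ::
    "(complex \<Rightarrow> complex ^ 'r) set \<Rightarrow>
     ((complex \<Rightarrow> complex ^ 'r) \<Rightarrow> (complex \<Rightarrow> complex ^ 'r)) \<Rightarrow> ereal" where
  "L2_op_norm S T = (SUP f \<in> {f \<in> S. L2_norm f \<le> 1}. ereal (L2_norm (T f)))"

definition ess_norm ::
    "(complex \<Rightarrow> complex ^ 'r) set \<Rightarrow> (complex \<Rightarrow> complex ^ 'r) set \<Rightarrow>
     ((complex \<Rightarrow> complex ^ 'r) \<Rightarrow> (complex \<Rightarrow> complex ^ 'r)) \<Rightarrow> ereal" where
  "ess_norm S S' T =
     (INF K \<in> {K. compact_op S S' K}. L2_op_norm S (\<lambda>f \<zeta>. T f \<zeta> - K f \<zeta>))"

definition dense_range ::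
    "(complex \<Rightarrow> complex ^ 'r) set \<Rightarrow> (complex \<Rightarrow> complex ^ 'r) set \<Rightarrow>
     ((complex \<Rightarrow> complex ^ 'r) \<Rightarrow> (complex \<Rightarrow> complex ^ 'r)) \<Rightarrow> bool" where
  "dense_range S S' T \<longleftrightarrow>
     (\<forall>g\<in>S'. \<forall>\<epsilon>>0. \<exists>f\<in>S. L2_norm (\<lambda>\<zeta>. T f \<zeta> - g \<zeta>) < \<epsilon>)"

definition trivial_kernel ::
    "(complex \<Rightarrow> complex ^ 'r) set \<Rightarrow>
     ((complex \<Rightarrow> complex ^ 'r) \<Rightarrow> (complex \<Rightarrow> complex ^ 'r)) \<Rightarrow> bool" where
  "trivial_kernel S T \<longleftrightarrow>
     (\<forall>f\<in>S. (AE \<zeta> in circle_measure. T f \<zeta> = 0) \<longrightarrow> (AE \<zeta> in circle_measure. f \<zeta> = 0))"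


subsection \<open>Superoptimal approximation\<close>

primrec Omega :: "(complex \<Rightarrow> complex ^ 'r ^ 'r) \<Rightarrow> nat \<Rightarrow> (complex \<Rightarrow> complex ^ 'r ^ 'r) set" where
  "Omega \<Phi> 0 = {F \<in> Hinf. \<forall>G\<in>Hinf.
     esssup circle_measure (\<lambda>\<zeta>. ereal (op_norm (\<Phi> \<zeta> - F \<zeta>)))
       \<le> esssup circle_measure (\<lambda>\<zeta>. ereal (op_norm (\<Phi> \<zeta> - G \<zeta>)))}"
| "Omega \<Phi> (Suc j) = {F \<in> Omega \<Phi> j. \<forall>G\<in>Omega \<Phi> j.
     esssup circle_measure (\<lambda>\<zeta>. ereal (sing_val (Suc j) (\<Phi> \<zeta> - F \<zeta>)))
       \<le> esssup circle_measure (\<lambda>\<zeta>. ereal (sing_val (Suc j) (\<Phi> \<zeta> - G \<zeta>)))}"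

definition superoptimal ::
    "(complex \<Rightarrow> complex ^ 'r ^ 'r) \<Rightarrow> (complex \<Rightarrow> complex ^ 'r ^ 'r) set" where
  "superoptimal (\<Phi> :: complex \<Rightarrow> complex ^ 'r ^ 'r) = Omega \<Phi> (CARD('r) - 1)"

definition very_badly_approximable :: "(complex \<Rightarrow> complex ^ 'r ^ 'r) \<Rightarrow> bool" where
  "very_badly_approximable \<Phi> \<longleftrightarrow> (\<lambda>\<zeta>. 0) \<in> superoptimal \<Phi>"

end

theory Submission
  imports Defs "HOL-Complex_Analysis.Cauchy_Integral_Formula" "HOL-Probability.Probability_Measure"
begin

text \<open>
  Let \<open>T\<close> and \<open>H\<close> be the Toeplitz and the Hankel operator of the unitary-valued function \<open>U\<close>, and write
  \<open>z\<close> for the coordinate on the circle.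

  \<^bold>\<open>Dense range and trivial kernel.\<close> The Toeplitz operators with symbols \<open>zU\<close> and \<open>(zU)\<^sup>*\<close> are adjoint
  to each other, so the orthogonal complement of the range of the first is the kernel of the second
  (\<open>dense_range_iff_trivial_kernel\<close>).

  \<^bold>\<open>Use of the essential norm.\<close> On \<open>H2\<close> one has \<open>\<parallel>f\<parallel>\<^sup>2 = \<parallel>T f\<parallel>\<^sup>2 + \<parallel>H f\<parallel>\<^sup>2\<close>, and \<open>H\<close> is a strict
  contraction up to a compact operator. Hence a bounded sequence whose images under \<open>T\<close> converge has a
  convergent subsequence (\<open>toeplitz_proper\<close>), and \<open>T\<close> is bounded below modulo its kernel, also on
  \<open>z H2\<close> (\<open>toeplitz_bounded_below\<close>). In particular, if the Toeplitz operator with symbol \<open>zU\<close> has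
  dense range, then it is onto (\<open>dense_range_imp_surj\<close>).

  \<^bold>\<open>Dense range implies very badly approximable.\<close> Choose \<open>k\<^sub>j\<close> in \<open>z H2\<close> with \<open>T k\<^sub>j = e\<^sub>j\<close>, the standard
  unit vectors. Then \<open>v\<^sub>j = U k\<^sub>j\<close> lies in \<open>e\<^sub>j + H2_minus\<close>, so \<open>f\<^sub>j = k\<^sub>j / z\<close> is a vector of \<open>H2\<close> with
  \<open>U f\<^sub>j\<close> in \<open>H2_minus\<close>. If \<open>F\<close> in \<open>Hinf\<close> satisfies \<open>\<parallel>U - F\<parallel> \<le> 1\<close>, then \<open>F f\<^sub>j\<close> and \<open>U f\<^sub>j\<close> are
  orthogonal, \<open>\<parallel>F f\<^sub>j\<parallel>\<^sup>2 + \<parallel>U f\<^sub>j\<parallel>\<^sup>2 \<le> \<parallel>f\<^sub>j\<parallel>\<^sup>2\<close>, and therefore \<open>F k\<^sub>j = 0\<close>: the matrix \<open>F U\<^sup>*\<close>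
  annihilates every \<open>v\<^sub>j\<close>. The entrywise conjugate of the matrix with columns \<open>v\<^sub>j\<close> is analytic and
  equals the identity at the origin, so its determinant should not vanish. Its entries are only
  square integrable, but a suitable limit of scalar multiples of it has constant norm and still equals the
  identity at the origin (\<open>constant_modulus_multiple\<close>); the determinant of that bounded analytic matrix has
  mean \<open>1\<close>. It follows that \<open>F\<close> vanishes on a set of positive measure (\<open>approximant_zero\<close>), where all
  singular values of \<open>U - F\<close> are those of \<open>U\<close>, namely \<open>1\<close>. So no approximant improves on zero at any
  stage (\<open>very_badly_approximable_if\<close>).

  \<^bold>\<open>Very badly approximable implies trivial kernel.\<close> Suppose that \<open>f \<noteq> 0\<close> lies in the kernel of the
  Toeplitz operator with symbol \<open>(zU)\<^sup>*\<close>, and put \<open>w = U\<^sup>* f\<close>. Then \<open>w\<close> is antianalytic, it vanishes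
  almost nowhere, and it is pointwise orthogonal to every vector in the kernel of \<open>T\<close>. With \<open>u = w / |w|\<close>
  and \<open>\<Lambda> = 1 - \<delta> u u\<^sup>*\<close>, boundedness below modulo the kernel yields \<open>\<parallel>H k\<parallel>\<^sup>2 \<le> \<langle>\<Lambda> k, k\<rangle>\<close> on
  \<open>H2\<close> for small \<open>\<delta> > 0\<close>. A Nehari theorem with weight \<open>\<Lambda>\<close> (\<open>weighted_nehari\<close>) provides \<open>F\<close> in \<open>Hinf\<close>
  with \<open>|(U - F) x|\<^sup>2 \<le> \<langle>\<Lambda> x, x\<rangle>\<close> pointwise. Thus \<open>\<parallel>U - F\<parallel> \<le> 1\<close>, while the choice \<open>x = u\<close> shows that
  the smallest singular value of \<open>U - F\<close> is at most \<open>sqrt (1 - \<delta>)\<close> (\<open>kernel_gives_approximant\<close>), and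
  zero is not superoptimal (\<open>not_very_badly_approximable\<close>).

  \<^bold>\<open>The weighted Nehari theorem\<close> is proved by choosing the Fourier coefficients of \<open>F\<close> one after the
  other (\<open>hankel_dominated_step\<close>): each of them is the missing block of a partially given positive
  semidefinite form (\<open>psd_completion\<close>). The analysis on the circle rests on the radial limit theorem for
  Poisson integrals (\<open>fatou_radial\<close>), which gives uniqueness of Fourier coefficients, the boundary values
  of bounded analytic functions, and pointwise inequalities from integrated ones.
\<close>

\<comment> \<open>The infix dollar denotes vector components throughout.\<close>
no_notation fps_nth (infixl "$" 75)

abbreviation "\<mu> \<equiv> circle_measure"

section \<open>Normalized arc length on the circle\<close>

lemma cis_measurable_circle:
  "cis \<in> measurable (uniform_measure lborel {0..2 * pi}) (restrict_space borel (sphere 0 1))"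
proof (rule measurable_restrict_space2)
  have "cis \<in> borel_measurable borel"
    by (intro borel_measurable_continuous_onI continuous_intros)
  then show "cis \<in> borel_measurable (uniform_measure lborel {0..2 * pi})"
    by (simp add: measurable_def)
qed auto

lemma space_circle [simp]: "space \<mu> = sphere 0 1"
  by (simp add: circle_measure_def space_restrict_space)

lemma sets_circle [measurable_cong]: "sets \<mu> = sets (restrict_space borel (sphere 0 1))"
  by (simp add: circle_measure_def)

lemma Int_sphere_sets_circle [intro]: "A \<in> sets borel \<Longrightarrow> A \<inter> sphere 0 1 \<in> sets \<mu>"
  unfolding sets_circle sets_restrict_space by (subst Int_commute) (rule imageI)

lemma prob_space_circle: "prob_space \<mu>"
proof -
  interpret prob_space "uniform_measure lborel {0..2 * pi}"
    by (rule prob_space_uniform_measure) auto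
  show ?thesis
    unfolding circle_measure_def by (rule prob_space_distr) (rule cis_measurable_circle)
qed

interpretation circle: prob_space \<mu>
  by (rule prob_space_circle)

lemma borel_imp_circle_measurable: "f \<in> borel_measurable borel \<Longrightarrow> f \<in> borel_measurable \<mu>"
  unfolding measurable_cong_sets[OF sets_circle refl] by (rule measurable_restrict_space1)

lemma continuous_circle_measurable [intro]:
  "continuous_on (sphere 0 1) f \<Longrightarrow> f \<in> borel_measurable \<mu>"
  unfolding measurable_cong_sets[OF sets_circle refl]
  by (rule borel_measurable_continuous_on_restrict)

lemma AE_circle_norm: "AE \<zeta> in \<mu>. norm \<zeta> = 1"
  by (rule AE_I2) simp

lemma powi_measurable [measurable]: "(\<lambda>\<zeta>. \<zeta> powi n) \<in> borel_measurable \<mu>"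
  by (rule continuous_circle_measurable) (auto intro!: continuous_intros)

lemma ident_circle_measurable [measurable]: "(\<lambda>\<zeta>. \<zeta>) \<in> borel_measurable \<mu>"
  by (rule continuous_circle_measurable) (auto intro!: continuous_intros)

lemma integral_circle_powi: "(LINT \<zeta>|\<mu>. \<zeta> powi n) = (if n = 0 then 1 else 0)"
proof (cases "n = 0")
  case False
  have "(LINT \<zeta>|\<mu>. \<zeta> powi n) = (LINT t|uniform_measure lborel {0..2 * pi}. cis t powi n)"
    unfolding circle_measure_def
    by (rule integral_distr[OF cis_measurable_circle])
       (simp add: measurable_cong_sets[OF sets_circle[symmetric] refl])
  also have "\<dots> = (LINT t|density lborel (\<lambda>t. ennreal (indicator {0..2*pi} t / (2*pi))). cis t powi n)"
    unfolding uniform_measure_def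
    by (rule arg_cong[where f="\<lambda>M. integral\<^sup>L M _"], rule density_cong)
       (auto simp: indicator_def divide_ennreal ennreal_1[symmetric] simp del: ennreal_1)
  also have "\<dots> = (LINT t|lborel. (indicator {0..2*pi} t / (2*pi)) *\<^sub>R cis t powi n)"
    by (rule integral_density) (auto intro!: borel_measurable_continuous_onI continuous_intros)
  also have "\<dots> = (1/(2*pi)) *\<^sub>R (LINT t|lborel. indicator {0..2*pi} t *\<^sub>R cis t powi n)"
    by (subst integral_scaleR_right[symmetric]) (auto simp: divide_simps)
  also have "(LINT t|lborel. indicator {0..2*pi} t *\<^sub>R cis t powi n)
      = cis (of_int n * (2*pi)) / (\<i> * of_int n) - cis (of_int n * 0) / (\<i> * of_int n)"
  proof (rule integral_FTC_Icc)
    show "((\<lambda>t. cis (of_int n * t) / (\<i> * of_int n)) has_vector_derivative cis x powi n) (at x within {0..2*pi})"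
      for x
    proof -
      have "((\<lambda>z. exp (\<i> * of_int n * z) / (\<i> * of_int n)) has_field_derivative exp (\<i> * of_int n * of_real x))
          (at (of_real x))"
        using False by (auto intro!: derivative_eq_intros simp: field_simps)
      from has_vector_derivative_real_field[OF this] show ?thesis
        by (simp only: cis_power_int) (simp add: cis_conv_exp mult_ac)
    qed
  qed (auto intro!: continuous_intros)
  also have "cis (of_int n * (2*pi)) = 1"
    by (metis cis_multiple_2pi Ints_of_int mult.commute)
  finally show ?thesis using False by simp
qed (use circle.prob_space in simp)

text \<open>
  Concavity of the sine would give the constant \<open>2 / pi\<close>; one half is enough here.
\<close>

lemma abs_sin_ge_half:
  assumes "\<bar>t\<bar> \<le> pi/2" shows "\<bar>t\<bar> / 2 \<le> \<bar>sin t\<bar>"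
proof -
  have main: "t / 2 \<le> sin t" if t: "0 \<le> t" "t \<le> pi/2" for t :: real
  proof (cases "t \<le> pi/3")
    case True
    show ?thesis
    proof (cases "t = 0")
      case False
      have "\<exists>z>0. z < t \<and> sin t - sin 0 = (t - 0) * cos z"
        by (rule MVT2) (use t False in \<open>auto intro!: derivative_eq_intros\<close>)
      then obtain z where z: "0 < z" "z < t" "sin t = t * cos z" by auto
      have "cos (pi/3) \<le> cos z"
        by (rule cos_monotone_0_pi_le) (use z True in auto)
      then have "1/2 \<le> cos z" by (simp add: cos_60)
      then show ?thesis using z t mult_left_mono[of "1/2" "cos z" t] by simp
    qed auto
  next
    case False
    have "sin (pi/3) \<le> sin t"
      by (rule sin_monotone_2pi_le) (use False t in auto)
    moreover have "t / 2 \<le> 4/5" using t pi_less_4 pi_approx by (simp add: field_simps)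
    moreover have "(4/5::real) \<le> sqrt 3 / 2"
      using real_le_rsqrt[of "8/5" 3] by (simp add: power2_eq_square)
    ultimately show ?thesis by (simp add: sin_60)
  qed
  show ?thesis
    using main[of t] main[of "-t"] assms by (cases "t \<ge> 0") auto
qed

lemma norm_cis_diff: "norm (cis a - cis b) = 2 * \<bar>sin ((a - b) / 2)\<bar>"
proof -
  have "(norm (cis a - cis b))\<^sup>2 = (2 * \<bar>sin ((a - b) / 2)\<bar>)\<^sup>2"
  proof -
    have "(norm (cis a - cis b))\<^sup>2 = (cos a - cos b)\<^sup>2 + (sin a - sin b)\<^sup>2"
      by (simp add: cmod_power2)
    also have "\<dots> = 2 - 2 * cos (a - b)"
      using sin_cos_squared_add[of a] sin_cos_squared_add[of b]
      by (simp add: cos_diff power2_eq_square algebra_simps)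
    also have "cos (a - b) = 1 - 2 * (sin ((a-b)/2))\<^sup>2"
      using cos_double_sin[of "(a-b)/2"] by (metis field_sum_of_halves mult_2)
    finally show ?thesis by (simp add: power_mult_distrib)
  qed
  then show ?thesis by (subst (asm) power2_eq_iff_nonneg) auto
qed

text \<open>
  The angles \<open>t\<close> with \<open>cis t\<close> within \<open>\<rho>\<close> of \<open>cis \<alpha>\<close> lie within \<open>2 \<rho>\<close> of \<open>\<alpha>\<close> modulo \<open>2 pi\<close>; for
  \<open>t\<close> in \<open>[0, 2 pi]\<close> three translates of that interval are enough.
\<close>

lemma measure_circle_ball:
  assumes a: "norm a = 1" and \<rho>: "0 < \<rho>"
  shows "emeasure \<mu> (ball a \<rho> \<inter> sphere 0 1) \<le> ennreal (2 * \<rho>)"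
proof -
  obtain \<alpha> where \<alpha>: "0 \<le> \<alpha>" "\<alpha> < 2*pi" "a = cis \<alpha>"
    using a by (metis Arg2pi_ge_0 Arg2pi_lt_2pi Arg2pi_eq cis_conv_exp mult_1 of_real_1)
  define J where "J = (\<Union>k\<in>{-1,0,1::real}. {\<alpha> + 2*pi*k - 2*\<rho> .. \<alpha> + 2*pi*k + 2*\<rho>})"
  have sub: "{0..2*pi} \<inter> cis -` ball a \<rho> \<subseteq> J"
  proof
    fix t assume "t \<in> {0..2*pi} \<inter> cis -` ball a \<rho>"
    then have t: "0 \<le> t" "t \<le> 2*pi" "norm (cis t - cis \<alpha>) < \<rho>"
      using \<alpha> by (auto simp: dist_norm norm_minus_commute)
    define s where "s = (t - \<alpha>)/2"
    have s: "2 * \<bar>sin s\<bar> < \<rho>" using t(3) norm_cis_diff[of t \<alpha>] by (simp add: s_def)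
    have sb: "-pi \<le> s" "s \<le> pi" using t \<alpha> by (auto simp: s_def)
    have "\<exists>k\<in>{-1,0,1::real}. \<bar>s - pi*k\<bar> \<le> pi/2"
    proof -
      consider "\<bar>s\<bar> \<le> pi/2" | "s > pi/2" | "s < -pi/2" by linarith
      then show ?thesis using sb by cases auto
    qed
    then obtain k where k: "k \<in> {-1,0,1::real}" "\<bar>s - pi*k\<bar> \<le> pi/2" by (elim bexE)
    have "\<bar>sin (s - pi*k)\<bar> = \<bar>sin s\<bar>" using k(1) by (auto simp: sin_diff)
    then have "\<bar>s - pi*k\<bar> < \<rho>" using abs_sin_ge_half[OF k(2)] s by simp
    then have "t \<in> {\<alpha> + 2*pi*k - 2*\<rho> .. \<alpha> + 2*pi*k + 2*\<rho>}"
      unfolding s_def by (auto simp: abs_if field_simps split: if_splits)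
    then show "t \<in> J" unfolding J_def using k(1) by blast
  qed
  have Jm: "J \<in> sets lborel" unfolding J_def by auto
  have "emeasure lborel J \<le> (\<Sum>k\<in>{-1,0,1::real}. emeasure lborel {\<alpha> + 2*pi*k - 2*\<rho> .. \<alpha> + 2*pi*k + 2*\<rho>})"
    unfolding J_def by (rule emeasure_subadditive_finite) auto
  also have "\<dots> = ennreal (12 * \<rho>)"
    using \<rho> by (simp add: algebra_simps mult_2[symmetric]) (simp add: ennreal_numeral[symmetric] ennreal_mult'[symmetric]
        del: ennreal_numeral)
  finally have J: "emeasure lborel J \<le> ennreal (12*\<rho>)" .
  have "emeasure \<mu> (ball a \<rho> \<inter> sphere 0 1)
      = emeasure (uniform_measure lborel {0..2*pi}) (cis -` (ball a \<rho> \<inter> sphere 0 1) \<inter> space (uniform_measure lborel {0..2*pi}))"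
    unfolding circle_measure_def
    by (rule emeasure_distr[OF cis_measurable_circle])
       (unfold sets_circle[symmetric], rule Int_sphere_sets_circle, simp)
  also have "\<dots> = emeasure lborel ({0..2*pi} \<inter> cis -` ball a \<rho>) / ennreal (2*pi)"
  proof -
    have eq: "cis -` (ball a \<rho> \<inter> sphere 0 1) \<inter> space (uniform_measure lborel {0..2*pi}) = cis -` ball a \<rho>"
      by auto
    have "cis -` ball a \<rho> \<inter> space borel \<in> sets borel"
      by (rule measurable_sets[of cis borel borel]) (auto intro!: borel_measurable_continuous_onI continuous_intros)
    then show ?thesis unfolding eq by (subst emeasure_uniform_measure) auto
  qed
  also have "\<dots> \<le> ennreal (12*\<rho>) / ennreal (2*pi)"
    by (rule divide_right_mono_ennreal, rule order_trans[OF emeasure_mono[OF sub Jm] J])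
  also have "\<dots> \<le> ennreal (2*\<rho>)"
    using \<rho> pi_gt3 by (subst divide_ennreal) (auto simp: field_simps intro!: ennreal_leI mult_left_mono)
  finally show ?thesis .
qed


section \<open>Small averages and the Poisson kernel\<close>

text \<open>
  The set \<open>B\<close> is not assumed to be measurable.
\<close>

lemma null_set_by_covers:
  assumes "\<And>e::real. 0 < e \<Longrightarrow> \<exists>N\<in>sets M. B \<subseteq> N \<and> emeasure M N \<le> ennreal e"
  shows "AE x in M. x \<notin> B"
proof -
  have "\<forall>k::nat. \<exists>N\<in>sets M. B \<subseteq> N \<and> emeasure M N \<le> ennreal (1 / Suc k)"
    using assms by simp
  then obtain N where N: "\<And>k::nat. N k \<in> sets M" "\<And>k. B \<subseteq> N k" "\<And>k. emeasure M (N k) \<le> ennreal (1 / Suc k)"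
    by metis
  have "emeasure M (\<Inter>k. N k) \<le> ennreal e" if e: "0 < e" for e :: real
  proof -
    obtain k :: nat where k: "1 / Suc k < e" using reals_Archimedean[OF e] by (auto simp only: inverse_eq_divide)
    have "emeasure M (\<Inter>k. N k) \<le> emeasure M (N k)"
      by (rule emeasure_mono) (use N in auto)
    also have "\<dots> \<le> ennreal (1 / Suc k)" by (rule N)
    also have "\<dots> \<le> ennreal e" by (rule ennreal_leI) (use k in simp)
    finally show ?thesis .
  qed
  then have "emeasure M (\<Inter>k. N k) = 0"
    by (metis ennreal_le_epsilon add_0 le_zero_eq)
  then have "(\<Inter>k. N k) \<in> null_sets M"
    using N by (intro null_setsI) auto
  then show ?thesis
    by (rule AE_I') (use N in auto)
qed

text \<open>
  A nonnegative integrable function has vanishing density at almost every point of a set on which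
  it vanishes. The measure with density \<open>v\<close> is small on an open neighbourhood of that set,
  and the points where the averages stay large are covered by few balls (Vitali).
\<close>

lemma vanishing_density_AE:
  fixes v :: "complex \<Rightarrow> real"
  assumes v: "integrable \<mu> v" "\<And>w. 0 \<le> v w" and E: "E \<in> sets \<mu>" "\<And>w. w \<in> E \<Longrightarrow> v w = 0"
  shows "AE \<zeta> in \<mu>. \<zeta> \<in> E \<longrightarrow> (\<forall>\<epsilon>>0. \<exists>\<rho>0>0. \<forall>\<rho>. 0 < \<rho> \<and> \<rho> < \<rho>0 \<longrightarrow>
           (LINT w|\<mu>. indicator (ball \<zeta> \<rho>) w * v w) \<le> \<epsilon> * \<rho>)"
proof -
  define \<nu> where "\<nu> = distr (density \<mu> (\<lambda>w. ennreal (v w))) borel (\<lambda>w. w)"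
  have [measurable]: "v \<in> borel_measurable \<mu>" using v(1) by auto
  have idm: "(\<lambda>w. w) \<in> measurable (density \<mu> (\<lambda>w. ennreal (v w))) borel"
    by simp
  have \<nu>: "emeasure \<nu> A = (\<integral>\<^sup>+w. ennreal (v w) * indicator A w \<partial>\<mu>)" if A: "A \<in> sets borel" for A
  proof -
    have "A \<inter> sphere 0 1 \<in> sets \<mu>" using A by (rule Int_sphere_sets_circle)
    then have "emeasure \<nu> A = (\<integral>\<^sup>+w. ennreal (v w) * indicator (A \<inter> sphere 0 1) w \<partial>\<mu>)"
      unfolding \<nu>_def using A
      by (subst emeasure_distr[OF idm]) (auto simp: emeasure_density)
    also have "\<dots> = (\<integral>\<^sup>+w. ennreal (v w) * indicator A w \<partial>\<mu>)"
      by (rule nn_integral_cong) (auto simp: indicator_def)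
    finally show ?thesis .
  qed
  have vint: "(\<integral>\<^sup>+w. ennreal (v w) \<partial>\<mu>) < \<infinity>"
    using v by (simp add: nn_integral_eq_integral)
  have sets\<nu>[simp]: "sets \<nu> = sets borel" by (simp add: \<nu>_def)
  have fin: "emeasure \<nu> (space \<nu>) \<noteq> \<infinity>"
    using \<nu>[of UNIV] vint by (simp add: \<nu>_def)
  have Eb: "E \<in> sets borel"
    using E(1) by (auto simp: sets_circle sets_restrict_space)
  have ball_int: "emeasure \<nu> (ball \<zeta> \<rho>) = ennreal (LINT w|\<mu>. indicator (ball \<zeta> \<rho>) w * v w)" for \<zeta> \<rho>
  proof -
    have "integrable \<mu> (\<lambda>w. indicator (ball \<zeta> \<rho>) w * v w)"
      using v(1) by (rule Bochner_Integration.integrable_bound)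
        (auto simp: indicator_def intro!: borel_measurable_times borel_imp_circle_measurable)
    then show ?thesis
      using v by (subst \<nu>) (auto simp: nn_integral_eq_integral[symmetric] ennreal_mult' ennreal_indicator mult.commute)
  qed
  \<comment> \<open>The points of \<open>E\<close> where the averages exceed \<open>\<epsilon>\<close> at arbitrarily small scales form a null set.\<close>
  have bad: "AE \<zeta> in \<mu>. \<zeta> \<notin> {\<zeta>\<in>E. \<forall>\<rho>0>0. \<exists>\<rho>. 0 < \<rho> \<and> \<rho> < \<rho>0 \<and>
           \<epsilon> * \<rho> < (LINT w|\<mu>. indicator (ball \<zeta> \<rho>) w * v w)}" (is "AE \<zeta> in \<mu>. \<zeta> \<notin> ?B")
    if \<epsilon>: "0 < \<epsilon>" for \<epsilon> :: real
  proof -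
    define B where "B = ?B"
    have BE: "\<zeta> \<in> E" if "\<zeta> \<in> B" for \<zeta> using that unfolding B_def by blast
    have Bbad: "\<exists>\<rho>. 0 < \<rho> \<and> \<rho> < \<rho>0 \<and> \<epsilon> * \<rho> < (LINT w|\<mu>. indicator (ball \<zeta> \<rho>) w * v w)"
      if "\<zeta> \<in> B" "0 < \<rho>0" for \<zeta> \<rho>0 using that unfolding B_def by blast
    have "AE \<zeta> in \<mu>. \<zeta> \<notin> B"
    proof (rule null_set_by_covers)
      fix e :: real assume e: "0 < e"
      have "emeasure \<nu> E = (\<integral>\<^sup>+w. 0 \<partial>\<mu>)"
        unfolding \<nu>[OF Eb] by (rule nn_integral_cong) (auto simp: indicator_def E(2))
      then have "emeasure \<nu> E = 0" by simp
      then have "(INF U \<in> {U. E \<subseteq> U \<and> open U}. emeasure \<nu> U) < ennreal (e * \<epsilon> / 10)"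
        using outer_regular[OF sets\<nu> fin Eb] e \<epsilon> by simp
      then obtain O1 where O1: "E \<subseteq> O1" "open O1" "emeasure \<nu> O1 < ennreal (e * \<epsilon> / 10)"
        by (auto simp: INF_less_iff)
      have "\<exists>\<rho>. 0 < \<rho> \<and> \<rho> < 1 \<and> ball \<zeta> \<rho> \<subseteq> O1 \<and> \<epsilon> * \<rho> < (LINT w|\<mu>. indicator (ball \<zeta> \<rho>) w * v w)"
        if \<zeta>B: "\<zeta> \<in> B" for \<zeta>
      proof -
        have "\<zeta> \<in> E" by (rule BE[OF \<zeta>B])
        then have "\<zeta> \<in> O1" using O1(1) by (rule rev_subsetD)
        then obtain d where d: "d > 0" "ball \<zeta> d \<subseteq> O1" by (rule openE[OF O1(2)])
        have "min 1 d > 0" using d by simp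
        then obtain \<rho> where "0 < \<rho>" "\<rho> < min 1 d" "\<epsilon> * \<rho> < (LINT w|\<mu>. indicator (ball \<zeta> \<rho>) w * v w)"
          using Bbad[OF \<zeta>B, of "min 1 d"] by blast
        moreover have "ball \<zeta> \<rho> \<subseteq> ball \<zeta> d" using \<open>\<rho> < min 1 d\<close> by auto
        ultimately show ?thesis using d(2) by (intro exI[of _ \<rho>]) auto
      qed
      then obtain \<rho> where \<rho>: "\<And>\<zeta>. \<zeta> \<in> B \<Longrightarrow> 0 < \<rho> \<zeta> \<and> \<rho> \<zeta> < 1 \<and> ball \<zeta> (\<rho> \<zeta>) \<subseteq> O1 \<and>
          \<epsilon> * \<rho> \<zeta> < (LINT w|\<mu>. indicator (ball \<zeta> (\<rho> \<zeta>)) w * v w)"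
        by metis
      \<comment> \<open>Disjoint balls whose fivefold enlargements cover \<open>B\<close>. Each enlargement has \<open>\<mu>\<close>-measure at most
          \<open>10 / \<epsilon>\<close> times the \<open>\<nu>\<close>-measure of the ball, and the balls lie in \<open>O1\<close>.\<close>
      obtain C where C: "countable C" "C \<subseteq> B"
         "pairwise (\<lambda>i j. disjnt (ball i (\<rho> i)) (ball j (\<rho> j))) C"
         "B \<subseteq> (\<Union>i\<in>C. ball i (5 * \<rho> i))"
      proof (rule Vitali_covering_lemma_balls[of B "\<lambda>i. i" \<rho> B 1])
        show "B \<subseteq> (\<Union>i\<in>B. ball i (\<rho> i))" using \<rho> by (meson UN_I centre_in_ball subsetI)
        show "0 < \<rho> i \<and> \<rho> i \<le> 1" if "i \<in> B" for i using \<rho>[OF that] by simp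
      qed blast
      define J where "J = to_nat_on C ` C"
      define A where "A n = (if n \<in> J then ball (from_nat_into C n) (\<rho> (from_nat_into C n)) else {})" for n
      define A5 where "A5 n = (if n \<in> J then ball (from_nat_into C n) (5 * \<rho> (from_nat_into C n)) \<inter> sphere 0 1 else {})" for n
      have JC: "from_nat_into C n \<in> C" if "n \<in> J" for n
        using that C(1) by (auto simp: J_def)
      have inj: "from_nat_into C n \<noteq> from_nat_into C k" if "n \<in> J" "k \<in> J" "n \<noteq> k" for n k
        using that C(1) by (auto simp: J_def)
      have A5s: "A5 n \<in> sets \<mu>" for n unfolding A5_def by (cases "n \<in> J") (simp_all add: Int_sphere_sets_circle)
      have le: "emeasure \<mu> (A5 n) \<le> ennreal (10 / \<epsilon>) * emeasure \<nu> (A n)" for n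
      proof (cases "n \<in> J")
        case True
        let ?i = "from_nat_into C n"
        have i: "?i \<in> B" using JC[OF True] C(2) by auto
        have "norm ?i = 1" using BE[OF i] sets.sets_into_space[OF E(1)] by auto
        then have "emeasure \<mu> (A5 n) \<le> ennreal (2 * (5 * \<rho> ?i))"
          using True measure_circle_ball[of ?i "5 * \<rho> ?i"] \<rho>[OF i] by (simp add: A5_def)
        also have "\<dots> = ennreal (10/\<epsilon>) * ennreal (\<epsilon> * \<rho> ?i)"
          using \<epsilon> \<rho>[OF i] by (simp add: ennreal_mult''[symmetric])
        also have "\<dots> \<le> ennreal (10/\<epsilon>) * emeasure \<nu> (A n)"
          unfolding A_def using True \<rho>[OF i] by (auto simp: ball_int intro!: mult_left_mono ennreal_leI)
        finally show ?thesis .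
      qed (simp add: A5_def)
      have disj: "disjoint_family A"
        using C(3) JC inj by (auto simp: disjoint_family_on_def A_def pairwise_def disjnt_def)
      have "emeasure \<mu> (\<Union>n. A5 n) \<le> (\<Sum>n. emeasure \<mu> (A5 n))"
        by (rule emeasure_subadditive_countably) (use A5s in auto)
      also have "\<dots> \<le> (\<Sum>n. ennreal (10 / \<epsilon>) * emeasure \<nu> (A n))"
        by (rule suminf_le) (use le in auto)
      also have "\<dots> = ennreal (10 / \<epsilon>) * (\<Sum>n. emeasure \<nu> (A n))" by simp
      also have "(\<Sum>n. emeasure \<nu> (A n)) = emeasure \<nu> (\<Union>n. A n)"
      proof (rule suminf_emeasure)
        show "range A \<subseteq> sets \<nu>" by (auto simp: A_def)
      qed (rule disj)
      also have "\<dots> \<le> emeasure \<nu> O1"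
      proof (rule emeasure_mono)
        show "(\<Union>n. A n) \<subseteq> O1"
        proof
          fix x assume "x \<in> (\<Union>n. A n)"
          then obtain n where n: "n \<in> J" "x \<in> ball (from_nat_into C n) (\<rho> (from_nat_into C n))"
            by (auto simp: A_def split: if_splits)
          have "from_nat_into C n \<in> B" using JC[OF n(1)] C(2) by blast
          then show "x \<in> O1" using \<rho> n(2) by blast
        qed
      qed (use O1 in auto)
      also have "ennreal (10/\<epsilon>) * emeasure \<nu> O1 \<le> ennreal (10/\<epsilon>) * ennreal (e * \<epsilon> / 10)"
        by (rule mult_left_mono) (use O1 in auto)
      also have "\<dots> = ennreal e" using e \<epsilon> by (simp add: ennreal_mult''[symmetric])
      finally have small: "emeasure \<mu> (\<Union>n. A5 n) \<le> ennreal e" by (simp add: mult_left_mono)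
      have "B \<subseteq> (\<Union>n. A5 n)"
      proof
        fix x assume x: "x \<in> B"
        then obtain i where i: "i \<in> C" "x \<in> ball i (5 * \<rho> i)" using C(4) by auto
        have "x \<in> sphere 0 1" using BE[OF x] sets.sets_into_space[OF E(1)] by auto
        then have "x \<in> A5 (to_nat_on C i)" using i C(1) by (auto simp: A5_def J_def)
        then show "x \<in> (\<Union>n. A5 n)" by blast
      qed
      then show "\<exists>N\<in>sets \<mu>. B \<subseteq> N \<and> emeasure \<mu> N \<le> ennreal e"
        using small A5s by (intro bexI[of _ "\<Union>n. A5 n"]) auto
    qed
    then show ?thesis unfolding B_def .
  qed
  have "AE \<zeta> in \<mu>. \<forall>n::nat. \<zeta> \<notin> {\<zeta>\<in>E. \<forall>\<rho>0>0. \<exists>\<rho>. 0 < \<rho> \<and> \<rho> < \<rho>0 \<and>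
           (1 / Suc n) * \<rho> < (LINT w|\<mu>. indicator (ball \<zeta> \<rho>) w * v w)}"
    unfolding AE_all_countable by (intro allI bad) simp
  then show ?thesis
  proof (rule AE_mp, intro AE_I2 impI allI)
    fix \<zeta> and \<epsilon> :: real
    assume a: "\<forall>n::nat. \<zeta> \<notin> {\<zeta>\<in>E. \<forall>\<rho>0>0. \<exists>\<rho>. 0 < \<rho> \<and> \<rho> < \<rho>0 \<and>
           (1 / Suc n) * \<rho> < (LINT w|\<mu>. indicator (ball \<zeta> \<rho>) w * v w)}"
      and \<zeta>: "\<zeta> \<in> E" and \<epsilon>: "0 < \<epsilon>"
    obtain n :: nat where n: "1 / Suc n < \<epsilon>" using reals_Archimedean[OF \<epsilon>] by (auto simp only: inverse_eq_divide)
    have nW: "\<exists>x>0. \<forall>y. 0 < y \<and> y < x \<longrightarrow> W y \<le> e * y"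
      if "\<not> (\<forall>x>0. \<exists>y. 0 < y \<and> y < x \<and> e * y < W y)" for W :: "real \<Rightarrow> real" and e
      using that by (meson not_le)
    have "\<exists>\<rho>0>0. \<forall>\<rho>. 0 < \<rho> \<and> \<rho> < \<rho>0 \<longrightarrow>
           (LINT w|\<mu>. indicator (ball \<zeta> \<rho>) w * v w) \<le> (1 / Suc n) * \<rho>"
      by (rule nW) (use spec[OF a, of n] \<zeta> in \<open>simp only: mem_Collect_eq simp_thms\<close>)
    then obtain \<rho>0 where "\<rho>0 > 0 \<and> (\<forall>\<rho>. 0 < \<rho> \<and> \<rho> < \<rho>0 \<longrightarrow>
           (LINT w|\<mu>. indicator (ball \<zeta> \<rho>) w * v w) \<le> (1 / Suc n) * \<rho>)" ..
    then have \<rho>0: "\<rho>0 > 0" "\<And>\<rho>. 0 < \<rho> \<and> \<rho> < \<rho>0 \<Longrightarrow>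
           (LINT w|\<mu>. indicator (ball \<zeta> \<rho>) w * v w) \<le> (1 / Suc n) * \<rho>"
      by (simp_all only:)
    show "\<exists>\<rho>0>0. \<forall>\<rho>. 0 < \<rho> \<and> \<rho> < \<rho>0 \<longrightarrow> (LINT w|\<mu>. indicator (ball \<zeta> \<rho>) w * v w) \<le> \<epsilon> * \<rho>"
    proof (intro exI[of _ \<rho>0] conjI allI impI \<rho>0(1))
      fix \<rho> assume \<rho>: "0 < \<rho> \<and> \<rho> < \<rho>0"
      then have "(LINT w|\<mu>. indicator (ball \<zeta> \<rho>) w * v w) \<le> (1 / Suc n) * \<rho>" by (rule \<rho>0(2))
      also have "\<dots> \<le> \<epsilon> * \<rho>" using n \<rho> by (intro mult_right_mono) auto
      finally show "(LINT w|\<mu>. indicator (ball \<zeta> \<rho>) w * v w) \<le> \<epsilon> * \<rho>" .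
    qed
  qed
qed

section \<open>Poisson integrals and the theorem of Fatou\<close>

text \<open>The Poisson kernel of the unit disk, for \<open>z\<close> in the disk and \<open>w\<close> on the circle.\<close>

definition poisson :: "complex \<Rightarrow> complex \<Rightarrow> real" where
  "poisson z w = (1 - (norm z)\<^sup>2) / (norm (w - z))\<^sup>2"

text \<open>Fourier coefficients of a scalar function; the index runs through all integers.\<close>

definition fcoef :: "(complex \<Rightarrow> complex) \<Rightarrow> int \<Rightarrow> complex" where
  "fcoef f n = (LINT \<zeta>|\<mu>. \<zeta> powi (- n) * f \<zeta>)"

lemma poisson_nonneg: "norm z < 1 \<Longrightarrow> 0 \<le> poisson z w"
  unfolding poisson_def by (intro divide_nonneg_nonneg) (auto simp: power_le_one)

lemma poisson_measurable [measurable]: "poisson z \<in> borel_measurable \<mu>"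
  unfolding poisson_def by measurable

lemma poisson_le:
  assumes "norm z < 1" "norm w = 1" shows "poisson z w \<le> 1 / (1 - norm z)\<^sup>2"
proof -
  have "1 - norm z \<le> norm (w - z)" using norm_triangle_ineq2[of w z] assms by simp
  then have "(1 - norm z)\<^sup>2 \<le> (norm (w - z))\<^sup>2" using assms by (intro power_mono) auto
  moreover have "0 < (1 - norm z)\<^sup>2" using assms by simp
  ultimately show ?thesis unfolding poisson_def
    by (intro frac_le) (auto)
qed

lemma integrable_circle_bound:
  fixes g :: "complex \<Rightarrow> 'b::{real_normed_field, banach, second_countable_topology}"
  assumes f: "integrable \<mu> f" and [measurable]: "g \<in> borel_measurable \<mu>" and b: "\<And>w. norm w = 1 \<Longrightarrow> norm (g w) \<le> b"
  shows "integrable \<mu> (\<lambda>w. g w * f w)"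
proof (rule Bochner_Integration.integrable_bound)
  show "integrable \<mu> (\<lambda>w. b * norm (f w))" using f by simp
  show "(\<lambda>w. g w * f w) \<in> borel_measurable \<mu>" using f by measurable
  show "AE w in \<mu>. norm (g w * f w) \<le> norm (b * norm (f w))"
  proof (rule AE_I2)
    fix w assume "w \<in> space \<mu>"
    then have w: "norm w = 1" by simp
    have b0: "0 \<le> b" using b[OF w] norm_ge_zero order_trans by blast
    show "norm (g w * f w) \<le> norm (b * norm (f w))"
      using b[OF w] b0 by (simp add: norm_mult mult_right_mono)
  qed
qed

lemma integrable_poisson:
  assumes "integrable \<mu> f" "norm z < 1" shows "integrable \<mu> (\<lambda>w. complex_of_real (poisson z w) * f w)"
  using assms(1) by (rule integrable_circle_bound[where b="1 / (1 - norm z)\<^sup>2"])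
    (auto simp: poisson_nonneg assms poisson_le)

lemma integrable_poisson_real:
  assumes "integrable \<mu> f" "norm z < 1" shows "integrable \<mu> (\<lambda>w. poisson z w * f w :: real)"
  using assms(1) by (rule integrable_circle_bound[where b="1 / (1 - norm z)\<^sup>2"])
    (auto simp: poisson_nonneg assms poisson_le)

lemma norm_powi_circle: "norm (w::complex) = 1 \<Longrightarrow> norm (w powi n) = 1"
  by (simp add: norm_power_int)

lemma integrable_powi: "integrable \<mu> f \<Longrightarrow> integrable \<mu> (\<lambda>w. w powi n * f w :: complex)"
  by (rule integrable_circle_bound[where b=1]) (auto simp: norm_powi_circle)

text \<open>
  Two geometric series; the constant term is counted once.
\<close>

lemma poisson_sums:
  assumes z: "norm z < 1" and w: "norm w = 1"
  shows "(\<lambda>n. z^n * w powi (- int n) + (if n = 0 then 0 else cnj z ^ n * w powi int n)) sums complex_of_real (poisson z w)"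
proof -
  have w0: "w \<noteq> 0" using w by auto
  have ww: "w * cnj w = 1" using w by (simp add: complex_norm_square[symmetric])
  have "(\<lambda>n. (z / w)^n) sums (1 / (1 - z/w))"
    by (rule geometric_sums) (use z w in \<open>simp add: norm_divide\<close>)
  moreover have "(\<lambda>n. (cnj z * w)^Suc n) sums (cnj z * w * (1 / (1 - cnj z * w)))"
    unfolding power_Suc
    by (intro sums_mult geometric_sums) (use z w in \<open>simp add: norm_mult\<close>)
  then have "(\<lambda>n. (\<lambda>n. if n = 0 then 0 else (cnj z * w)^n) (Suc n)) sums (cnj z * w * (1 / (1 - cnj z * w)))"
    by simp
  from sums_Suc[OF this]
  have "(\<lambda>n. if n = 0 then 0 else (cnj z * w)^n) sums (cnj z * w / (1 - cnj z * w))" by simp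
  ultimately have "(\<lambda>n. (z / w)^n + (if n = 0 then 0 else (cnj z * w)^n)) sums
      (1 / (1 - z/w) + cnj z * w / (1 - cnj z * w))"
    by (rule sums_add)
  moreover have "1 / (1 - z/w) + cnj z * w / (1 - cnj z * w) = complex_of_real (poisson z w)"
  proof -
    have n1: "w - z \<noteq> 0" using z w by auto
    have n2: "cnj w - cnj z \<noteq> 0" using n1 by (metis complex_cnj_cancel_iff complex_cnj_diff complex_cnj_zero_iff)
    have "1 - cnj z * w = w * (cnj w - cnj z)" using ww by (simp add: algebra_simps)
    then have "cnj z * w / (1 - cnj z * w) = cnj z / (cnj w - cnj z)" using w0 by simp
    moreover have "1 / (1 - z/w) = w / (w - z)" using w0 n1 by (simp add: field_simps)
    moreover have "w / (w - z) + cnj z / (cnj w - cnj z) = (w * (cnj w - cnj z) + cnj z * (w - z)) / ((w - z) * (cnj w - cnj z))"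
      using n1 n2 by (rule add_frac_eq)
    moreover have "w * (cnj w - cnj z) + cnj z * (w - z) = complex_of_real (1 - (norm z)\<^sup>2)"
      using ww complex_norm_square[of z] by (simp add: algebra_simps)
    moreover have "(w - z) * (cnj w - cnj z) = complex_of_real ((norm (w - z))\<^sup>2)"
      by (simp only: complex_norm_square complex_cnj_diff)
    ultimately show ?thesis by (simp add: poisson_def)
  qed
  moreover have "(z / w)^n + (if n = 0 then 0 else (cnj z * w)^n) =
      z^n * w powi (- int n) + (if n = 0 then 0 else cnj z ^ n * w powi int n)" for n
    by (simp add: power_divide power_mult_distrib power_int_minus divide_inverse power_inverse)
  ultimately show ?thesis by simp
qed

lemma poisson_fourier:
  assumes f: "integrable \<mu> f" and z: "norm z < 1"
  shows "(\<lambda>n. z^n * fcoef f (int n) + (if n = 0 then 0 else cnj z ^ n * fcoef f (- int n))) sums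
           (LINT w|\<mu>. complex_of_real (poisson z w) * f w)"
proof -
  define a where "a n w = (z^n * w powi (- int n) + (if n = 0 then 0 else cnj z ^ n * w powi int n)) * f w" for n w
  have a_int: "integrable \<mu> (a n)" for n
    unfolding a_def by (rule integrable_circle_bound[OF f, where b="norm z ^ n + norm z ^ n"])
      (auto intro!: norm_triangle_le add_mono simp: norm_mult norm_power norm_powi_circle)
  have a_norm: "norm (a n w) \<le> 2 * norm z ^ n * norm (f w)" if "norm w = 1" for n w
    unfolding a_def norm_mult
    using that by (intro mult_right_mono) (auto intro!: norm_triangle_le simp: norm_mult norm_power norm_powi_circle)
  have geo: "summable (\<lambda>n. norm z ^ n)" using z by (simp add: summable_geometric)
  have "(\<lambda>n. LINT w|\<mu>. a n w) sums (LINT w|\<mu>. (\<Sum>n. a n w))"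
  proof (rule sums_integral[OF a_int])
    show "AE w in \<mu>. summable (\<lambda>n. norm (a n w))"
    proof (rule AE_I2)
      fix w assume w: "w \<in> space \<mu>"
      show "summable (\<lambda>n. norm (a n w))"
        by (rule summable_comparison_test'[where g="\<lambda>n. 2 * norm z ^ n * norm (f w)" and N=0])
           (use a_norm w geo in \<open>auto intro!: summable_mult2 summable_mult\<close>)
    qed
    show "summable (\<lambda>n. LINT w|\<mu>. norm (a n w))"
    proof (rule summable_comparison_test'[where N=0])
      show "summable (\<lambda>n. 2 * norm z ^ n * (LINT w|\<mu>. norm (f w)))"
        using geo by (auto intro!: summable_mult2 summable_mult)
      show "norm (LINT w|\<mu>. norm (a n w)) \<le> 2 * norm z ^ n * (LINT w|\<mu>. norm (f w))" for n
      proof -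
        have "(LINT w|\<mu>. norm (a n w)) \<le> (LINT w|\<mu>. 2 * norm z ^ n * norm (f w))"
          by (rule integral_mono) (use a_int a_norm f in auto)
        then show ?thesis by simp
      qed
    qed
  qed
  moreover have "(LINT w|\<mu>. (\<Sum>n. a n w)) = (LINT w|\<mu>. complex_of_real (poisson z w) * f w)"
  proof (rule Bochner_Integration.integral_cong[OF refl])
    fix w assume "w \<in> space \<mu>"
    then have "norm w = 1" by simp
    from sums_mult2[OF poisson_sums[OF z this], of "f w"]
    show "(\<Sum>n. a n w) = complex_of_real (poisson z w) * f w"
      unfolding a_def by (rule sums_unique[symmetric])
  qed
  moreover have "(LINT w|\<mu>. a n w) = z^n * fcoef f (int n) + (if n = 0 then 0 else cnj z ^ n * fcoef f (- int n))" for n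
  proof -
    have "(LINT w|\<mu>. a n w) = (LINT w|\<mu>. z^n * (w powi (- int n) * f w) + (if n = 0 then 0 else cnj z ^ n) * (w powi (int n) * f w))"
      by (rule Bochner_Integration.integral_cong) (auto simp: a_def algebra_simps)
    also have "\<dots> = z^n * fcoef f (int n) + (if n = 0 then 0 else cnj z ^ n) * fcoef f (- int n)"
      unfolding fcoef_def
      by (subst Bochner_Integration.integral_add)
         (intro integrable_mult_right integrable_powi f, rule integrable_mult_right, rule integrable_powi[OF f], simp)
    finally show ?thesis by simp
  qed
  ultimately show ?thesis by simp
qed

lemma integral_poisson: assumes "norm z < 1" shows "(LINT w|\<mu>. poisson z w) = 1"
proof -
  have "(\<lambda>n. z^n * fcoef (\<lambda>_. 1) (int n) + (if n = 0 then 0 else cnj z ^ n * fcoef (\<lambda>_. 1) (- int n))) sums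
           (LINT w|\<mu>. complex_of_real (poisson z w) * 1)"
    by (rule poisson_fourier) (use assms in auto)
  moreover have "(\<lambda>n. z^n * fcoef (\<lambda>_. 1) (int n) + (if n = 0 then 0 else cnj z ^ n * fcoef (\<lambda>_. 1) (- int n))) =
      (\<lambda>n. if n = 0 then 1 else 0)"
  proof -
    have "fcoef (\<lambda>_. 1) k = (if k = 0 then 1 else 0)" for k
      unfolding fcoef_def mult_1_right by (simp only: integral_circle_powi neg_equal_0_iff_equal)
    then show ?thesis by (auto simp: fun_eq_iff)
  qed
  ultimately have "(\<lambda>n. if n = 0 then 1 else 0::complex) sums (LINT w|\<mu>. complex_of_real (poisson z w))"
    by simp
  moreover have "(\<lambda>n. if n = 0 then 1 else 0::complex) sums 1" using sums_single[of 0 "\<lambda>_. 1"] by simp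
  ultimately have "(LINT w|\<mu>. complex_of_real (poisson z w)) = 1" using sums_unique2 by blast
  then show ?thesis by (simp add: integral_complex_of_real)
qed

text \<open>
  At the point \<open>r \<zeta>\<close> the kernel is at most \<open>2 / (1 - r)\<close> everywhere, and of order \<open>1 - r\<close> away
  from \<open>\<zeta>\<close>.
\<close>

lemma poisson_radial_bounds:
  assumes \<zeta>: "norm \<zeta> = 1" and w: "norm w = 1" and r: "0 \<le> r" "r < 1"
  shows "poisson (of_real r * \<zeta>) w \<le> 2 / (1 - r)"
    and "0 < D \<Longrightarrow> D \<le> norm (w - \<zeta>) \<Longrightarrow> poisson (of_real r * \<zeta>) w \<le> 8 * (1 - r) / D\<^sup>2"
proof -
  have nz: "norm (of_real r * \<zeta>) = r" using \<zeta> r by (simp add: norm_mult)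
  have num: "1 - r\<^sup>2 \<le> 2 * (1 - r)" "0 \<le> 1 - r\<^sup>2"
    using r sum_squares_bound[of r 1] mult_left_le_one_le[of r r] by (auto simp: power2_eq_square)
  have 1: "1 - r \<le> norm (w - of_real r * \<zeta>)" using norm_triangle_ineq2[of w "of_real r * \<zeta>"] nz w by simp
  have "norm (w - \<zeta>) \<le> norm (w - of_real r * \<zeta>) + norm (of_real r * \<zeta> - \<zeta>)"
    using norm_triangle_ineq[of "w - of_real r * \<zeta>" "of_real r * \<zeta> - \<zeta>"] by simp
  also have "of_real r * \<zeta> - \<zeta> = of_real (r - 1) * \<zeta>" by (simp add: algebra_simps)
  also have "norm \<dots> = 1 - r" using \<zeta> r by (simp add: norm_mult del: of_real_diff)
  finally have 2: "norm (w - \<zeta>) \<le> 2 * norm (w - of_real r * \<zeta>)" using 1 by simp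
  have "poisson (of_real r * \<zeta>) w \<le> (2 * (1 - r)) / (1 - r)\<^sup>2"
    unfolding poisson_def nz using num 1 r by (intro frac_le power_mono) auto
  also have "\<dots> = 2 / (1 - r)" using r by (simp add: power2_eq_square divide_simps)
  finally show "poisson (of_real r * \<zeta>) w \<le> 2 / (1 - r)" .
  assume D: "0 < D" "D \<le> norm (w - \<zeta>)"
  have "poisson (of_real r * \<zeta>) w \<le> (2 * (1 - r)) / (D/2)\<^sup>2"
    unfolding poisson_def nz using num 2 D r by (intro frac_le power_mono) auto
  then show "poisson (of_real r * \<zeta>) w \<le> 8 * (1 - r) / D\<^sup>2"
    by (simp add: power2_eq_square)
qed

text \<open>Cut the circle into dyadic rings around \<open>\<zeta>\<close>, starting at scale \<open>1 - r\<close>.\<close>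

lemma poisson_dyadic_bound:
  assumes \<zeta>: "norm \<zeta> = 1" and w: "norm w = 1" and r: "0 \<le> r" "r < 1"
    and K: "2^K * (1 - r) < \<rho>0" "\<rho>0 \<le> 2^Suc K * (1 - r)" "0 < \<rho>0"
  shows "poisson (of_real r * \<zeta>) w \<le>
    (\<Sum>k\<le>K. 32 / (1 - r) * (1/4)^k * indicator (ball \<zeta> (2^k * (1 - r))) w) + 32 * (1 - r) / \<rho>0\<^sup>2"
    (is "_ \<le> ?S + ?R")
proof -
  let ?d = "norm (w - \<zeta>)" let ?\<delta> = "1 - r"
  have \<delta>: "0 < ?\<delta>" using r by simp
  have S0: "0 \<le> ?S" by (rule sum_nonneg) (use \<delta> in auto)
  have R0: "0 \<le> ?R" using \<delta> by simp
  have term_le: "32 / ?\<delta> * (1/4)^k \<le> ?S" if "k \<le> K" "?d < 2^k * ?\<delta>" for k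
  proof -
    have "32 / ?\<delta> * (1/4)^k = 32 / ?\<delta> * (1/4)^k * indicator (ball \<zeta> (2^k * ?\<delta>)) w"
      using that by (simp add: indicator_def dist_norm norm_minus_commute)
    also have "\<dots> \<le> ?S"
      by (rule member_le_sum) (use that \<delta> in auto)
    finally show ?thesis .
  qed
  show ?thesis
  proof (cases "?d < 2^K * ?\<delta>")
    case False
    then have "\<rho>0 / 2 \<le> ?d" using K by simp
    then have "poisson (of_real r * \<zeta>) w \<le> 8 * ?\<delta> / (\<rho>0/2)\<^sup>2"
      using poisson_radial_bounds(2)[OF \<zeta> w r, of "\<rho>0/2"] K by simp
    also have "\<dots> = ?R" by (simp add: power2_eq_square)
    finally show ?thesis using S0 by simp
  next
    case True
    define k where "k = (LEAST k. ?d < 2^k * ?\<delta>)"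
    have k: "?d < 2^k * ?\<delta>" unfolding k_def using True by (rule LeastI)
    have kK: "k \<le> K" unfolding k_def using True by (rule Least_le)
    have "poisson (of_real r * \<zeta>) w \<le> 32 / ?\<delta> * (1/4)^k"
    proof (cases k)
      case 0
      have "2 / ?\<delta> \<le> 32 / ?\<delta>" using \<delta> by (intro divide_right_mono) auto
      then show ?thesis using poisson_radial_bounds(1)[OF \<zeta> w r] 0 by simp
    next
      case (Suc j)
      have "\<not> ?d < 2^j * ?\<delta>" using not_less_Least[of j "\<lambda>k. ?d < 2^k * ?\<delta>"] Suc unfolding k_def by simp
      then have "poisson (of_real r * \<zeta>) w \<le> 8 * ?\<delta> / (2^j * ?\<delta>)\<^sup>2"
        using poisson_radial_bounds(2)[OF \<zeta> w r, of "2^j * ?\<delta>"] \<delta> by simp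
      also have "\<dots> = 32 / ?\<delta> * (1/4)^k"
      proof -
        have "((2::real)^j)\<^sup>2 = 4^j" by (simp add: power_mult[symmetric] mult.commute[of j]) (simp add: power_mult)
        then have "(2^j * ?\<delta>)\<^sup>2 = 4^j * (?\<delta> * ?\<delta>)" by (simp only: power_mult_distrib power2_eq_square[of ?\<delta>])
        then show ?thesis using \<delta> Suc by (simp add: power_divide divide_simps)
      qed
      finally show ?thesis .
    qed
    also have "\<dots> \<le> ?S" by (rule term_le[OF kK k])
    finally show ?thesis using R0 by simp
  qed
qed

text \<open>
  If the averages of \<open>v\<close> over small balls around \<open>\<zeta>\<close> tend to zero, then so does its Poisson integral
  along the radius: the dyadic bound turns it into a geometric sum of such averages.
\<close>

lemma poisson_integral_vanishing_density:
  fixes v :: "complex \<Rightarrow> real"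
  assumes v: "integrable \<mu> v" "\<And>w. 0 \<le> v w" and \<zeta>: "norm \<zeta> = 1"
    and V: "\<And>\<epsilon>. 0 < \<epsilon> \<Longrightarrow> \<exists>\<rho>0>0. \<forall>\<rho>. 0 < \<rho> \<and> \<rho> < \<rho>0 \<longrightarrow> (LINT w|\<mu>. indicator (ball \<zeta> \<rho>) w * v w) \<le> \<epsilon> * \<rho>"
  shows "((\<lambda>r. LINT w|\<mu>. poisson (of_real r * \<zeta>) w * v w) \<longlongrightarrow> 0) (at_left 1)"
proof (rule tendstoI)
  fix e :: real assume e: "0 < e"
  obtain \<rho>0 where \<rho>0: "\<rho>0 > 0" "\<And>\<rho>. 0 < \<rho> \<Longrightarrow> \<rho> < \<rho>0 \<Longrightarrow> (LINT w|\<mu>. indicator (ball \<zeta> \<rho>) w * v w) \<le> e/128 * \<rho>"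
    using V[of "e/128"] e by auto
  define L where "L = (LINT w|\<mu>. v w)"
  have L: "0 \<le> L" unfolding L_def using v by simp
  have "((\<lambda>r. 32 * (1 - r) / \<rho>0\<^sup>2 * L) \<longlongrightarrow> 32 * (1 - 1) / \<rho>0\<^sup>2 * L) (at_left (1::real))"
    using \<rho>0 by (intro tendsto_intros) auto
  then have lim0: "((\<lambda>r. 32 * (1 - r) / \<rho>0\<^sup>2 * L) \<longlongrightarrow> 0) (at_left (1::real))" by simp
  have "eventually (\<lambda>r. 32 * (1 - r) / \<rho>0\<^sup>2 * L < e/2) (at_left (1::real))"
    using order_tendstoD(2)[OF lim0, of "e/2"] e by simp
  moreover have "eventually (\<lambda>r::real. max 0 (1 - \<rho>0) < r \<and> r < 1) (at_left 1)"
    using \<rho>0 eventually_at_left_real[of "max 0 (1 - \<rho>0)" 1] by simp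
  ultimately show "eventually (\<lambda>r. dist (LINT w|\<mu>. poisson (of_real r * \<zeta>) w * v w) 0 < e) (at_left 1)"
  proof eventually_elim
    case (elim r)
    let ?\<delta> = "1 - r"
    have r: "0 \<le> r" "r < 1" and \<delta>: "0 < ?\<delta>" "?\<delta> < \<rho>0" using elim by auto
    define K where "K = (LEAST K. \<rho>0 \<le> 2^Suc K * ?\<delta>)"
    have "\<exists>K. \<rho>0 \<le> 2^Suc K * ?\<delta>"
    proof -
      obtain K where "\<rho>0 / ?\<delta> < 2^K" using real_arch_pow[of 2] by force
      then have "\<rho>0 < 2^K * ?\<delta>" using \<delta> by (simp add: field_simps)
      also have "\<dots> \<le> 2^Suc K * ?\<delta>" using \<delta> by (intro mult_right_mono) auto
      finally show ?thesis by (intro exI[of _ K]) simp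
    qed
    then have K1: "\<rho>0 \<le> 2^Suc K * ?\<delta>" unfolding K_def by (rule LeastI_ex)
    have K2: "2^K * ?\<delta> < \<rho>0"
    proof (cases K)
      case (Suc j)
      then show ?thesis using not_less_Least[of j "\<lambda>K. \<rho>0 \<le> 2^Suc K * ?\<delta>"] unfolding K_def by simp
    qed (use \<delta> in simp)
    have ind_int: "integrable \<mu> (\<lambda>w. indicator (ball \<zeta> \<rho>) w * v w)" for \<rho>
      using v(1) by (rule integrable_circle_bound[where b=1]) (auto simp: indicator_def intro!: borel_imp_circle_measurable)
    have "(LINT w|\<mu>. poisson (of_real r * \<zeta>) w * v w) \<le>
      (LINT w|\<mu>. (\<Sum>k\<le>K. 32 / ?\<delta> * (1/4)^k * (indicator (ball \<zeta> (2^k * ?\<delta>)) w * v w)) + 32 * ?\<delta> / \<rho>0\<^sup>2 * v w)"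
    proof (rule integral_mono)
      show "integrable \<mu> (\<lambda>w. poisson (of_real r * \<zeta>) w * v w)"
        by (rule integrable_poisson_real) (use v \<zeta> r in \<open>auto simp: norm_mult\<close>)
      show "integrable \<mu> (\<lambda>w. (\<Sum>k\<le>K. 32 / ?\<delta> * (1/4)^k * (indicator (ball \<zeta> (2^k * ?\<delta>)) w * v w)) + 32 * ?\<delta> / \<rho>0\<^sup>2 * v w)"
        using ind_int v(1) by (intro Bochner_Integration.integrable_add Bochner_Integration.integrable_sum integrable_mult_right) auto
      fix w assume "w \<in> space \<mu>"
      then have w: "norm w = 1" by simp
      have "poisson (of_real r * \<zeta>) w * v w \<le>
        ((\<Sum>k\<le>K. 32 / ?\<delta> * (1/4)^k * indicator (ball \<zeta> (2^k * ?\<delta>)) w) + 32 * ?\<delta> / \<rho>0\<^sup>2) * v w"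
        by (rule mult_right_mono[OF poisson_dyadic_bound[OF \<zeta> w r K2 K1 \<rho>0(1)] v(2)])
      then show "poisson (of_real r * \<zeta>) w * v w \<le>
        (\<Sum>k\<le>K. 32 / ?\<delta> * (1/4)^k * (indicator (ball \<zeta> (2^k * ?\<delta>)) w * v w)) + 32 * ?\<delta> / \<rho>0\<^sup>2 * v w"
        by (simp add: distrib_right sum_distrib_right mult.assoc)
    qed
    also have "\<dots> = (\<Sum>k\<le>K. 32 / ?\<delta> * (1/4)^k * (LINT w|\<mu>. indicator (ball \<zeta> (2^k * ?\<delta>)) w * v w)) + 32 * ?\<delta> / \<rho>0\<^sup>2 * L"
      using ind_int v(1) unfolding L_def
      by (subst Bochner_Integration.integral_add) (auto intro!: Bochner_Integration.integrable_sum)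
    also have "(\<Sum>k\<le>K. 32 / ?\<delta> * (1/4)^k * (LINT w|\<mu>. indicator (ball \<zeta> (2^k * ?\<delta>)) w * v w)) \<le> (\<Sum>k\<le>K. e/4 * (1/2)^k)"
    proof (rule sum_mono)
      fix k assume "k \<in> {..K}"
      then have "(2::real)^k \<le> 2^K" by (intro power_increasing) auto
      then have "2^k * ?\<delta> \<le> 2^K * ?\<delta>" using \<delta> by (intro mult_right_mono) auto
      then have "2^k * ?\<delta> < \<rho>0" using K2 by simp
      then have "(LINT w|\<mu>. indicator (ball \<zeta> (2^k * ?\<delta>)) w * v w) \<le> e/128 * (2^k * ?\<delta>)"
        using \<rho>0(2) \<delta> by simp
      then have "32 / ?\<delta> * (1/4)^k * (LINT w|\<mu>. indicator (ball \<zeta> (2^k * ?\<delta>)) w * v w) \<le> 32 / ?\<delta> * (1/4)^k * (e/128 * (2^k * ?\<delta>))"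
        using \<delta> by (intro mult_left_mono) auto
      also have "\<dots> = e/4 * ((1/4)^k * 2^k)" using \<delta> by simp
      also have "(1/4)^k * 2^k = (1/2::real)^k" by (simp add: power_mult_distrib[symmetric])
      finally show "32 / ?\<delta> * (1/4)^k * (LINT w|\<mu>. indicator (ball \<zeta> (2^k * ?\<delta>)) w * v w) \<le> e/4 * (1/2)^k" .
    qed
    also have "(\<Sum>k\<le>K. e/4 * (1/2)^k) \<le> e/2"
    proof -
      have "(\<Sum>k\<le>K. (1/2::real)^k) \<le> 2"
      proof -
        have "(1 - 1/2) * (\<Sum>k\<le>K. (1/2::real)^k) = 1 - (1/2)^Suc K" by (rule sum_gp_basic)
        moreover have "(1 - 1/2) * (\<Sum>k\<le>K. (1/2::real)^k) = (\<Sum>k\<le>K. (1/2::real)^k) / 2"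
          by (subst diff_divide_eq_iff) simp_all
        moreover have "0 \<le> (1/2::real)^Suc K" by simp
        ultimately show ?thesis by linarith
      qed
      then show ?thesis unfolding sum_distrib_left[symmetric] using e by (simp add: field_simps)
    qed
    finally have "(LINT w|\<mu>. poisson (of_real r * \<zeta>) w * v w) < e" using elim by simp
    moreover have "0 \<le> (LINT w|\<mu>. poisson (of_real r * \<zeta>) w * v w)"
      by (rule integral_nonneg_AE, rule AE_I2, rule mult_nonneg_nonneg, rule poisson_nonneg)
         (use v \<zeta> r in \<open>auto simp: norm_mult\<close>)
    ultimately show ?case by (simp add: dist_real_def)
  qed
qed

text \<open>
  The theorem of Fatou on radial limits. For a constant \<open>c\<close> close to \<open>f \<zeta>\<close> the excess of \<open>|f - c|\<close> over
  \<open>1 / Suc n\<close> vanishes at \<open>\<zeta>\<close>, hence has vanishing density at almost every such \<open>\<zeta>\<close>. Countably many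
  \<open>c\<close> and \<open>n\<close> suffice.
\<close>

theorem fatou_radial:
  fixes f :: "complex \<Rightarrow> complex"
  assumes f: "integrable \<mu> f"
  shows "AE \<zeta> in \<mu>. ((\<lambda>r. LINT w|\<mu>. of_real (poisson (of_real r * \<zeta>) w) * f w) \<longlongrightarrow> f \<zeta>) (at_left 1)"
proof -
  have [measurable]: "f \<in> borel_measurable \<mu>" using f by auto
  obtain D :: "complex set" where D: "countable D" "\<And>X. open X \<Longrightarrow> X \<noteq> {} \<Longrightarrow> \<exists>d\<in>D. d \<in> X"
    using countable_dense_setE by blast
  define v where "v c n w = max 0 (norm (f w - c) - 1 / Suc n)" for c w and n :: nat
  define E where "E c n = {w \<in> space \<mu>. norm (f w - c) \<le> 1 / Suc n}" for c and n :: nat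
  have v_int: "integrable \<mu> (v c n)" for c n
    unfolding v_def using f by (intro Bochner_Integration.integrable_max) auto
  have E_sets: "E c n \<in> sets \<mu>" for c n unfolding E_def by measurable
  have "AE \<zeta> in \<mu>. \<zeta> \<in> E c n \<longrightarrow> (\<forall>\<epsilon>>0. \<exists>\<rho>0>0. \<forall>\<rho>. 0 < \<rho> \<and> \<rho> < \<rho>0 \<longrightarrow>
           (LINT w|\<mu>. indicator (ball \<zeta> \<rho>) w * v c n w) \<le> \<epsilon> * \<rho>)" for c n
    by (rule vanishing_density_AE[OF v_int _ E_sets]) (auto simp: v_def E_def)
  then have "AE \<zeta> in \<mu>. \<forall>c\<in>D. \<forall>n. \<zeta> \<in> E c n \<longrightarrow> (\<forall>\<epsilon>>0. \<exists>\<rho>0>0. \<forall>\<rho>. 0 < \<rho> \<and> \<rho> < \<rho>0 \<longrightarrow>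
           (LINT w|\<mu>. indicator (ball \<zeta> \<rho>) w * v c n w) \<le> \<epsilon> * \<rho>)"
    by (simp add: AE_all_countable AE_ball_countable[OF D(1)])
  then show ?thesis
  proof (rule AE_mp, intro AE_I2 impI)
    fix \<zeta> assume "\<zeta> \<in> space \<mu>" and A: "\<forall>c\<in>D. \<forall>n. \<zeta> \<in> E c n \<longrightarrow> (\<forall>\<epsilon>>0. \<exists>\<rho>0>0. \<forall>\<rho>. 0 < \<rho> \<and> \<rho> < \<rho>0 \<longrightarrow>
           (LINT w|\<mu>. indicator (ball \<zeta> \<rho>) w * v c n w) \<le> \<epsilon> * \<rho>)"
    then have \<zeta>: "norm \<zeta> = 1" by simp
    show "((\<lambda>r. LINT w|\<mu>. of_real (poisson (of_real r * \<zeta>) w) * f w) \<longlongrightarrow> f \<zeta>) (at_left 1)"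
    proof (rule tendstoI)
      fix e :: real assume e: "0 < e"
      obtain n :: nat where n: "1 / Suc n < e/3"
        using reals_Archimedean[of "e/3"] e unfolding inverse_eq_divide by auto
      obtain c where c: "c \<in> D" "c \<in> ball (f \<zeta>) (1 / Suc n)"
        using D(2)[of "ball (f \<zeta>) (1 / Suc n)"] by auto
      have "\<zeta> \<in> E c n" using c(2) \<open>\<zeta> \<in> space \<mu>\<close> by (simp add: E_def dist_norm)
      then have "((\<lambda>r. LINT w|\<mu>. poisson (of_real r * \<zeta>) w * v c n w) \<longlongrightarrow> 0) (at_left 1)"
        using A c(1) by (intro poisson_integral_vanishing_density v_int \<zeta>) (auto simp: v_def)
      then have "eventually (\<lambda>r. (LINT w|\<mu>. poisson (of_real r * \<zeta>) w * v c n w) < e/3) (at_left 1)"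
        using e by (intro order_tendstoD(2)) auto
      moreover have "eventually (\<lambda>r::real. 0 < r \<and> r < 1) (at_left 1)"
        using eventually_at_left_real[of 0 "1::real"] by simp
      ultimately show "eventually (\<lambda>r. dist (LINT w|\<mu>. of_real (poisson (of_real r * \<zeta>) w) * f w) (f \<zeta>) < e) (at_left 1)"
      proof eventually_elim
        case (elim r)
        let ?P = "poisson (of_real r * \<zeta>)"
        have nz: "norm (of_real r * \<zeta>) < 1" using \<zeta> elim by (simp add: norm_mult)
        have P1: "integrable \<mu> ?P" using integrable_poisson_real[of "\<lambda>_. 1", OF _ nz] by simp
        have Pf: "integrable \<mu> (\<lambda>w. of_real (?P w) * f w)" by (rule integrable_poisson[OF f nz])
        have Pfc: "integrable \<mu> (\<lambda>w. of_real (?P w) * (f w - c))"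
          by (rule integrable_poisson[OF _ nz]) (use f in auto)
        have Pv: "integrable \<mu> (\<lambda>w. ?P w * v c n w)" by (rule integrable_poisson_real[OF v_int nz])
        have "(LINT w|\<mu>. of_real (?P w) * (f w - c)) = (LINT w|\<mu>. of_real (?P w) * f w) - (LINT w|\<mu>. of_real (?P w) * c)"
          unfolding right_diff_distrib using Pf P1 by (intro Bochner_Integration.integral_diff) auto
        also have "(LINT w|\<mu>. of_real (?P w) * c) = c"
          using integral_poisson[OF nz] by (simp add: integral_complex_of_real)
        finally have "norm ((LINT w|\<mu>. of_real (?P w) * f w) - c) = norm (LINT w|\<mu>. of_real (?P w) * (f w - c))"
          by simp
        also have "\<dots> \<le> (LINT w|\<mu>. norm (of_real (?P w) * (f w - c)))"
          by (rule integral_norm_bound)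
        also have "\<dots> \<le> (LINT w|\<mu>. ?P w * v c n w + ?P w * (1 / Suc n))"
        proof (rule integral_mono)
          show "integrable \<mu> (\<lambda>w. ?P w * v c n w + ?P w * (1 / Suc n))" using Pv P1 by simp
          fix w
          have "norm (f w - c) \<le> v c n w + 1 / Suc n" by (simp add: v_def)
          then have "?P w * norm (f w - c) \<le> ?P w * (v c n w + 1 / Suc n)"
            by (rule mult_left_mono) (rule poisson_nonneg[OF nz])
          then show "norm (of_real (?P w) * (f w - c)) \<le> ?P w * v c n w + ?P w * (1 / Suc n)"
            by (simp only: norm_mult norm_of_real abs_of_nonneg[OF poisson_nonneg[OF nz]] distrib_left)
        qed (use Pfc in auto)
        also have "\<dots> = (LINT w|\<mu>. ?P w * v c n w) + 1 / Suc n"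
          using Pv P1 integral_poisson[OF nz] by (subst Bochner_Integration.integral_add) auto
        finally have "norm ((LINT w|\<mu>. of_real (?P w) * f w) - c) < 2 * e / 3" using elim n by simp
        moreover have "norm (c - f \<zeta>) < e/3" using c(2) n by (simp add: dist_norm norm_minus_commute)
        ultimately have "norm ((LINT w|\<mu>. of_real (?P w) * f w) - f \<zeta>) < e"
          using norm_triangle_ineq[of "(LINT w|\<mu>. of_real (?P w) * f w) - c" "c - f \<zeta>"] by simp
        then show ?case by (simp add: dist_norm)
      qed
    qed
  qed
qed

subsection \<open>Consequences of radial convergence\<close>

lemma fourier_unique:
  assumes f: "integrable \<mu> f" and z: "\<And>n. fcoef f n = 0"
  shows "AE \<zeta> in \<mu>. f \<zeta> = 0"
  using fatou_radial[OF f]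
proof (rule AE_mp, intro AE_I2 impI)
  fix \<zeta> assume "\<zeta> \<in> space \<mu>" and l: "((\<lambda>r. LINT w|\<mu>. of_real (poisson (of_real r * \<zeta>) w) * f w) \<longlongrightarrow> f \<zeta>) (at_left 1)"
  have "eventually (\<lambda>r::real. 0 < r \<and> r < 1) (at_left 1)"
    using eventually_at_left_real[of 0 "1::real"] by simp
  then have "eventually (\<lambda>r. (LINT w|\<mu>. of_real (poisson (of_real r * \<zeta>) w) * f w) = 0) (at_left 1)"
  proof eventually_elim
    case (elim r)
    have nz: "norm (of_real r * \<zeta>) < 1" using \<open>\<zeta> \<in> space \<mu>\<close> elim by (simp add: norm_mult)
    have "(\<lambda>n::nat. 0) sums (LINT w|\<mu>. of_real (poisson (of_real r * \<zeta>) w) * f w)"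
      using poisson_fourier[OF f nz] by (simp add: z cong: if_cong)
    then show ?case using sums_unique2[OF sums_zero] by metis
  qed
  then have "((\<lambda>r. LINT w|\<mu>. of_real (poisson (of_real r * \<zeta>) w) * f w) \<longlongrightarrow> 0) (at_left 1)"
    by (rule tendsto_eventually)
  then show "f \<zeta> = 0" using tendsto_unique[OF _ l] by simp
qed

text \<open>
  A bounded function without negative Fourier coefficients is the radial limit of its Poisson integral,
  which is a power series.
\<close>

lemma bounded_analytic_boundary:
  assumes [measurable]: "f \<in> borel_measurable \<mu>" and b: "AE \<zeta> in \<mu>. norm (f \<zeta>) \<le> b" and neg: "\<And>n. n < 0 \<Longrightarrow> fcoef f n = 0"
  shows "\<exists>G. G holomorphic_on ball 0 1 \<and> (\<forall>z\<in>ball 0 1. norm (G z) \<le> b) \<and>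
     (AE \<zeta> in \<mu>. ((\<lambda>t. G (of_real t * \<zeta>)) \<longlongrightarrow> f \<zeta>) (at_left 1))"
proof -
  have f: "integrable \<mu> f" by (rule circle.integrable_const_bound[OF b]) simp
  define G where "G z = (LINT w|\<mu>. of_real (poisson z w) * f w)" for z
  have ser: "(\<lambda>n. fcoef f (int n) * z^n) sums G z" if "norm z < 1" for z
    using poisson_fourier[OF f that] neg unfolding G_def by (simp add: mult.commute cong: if_cong)
  have "(\<lambda>n. fcoef f (int n) * (z - 0)^n) sums G z" if "z \<in> ball 0 1" for z
    using ser[of z] that by simp
  then have "G holomorphic_on ball 0 1" by (rule power_series_holomorphic)
  moreover have "norm (G z) \<le> b" if "z \<in> ball 0 1" for z
  proof -
    have nz: "norm z < 1" using that by simp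
    have P1: "integrable \<mu> (poisson z)" using integrable_poisson_real[of "\<lambda>_. 1", OF _ nz] by simp
    have "norm (G z) \<le> (LINT w|\<mu>. norm (of_real (poisson z w) * f w))"
      unfolding G_def by (rule integral_norm_bound)
    also have "\<dots> \<le> (LINT w|\<mu>. poisson z w * b)"
    proof (rule integral_mono_AE)
      show "AE w in \<mu>. norm (of_real (poisson z w) * f w) \<le> poisson z w * b"
        using b by eventually_elim (simp add: norm_mult poisson_nonneg[OF nz] mult_left_mono)
    qed (use integrable_poisson[OF f nz] P1 in auto)
    also have "\<dots> = b" using integral_poisson[OF nz] by simp
    finally show ?thesis .
  qed
  moreover have "AE \<zeta> in \<mu>. ((\<lambda>t. G (of_real t * \<zeta>)) \<longlongrightarrow> f \<zeta>) (at_left 1)"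
    using fatou_radial[OF f] unfolding G_def .
  ultimately show ?thesis by blast
qed

text \<open>
  The Poisson kernel is \<open>1 - |z|\<^sup>2\<close> times the square of the modulus of \<open>1 / (1 - cnj z * w)\<close>, which is a
  limit of polynomials in \<open>w\<close>; so the Poisson integral of \<open>g\<close> is nonnegative, and so is its boundary value.
\<close>

lemma nonneg_by_squares:
  fixes g :: "complex \<Rightarrow> real"
  assumes g: "integrable \<mu> g"
    and sq: "\<And>(c :: nat \<Rightarrow> complex) N. 0 \<le> (LINT w|\<mu>. (norm (\<Sum>n<N. c n * w^n))\<^sup>2 * g w)"
  shows "AE \<zeta> in \<mu>. 0 \<le> g \<zeta>"
proof -
  have P: "0 \<le> (LINT w|\<mu>. poisson z w * g w)" if z: "norm z < 1" for z
  proof -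
    define S where "S N w = (\<Sum>n<N. (cnj z * w)^n)" for N w
    have lim: "(\<lambda>N. LINT w|\<mu>. (norm (S N w))\<^sup>2 * g w) \<longlonglongrightarrow> (LINT w|\<mu>. (norm (1 / (1 - cnj z * w)))\<^sup>2 * g w)"
    proof (rule integral_dominated_convergence[where w="\<lambda>w. (1 / (1 - norm z))\<^sup>2 * norm (g w)"])
      show "AE w in \<mu>. (\<lambda>N. (norm (S N w))\<^sup>2 * g w) \<longlonglongrightarrow> (norm (1 / (1 - cnj z * w)))\<^sup>2 * g w"
      proof (rule AE_I2)
        fix w assume "w \<in> space \<mu>"
        then have "(\<lambda>N. S N w) \<longlonglongrightarrow> 1 / (1 - cnj z * w)"
          using geometric_sums[of "cnj z * w"] z unfolding sums_def S_def by (simp add: norm_mult)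
        then show "(\<lambda>N. (norm (S N w))\<^sup>2 * g w) \<longlonglongrightarrow> (norm (1 / (1 - cnj z * w)))\<^sup>2 * g w"
          by (intro tendsto_intros)
      qed
      show "AE w in \<mu>. norm ((norm (S N w))\<^sup>2 * g w) \<le> (1 / (1 - norm z))\<^sup>2 * norm (g w)" for N
      proof (rule AE_I2)
        fix w assume w: "w \<in> space \<mu>"
        have "norm (S N w) \<le> (\<Sum>n<N. norm z ^ n)"
          unfolding S_def by (rule order_trans[OF norm_sum]) (use w in \<open>simp add: norm_mult norm_power\<close>)
        also have "\<dots> \<le> (\<Sum>n. norm z ^ n)" by (rule sum_le_suminf) (use z in \<open>auto simp: summable_geometric\<close>)
        also have "\<dots> = 1 / (1 - norm z)" using z by (simp add: suminf_geometric)
        finally have "(norm (S N w))\<^sup>2 \<le> (1 / (1 - norm z))\<^sup>2" by (intro power_mono) auto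
        then show "norm ((norm (S N w))\<^sup>2 * g w) \<le> (1 / (1 - norm z))\<^sup>2 * norm (g w)"
          by (simp add: abs_mult mult_right_mono)
      qed
      show "integrable \<mu> (\<lambda>w. (1 / (1 - norm z))\<^sup>2 * norm (g w))" using g by simp
    qed (use g in \<open>auto simp: S_def\<close>)
    have "0 \<le> (LINT w|\<mu>. (norm (S N w))\<^sup>2 * g w)" for N
      using sq[of "\<lambda>n. cnj z ^ n" N] unfolding S_def by (simp add: power_mult_distrib)
    with lim have "0 \<le> (LINT w|\<mu>. (norm (1 / (1 - cnj z * w)))\<^sup>2 * g w)"
      by (intro LIMSEQ_le_const) auto
    then have "0 \<le> (1 - (norm z)\<^sup>2) * (LINT w|\<mu>. (norm (1 / (1 - cnj z * w)))\<^sup>2 * g w)"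
      using z by (intro mult_nonneg_nonneg) (auto simp: power_le_one)
    also have "\<dots> = (LINT w|\<mu>. (1 - (norm z)\<^sup>2) * ((norm (1 / (1 - cnj z * w)))\<^sup>2 * g w))" by simp
    also have "\<dots> = (LINT w|\<mu>. poisson z w * g w)"
    proof (rule Bochner_Integration.integral_cong[OF refl])
      fix w assume "w \<in> space \<mu>"
      then have w: "norm w = 1" by simp
      have "norm (1 - cnj z * w) = norm (cnj (w * (cnj w - cnj z)))"
      proof -
        have "w * cnj w = 1" using w by (simp add: complex_norm_square[symmetric])
        then have "1 - cnj z * w = w * (cnj w - cnj z)" by (simp add: algebra_simps)
        then show ?thesis by (simp only: complex_mod_cnj)
      qed
      also have "\<dots> = norm (w - z)" using w by (simp add: norm_mult complex_cnj_diff[symmetric] del: complex_cnj_diff)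
      finally have "norm (1 - cnj z * w) = norm (w - z)" .
      then show "(1 - (norm z)\<^sup>2) * ((norm (1 / (1 - cnj z * w)))\<^sup>2 * g w) = poisson z w * g w"
        by (simp add: poisson_def norm_divide power_divide)
    qed
    finally show ?thesis .
  qed
  have "integrable \<mu> (\<lambda>w. complex_of_real (g w))" using g by simp
  from fatou_radial[OF this] show ?thesis
  proof (rule AE_mp, intro AE_I2 impI)
    fix \<zeta> assume "\<zeta> \<in> space \<mu>" and l: "((\<lambda>r. LINT w|\<mu>. of_real (poisson (of_real r * \<zeta>) w) * of_real (g w)) \<longlongrightarrow> complex_of_real (g \<zeta>)) (at_left 1)"
    from tendsto_Re[OF l]
    have l': "((\<lambda>r. LINT w|\<mu>. poisson (of_real r * \<zeta>) w * g w) \<longlongrightarrow> g \<zeta>) (at_left 1)"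
      by (simp add: of_real_mult[symmetric] integral_complex_of_real del: of_real_mult)
    have "eventually (\<lambda>r::real. 0 < r \<and> r < 1) (at_left 1)"
      using eventually_at_left_real[of 0 "1::real"] by simp
    then have "eventually (\<lambda>r. 0 \<le> (LINT w|\<mu>. poisson (of_real r * \<zeta>) w * g w)) (at_left 1)"
      by eventually_elim (use \<open>\<zeta> \<in> space \<mu>\<close> in \<open>auto intro!: P simp: norm_mult\<close>)
    then show "0 \<le> g \<zeta>" using tendsto_lowerbound[OF l'] by simp
  qed
qed

section \<open>Positive semidefinite sesquilinear forms\<close>

text \<open>
  Nonnegativity of this quadratic polynomial in the real variable \<open>t\<close> is used at \<open>t = 1 / b\<close>. In the
  degenerate case \<open>b = 0\<close> it forces \<open>d = 0\<close>.
\<close>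

lemma quadratic_discriminant:
  fixes b d e :: real
  assumes "\<And>t. 0 \<le> e - 2 * t * d + t\<^sup>2 * d * b" "0 \<le> b" "0 \<le> d" "0 \<le> e"
  shows "d \<le> e * b"
proof (cases "b = 0")
  case True
  have "d = 0"
  proof (rule ccontr)
    assume "d \<noteq> 0"
    then have "0 \<le> e - 2 * ((e + 1) / d) * d" using assms(1)[of "(e+1)/d"] True by simp
    moreover have "2 * ((e + 1) / d) * d = 2 * (e + 1)" using \<open>d \<noteq> 0\<close> by simp
    ultimately show False using assms(4) by simp
  qed
  then show ?thesis using True by simp
next
  case False
  then have b: "0 < b" using assms by simp
  have "0 \<le> e - 2 * (1/b) * d + (1/b)\<^sup>2 * d * b" by (rule assms)
  also have "\<dots> = e - d / b" using b by (simp add: power2_eq_square field_simps)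
  finally show ?thesis using b by (simp add: field_simps)
qed

lemma choice2: "(\<And>n s. \<exists>x. P n s x) \<Longrightarrow> \<exists>f. \<forall>n s. P n s (f n s)"
  by metis

text \<open>
  A set closed under two operations \<open>add\<close> and \<open>scale\<close>, with a positive semidefinite form that is linear
  in its first argument. No other vector space law is needed.
\<close>

locale semi_inner =
  fixes S :: "'v set" and add :: "'v \<Rightarrow> 'v \<Rightarrow> 'v" and scale :: "complex \<Rightarrow> 'v \<Rightarrow> 'v"
    and B :: "'v \<Rightarrow> 'v \<Rightarrow> complex"
  assumes nonempty: "S \<noteq> {}"
    and add_closed: "\<lbrakk>x \<in> S; y \<in> S\<rbrakk> \<Longrightarrow> add x y \<in> S"
    and scale_closed: "x \<in> S \<Longrightarrow> scale c x \<in> S"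
    and B_add: "\<lbrakk>x \<in> S; y \<in> S; z \<in> S\<rbrakk> \<Longrightarrow> B (add x y) z = B x z + B y z"
    and B_scale: "\<lbrakk>x \<in> S; z \<in> S\<rbrakk> \<Longrightarrow> B (scale c x) z = c * B x z"
    and B_cnj: "\<lbrakk>x \<in> S; y \<in> S\<rbrakk> \<Longrightarrow> B y x = cnj (B x y)"
    and B_pos: "x \<in> S \<Longrightarrow> 0 \<le> Re (B x x)"
begin

lemma B_add_right: "\<lbrakk>x \<in> S; y \<in> S; z \<in> S\<rbrakk> \<Longrightarrow> B z (add x y) = B z x + B z y"
  using B_cnj[of "add x y" z] B_cnj[of x z] B_cnj[of y z] B_add[of x y z] add_closed[of x y] by simp

lemma B_scale_right: "\<lbrakk>x \<in> S; z \<in> S\<rbrakk> \<Longrightarrow> B z (scale c x) = cnj c * B z x"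
  using B_cnj[of "scale c x" z] B_cnj[of x z] B_scale[of x z c] scale_closed[of x c] by simp

lemma B_self: "x \<in> S \<Longrightarrow> B x x = of_real (Re (B x x))"
  using B_cnj[of x x] by (simp add: complex_eq_iff)

lemma B_add_scale_self:
  assumes "x \<in> S" "y \<in> S"
  shows "Re (B (add x (scale c y)) (add x (scale c y))) =
     Re (B x x) + 2 * Re (c * B y x) + (norm c)\<^sup>2 * Re (B y y)"
proof -
  have "B (add x (scale c y)) (add x (scale c y)) = B x x + c * B y x + cnj c * B x y + c * cnj c * B y y"
    using assms by (simp add: B_add B_add_right B_scale B_scale_right add_closed scale_closed algebra_simps)
  also have "cnj c * B x y = cnj (c * B y x)" using B_cnj[OF assms] by simp
  also have "c * cnj c * B y y = of_real ((norm c)\<^sup>2 * Re (B y y))"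
    using B_self[OF assms(2)] complex_norm_square[of c] by (metis of_real_mult)
  finally show ?thesis by simp
qed

lemma B_add_self:
  assumes "x \<in> S" "y \<in> S"
  shows "Re (B (add x y) (add x y)) = Re (B x x) + 2 * Re (B y x) + Re (B y y)"
  using assms B_cnj[OF assms] by (simp add: B_add B_add_right add_closed)

lemma Cauchy_Schwarz:
  assumes "x \<in> S" "y \<in> S"
  shows "(norm (B x y))\<^sup>2 \<le> Re (B x x) * Re (B y y)"
proof (rule quadratic_discriminant)
  fix t :: real
  have e: "B x y * cnj (B x y) = of_real ((norm (B x y))\<^sup>2)" using complex_norm_square[of "B x y"] by simp
  have "0 \<le> Re (B (add x (scale (- of_real t * B x y) y)) (add x (scale (- of_real t * B x y) y)))"
    by (intro B_pos add_closed scale_closed assms)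
  also have "\<dots> = Re (B x x) + 2 * Re (- of_real t * (B x y * cnj (B x y))) + (norm (- of_real t * B x y))\<^sup>2 * Re (B y y)"
    unfolding B_add_scale_self[OF assms] using B_cnj[OF assms] by (simp add: mult.assoc)
  also have "\<dots> = Re (B x x) - 2 * t * (norm (B x y))\<^sup>2 + t\<^sup>2 * (norm (B x y))\<^sup>2 * Re (B y y)"
    unfolding e by (simp add: norm_mult power_mult_distrib)
  finally show "0 \<le> Re (B x x) - 2 * t * (norm (B x y))\<^sup>2 + t\<^sup>2 * (norm (B x y))\<^sup>2 * Re (B y y)" .
qed (use B_pos assms in auto)

text \<open>
  An approximate Riesz representation: near-minimizers of \<open>B x x - 2 Re (\<phi> x)\<close> almost represent \<open>\<phi>\<close>.
  The space need be neither complete nor Hausdorff, so there may be no exact representative.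
\<close>

lemma approx_riesz:
  assumes lin: "\<And>x y. \<lbrakk>x \<in> S; y \<in> S\<rbrakk> \<Longrightarrow> \<phi> (add x y) = \<phi> x + \<phi> y" "\<And>c x. x \<in> S \<Longrightarrow> \<phi> (scale c x) = c * \<phi> x"
    and bdd: "\<And>y. y \<in> S \<Longrightarrow> 0 \<le> Re (B y y) + 2 * Re (\<phi> y) + A" and \<epsilon>: "0 < \<epsilon>"
  shows "\<exists>x\<in>S. \<forall>y\<in>S. (norm (B y x - \<phi> y))\<^sup>2 \<le> \<epsilon> * Re (B y y)"
proof -
  define Q where "Q x = Re (B x x) - 2 * Re (\<phi> x)" for x
  have Qb: "- A \<le> Q x" if "x \<in> S" for x
    using bdd[OF scale_closed[OF that, of "-1"]] that
    by (simp add: Q_def lin B_scale B_scale_right scale_closed)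
  have bb: "bdd_below (Q ` S)" using Qb by (intro bdd_belowI[of _ "-A"]) auto
  have "Inf (Q ` S) < Inf (Q ` S) + \<epsilon>" using \<epsilon> by simp
  then obtain x where x: "x \<in> S" "Q x < Inf (Q ` S) + \<epsilon>"
    using nonempty by (subst (asm) cInf_less_iff) (auto simp: bb)
  have "(norm (B y x - \<phi> y))\<^sup>2 \<le> \<epsilon> * Re (B y y)" if y: "y \<in> S" for y
  proof (rule quadratic_discriminant)
    fix t :: real
    let ?d = "B y x - \<phi> y" let ?c = "- of_real t * cnj ?d"
    have m: "add x (scale ?c y) \<in> S" by (intro add_closed scale_closed x y)
    have "Q x - \<epsilon> \<le> Q (add x (scale ?c y))"
      using cInf_lower[OF imageI[OF m] bb] x(2) by simp
    also have "\<dots> = Q x + 2 * Re (?c * ?d) + (norm ?c)\<^sup>2 * Re (B y y)"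
      unfolding Q_def B_add_scale_self[OF x(1) y] using x(1) y
      by (simp add: lin scale_closed algebra_simps)
    also have "?c * ?d = of_real (- t * (norm ?d)\<^sup>2)"
      using complex_norm_square[of ?d] by simp
    also have "(norm ?c)\<^sup>2 = t\<^sup>2 * (norm ?d)\<^sup>2" by (simp add: norm_mult power_mult_distrib del: complex_cnj_diff)
    finally show "0 \<le> \<epsilon> - 2 * t * (norm ?d)\<^sup>2 + t\<^sup>2 * (norm ?d)\<^sup>2 * Re (B y y)" by simp
  qed (use B_pos y \<epsilon> in auto)
  then show ?thesis using x(1) by blast
qed

text \<open>
  The operations on \<open>S\<close> are not assumed to satisfy any laws, so a linear combination is described by its
  inner products only.
\<close>

lemma linear_combination:
  assumes "finite I" "\<And>i. i \<in> I \<Longrightarrow> x i \<in> S"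
  shows "\<exists>X\<in>S. \<forall>z\<in>S. B X z = (\<Sum>i\<in>I. c i * B (x i) z)"
  using assms
proof (induction I rule: finite_induct)
  case empty
  obtain z0 where "z0 \<in> S" using nonempty by blast
  then show ?case by (intro bexI[of _ "scale 0 z0"]) (auto simp: B_scale scale_closed)
next
  case (insert i I)
  then obtain X where "X \<in> S" "\<forall>z\<in>S. B X z = (\<Sum>i\<in>I. c i * B (x i) z)" by auto
  with insert show ?case
    by (intro bexI[of _ "add (scale (c i) (x i)) X"]) (auto simp: B_add B_scale add_closed scale_closed)
qed

text \<open>
  One step of positive semidefinite completion. Two finite families of new vectors are given by their
  inner products with \<open>S\<close>; each of them separately extends the form to a positive semidefinite one.
  Then both can be adjoined simultaneously: the missing mutual inner products are those of the
  (approximate) projections of the new vectors to \<open>S\<close>.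
\<close>

lemma psd_completion:
  fixes \<alpha> \<beta> :: "'i::finite \<Rightarrow> 'v \<Rightarrow> complex" and a b :: "complex ^ 'i \<Rightarrow> real"
  assumes lin_\<alpha>: "\<And>i x y. \<lbrakk>x \<in> S; y \<in> S\<rbrakk> \<Longrightarrow> \<alpha> i (add x y) = \<alpha> i x + \<alpha> i y" "\<And>i c x. x \<in> S \<Longrightarrow> \<alpha> i (scale c x) = c * \<alpha> i x"
    and lin_\<beta>: "\<And>i x y. \<lbrakk>x \<in> S; y \<in> S\<rbrakk> \<Longrightarrow> \<beta> i (add x y) = \<beta> i x + \<beta> i y" "\<And>i c x. x \<in> S \<Longrightarrow> \<beta> i (scale c x) = c * \<beta> i x"
    and pos_\<alpha>: "\<And>s y. y \<in> S \<Longrightarrow> 0 \<le> Re (B y y) + 2 * Re (\<Sum>i\<in>UNIV. cnj (s $ i) * \<alpha> i y) + a s"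
    and pos_\<beta>: "\<And>s y. y \<in> S \<Longrightarrow> 0 \<le> Re (B y y) + 2 * Re (\<Sum>i\<in>UNIV. cnj (s $ i) * \<beta> i y) + b s"
  shows "\<exists>\<gamma> :: complex ^ 'i ^ 'i. \<forall>s t. \<forall>y\<in>S. 0 \<le> Re (B y y) + a s + b t
      + 2 * Re (\<Sum>i\<in>UNIV. cnj (s $ i) * \<alpha> i y) + 2 * Re (\<Sum>j\<in>UNIV. cnj (t $ j) * \<beta> j y)
      + 2 * Re (\<Sum>i\<in>UNIV. \<Sum>j\<in>UNIV. s $ i * cnj (t $ j) * \<gamma> $ i $ j)"
proof -
  define e where "e n = 1 / real (Suc n)" for n
  have e0: "0 < e n" for n by (simp add: e_def)
  have e1: "e n \<le> 1" for n by (simp add: e_def)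
  have e_lim: "e \<longlonglongrightarrow> 0" unfolding e_def by (rule LIMSEQ_Suc[OF lim_1_over_n])
  have repr: "\<exists>x. \<forall>n i. x n i \<in> S \<and> (\<forall>y\<in>S. (norm (B y (x n i) - \<psi> i y))\<^sup>2 \<le> e n * Re (B y y))"
    if lin: "\<And>i x y. \<lbrakk>x \<in> S; y \<in> S\<rbrakk> \<Longrightarrow> \<psi> i (add x y) = \<psi> i x + \<psi> i y" "\<And>i c x. x \<in> S \<Longrightarrow> \<psi> i (scale c x) = c * \<psi> i x"
      and pos: "\<And>s y. y \<in> S \<Longrightarrow> 0 \<le> Re (B y y) + 2 * Re (\<Sum>i\<in>UNIV. cnj (s $ i) * \<psi> i y) + q s"
    for \<psi> :: "'i \<Rightarrow> 'v \<Rightarrow> complex" and q :: "complex ^ 'i \<Rightarrow> real"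
  proof -
    have "\<exists>x\<in>S. \<forall>y\<in>S. (norm (B y x - \<psi> i y))\<^sup>2 \<le> e n * Re (B y y)" for i n
    proof (rule approx_riesz[OF lin _ e0])
      fix y assume "y \<in> S"
      from pos[OF this, of "axis i 1"] show "0 \<le> Re (B y y) + 2 * Re (\<psi> i y) + q (axis i 1)"
        by (simp add: axis_def if_distrib[of cnj] if_distrib[of "\<lambda>x. x * _"] sum.delta cong: if_cong)
    qed
    then show ?thesis by (intro choice2) (simp add: Bex_def)
  qed
  \<comment> \<open>\<open>X n s\<close> approximates the projection of the combination \<open>s\<close> of the new vectors.\<close>
  have proj: "\<exists>X. (\<forall>n s. X n s \<in> S) \<and> (\<forall>n s. \<forall>z\<in>S. B (X n s) z = (\<Sum>i\<in>UNIV. s $ i * B (x n i) z))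
      \<and> (\<forall>s. \<forall>y\<in>S. (\<lambda>n. B y (X n s)) \<longlonglongrightarrow> (\<Sum>i\<in>UNIV. cnj (s $ i) * \<psi> i y))
      \<and> (\<forall>s. \<exists>M. \<forall>n. Re (B (X n s) (X n s)) \<le> M \<and> Re (B (X n s) (X n s)) \<le> q s + M * sqrt (e n))"
    if lin: "\<And>i x y. \<lbrakk>x \<in> S; y \<in> S\<rbrakk> \<Longrightarrow> \<psi> i (add x y) = \<psi> i x + \<psi> i y" "\<And>i c x. x \<in> S \<Longrightarrow> \<psi> i (scale c x) = c * \<psi> i x"
      and pos: "\<And>s y. y \<in> S \<Longrightarrow> 0 \<le> Re (B y y) + 2 * Re (\<Sum>i\<in>UNIV. cnj (s $ i) * \<psi> i y) + q s"
      and x: "\<forall>n i. x n i \<in> S \<and> (\<forall>y\<in>S. (norm (B y (x n i) - \<psi> i y))\<^sup>2 \<le> e n * Re (B y y))"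
    for \<psi> :: "'i \<Rightarrow> 'v \<Rightarrow> complex" and q :: "complex ^ 'i \<Rightarrow> real" and x
  proof -
    have "\<exists>X. X \<in> S \<and> (\<forall>z\<in>S. B X z = (\<Sum>i\<in>UNIV. s $ i * B (x n i) z))" for n s
      using x linear_combination[of UNIV "x n" "\<lambda>i. s $ i"] by (auto simp: Bex_def)
    from choice2[OF this] obtain X where "\<forall>n s. X n s \<in> S \<and> (\<forall>z\<in>S. B (X n s) z = (\<Sum>i\<in>UNIV. s $ i * B (x n i) z))" ..
    then have X: "\<And>n s. X n s \<in> S" "\<And>n s z. z \<in> S \<Longrightarrow> B (X n s) z = (\<Sum>i\<in>UNIV. s $ i * B (x n i) z)"
      by simp_all
    have Xr: "B z (X n s) = (\<Sum>i\<in>UNIV. cnj (s $ i) * B z (x n i))" if "z \<in> S" for n s z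
    proof -
      have "B z (X n s) = cnj (B (X n s) z)" using B_cnj[OF X(1) that] .
      also have "\<dots> = (\<Sum>i\<in>UNIV. cnj (s $ i) * cnj (B (x n i) z))" using X(2)[OF that] by simp
      also have "\<dots> = (\<Sum>i\<in>UNIV. cnj (s $ i) * B z (x n i))"
        by (intro sum.cong refl arg_cong2[where f="(*)"]) (use x that in \<open>auto intro: B_cnj[symmetric]\<close>)
      finally show ?thesis .
    qed
    have err: "norm (B y (X n s) - (\<Sum>i\<in>UNIV. cnj (s $ i) * \<psi> i y)) \<le> (\<Sum>i\<in>UNIV. norm (s $ i)) * (sqrt (e n) * sqrt (Re (B y y)))"
      if y: "y \<in> S" for n s y
    proof -
      have "norm (B y (x n i) - \<psi> i y) \<le> sqrt (e n) * sqrt (Re (B y y))" for i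
        unfolding real_sqrt_mult[symmetric] using x y by (intro real_le_rsqrt) auto
      then have "norm (\<Sum>i\<in>UNIV. cnj (s $ i) * (B y (x n i) - \<psi> i y)) \<le> (\<Sum>i\<in>UNIV. norm (s $ i) * (sqrt (e n) * sqrt (Re (B y y))))"
        by (intro order_trans[OF norm_sum] sum_mono) (simp add: norm_mult mult_left_mono)
      then show ?thesis
        by (simp add: Xr[OF y] sum_subtractf[symmetric] right_diff_distrib sum_distrib_right)
    qed
    have conv: "(\<lambda>n. B y (X n s)) \<longlonglongrightarrow> (\<Sum>i\<in>UNIV. cnj (s $ i) * \<psi> i y)" if y: "y \<in> S" for s y
    proof (rule LIM_zero_cancel, rule Lim_null_comparison)
      show "eventually (\<lambda>n. norm (B y (X n s) - (\<Sum>i\<in>UNIV. cnj (s $ i) * \<psi> i y)) \<le> (\<Sum>i\<in>UNIV. norm (s $ i)) * (sqrt (e n) * sqrt (Re (B y y)))) sequentially"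
        using err[OF y] by simp
      have "(\<lambda>n. (\<Sum>i\<in>UNIV. norm (s $ i)) * (sqrt (e n) * sqrt (Re (B y y)))) \<longlonglongrightarrow> (\<Sum>i\<in>UNIV. norm (s $ i)) * (sqrt 0 * sqrt (Re (B y y)))"
        by (intro tendsto_intros e_lim)
      then show "(\<lambda>n. (\<Sum>i\<in>UNIV. norm (s $ i)) * (sqrt (e n) * sqrt (Re (B y y)))) \<longlonglongrightarrow> 0" by simp
    qed
    have bound: "\<exists>M. \<forall>n. Re (B (X n s) (X n s)) \<le> M \<and> Re (B (X n s) (X n s)) \<le> q s + M * sqrt (e n)" for s
    proof -
      define c where "c = (\<Sum>i\<in>UNIV. norm (s $ i))"
      have c0: "0 \<le> c" unfolding c_def by (rule sum_nonneg) simp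
      have main: "Re (B (X n s) (X n s)) \<le> q s + 2 * c * sqrt (e n) * sqrt (Re (B (X n s) (X n s)))" for n
      proof -
        let ?X = "X n s" let ?p = "\<Sum>i\<in>UNIV. cnj (s $ i) * \<psi> i ?X"
        have "0 \<le> Re (B (scale (-1) ?X) (scale (-1) ?X)) + 2 * Re (\<Sum>i\<in>UNIV. cnj (s $ i) * \<psi> i (scale (-1) ?X)) + q s"
          by (intro pos scale_closed X)
        then have 1: "2 * Re ?p \<le> Re (B ?X ?X) + q s"
          using X(1) by (simp add: lin B_scale B_scale_right scale_closed sum_negf)
        have "\<bar>Re (B ?X ?X - ?p)\<bar> \<le> c * (sqrt (e n) * sqrt (Re (B ?X ?X)))"
          using err[OF X(1), of n s n s] abs_Re_le_cmod order_trans unfolding c_def by blast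
        then have "2 * Re (B ?X ?X) \<le> 2 * Re ?p + 2 * (c * (sqrt (e n) * sqrt (Re (B ?X ?X))))"
          by (simp add: abs_le_iff)
        with 1 show ?thesis by (simp add: mult.assoc)
      qed
      have bd: "Re (B (X n s) (X n s)) \<le> 2 * \<bar>q s\<bar> + 4 * c\<^sup>2" for n
      proof -
        define u where "u = sqrt (Re (B (X n s) (X n s)))"
        have u: "u\<^sup>2 = Re (B (X n s) (X n s))" unfolding u_def using B_pos[OF X(1)] by simp
        have u0: "0 \<le> u" unfolding u_def using B_pos[OF X(1)] by simp
        have "sqrt (e n) \<le> 1" using e1 by simp
        then have "2 * c * sqrt (e n) * u \<le> 2 * c * 1 * u"
          using c0 u0 by (intro mult_right_mono mult_left_mono) auto
        then have "u\<^sup>2 \<le> \<bar>q s\<bar> + 2 * c * u" using main[of n] u unfolding u_def[symmetric] by simp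
        moreover have "0 \<le> (u - 2 * c)\<^sup>2" by simp
        then have "4 * c * u \<le> u\<^sup>2 + 4 * c\<^sup>2" by (simp add: power2_eq_square algebra_simps)
        ultimately show ?thesis using u by simp
      qed
      define M where "M = max (2 * \<bar>q s\<bar> + 4 * c\<^sup>2) (2 * c * sqrt (2 * \<bar>q s\<bar> + 4 * c\<^sup>2))"
      have "Re (B (X n s) (X n s)) \<le> q s + M * sqrt (e n)" for n
      proof -
        have "2 * c * sqrt (Re (B (X n s) (X n s))) \<le> 2 * c * sqrt (2 * \<bar>q s\<bar> + 4 * c\<^sup>2)"
          using bd[of n] c0 by (intro mult_left_mono) auto
        also have "\<dots> \<le> M" unfolding M_def by simp
        finally have "(2 * c * sqrt (Re (B (X n s) (X n s)))) * sqrt (e n) \<le> M * sqrt (e n)"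
          using e0[of n] by (intro mult_right_mono) auto
        then show ?thesis using main[of n] by (simp add: mult_ac)
      qed
      moreover have "Re (B (X n s) (X n s)) \<le> M" for n using bd[of n] unfolding M_def by simp
      ultimately show ?thesis by blast
    qed
    show ?thesis using X conv bound by blast
  qed
  obtain x where x: "\<forall>n i. x n i \<in> S \<and> (\<forall>y\<in>S. (norm (B y (x n i) - \<alpha> i y))\<^sup>2 \<le> e n * Re (B y y))"
    using repr[OF lin_\<alpha> pos_\<alpha>] by blast
  obtain y where y: "\<forall>n i. y n i \<in> S \<and> (\<forall>z\<in>S. (norm (B z (y n i) - \<beta> i z))\<^sup>2 \<le> e n * Re (B z z))"
    using repr[OF lin_\<beta> pos_\<beta>] by blast
  obtain X where X: "\<And>n s. X n s \<in> S" "\<And>n s z. z \<in> S \<Longrightarrow> B (X n s) z = (\<Sum>i\<in>UNIV. s $ i * B (x n i) z)"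
      "\<And>s z. z \<in> S \<Longrightarrow> (\<lambda>n. B z (X n s)) \<longlonglongrightarrow> (\<Sum>i\<in>UNIV. cnj (s $ i) * \<alpha> i z)"
      "\<And>s. \<exists>M. \<forall>n. Re (B (X n s) (X n s)) \<le> M \<and> Re (B (X n s) (X n s)) \<le> a s + M * sqrt (e n)"
    using proj[OF lin_\<alpha> pos_\<alpha> x] by blast
  obtain Y where Y: "\<And>n s. Y n s \<in> S" "\<And>n s z. z \<in> S \<Longrightarrow> B (Y n s) z = (\<Sum>i\<in>UNIV. s $ i * B (y n i) z)"
      "\<And>s z. z \<in> S \<Longrightarrow> (\<lambda>n. B z (Y n s)) \<longlonglongrightarrow> (\<Sum>i\<in>UNIV. cnj (s $ i) * \<beta> i z)"
      "\<And>s. \<exists>M. \<forall>n. Re (B (Y n s) (Y n s)) \<le> M \<and> Re (B (Y n s) (Y n s)) \<le> b s + M * sqrt (e n)"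
    using proj[OF lin_\<beta> pos_\<beta> y] by blast
  \<comment> \<open>The mutual inner products are bounded by Cauchy--Schwarz; a limit point of them is the answer.\<close>
  define \<Gamma> :: "nat \<Rightarrow> complex ^ 'i ^ 'i" where "\<Gamma> n = (\<chi> i j. B (X n (axis i 1)) (Y n (axis j 1)))" for n
  have XY: "B (X n s) (Y n t) = (\<Sum>i\<in>UNIV. \<Sum>j\<in>UNIV. s $ i * cnj (t $ j) * \<Gamma> n $ i $ j)" for n s t
  proof -
    have Yr: "B z (Y n t) = (\<Sum>j\<in>UNIV. cnj (t $ j) * B z (y n j))" if "z \<in> S" for z t
    proof -
      have "B z (Y n t) = cnj (B (Y n t) z)" using B_cnj[OF Y(1) that] .
      also have "\<dots> = (\<Sum>i\<in>UNIV. cnj (t $ i) * cnj (B (y n i) z))" using Y(2)[OF that] by simp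
      also have "\<dots> = (\<Sum>i\<in>UNIV. cnj (t $ i) * B z (y n i))"
        by (intro sum.cong refl arg_cong2[where f="(*)"]) (use y that in \<open>auto intro: B_cnj[symmetric]\<close>)
      finally show ?thesis .
    qed
    have "\<Gamma> n $ i $ j = B (x n i) (y n j)" for i j
      using x y X(1) Y(1)
      by (simp add: \<Gamma>_def Yr X(2))
         (simp add: axis_def if_distrib[of cnj] if_distrib[of "\<lambda>x. x * _"] sum.delta cong: if_cong)
    then show ?thesis using x y Y(1)
      by (simp add: X(2) Yr sum_distrib_left mult.assoc)
  qed
  have "bounded (range \<Gamma>)"
  proof -
    have "\<exists>M. \<forall>n. norm (\<Gamma> n $ i $ j) \<le> M" for i j
    proof -
      obtain M1 where M1: "\<And>n. Re (B (X n (axis i 1)) (X n (axis i 1))) \<le> M1" using X(4)[of "axis i 1"] by blast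
      obtain M2 where M2: "\<And>n. Re (B (Y n (axis j 1)) (Y n (axis j 1))) \<le> M2" using Y(4)[of "axis j 1"] by blast
      have "(norm (\<Gamma> n $ i $ j))\<^sup>2 \<le> M1 * M2" for n
        unfolding \<Gamma>_def vec_lambda_beta
        by (rule order_trans[OF Cauchy_Schwarz[OF X(1) Y(1)]])
           (use M1 M2 X(1) Y(1) B_pos order_trans in \<open>blast intro: mult_mono\<close>)
      then show ?thesis by (intro exI[of _ "sqrt (M1 * M2)"]) (simp add: real_le_rsqrt)
    qed
    then obtain M where M: "\<And>i j n. norm (\<Gamma> n $ i $ j) \<le> M i j" by metis
    have "norm (\<Gamma> n) \<le> (\<Sum>i\<in>UNIV. \<Sum>j\<in>UNIV. M i j)" for n
    proof -
      have "norm (\<Gamma> n) \<le> (\<Sum>i\<in>UNIV. norm (\<Gamma> n $ i))" by (rule norm_le_componentwise_cart[THEN order_trans, of _ "\<Gamma> n"])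
        (auto simp: norm_vec_def intro: L2_set_le_sum)
      also have "\<dots> \<le> (\<Sum>i\<in>UNIV. \<Sum>j\<in>UNIV. norm (\<Gamma> n $ i $ j))"
        by (intro sum_mono) (auto simp: norm_vec_def intro: L2_set_le_sum)
      also have "\<dots> \<le> (\<Sum>i\<in>UNIV. \<Sum>j\<in>UNIV. M i j)" by (intro sum_mono M)
      finally show ?thesis .
    qed
    then show ?thesis by (intro boundedI) auto
  qed
  then obtain \<gamma> \<rho> where \<rho>: "strict_mono (\<rho> :: nat \<Rightarrow> nat)" "(\<Gamma> \<circ> \<rho>) \<longlonglongrightarrow> \<gamma>"
    using bounded_imp_convergent_subsequence by blast
  have "0 \<le> Re (B z z) + a s + b t
      + 2 * Re (\<Sum>i\<in>UNIV. cnj (s $ i) * \<alpha> i z) + 2 * Re (\<Sum>j\<in>UNIV. cnj (t $ j) * \<beta> j z)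
      + 2 * Re (\<Sum>i\<in>UNIV. \<Sum>j\<in>UNIV. s $ i * cnj (t $ j) * \<gamma> $ i $ j)" (is "0 \<le> ?R") if z: "z \<in> S" for s t z
  proof -
    obtain M1 where M1: "\<And>n. Re (B (X n s) (X n s)) \<le> a s + M1 * sqrt (e n)" using X(4)[of s] by blast
    obtain M2 where M2: "\<And>n. Re (B (Y n t) (Y n t)) \<le> b t + M2 * sqrt (e n)" using Y(4)[of t] by blast
    define v where "v n = Re (B z z) + (a s + M1 * sqrt (e n)) + (b t + M2 * sqrt (e n))
      + 2 * Re (B z (X n s)) + 2 * Re (B z (Y n t))
      + 2 * Re (\<Sum>i\<in>UNIV. \<Sum>j\<in>UNIV. s $ i * cnj (t $ j) * \<Gamma> n $ i $ j)" for n
    have "0 \<le> v n" for n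
    proof -
      have "0 \<le> Re (B (add (add z (X n s)) (Y n t)) (add (add z (X n s)) (Y n t)))"
        by (intro B_pos add_closed z X Y)
      also have "\<dots> = Re (B z z) + Re (B (X n s) (X n s)) + Re (B (Y n t) (Y n t))
          + 2 * Re (B z (X n s)) + 2 * Re (B z (Y n t)) + 2 * Re (B (X n s) (Y n t))"
        using z X(1) Y(1) B_cnj[OF z X(1)[of n s]] B_cnj[OF z Y(1)[of n t]] B_cnj[OF X(1)[of n s] Y(1)[of n t]]
        by (simp add: B_add_self add_closed B_add_right B_add)
      finally show ?thesis using M1[of n] M2[of n] unfolding v_def XY[symmetric] by linarith
    qed
    moreover have "(\<lambda>n. v (\<rho> n)) \<longlonglongrightarrow> Re (B z z) + (a s + M1 * sqrt 0) + (b t + M2 * sqrt 0)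
      + 2 * Re (\<Sum>i\<in>UNIV. cnj (s $ i) * \<alpha> i z) + 2 * Re (\<Sum>j\<in>UNIV. cnj (t $ j) * \<beta> j z)
      + 2 * Re (\<Sum>i\<in>UNIV. \<Sum>j\<in>UNIV. s $ i * cnj (t $ j) * \<gamma> $ i $ j)"
    proof -
      have G: "(\<lambda>n. \<Gamma> (\<rho> n)) \<longlonglongrightarrow> \<gamma>" using \<rho>(2) by (simp add: o_def)
      have e': "(\<lambda>n. e (\<rho> n)) \<longlonglongrightarrow> 0" using LIMSEQ_subseq_LIMSEQ[OF e_lim \<rho>(1)] by (simp add: o_def)
      have X': "(\<lambda>n. B z (X (\<rho> n) s)) \<longlonglongrightarrow> (\<Sum>i\<in>UNIV. cnj (s $ i) * \<alpha> i z)"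
        using LIMSEQ_subseq_LIMSEQ[OF X(3)[OF z] \<rho>(1)] by (simp add: o_def)
      have Y': "(\<lambda>n. B z (Y (\<rho> n) t)) \<longlonglongrightarrow> (\<Sum>i\<in>UNIV. cnj (t $ i) * \<beta> i z)"
        using LIMSEQ_subseq_LIMSEQ[OF Y(3)[OF z] \<rho>(1)] by (simp add: o_def)
      show ?thesis unfolding v_def
        by (intro tendsto_intros tendsto_Re X' Y' e' tendsto_vec_nth G)
    qed
    ultimately have "0 \<le> Re (B z z) + (a s + M1 * sqrt 0) + (b t + M2 * sqrt 0)
      + 2 * Re (\<Sum>i\<in>UNIV. cnj (s $ i) * \<alpha> i z) + 2 * Re (\<Sum>j\<in>UNIV. cnj (t $ j) * \<beta> j z)
      + 2 * Re (\<Sum>i\<in>UNIV. \<Sum>j\<in>UNIV. s $ i * cnj (t $ j) * \<gamma> $ i $ j)"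
      by (intro LIMSEQ_le_const) auto
    then show ?thesis by simp
  qed
  then show ?thesis by blast
qed

end

section \<open>Square integrable vector functions\<close>

text \<open>The inner product on complex vectors, linear in the first argument.\<close>

definition cdot :: "complex ^ 'r \<Rightarrow> complex ^ 'r \<Rightarrow> complex" where
  "cdot x y = (\<Sum>i\<in>UNIV. x $ i * cnj (y $ i))"

lemma cdot_add_left: "cdot (x + y) z = cdot x z + cdot y z"
  by (simp add: cdot_def distrib_right sum.distrib)

lemma cdot_add_right: "cdot z (x + y) = cdot z x + cdot z y"
  by (simp add: cdot_def distrib_left sum.distrib)

lemma cdot_diff_left: "cdot (x - y) z = cdot x z - cdot y z"
  by (simp add: cdot_def left_diff_distrib sum_subtractf)

lemma cdot_diff_right: "cdot z (x - y) = cdot z x - cdot z y"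
  by (simp add: cdot_def right_diff_distrib sum_subtractf)

lemma cdot_scale_left: "cdot (c *s x) z = c * cdot x z"
  by (simp add: cdot_def sum_distrib_left mult.assoc)

lemma cdot_scale_right: "cdot z (c *s x) = cnj c * cdot z x"
  by (simp add: cdot_def sum_distrib_left mult_ac)

lemma cdot_cnj: "cnj (cdot x y) = cdot y x"
  by (simp add: cdot_def mult.commute)

lemma cdot_zero [simp]: "cdot 0 x = 0" "cdot x 0 = 0"
  by (simp_all add: cdot_def)

lemma norm_vec_sq: "(norm (x :: complex ^ 'r))\<^sup>2 = (\<Sum>i\<in>UNIV. (norm (x $ i))\<^sup>2)"
  by (simp add: norm_vec_def L2_set_def sum_nonneg)

lemma cdot_self: "cdot x x = of_real ((norm x)\<^sup>2)"
  by (simp add: cdot_def norm_vec_sq complex_norm_square[symmetric] del: of_real_power)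

lemma norm_cdot_le: "norm (cdot x y) \<le> norm x * norm y"
proof -
  have "norm (cdot x y) \<le> (\<Sum>i\<in>UNIV. \<bar>norm (x $ i)\<bar> * \<bar>norm (y $ i)\<bar>)"
    unfolding cdot_def by (rule order_trans[OF norm_sum]) (simp add: norm_mult)
  also have "\<dots> \<le> norm x * norm y"
    unfolding norm_vec_def by (rule L2_set_mult_ineq)
  finally show ?thesis .
qed

lemma cdot_axis: "cdot x (axis i 1) = x $ i"
  by (simp add: cdot_def axis_def if_distrib[of cnj] if_distrib[of "\<lambda>y. _ * y"] sum.delta cong: if_cong)

lemma norm_smult_vec: "norm (c *s x) = norm c * norm (x :: complex ^ 'r)"
proof -
  have "(norm (c *s x))\<^sup>2 = (norm c * norm x)\<^sup>2"
    by (simp add: norm_vec_sq power_mult_distrib norm_mult sum_distrib_left)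
  then show ?thesis by (subst (asm) power2_eq_iff_nonneg) auto
qed

lemma cnj_measurable [measurable (raw)]:
  "f \<in> borel_measurable M \<Longrightarrow> (\<lambda>x. cnj (f x)) \<in> borel_measurable M"
  using measurable_compose[of f M borel cnj borel] borel_measurable_continuous_onI[of cnj]
  by (simp add: continuous_on_cnj continuous_on_id)

lemma vec_nth_measurable [measurable (raw)]:
  fixes f :: "'a \<Rightarrow> 'b::euclidean_space ^ 'r"
  assumes "f \<in> borel_measurable M"
  shows "(\<lambda>x. f x $ i) \<in> borel_measurable M"
proof -
  have "(\<lambda>x::'b ^ 'r. x $ i) \<in> borel_measurable borel"
    by (intro borel_measurable_continuous_onI continuous_on_component continuous_on_id)
  from measurable_compose[OF assms this] show ?thesis .
qed

lemma vec_lambda_measurable [measurable (raw)]: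
  fixes f :: "'r::finite \<Rightarrow> 'a \<Rightarrow> 'b::euclidean_space"
  assumes "\<And>i. f i \<in> borel_measurable M"
  shows "(\<lambda>x. \<chi> i. f i x) \<in> borel_measurable M"
proof (rule borel_measurable_euclidean_space[THEN iffD2], rule ballI)
  fix b :: "'b ^ 'r" assume "b \<in> Basis"
  then obtain i u where b: "b = axis i u" unfolding Basis_vec_def by blast
  have "(\<lambda>x. f i x \<bullet> u) \<in> borel_measurable M"
    by (rule borel_measurable_inner[OF assms borel_measurable_const])
  then show "(\<lambda>x. (\<chi> i. f i x) \<bullet> b) \<in> borel_measurable M"
    unfolding b inner_axis by simp
qed

lemma smult_measurable [measurable (raw)]:
  fixes f :: "'a \<Rightarrow> complex ^ 'r"
  assumes [measurable]: "c \<in> borel_measurable M" "f \<in> borel_measurable M"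
  shows "(\<lambda>x. c x *s f x) \<in> borel_measurable M"
  unfolding vector_scalar_mult_def by measurable

lemma cdot_measurable [measurable (raw)]:
  assumes [measurable]: "f \<in> borel_measurable M" "g \<in> borel_measurable M"
  shows "(\<lambda>x. cdot (f x) (g x)) \<in> borel_measurable M"
  unfolding cdot_def by measurable

lemma matrix_vector_measurable [measurable (raw)]:
  fixes A :: "'a \<Rightarrow> complex ^ 'n ^ 'm"
  assumes [measurable]: "A \<in> borel_measurable M" "f \<in> borel_measurable M"
  shows "(\<lambda>x. A x *v f x) \<in> borel_measurable M"
  unfolding matrix_vector_mult_def by measurable

lemma adjoint_measurable [measurable (raw)]:
  fixes A :: "'a \<Rightarrow> complex ^ 'n ^ 'm"
  assumes [measurable]: "A \<in> borel_measurable M"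
  shows "(\<lambda>x. adjoint_matrix (A x)) \<in> borel_measurable M"
  unfolding adjoint_matrix_def map_matrix_def transpose_def vec_lambda_beta by measurable

lemma map_matrix_mult_measurable [measurable (raw)]:
  fixes A :: "'a \<Rightarrow> complex ^ 'n ^ 'm"
  assumes [measurable]: "c \<in> borel_measurable M" "A \<in> borel_measurable M"
  shows "(\<lambda>x. map_matrix ((*) (c x)) (A x)) \<in> borel_measurable M"
  unfolding map_matrix_def by measurable

lemma L2_measurable [measurable_dest]: "f \<in> L2 \<Longrightarrow> f \<in> borel_measurable \<mu>"
  by (simp add: L2_def)

lemma L2_integrable: "f \<in> L2 \<Longrightarrow> integrable \<mu> (\<lambda>\<zeta>. (norm (f \<zeta>))\<^sup>2)"
  by (simp add: L2_def)

lemma L2_inner_cdot: "L2_inner f g = (LINT \<zeta>|\<mu>. cdot (f \<zeta>) (g \<zeta>))"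
  by (simp add: L2_inner_def cdot_def)

lemma L2_bound:
  assumes [measurable]: "f \<in> borel_measurable \<mu>" and g: "integrable \<mu> g"
    and b: "AE \<zeta> in \<mu>. (norm (f \<zeta>))\<^sup>2 \<le> g \<zeta>"
  shows "f \<in> L2"
proof -
  have "integrable \<mu> (\<lambda>\<zeta>. (norm (f \<zeta>))\<^sup>2)"
    by (rule Bochner_Integration.integrable_bound[OF g]) (use b in \<open>auto elim: eventually_mono\<close>)
  then show ?thesis by (simp add: L2_def)
qed

lemma L2_bounded:
  assumes "f \<in> borel_measurable \<mu>" "AE \<zeta> in \<mu>. norm (f \<zeta>) \<le> b"
  shows "f \<in> L2"
proof (rule L2_bound[OF assms(1)])
  show "AE \<zeta> in \<mu>. (norm (f \<zeta>))\<^sup>2 \<le> b\<^sup>2"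
    using assms(2) by eventually_elim (auto intro: power_mono)
qed simp

lemma L2_const [simp]: "(\<lambda>\<zeta>. c) \<in> L2"
  by (rule L2_bounded[where b="norm c"]) auto

lemma sum_square_bound: "(norm (x + y :: 'a::real_normed_vector))\<^sup>2 \<le> 2 * (norm x)\<^sup>2 + 2 * (norm y)\<^sup>2"
proof -
  have "(norm (x + y))\<^sup>2 \<le> (norm x + norm y)\<^sup>2" by (intro power_mono norm_triangle_ineq) simp
  also have "\<dots> \<le> 2 * (norm x)\<^sup>2 + 2 * (norm y)\<^sup>2"
    using sum_squares_bound[of "norm x" "norm y"] by (simp add: power2_sum)
  finally show ?thesis .
qed

lemma L2_add: assumes "f \<in> L2" "g \<in> L2" shows "(\<lambda>\<zeta>. f \<zeta> + g \<zeta>) \<in> L2"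
proof (rule L2_bound)
  show "integrable \<mu> (\<lambda>\<zeta>. 2 * (norm (f \<zeta>))\<^sup>2 + 2 * (norm (g \<zeta>))\<^sup>2)"
    using L2_integrable[OF assms(1)] L2_integrable[OF assms(2)] by simp
qed (use assms sum_square_bound in \<open>auto\<close>)

lemma L2_mult_bounded:
  assumes [measurable]: "c \<in> borel_measurable \<mu>" and b: "AE \<zeta> in \<mu>. norm (c \<zeta>) \<le> b" and f: "f \<in> L2"
  shows "(\<lambda>\<zeta>. c \<zeta> *s f \<zeta>) \<in> L2"
proof (rule L2_bound)
  show "integrable \<mu> (\<lambda>\<zeta>. b\<^sup>2 * (norm (f \<zeta>))\<^sup>2)" using f by (auto dest: L2_integrable)
  show "AE \<zeta> in \<mu>. (norm (c \<zeta> *s f \<zeta>))\<^sup>2 \<le> b\<^sup>2 * (norm (f \<zeta>))\<^sup>2"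
    using b by eventually_elim (auto simp: norm_smult_vec power_mult_distrib intro!: mult_right_mono power_mono)
qed (use f in measurable)

lemma L2_scale: "f \<in> L2 \<Longrightarrow> (\<lambda>\<zeta>. c *s f \<zeta>) \<in> L2"
  by (rule L2_mult_bounded[where b="norm c"]) auto

lemma L2_diff: assumes "f \<in> L2" "g \<in> L2" shows "(\<lambda>\<zeta>. f \<zeta> - g \<zeta>) \<in> L2"
  using L2_add[OF assms(1) L2_scale[OF assms(2), of "-1"]] by (simp add: vector_sneg_minus1[symmetric])

lemma L2_sum: "(\<And>i. i \<in> I \<Longrightarrow> f i \<in> L2) \<Longrightarrow> (\<lambda>\<zeta>. \<Sum>i\<in>I. f i \<zeta>) \<in> L2"
  by (induction I rule: infinite_finite_induct) (auto intro: L2_add)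

lemma integrable_cdot [intro]:
  assumes "f \<in> L2" "g \<in> L2" shows "integrable \<mu> (\<lambda>\<zeta>. cdot (f \<zeta>) (g \<zeta>))"
proof (rule Bochner_Integration.integrable_bound)
  show "integrable \<mu> (\<lambda>\<zeta>. (norm (f \<zeta>))\<^sup>2 + (norm (g \<zeta>))\<^sup>2)"
    using L2_integrable[OF assms(1)] L2_integrable[OF assms(2)] by simp
  show "AE \<zeta> in \<mu>. norm (cdot (f \<zeta>) (g \<zeta>)) \<le> norm ((norm (f \<zeta>))\<^sup>2 + (norm (g \<zeta>))\<^sup>2)"
  proof (rule AE_I2)
    fix \<zeta>
    have "norm (cdot (f \<zeta>) (g \<zeta>)) \<le> norm (f \<zeta>) * norm (g \<zeta>)" by (rule norm_cdot_le)
    also have "\<dots> \<le> 2 * norm (f \<zeta>) * norm (g \<zeta>)" by simp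
    also have "\<dots> \<le> (norm (f \<zeta>))\<^sup>2 + (norm (g \<zeta>))\<^sup>2" by (rule sum_squares_bound)
    finally show "norm (cdot (f \<zeta>) (g \<zeta>)) \<le> norm ((norm (f \<zeta>))\<^sup>2 + (norm (g \<zeta>))\<^sup>2)" by simp
  qed
qed (use assms in measurable)

lemma L2_inner_add_left:
  "\<lbrakk>f \<in> L2; g \<in> L2; h \<in> L2\<rbrakk> \<Longrightarrow> L2_inner (\<lambda>\<zeta>. f \<zeta> + g \<zeta>) h = L2_inner f h + L2_inner g h"
  unfolding L2_inner_cdot cdot_add_left by (rule Bochner_Integration.integral_add) auto

lemma L2_inner_add_right:
  "\<lbrakk>f \<in> L2; g \<in> L2; h \<in> L2\<rbrakk> \<Longrightarrow> L2_inner h (\<lambda>\<zeta>. f \<zeta> + g \<zeta>) = L2_inner h f + L2_inner h g"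
  unfolding L2_inner_cdot cdot_add_right by (rule Bochner_Integration.integral_add) auto

lemma L2_inner_diff_left:
  "\<lbrakk>f \<in> L2; g \<in> L2; h \<in> L2\<rbrakk> \<Longrightarrow> L2_inner (\<lambda>\<zeta>. f \<zeta> - g \<zeta>) h = L2_inner f h - L2_inner g h"
  unfolding L2_inner_cdot cdot_diff_left by (rule Bochner_Integration.integral_diff) auto

lemma L2_inner_diff_right:
  "\<lbrakk>f \<in> L2; g \<in> L2; h \<in> L2\<rbrakk> \<Longrightarrow> L2_inner h (\<lambda>\<zeta>. f \<zeta> - g \<zeta>) = L2_inner h f - L2_inner h g"
  unfolding L2_inner_cdot cdot_diff_right by (rule Bochner_Integration.integral_diff) auto

lemma L2_inner_scale_left: "L2_inner (\<lambda>\<zeta>. c *s f \<zeta>) h = c * L2_inner f h"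
  unfolding L2_inner_cdot cdot_scale_left by simp

lemma L2_inner_scale_right: "L2_inner h (\<lambda>\<zeta>. c *s f \<zeta>) = cnj c * L2_inner h f"
  unfolding L2_inner_cdot cdot_scale_right by simp

lemma L2_inner_cnj: "cnj (L2_inner f g) = L2_inner g f"
  unfolding L2_inner_cdot Bochner_Integration.integral_cnj[symmetric] cdot_cnj ..

lemma L2_inner_zero [simp]: "L2_inner (\<lambda>_. 0) f = 0" "L2_inner f (\<lambda>_. 0) = 0"
  by (simp_all add: L2_inner_cdot)

lemma L2_inner_sum_left:
  assumes "\<And>i. i \<in> I \<Longrightarrow> f i \<in> L2" "h \<in> L2"
  shows "L2_inner (\<lambda>\<zeta>. \<Sum>i\<in>I. f i \<zeta>) h = (\<Sum>i\<in>I. L2_inner (f i) h)"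
  using assms by (induction I rule: infinite_finite_induct) (auto simp: L2_inner_add_left L2_sum)

lemma L2_inner_cong_AE:
  assumes "AE \<zeta> in \<mu>. f \<zeta> = f' \<zeta>" "AE \<zeta> in \<mu>. g \<zeta> = g' \<zeta>"
    and [measurable]: "f \<in> borel_measurable \<mu>" "f' \<in> borel_measurable \<mu>" "g \<in> borel_measurable \<mu>" "g' \<in> borel_measurable \<mu>"
  shows "L2_inner f g = L2_inner f' g'"
  unfolding L2_inner_cdot
  by (rule integral_cong_AE) (use assms(1,2) in auto)

lemma L2_norm_nonneg [simp]: "0 \<le> L2_norm f"
  unfolding L2_norm_def by simp

lemma L2_norm_sq: "(L2_norm f)\<^sup>2 = (LINT \<zeta>|\<mu>. (norm (f \<zeta>))\<^sup>2)"
  unfolding L2_norm_def by simp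

lemma L2_inner_self: "L2_inner f f = of_real ((L2_norm f)\<^sup>2)"
  unfolding L2_inner_cdot cdot_self L2_norm_sq integral_complex_of_real ..

lemma L2_norm_cong_AE:
  assumes "AE \<zeta> in \<mu>. norm (f \<zeta>) = norm (g \<zeta>)"
    and [measurable]: "f \<in> borel_measurable \<mu>" "g \<in> borel_measurable \<mu>"
  shows "L2_norm f = L2_norm g"
  unfolding L2_norm_def
  by (intro arg_cong[where f=sqrt] integral_cong_AE) (use assms(1) in \<open>auto elim: eventually_mono\<close>)

interpretation L2: semi_inner "L2 :: (complex \<Rightarrow> complex ^ 'r) set"
  "\<lambda>f g \<zeta>. f \<zeta> + g \<zeta>" "\<lambda>c f \<zeta>. c *s f \<zeta>" L2_inner
proof
  show "(L2 :: (complex \<Rightarrow> complex ^ 'r) set) \<noteq> {}" using L2_const by blast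
qed (auto simp: L2_add L2_scale L2_inner_add_left L2_inner_scale_left L2_inner_cnj L2_inner_self)

lemma L2_Cauchy_Schwarz:
  assumes "f \<in> L2" "g \<in> L2" shows "norm (L2_inner f g) \<le> L2_norm f * L2_norm g"
proof -
  have "(norm (L2_inner f g))\<^sup>2 \<le> (L2_norm f * L2_norm g)\<^sup>2"
    using L2.Cauchy_Schwarz[OF assms] by (simp add: L2_inner_self power_mult_distrib)
  then show ?thesis by (rule power2_le_imp_le) simp
qed

lemma L2_norm_scale: "L2_norm (\<lambda>\<zeta>. c *s f \<zeta>) = norm c * L2_norm f"
  unfolding L2_norm_def norm_smult_vec power_mult_distrib by (simp add: real_sqrt_mult)

lemma L2_norm_add_sq:
  assumes "f \<in> L2" "g \<in> L2"
  shows "(L2_norm (\<lambda>\<zeta>. f \<zeta> + g \<zeta>))\<^sup>2 = (L2_norm f)\<^sup>2 + 2 * Re (L2_inner g f) + (L2_norm g)\<^sup>2"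
  using L2.B_add_self[OF assms] by (simp add: L2_inner_self)

lemma L2_norm_triangle:
  assumes "f \<in> L2" "g \<in> L2" shows "L2_norm (\<lambda>\<zeta>. f \<zeta> + g \<zeta>) \<le> L2_norm f + L2_norm g"
proof (rule power2_le_imp_le)
  have "Re (L2_inner g f) \<le> L2_norm g * L2_norm f"
    using L2_Cauchy_Schwarz[OF assms(2,1)] complex_Re_le_cmod order_trans by blast
  then show "(L2_norm (\<lambda>\<zeta>. f \<zeta> + g \<zeta>))\<^sup>2 \<le> (L2_norm f + L2_norm g)\<^sup>2"
    unfolding L2_norm_add_sq[OF assms] by (simp add: power2_sum mult.commute)
qed simp

lemma L2_norm_minus_commute: "L2_norm (\<lambda>\<zeta>. f \<zeta> - g \<zeta>) = L2_norm (\<lambda>\<zeta>. g \<zeta> - f \<zeta>)"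
  unfolding L2_norm_def by (simp add: norm_minus_commute)

lemma L2_norm_triangle_diff:
  assumes "f \<in> L2" "g \<in> L2" "h \<in> L2"
  shows "L2_norm (\<lambda>\<zeta>. f \<zeta> - h \<zeta>) \<le> L2_norm (\<lambda>\<zeta>. f \<zeta> - g \<zeta>) + L2_norm (\<lambda>\<zeta>. g \<zeta> - h \<zeta>)"
  using L2_norm_triangle[OF L2_diff[OF assms(1,2)] L2_diff[OF assms(2,3)]] by simp

lemma L2_norm_le_add_diff:
  assumes "f \<in> L2" "g \<in> L2"
  shows "L2_norm f \<le> L2_norm g + L2_norm (\<lambda>\<zeta>. f \<zeta> - g \<zeta>)"
  using L2_norm_triangle[OF assms(2) L2_diff[OF assms]] by simp

lemma L2_norm_zero [simp]: "L2_norm (\<lambda>_. 0) = 0"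
  by (simp add: L2_norm_def)

lemma L2_norm_eq_0:
  assumes "f \<in> L2" shows "L2_norm f = 0 \<longleftrightarrow> (AE \<zeta> in \<mu>. f \<zeta> = 0)"
proof -
  have "L2_norm f = 0 \<longleftrightarrow> (LINT \<zeta>|\<mu>. (norm (f \<zeta>))\<^sup>2) = 0" by (simp add: L2_norm_def)
  also have "\<dots> \<longleftrightarrow> (AE \<zeta> in \<mu>. (norm (f \<zeta>))\<^sup>2 = 0)"
    by (rule integral_nonneg_eq_0_iff_AE) (use assms in \<open>auto dest: L2_integrable\<close>)
  finally show ?thesis by simp
qed

text \<open>
  The circle has total measure one.
\<close>

lemma L1_le_L2_norm:
  assumes "f \<in> L2" shows "integrable \<mu> (\<lambda>\<zeta>. norm (f \<zeta>))" "(LINT \<zeta>|\<mu>. norm (f \<zeta>)) \<le> L2_norm f"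
proof -
  show i: "integrable \<mu> (\<lambda>\<zeta>. norm (f \<zeta>))"
  proof (rule Bochner_Integration.integrable_bound)
    show "integrable \<mu> (\<lambda>\<zeta>. 1 + (norm (f \<zeta>))\<^sup>2)" using assms by (auto dest: L2_integrable)
    show "AE \<zeta> in \<mu>. norm (norm (f \<zeta>)) \<le> norm (1 + (norm (f \<zeta>))\<^sup>2)"
    proof (rule AE_I2)
      fix \<zeta> show "norm (norm (f \<zeta>)) \<le> norm (1 + (norm (f \<zeta>))\<^sup>2)"
        using sum_squares_bound[of 1 "norm (f \<zeta>)"] norm_ge_zero[of "f \<zeta>"]
        by (simp del: norm_ge_zero)
    qed
  qed (use assms in measurable)
  have "(LINT \<zeta>|\<mu>. norm (f \<zeta>))\<^sup>2 \<le> (LINT \<zeta>|\<mu>. (norm (f \<zeta>))\<^sup>2)"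
  proof -
    let ?a = "LINT \<zeta>|\<mu>. norm (f \<zeta>)"
    have "0 \<le> (LINT \<zeta>|\<mu>. (norm (f \<zeta>) - ?a)\<^sup>2)" by simp
    also have "\<dots> = (LINT \<zeta>|\<mu>. (norm (f \<zeta>))\<^sup>2 - 2 * ?a * norm (f \<zeta>) + ?a\<^sup>2)"
      by (rule Bochner_Integration.integral_cong) (auto simp: power2_diff algebra_simps)
    also have "\<dots> = (LINT \<zeta>|\<mu>. (norm (f \<zeta>))\<^sup>2) - 2 * ?a * ?a + ?a\<^sup>2"
      using i L2_integrable[OF assms] circle.prob_space
      by (subst Bochner_Integration.integral_add) (auto)
    finally show ?thesis by (simp add: power2_eq_square)
  qed
  then show "(LINT \<zeta>|\<mu>. norm (f \<zeta>)) \<le> L2_norm f"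
    unfolding L2_norm_def by (rule real_le_rsqrt)
qed

text \<open>
  Convergence in mean implies almost everywhere convergence of a subsequence.
\<close>

lemma L2_AE_subsequence:
  assumes s: "\<And>n. s n \<in> L2" and g: "g \<in> L2" and lim: "(\<lambda>n. L2_norm (\<lambda>\<zeta>. s n \<zeta> - g \<zeta>)) \<longlonglongrightarrow> 0"
  shows "\<exists>\<rho>::nat\<Rightarrow>nat. strict_mono \<rho> \<and> (AE \<zeta> in \<mu>. (\<lambda>n. s (\<rho> n) \<zeta>) \<longlonglongrightarrow> g \<zeta>)"
proof -
  have d: "(\<lambda>\<zeta>. s n \<zeta> - g \<zeta>) \<in> L2" for n by (intro L2_diff s g)
  have "(\<lambda>n. LINT \<zeta>|\<mu>. norm (s n \<zeta> - g \<zeta>)) \<longlonglongrightarrow> 0"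
    by (rule Lim_null_comparison[OF _ lim]) (use L1_le_L2_norm[OF d] in simp)
  then have "\<exists>\<rho>::nat\<Rightarrow>nat. strict_mono \<rho> \<and> (AE \<zeta> in \<mu>. (\<lambda>n. norm (s (\<rho> n) \<zeta> - g \<zeta>)) \<longlonglongrightarrow> 0)"
    using tendsto_L1_AE_subseq[of \<mu> "\<lambda>n \<zeta>. norm (s n \<zeta> - g \<zeta>)"] L1_le_L2_norm(1)[OF d] by auto
  then obtain \<rho> :: "nat \<Rightarrow> nat" where \<rho>: "strict_mono \<rho>" "AE \<zeta> in \<mu>. (\<lambda>n. norm (s (\<rho> n) \<zeta> - g \<zeta>)) \<longlonglongrightarrow> 0"
    by blast
  have "AE \<zeta> in \<mu>. (\<lambda>n. s (\<rho> n) \<zeta>) \<longlonglongrightarrow> g \<zeta>"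
    using \<rho>(2) by eventually_elim (rule LIM_zero_cancel, rule tendsto_norm_zero_cancel)
  with \<rho>(1) show ?thesis by blast
qed

text \<open>
  A rapidly Cauchy subsequence converges almost everywhere, since the sum of the increments has finite
  integral; Fatou's lemma identifies its limit as the limit in the mean.
\<close>

lemma L2_complete:
  assumes f: "\<And>n. f n \<in> L2"
    and cauchy: "\<And>\<epsilon>. 0 < \<epsilon> \<Longrightarrow> \<exists>N. \<forall>m\<ge>N. \<forall>n\<ge>N. L2_norm (\<lambda>\<zeta>. f m \<zeta> - f n \<zeta>) < \<epsilon>"
  shows "\<exists>g\<in>L2. (\<lambda>n. L2_norm (\<lambda>\<zeta>. f n \<zeta> - g \<zeta>)) \<longlonglongrightarrow> 0"
proof -
  have [measurable]: "f n \<in> borel_measurable \<mu>" for n using f by auto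
  have "\<exists>s. (\<forall>k. \<forall>m\<ge>s k. \<forall>n\<ge>s k. L2_norm (\<lambda>\<zeta>. f m \<zeta> - f n \<zeta>) < (1/2)^k) \<and> strict_mono (s :: nat \<Rightarrow> nat)"
  proof -
    have "\<exists>s. \<forall>k. (\<forall>m\<ge>s k. \<forall>n\<ge>s k. L2_norm (\<lambda>\<zeta>. f m \<zeta> - f n \<zeta>) < (1/2)^k) \<and> s k < s (Suc k)"
    proof (rule dependent_nat_choice)
      show "\<exists>N. \<forall>m\<ge>N. \<forall>n\<ge>N. L2_norm (\<lambda>\<zeta>. f m \<zeta> - f n \<zeta>) < (1/2)^0" by (rule cauchy) simp
      fix N k :: nat
      obtain N' where N': "\<forall>m\<ge>N'. \<forall>n\<ge>N'. L2_norm (\<lambda>\<zeta>. f m \<zeta> - f n \<zeta>) < (1/2)^Suc k"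
        using cauchy[of "(1/2)^Suc k"] by auto
      show "\<exists>M. (\<forall>m\<ge>M. \<forall>n\<ge>M. L2_norm (\<lambda>\<zeta>. f m \<zeta> - f n \<zeta>) < (1/2)^Suc k) \<and> N < M"
        using N' by (intro exI[of _ "max N' (Suc N)"]) auto
    qed
    then show ?thesis by (auto simp: strict_mono_Suc_iff)
  qed
  then obtain s where s: "\<And>k m n. m \<ge> s k \<Longrightarrow> n \<ge> s k \<Longrightarrow> L2_norm (\<lambda>\<zeta>. f m \<zeta> - f n \<zeta>) < (1/2)^k"
    and sm: "strict_mono (s :: nat \<Rightarrow> nat)" by blast
  define h where "h k \<zeta> = norm (f (s (Suc k)) \<zeta> - f (s k) \<zeta>)" for k \<zeta>
  have h_meas [measurable]: "h k \<in> borel_measurable \<mu>" for k unfolding h_def by measurable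
  have h_le: "(\<integral>\<^sup>+\<zeta>. ennreal (h k \<zeta>) \<partial>\<mu>) \<le> ennreal ((1/2)^k)" for k
  proof -
    have d: "(\<lambda>\<zeta>. f (s (Suc k)) \<zeta> - f (s k) \<zeta>) \<in> L2" by (intro L2_diff f)
    have "(\<integral>\<^sup>+\<zeta>. ennreal (h k \<zeta>) \<partial>\<mu>) = ennreal (LINT \<zeta>|\<mu>. h k \<zeta>)"
      unfolding h_def by (rule nn_integral_eq_integral) (use L1_le_L2_norm(1)[OF d] in auto)
    also have "\<dots> \<le> ennreal ((1/2)^k)"
      unfolding h_def using L1_le_L2_norm(2)[OF d] s[of k "s (Suc k)" "s k"] sm
      by (intro ennreal_leI) (auto simp: strict_mono_less_eq intro: less_imp_le order_trans)
    finally show ?thesis .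
  qed
  have "(\<integral>\<^sup>+\<zeta>. (\<Sum>k. ennreal (h k \<zeta>)) \<partial>\<mu>) = (\<Sum>k. \<integral>\<^sup>+\<zeta>. ennreal (h k \<zeta>) \<partial>\<mu>)"
    by (rule nn_integral_suminf) simp
  also have "\<dots> \<le> (\<Sum>k. ennreal ((1/2)^k))" by (intro suminf_le h_le) auto
  also have "\<dots> < \<infinity>"
    by (subst suminf_ennreal_eq[of _ 2]) (use geometric_sums[of "1/2::real"] in auto)
  finally have "AE \<zeta> in \<mu>. (\<Sum>k. ennreal (h k \<zeta>)) \<noteq> \<infinity>"
    by (intro nn_integral_PInf_AE) auto
  then have conv: "AE \<zeta> in \<mu>. convergent (\<lambda>k. f (s k) \<zeta>)"
  proof (rule AE_mp, intro AE_I2 impI)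
    fix \<zeta> assume "(\<Sum>k. ennreal (h k \<zeta>)) \<noteq> \<infinity>"
    then have "summable (\<lambda>k. h k \<zeta>)" by (intro summable_suminf_not_top) (auto simp: h_def)
    then have "summable (\<lambda>k. f (s (Suc k)) \<zeta> - f (s k) \<zeta>)" unfolding h_def by (rule summable_norm_cancel)
    then have "convergent (\<lambda>n. \<Sum>k<n. f (s (Suc k)) \<zeta> - f (s k) \<zeta>)"
      by (simp only: summable_iff_convergent)
    then have "convergent (\<lambda>n. f (s n) \<zeta> - f (s 0) \<zeta>)"
      by (simp only: sum_lessThan_telescope[of "\<lambda>k. f (s k) \<zeta>"])
    from convergent_add[OF this convergent_const[of "f (s 0) \<zeta>"]]
    show "convergent (\<lambda>k. f (s k) \<zeta>)" by simp
  qed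
  define g where "g \<zeta> = lim (\<lambda>k. f (s k) \<zeta>)" for \<zeta>
  have g_meas [measurable]: "g \<in> borel_measurable \<mu>" unfolding g_def by (rule borel_measurable_lim_metric) simp
  have gl: "AE \<zeta> in \<mu>. (\<lambda>k. f (s k) \<zeta>) \<longlonglongrightarrow> g \<zeta>"
    using conv unfolding g_def by eventually_elim (simp add: convergent_LIMSEQ_iff)
  have key: "(\<integral>\<^sup>+\<zeta>. ennreal ((norm (f n \<zeta> - g \<zeta>))\<^sup>2) \<partial>\<mu>) \<le> ennreal (((1/2)^k)\<^sup>2)" if n: "n \<ge> s k" for n k
  proof -
    have "(\<integral>\<^sup>+\<zeta>. ennreal ((norm (f n \<zeta> - g \<zeta>))\<^sup>2) \<partial>\<mu>) = (\<integral>\<^sup>+\<zeta>. liminf (\<lambda>j. ennreal ((norm (f n \<zeta> - f (s j) \<zeta>))\<^sup>2)) \<partial>\<mu>)"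
    proof (rule nn_integral_cong_AE)
      show "AE \<zeta> in \<mu>. ennreal ((norm (f n \<zeta> - g \<zeta>))\<^sup>2) = liminf (\<lambda>j. ennreal ((norm (f n \<zeta> - f (s j) \<zeta>))\<^sup>2))"
        using gl
      proof eventually_elim
        case (elim \<zeta>)
        then have "(\<lambda>j. ennreal ((norm (f n \<zeta> - f (s j) \<zeta>))\<^sup>2)) \<longlonglongrightarrow> ennreal ((norm (f n \<zeta> - g \<zeta>))\<^sup>2)"
          by (intro tendsto_ennrealI tendsto_intros)
        then show ?case by (intro lim_imp_Liminf[symmetric]) auto
      qed
    qed
    also have "\<dots> \<le> liminf (\<lambda>j. \<integral>\<^sup>+\<zeta>. ennreal ((norm (f n \<zeta> - f (s j) \<zeta>))\<^sup>2) \<partial>\<mu>)"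
      by (rule nn_integral_liminf) simp
    also have "\<dots> \<le> liminf (\<lambda>j. ennreal (((1/2)^k)\<^sup>2))"
    proof (rule Liminf_mono)
      have "eventually (\<lambda>j. j \<ge> k) sequentially" by (rule eventually_ge_at_top)
      then show "eventually (\<lambda>j. (\<integral>\<^sup>+\<zeta>. ennreal ((norm (f n \<zeta> - f (s j) \<zeta>))\<^sup>2) \<partial>\<mu>) \<le> ennreal (((1/2)^k)\<^sup>2)) sequentially"
      proof eventually_elim
        case (elim j)
        have d: "(\<lambda>\<zeta>. f n \<zeta> - f (s j) \<zeta>) \<in> L2" by (intro L2_diff f)
        have "(\<integral>\<^sup>+\<zeta>. ennreal ((norm (f n \<zeta> - f (s j) \<zeta>))\<^sup>2) \<partial>\<mu>) = ennreal ((L2_norm (\<lambda>\<zeta>. f n \<zeta> - f (s j) \<zeta>))\<^sup>2)"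
          unfolding L2_norm_sq by (rule nn_integral_eq_integral) (use L2_integrable[OF d] in auto)
        also have "\<dots> \<le> ennreal (((1/2)^k)\<^sup>2)"
          using s[of k n "s j"] n elim sm by (intro ennreal_leI power_mono) (auto simp: strict_mono_less_eq less_imp_le)
        finally show ?case .
      qed
    qed
    also have "\<dots> = ennreal (((1/2)^k)\<^sup>2)" by (rule Liminf_const) simp
    finally show ?thesis .
  qed
  have dL2: "(\<lambda>\<zeta>. f n \<zeta> - g \<zeta>) \<in> L2" and dn: "L2_norm (\<lambda>\<zeta>. f n \<zeta> - g \<zeta>) \<le> (1/2)^k" if n: "n \<ge> s k" for n k
  proof -
    have i: "integrable \<mu> (\<lambda>\<zeta>. (norm (f n \<zeta> - g \<zeta>))\<^sup>2)"
      by (rule integrableI_bounded) (use key[OF n] in \<open>auto simp: le_less_trans\<close>)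
    then show "(\<lambda>\<zeta>. f n \<zeta> - g \<zeta>) \<in> L2" by (simp add: L2_def)
    have "ennreal (LINT \<zeta>|\<mu>. (norm (f n \<zeta> - g \<zeta>))\<^sup>2) \<le> ennreal (((1/2)^k)\<^sup>2)"
      using key[OF n] i by (subst (asm) nn_integral_eq_integral) auto
    then have "(L2_norm (\<lambda>\<zeta>. f n \<zeta> - g \<zeta>))\<^sup>2 \<le> ((1/2)^k)\<^sup>2"
      unfolding L2_norm_sq by (subst (asm) ennreal_le_iff) auto
    then show "L2_norm (\<lambda>\<zeta>. f n \<zeta> - g \<zeta>) \<le> (1/2)^k" by (rule power2_le_imp_le) simp
  qed
  have "(\<lambda>\<zeta>. f (s 0) \<zeta> - (f (s 0) \<zeta> - g \<zeta>)) \<in> L2" by (intro L2_diff f dL2[of 0]) simp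
  then have "g \<in> L2" by simp
  moreover have "(\<lambda>n. L2_norm (\<lambda>\<zeta>. f n \<zeta> - g \<zeta>)) \<longlonglongrightarrow> 0"
  proof (rule LIMSEQ_I)
    fix r :: real assume "0 < r"
    then obtain k where k: "(1/2::real)^k < r" using real_arch_pow_inv[of r "1/2"] by auto
    show "\<exists>no. \<forall>n\<ge>no. norm (L2_norm (\<lambda>\<zeta>. f n \<zeta> - g \<zeta>) - 0) < r"
      using dn[of k] k by (intro exI[of _ "s k"]) (auto intro: le_less_trans)
  qed
  ultimately show ?thesis by blast
qed

lemma L2_inner_tendsto:
  assumes s: "\<And>n. s n \<in> L2" and g: "g \<in> L2" and h: "h \<in> L2" and lim: "(\<lambda>n. L2_norm (\<lambda>\<zeta>. s n \<zeta> - g \<zeta>)) \<longlonglongrightarrow> 0"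
  shows "(\<lambda>n. L2_inner (s n) h) \<longlonglongrightarrow> L2_inner g h"
proof (rule LIM_zero_cancel, rule Lim_null_comparison)
  show "eventually (\<lambda>n. norm (L2_inner (s n) h - L2_inner g h) \<le> L2_norm (\<lambda>\<zeta>. s n \<zeta> - g \<zeta>) * L2_norm h) sequentially"
    using L2_Cauchy_Schwarz[OF L2_diff[OF s g] h] by (simp add: L2_inner_diff_left[OF s g h])
  show "(\<lambda>n. L2_norm (\<lambda>\<zeta>. s n \<zeta> - g \<zeta>) * L2_norm h) \<longlonglongrightarrow> 0"
    using tendsto_mult_left_zero[OF lim] .
qed

text \<open>
  Orthogonal projection onto the closure of a linear subspace. The approximate Riesz representation
  yields vectors of the subspace that form a Cauchy sequence.
\<close>

lemma L2_projection:
  fixes f :: "complex \<Rightarrow> complex ^ 'r"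
  assumes V: "V \<subseteq> L2" "V \<noteq> {}" "\<And>x y. \<lbrakk>x \<in> V; y \<in> V\<rbrakk> \<Longrightarrow> (\<lambda>\<zeta>. x \<zeta> + y \<zeta>) \<in> V" "\<And>c x. x \<in> V \<Longrightarrow> (\<lambda>\<zeta>. c *s x \<zeta>) \<in> V"
    and f: "f \<in> L2"
  shows "\<exists>g\<in>L2. \<exists>s. (\<forall>n. s n \<in> V) \<and> (\<lambda>n. L2_norm (\<lambda>\<zeta>. s n \<zeta> - g \<zeta>)) \<longlonglongrightarrow> 0 \<and>
     (\<forall>h\<in>V. L2_inner (\<lambda>\<zeta>. f \<zeta> - g \<zeta>) h = 0)"
proof -
  interpret V: semi_inner V "\<lambda>f g \<zeta>. f \<zeta> + g \<zeta>" "\<lambda>c f \<zeta>. c *s f \<zeta>" L2_inner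
    using V(2) by unfold_locales
      (auto simp: V(3,4) L2_inner_add_left[OF subsetD[OF V(1)] subsetD[OF V(1)] subsetD[OF V(1)]]
        L2_inner_scale_left L2_inner_cnj L2_inner_self)
  have "\<exists>x\<in>V. \<forall>y\<in>V. (norm (L2_inner y x - L2_inner y f))\<^sup>2 \<le> (1 / Suc n) * Re (L2_inner y y)" for n
  proof (rule V.approx_riesz[where A="(L2_norm f)\<^sup>2"])
    fix y assume "y \<in> V"
    then have "y \<in> L2" using V(1) by blast
    then show "0 \<le> Re (L2_inner y y) + 2 * Re (L2_inner y f) + (L2_norm f)\<^sup>2"
      using L2_norm_add_sq[OF f, of y] zero_le_power2[of "L2_norm (\<lambda>\<zeta>. f \<zeta> + y \<zeta>)"]
      by (simp add: L2_inner_self)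
  qed (use V(1) f in \<open>auto simp: L2_inner_add_left L2_inner_scale_left subset_iff\<close>)
  then obtain s where s: "\<And>n::nat. s n \<in> V"
    "\<And>n y. y \<in> V \<Longrightarrow> (norm (L2_inner y (s n) - L2_inner y f))\<^sup>2 \<le> (1 / Suc n) * Re (L2_inner y y)"
    by metis
  have sL: "s n \<in> L2" for n using s(1) V(1) by blast
  have near: "norm (L2_inner y (s n) - L2_inner y f) \<le> sqrt (1 / Suc n) * L2_norm y" if "y \<in> V" for y n
  proof (rule power2_le_imp_le)
    have "Re (L2_inner y y) = (L2_norm y)\<^sup>2" by (simp add: L2_inner_self)
    moreover have "(sqrt (1 / Suc n))\<^sup>2 = 1 / Suc n" by (rule real_sqrt_pow2) simp
    ultimately show "(norm (L2_inner y (s n) - L2_inner y f))\<^sup>2 \<le> (sqrt (1 / Suc n) * L2_norm y)\<^sup>2"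
      unfolding power_mult_distrib using s(2)[OF that, of n] by (simp only:)
    show "0 \<le> sqrt (1 / Suc n) * L2_norm y" by simp
  qed
  have sq_lim: "(\<lambda>n. sqrt (1 / real (Suc n))) \<longlonglongrightarrow> 0"
    using tendsto_real_sqrt[OF LIMSEQ_Suc[OF lim_1_over_n]] by simp
  have diff_V: "(\<lambda>\<zeta>. s m \<zeta> - s n \<zeta>) \<in> V" for m n
    using V(3)[OF s(1) V(4)[OF s(1)], of m "-1" n] by (simp add: vector_sneg_minus1[symmetric])
  have dist: "L2_norm (\<lambda>\<zeta>. s m \<zeta> - s n \<zeta>) \<le> sqrt (1 / Suc m) + sqrt (1 / Suc n)" for m n
  proof -
    let ?y = "\<lambda>\<zeta>. s m \<zeta> - s n \<zeta>"
    have yL: "?y \<in> L2" using diff_V V(1) by blast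
    have "of_real ((L2_norm ?y)\<^sup>2) = L2_inner ?y (s m) - L2_inner ?y (s n)"
      unfolding L2_inner_self[symmetric] using L2_inner_diff_right[OF sL sL yL] .
    also have "\<dots> = (L2_inner ?y (s m) - L2_inner ?y f) - (L2_inner ?y (s n) - L2_inner ?y f)" by simp
    also have "norm \<dots> \<le> sqrt (1 / Suc m) * L2_norm ?y + sqrt (1 / Suc n) * L2_norm ?y"
      by (rule order_trans[OF norm_triangle_ineq4 add_mono[OF near[OF diff_V] near[OF diff_V]]])
    finally have "(L2_norm ?y)\<^sup>2 \<le> (sqrt (1 / Suc m) + sqrt (1 / Suc n)) * L2_norm ?y"
      by (simp only: norm_of_real abs_power2 distrib_right)
    then show ?thesis
      by (cases "L2_norm ?y = 0") (auto simp: power2_eq_square less_le)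
  qed
  have "\<exists>g\<in>L2. (\<lambda>n. L2_norm (\<lambda>\<zeta>. s n \<zeta> - g \<zeta>)) \<longlonglongrightarrow> 0"
  proof (rule L2_complete[OF sL])
    fix \<epsilon> :: real assume "0 < \<epsilon>"
    then have "eventually (\<lambda>n. sqrt (1 / real (Suc n)) < \<epsilon>/2) sequentially"
      using order_tendstoD(2)[OF sq_lim, of "\<epsilon>/2"] by simp
    then obtain N where N: "\<And>n. n \<ge> N \<Longrightarrow> sqrt (1 / real (Suc n)) < \<epsilon>/2"
      by (auto simp: eventually_sequentially)
    show "\<exists>N. \<forall>m\<ge>N. \<forall>n\<ge>N. L2_norm (\<lambda>\<zeta>. s m \<zeta> - s n \<zeta>) < \<epsilon>"
    proof (intro exI[of _ N] allI impI)
      fix m n assume "m \<ge> N" "n \<ge> N"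
      then show "L2_norm (\<lambda>\<zeta>. s m \<zeta> - s n \<zeta>) < \<epsilon>" using dist[of m n] N[of m] N[of n] by linarith
    qed
  qed
  then obtain g where g: "g \<in> L2" "(\<lambda>n. L2_norm (\<lambda>\<zeta>. s n \<zeta> - g \<zeta>)) \<longlonglongrightarrow> 0" by blast
  have "L2_inner (\<lambda>\<zeta>. f \<zeta> - g \<zeta>) h = 0" if h: "h \<in> V" for h
  proof -
    have hL: "h \<in> L2" using h V(1) by blast
    have "(\<lambda>n. L2_inner h (s n) - L2_inner h f) \<longlonglongrightarrow> 0"
    proof (rule Lim_null_comparison)
      show "eventually (\<lambda>n. norm (L2_inner h (s n) - L2_inner h f) \<le> sqrt (1 / real (Suc n)) * L2_norm h) sequentially"
        using near[OF h] by simp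
      show "(\<lambda>n. sqrt (1 / real (Suc n)) * L2_norm h) \<longlonglongrightarrow> 0" using tendsto_mult_left_zero[OF sq_lim] .
    qed
    then have "(\<lambda>n. cnj (L2_inner h (s n))) \<longlonglongrightarrow> cnj (L2_inner h f)"
      by (intro tendsto_cnj) (rule LIM_zero_cancel)
    then have "(\<lambda>n. L2_inner (s n) h) \<longlonglongrightarrow> L2_inner f h" by (simp add: L2_inner_cnj)
    moreover have "(\<lambda>n. L2_inner (s n) h) \<longlonglongrightarrow> L2_inner g h" by (rule L2_inner_tendsto[OF sL g(1) hL g(2)])
    ultimately have "L2_inner f h = L2_inner g h" by (rule LIMSEQ_unique)
    then show ?thesis by (simp add: L2_inner_diff_left f g hL)
  qed
  then show ?thesis using g s(1) by blast
qed

section \<open>Multiplication by bounded matrix functions\<close>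

lemma bounded_linear_matrix: "bounded_linear (\<lambda>x. A *v x)" for A :: "complex ^ 'n ^ 'm"
  unfolding linear_conv_bounded_linear[symmetric]
  by (rule linearI) (auto simp: matrix_vector_right_distrib vec_eq_iff matrix_vector_mult_def scaleR_sum_right
      distrib_left sum.distrib)

lemma op_norm_bound: "norm (A *v x) \<le> op_norm A * norm x"
  unfolding op_norm_def by (rule onorm[OF bounded_linear_matrix])

lemma op_norm_nonneg [simp]: "0 \<le> op_norm A"
  unfolding op_norm_def by (rule onorm_pos_le[OF bounded_linear_matrix])

lemma op_norm_le: "(\<And>x. norm (A *v x) \<le> b * norm x) \<Longrightarrow> op_norm A \<le> b"
  unfolding op_norm_def by (rule onorm_le)

lemma op_norm_triangle: "op_norm (A + B) \<le> op_norm A + op_norm B"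
proof (rule op_norm_le)
  fix x
  have "norm ((A + B) *v x) \<le> norm (A *v x) + norm (B *v x)"
    by (simp add: matrix_vector_mult_add_rdistrib norm_triangle_ineq)
  also have "\<dots> \<le> (op_norm A + op_norm B) * norm x"
    using op_norm_bound[of A x] op_norm_bound[of B x] by (simp add: distrib_right)
  finally show "norm ((A + B) *v x) \<le> (op_norm A + op_norm B) * norm x" .
qed

lemma op_norm_uminus: "op_norm (- A) = op_norm A"
proof -
  have "(- A) *v x = - (A *v x)" for x
    by (simp add: vec_eq_iff matrix_vector_mult_def sum_negf)
  then have "(*v) (- A) = (\<lambda>x. - (A *v x))" by blast
  then show ?thesis unfolding op_norm_def by (simp add: onorm_neg)
qed

lemma cdot_adjoint: "cdot (A *v x) y = cdot x (adjoint_matrix A *v y)"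
proof -
  have "cdot (A *v x) y = (\<Sum>i\<in>UNIV. \<Sum>j\<in>UNIV. A $ i $ j * x $ j * cnj (y $ i))"
    by (simp add: cdot_def matrix_vector_mult_def sum_distrib_right)
  also have "\<dots> = (\<Sum>j\<in>UNIV. \<Sum>i\<in>UNIV. A $ i $ j * x $ j * cnj (y $ i))"
    by (rule sum.swap)
  also have "\<dots> = cdot x (adjoint_matrix A *v y)"
    by (simp add: cdot_def matrix_vector_mult_def adjoint_matrix_def transpose_def sum_distrib_left mult_ac)
  finally show ?thesis .
qed

lemma adjoint_adjoint [simp]: "adjoint_matrix (adjoint_matrix A) = A"
  by (simp add: adjoint_matrix_def transpose_def vec_eq_iff)

lemma unitary_norm: "unitary_matrix A \<Longrightarrow> norm (A *v x) = norm x"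
proof -
  assume "unitary_matrix A"
  then have "adjoint_matrix A *v (A *v x) = x"
    by (simp add: unitary_matrix_def matrix_vector_mul_assoc)
  then have "cdot (A *v x) (A *v x) = cdot x x" by (simp add: cdot_adjoint)
  then have "(norm (A *v x))\<^sup>2 = (norm x)\<^sup>2" unfolding cdot_self of_real_eq_iff .
  then show ?thesis by (subst (asm) power2_eq_iff_nonneg) auto
qed

lemma unitary_adjoint: "unitary_matrix A \<Longrightarrow> unitary_matrix (adjoint_matrix A)"
  by (simp add: unitary_matrix_def)

lemma map_matrix_mult_vec: "map_matrix ((*) c) A *v x = c *s (A *v x)"
  by (simp add: vec_eq_iff matrix_vector_mult_def sum_distrib_left mult.assoc)

lemma matrix_vector_scale: "A *v (c *s x) = c *s (A *v x)" for A :: "complex ^ 'n ^ 'm"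
  by (simp add: vec_eq_iff matrix_vector_mult_def sum_distrib_left mult_ac)

lemma LinfI: "F \<in> borel_measurable \<mu> \<Longrightarrow> AE \<zeta> in \<mu>. \<forall>x. norm (F \<zeta> *v x) \<le> C * norm x \<Longrightarrow> F \<in> Linf"
  unfolding Linf_def by (auto intro!: exI[of _ C] elim!: eventually_mono intro: op_norm_le)

lemma LinfD: assumes "F \<in> Linf" shows "F \<in> borel_measurable \<mu>" "\<exists>C\<ge>0. AE \<zeta> in \<mu>. \<forall>x. norm (F \<zeta> *v x) \<le> C * norm x"
proof -
  show "F \<in> borel_measurable \<mu>" using assms by (simp add: Linf_def)
  obtain C where "AE \<zeta> in \<mu>. op_norm (F \<zeta>) \<le> C" using assms by (auto simp: Linf_def)
  then have "AE \<zeta> in \<mu>. \<forall>x. norm (F \<zeta> *v x) \<le> max 0 C * norm x"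
  proof eventually_elim
    case (elim \<zeta>)
    show ?case
    proof
      fix x
      have "norm (F \<zeta> *v x) \<le> op_norm (F \<zeta>) * norm x" by (rule op_norm_bound)
      also have "\<dots> \<le> max 0 C * norm x" using elim by (intro mult_right_mono) auto
      finally show "norm (F \<zeta> *v x) \<le> max 0 C * norm x" .
    qed
  qed
  then show "\<exists>C\<ge>0. AE \<zeta> in \<mu>. \<forall>x. norm (F \<zeta> *v x) \<le> C * norm x" by (intro exI[of _ "max 0 C"]) auto
qed

lemma Linf_mult_L2: assumes F: "F \<in> Linf" and f: "f \<in> L2" shows "(\<lambda>\<zeta>. F \<zeta> *v f \<zeta>) \<in> L2"
proof -
  obtain C where C: "C \<ge> 0" "AE \<zeta> in \<mu>. \<forall>x. norm (F \<zeta> *v x) \<le> C * norm x" using LinfD(2)[OF F] by blast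
  show ?thesis
  proof (rule L2_bound)
    show "(\<lambda>\<zeta>. F \<zeta> *v f \<zeta>) \<in> borel_measurable \<mu>" using LinfD(1)[OF F] f by measurable
    show "integrable \<mu> (\<lambda>\<zeta>. C\<^sup>2 * (norm (f \<zeta>))\<^sup>2)" using L2_integrable[OF f] by simp
    show "AE \<zeta> in \<mu>. (norm (F \<zeta> *v f \<zeta>))\<^sup>2 \<le> C\<^sup>2 * (norm (f \<zeta>))\<^sup>2"
      using C(2) by eventually_elim (simp add: power_mult_distrib[symmetric] power_mono)
  qed
qed

lemma Linf_norm_le: assumes F: "F \<in> Linf" "AE \<zeta> in \<mu>. \<forall>x. norm (F \<zeta> *v x) \<le> norm x" and f: "f \<in> L2"
  shows "L2_norm (\<lambda>\<zeta>. F \<zeta> *v f \<zeta>) \<le> L2_norm f"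
  unfolding L2_norm_def
  by (intro real_sqrt_le_mono integral_mono_AE)
     (use F(2) L2_integrable[OF f] L2_integrable[OF Linf_mult_L2[OF F(1) f]] in \<open>auto elim!: eventually_mono intro!: power_mono\<close>)

lemma unitary_Linf:
  assumes "U \<in> borel_measurable \<mu>" "AE \<zeta> in \<mu>. unitary_matrix (U \<zeta>)" shows "U \<in> Linf"
  using assms(1) by (rule LinfI[where C=1]) (use assms(2) in \<open>auto elim!: eventually_mono simp: unitary_norm\<close>)

lemma unitary_L2_norm:
  assumes "U \<in> borel_measurable \<mu>" "AE \<zeta> in \<mu>. unitary_matrix (U \<zeta>)" "f \<in> L2"
  shows "L2_norm (\<lambda>\<zeta>. U \<zeta> *v f \<zeta>) = L2_norm f"
  by (rule L2_norm_cong_AE) (use assms in \<open>auto elim!: eventually_mono simp: unitary_norm\<close>)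

section \<open>Fourier coefficients and Hardy spaces of vector functions\<close>

lemma cnj_powi_circle: "norm \<zeta> = 1 \<Longrightarrow> cnj (\<zeta> powi n) = \<zeta> powi (- n)"
proof -
  assume "norm \<zeta> = 1"
  then have "cnj \<zeta> = inverse \<zeta>"
    by (metis complex_norm_square inverse_unique of_real_1 one_power2)
  then show ?thesis by (simp add: power_int_minus power_int_inverse)
qed

lemma cnj_base_powi_circle: "norm \<zeta> = 1 \<Longrightarrow> cnj \<zeta> powi n = \<zeta> powi (- n)"
  using cnj_powi_circle[of \<zeta> n] by simp

lemma cnj_powi_mult_powi_circle: "norm \<zeta> = 1 \<Longrightarrow> cnj \<zeta> powi n * \<zeta> powi n = 1"
proof -
  assume "norm \<zeta> = 1"
  then have "\<zeta> \<noteq> 0" by auto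
  then show ?thesis unfolding cnj_base_powi_circle[OF \<open>norm \<zeta> = 1\<close>] by (simp add: power_int_minus)
qed

lemma powi_add_circle: "norm \<zeta> = 1 \<Longrightarrow> (\<zeta>::complex) powi (m + n) = \<zeta> powi m * \<zeta> powi n"
  by (rule power_int_add) auto

lemma L2_shift: "f \<in> L2 \<Longrightarrow> (\<lambda>\<zeta>. \<zeta> powi n *s f \<zeta>) \<in> L2"
  by (rule L2_mult_bounded[where b=1]) (auto intro!: AE_I2 simp: norm_powi_circle)

lemma L2_shift_inner: "L2_inner (\<lambda>\<zeta>. \<zeta> powi n *s f \<zeta>) (\<lambda>\<zeta>. \<zeta> powi n *s g \<zeta>) = L2_inner f g"
  unfolding L2_inner_cdot
  by (rule Bochner_Integration.integral_cong)
     (auto simp: cdot_scale_left cdot_scale_right mult.assoc[symmetric] cnj_powi_mult_powi_circle)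

lemma L2_shift_inner_right: "L2_inner f (\<lambda>\<zeta>. \<zeta> powi n *s g \<zeta>) = L2_inner (\<lambda>\<zeta>. \<zeta> powi (- n) *s f \<zeta>) g"
  unfolding L2_inner_cdot
  by (rule Bochner_Integration.integral_cong) (auto simp: cdot_scale_left cdot_scale_right cnj_base_powi_circle)

lemma L2_norm_shift: "L2_norm (\<lambda>\<zeta>. \<zeta> powi n *s f \<zeta>) = L2_norm f"
  unfolding L2_norm_def
  by (intro arg_cong[where f=sqrt] Bochner_Integration.integral_cong) (auto simp: norm_smult_vec norm_powi_circle)

lemma L2_integrable_vec: "f \<in> L2 \<Longrightarrow> integrable \<mu> f"
  using L1_le_L2_norm(1)[of f] L2_measurable[of f] by (simp add: integrable_norm_iff)

lemma integrable_vec_nth: "f \<in> L2 \<Longrightarrow> integrable \<mu> (\<lambda>\<zeta>. f \<zeta> $ i)"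
  using integrable_bounded_linear[OF bounded_linear_vec_nth L2_integrable_vec] .

lemma fourier_coeff_nth: "f \<in> L2 \<Longrightarrow> fourier_coeff f n $ i = fcoef (\<lambda>\<zeta>. f \<zeta> $ i) n"
  unfolding fourier_coeff_def fcoef_def
  by (subst integral_bounded_linear[OF bounded_linear_vec_nth, symmetric])
     (auto intro: L2_integrable_vec L2_shift)

lemma fourier_coeff_inner: "f \<in> L2 \<Longrightarrow> cdot (fourier_coeff f n) x = L2_inner f (\<lambda>\<zeta>. \<zeta> powi n *s x)"
proof -
  assume f: "f \<in> L2"
  have "cdot (fourier_coeff f n) x = (\<Sum>i\<in>UNIV. (LINT \<zeta>|\<mu>. \<zeta> powi (- n) * f \<zeta> $ i) * cnj (x $ i))"
    by (simp add: cdot_def fourier_coeff_nth[OF f] fcoef_def)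
  also have "\<dots> = (LINT \<zeta>|\<mu>. (\<Sum>i\<in>UNIV. \<zeta> powi (- n) * f \<zeta> $ i * cnj (x $ i)))"
    by (subst Bochner_Integration.integral_sum)
       (auto intro!: integrable_powi integrable_vec_nth f simp del: power_int_minus)
  also have "\<dots> = L2_inner f (\<lambda>\<zeta>. \<zeta> powi n *s x)"
    unfolding L2_inner_def
    by (rule Bochner_Integration.integral_cong) (auto simp: cnj_base_powi_circle mult_ac)
  finally show ?thesis .
qed

lemma fourier_coeff_nth_inner: "f \<in> L2 \<Longrightarrow> fourier_coeff f n $ i = L2_inner f (\<lambda>\<zeta>. \<zeta> powi n *s axis i 1)"
  by (simp add: fourier_coeff_inner[symmetric] cdot_axis)

lemma monomial_L2 [simp]: "(\<lambda>\<zeta>. \<zeta> powi n *s c) \<in> L2"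
  by (rule L2_shift) simp

lemma fourier_coeff_eq_0_iff: "f \<in> L2 \<Longrightarrow> fourier_coeff f n = 0 \<longleftrightarrow> (\<forall>x. L2_inner f (\<lambda>\<zeta>. \<zeta> powi n *s x) = 0)"
proof
  assume f: "f \<in> L2"
  show "\<forall>x. L2_inner f (\<lambda>\<zeta>. \<zeta> powi n *s x) = 0" if "fourier_coeff f n = 0"
    using that by (simp add: fourier_coeff_inner[OF f, symmetric])
  show "fourier_coeff f n = 0" if "\<forall>x. L2_inner f (\<lambda>\<zeta>. \<zeta> powi n *s x) = 0"
    using that by (simp add: vec_eq_iff fourier_coeff_nth_inner[OF f])
qed

lemma fourier_coeff_add: "\<lbrakk>f \<in> L2; g \<in> L2\<rbrakk> \<Longrightarrow> fourier_coeff (\<lambda>\<zeta>. f \<zeta> + g \<zeta>) n = fourier_coeff f n + fourier_coeff g n"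
  by (simp add: vec_eq_iff fourier_coeff_nth_inner L2_add L2_inner_add_left)

lemma fourier_coeff_diff: "\<lbrakk>f \<in> L2; g \<in> L2\<rbrakk> \<Longrightarrow> fourier_coeff (\<lambda>\<zeta>. f \<zeta> - g \<zeta>) n = fourier_coeff f n - fourier_coeff g n"
  by (simp add: vec_eq_iff fourier_coeff_nth_inner L2_diff L2_inner_diff_left)

lemma fourier_coeff_scale: "f \<in> L2 \<Longrightarrow> fourier_coeff (\<lambda>\<zeta>. c *s f \<zeta>) n = c *s fourier_coeff f n"
  by (simp add: vec_eq_iff fourier_coeff_nth_inner L2_scale L2_inner_scale_left)

lemma fourier_coeff_shift:
  "f \<in> L2 \<Longrightarrow> fourier_coeff (\<lambda>\<zeta>. \<zeta> powi k *s f \<zeta>) n = fourier_coeff f (n - k)"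
  unfolding fourier_coeff_def
  by (rule Bochner_Integration.integral_cong) (auto simp: vector_smult_assoc powi_add_circle[symmetric])

lemma fourier_coeff_monomial: "fourier_coeff (\<lambda>\<zeta>. \<zeta> powi k *s c) n = (if n = k then c else 0)"
proof -
  have "fourier_coeff (\<lambda>\<zeta>. \<zeta> powi k *s c) n = fourier_coeff (\<lambda>\<zeta>. c) (n - k)"
    by (rule fourier_coeff_shift) simp
  moreover have "fourier_coeff (\<lambda>\<zeta>. c) (n - k) $ i = (if n = k then c else 0) $ i" for i
  proof -
    have "fourier_coeff (\<lambda>\<zeta>. c) (n - k) $ i = (LINT \<zeta>|\<mu>. \<zeta> powi (k - n)) * c $ i"
      by (simp add: fourier_coeff_nth fcoef_def)
    then show ?thesis by (simp only: integral_circle_powi) auto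
  qed
  ultimately show ?thesis by (simp add: vec_eq_iff)
qed

lemma fourier_coeff_const: "fourier_coeff (\<lambda>\<zeta>. c) n = (if n = 0 then c else 0)"
  using fourier_coeff_monomial[of 0 c n] by simp

lemma fourier_coeff_cong_AE:
  assumes "AE \<zeta> in \<mu>. f \<zeta> = g \<zeta>" and [measurable]: "f \<in> borel_measurable \<mu>" "g \<in> borel_measurable \<mu>"
  shows "fourier_coeff f n = fourier_coeff g n"
  unfolding fourier_coeff_def by (rule integral_cong_AE) (use assms(1) in auto)

lemma L2_cong_AE:
  assumes "f \<in> L2" "AE \<zeta> in \<mu>. f \<zeta> = g \<zeta>" "g \<in> borel_measurable \<mu>" shows "g \<in> L2"
  by (rule L2_bound[OF assms(3) L2_integrable[OF assms(1)]]) (use assms(2) in auto)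

lemma L2_fourier_unique:
  assumes f: "f \<in> L2" and z: "\<And>n. fourier_coeff f n = 0" shows "AE \<zeta> in \<mu>. f \<zeta> = 0"
proof -
  have "AE \<zeta> in \<mu>. f \<zeta> $ i = 0" for i
    by (rule fourier_unique[OF integrable_vec_nth[OF f]]) (simp add: fourier_coeff_nth[OF f, symmetric] z)
  then have "AE \<zeta> in \<mu>. \<forall>i\<in>UNIV. f \<zeta> $ i = 0" by (subst AE_finite_all) auto
  then show ?thesis by (simp add: vec_eq_iff)
qed

lemma fourier_coeff_tendsto:
  assumes s: "\<And>n. s n \<in> L2" and g: "g \<in> L2" and lim: "(\<lambda>n. L2_norm (\<lambda>\<zeta>. s n \<zeta> - g \<zeta>)) \<longlonglongrightarrow> 0"
  shows "(\<lambda>n. fourier_coeff (s n) k $ i) \<longlonglongrightarrow> fourier_coeff g k $ i"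
  unfolding fourier_coeff_nth_inner[OF s] fourier_coeff_nth_inner[OF g]
  by (rule L2_inner_tendsto[OF s g _ lim]) simp

text \<open>
  \<open>Hge N\<close> is \<open>\<zeta>\<^sup>N H2\<close>: the square integrable functions with spectrum in \<open>[N, \<infinity>)\<close>. \<open>Hlt N\<close> is its
  orthogonal complement. The spaces \<open>H2\<close> and \<open>H2_minus\<close> are \<open>Hge 0\<close> and \<open>Hlt 0\<close>.
\<close>

definition Hge :: "int \<Rightarrow> (complex \<Rightarrow> complex ^ 'r) set" where
  "Hge N = {f \<in> L2. \<forall>n<N. fourier_coeff f n = 0}"

definition Hlt :: "int \<Rightarrow> (complex \<Rightarrow> complex ^ 'r) set" where
  "Hlt N = {f \<in> L2. \<forall>n\<ge>N. fourier_coeff f n = 0}"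

lemma H2_eq_Hge: "H2 = Hge 0" by (simp add: H2_def Hge_def)

lemma HgeD: "f \<in> Hge N \<Longrightarrow> f \<in> L2" "f \<in> Hge N \<Longrightarrow> n < N \<Longrightarrow> fourier_coeff f n = 0"
  by (auto simp: Hge_def)

lemma HltD: "f \<in> Hlt N \<Longrightarrow> f \<in> L2" "f \<in> Hlt N \<Longrightarrow> N \<le> n \<Longrightarrow> fourier_coeff f n = 0"
  by (auto simp: Hlt_def)

lemma Hge_mono: "M \<le> N \<Longrightarrow> f \<in> Hge N \<Longrightarrow> f \<in> Hge M" by (auto simp: Hge_def)
lemma Hlt_mono: "N \<le> M \<Longrightarrow> f \<in> Hlt N \<Longrightarrow> f \<in> Hlt M" by (auto simp: Hlt_def)

lemma Hge_add: "f \<in> Hge N \<Longrightarrow> g \<in> Hge N \<Longrightarrow> (\<lambda>\<zeta>. f \<zeta> + g \<zeta>) \<in> Hge N"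
  by (auto simp: Hge_def L2_add fourier_coeff_add)
lemma Hge_diff: "f \<in> Hge N \<Longrightarrow> g \<in> Hge N \<Longrightarrow> (\<lambda>\<zeta>. f \<zeta> - g \<zeta>) \<in> Hge N"
  by (auto simp: Hge_def L2_diff fourier_coeff_diff)
lemma Hge_scale: "f \<in> Hge N \<Longrightarrow> (\<lambda>\<zeta>. c *s f \<zeta>) \<in> Hge N"
  by (auto simp: Hge_def L2_scale fourier_coeff_scale)
lemma Hge_zero [simp]: "(\<lambda>_. 0) \<in> Hge N"
  by (simp add: Hge_def fourier_coeff_const)
lemma Hge_shift: "f \<in> Hge N \<Longrightarrow> (\<lambda>\<zeta>. \<zeta> powi k *s f \<zeta>) \<in> Hge (N + k)"
  by (auto simp: Hge_def L2_shift fourier_coeff_shift)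
lemma Hge_monomial: "N \<le> n \<Longrightarrow> (\<lambda>\<zeta>. \<zeta> powi n *s c) \<in> Hge N"
  by (simp add: Hge_def fourier_coeff_monomial)
lemma Hge_const [simp]: "(\<lambda>\<zeta>. c) \<in> Hge 0"
  by (simp add: Hge_def fourier_coeff_const)
lemma Hge_cong_AE: "f \<in> Hge N \<Longrightarrow> AE \<zeta> in \<mu>. f \<zeta> = g \<zeta> \<Longrightarrow> g \<in> borel_measurable \<mu> \<Longrightarrow> g \<in> Hge N"
  using fourier_coeff_cong_AE[of f g] by (auto simp: Hge_def intro: L2_cong_AE)

lemma Hlt_add: "f \<in> Hlt N \<Longrightarrow> g \<in> Hlt N \<Longrightarrow> (\<lambda>\<zeta>. f \<zeta> + g \<zeta>) \<in> Hlt N"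
  by (auto simp: Hlt_def L2_add fourier_coeff_add)
lemma Hlt_diff: "f \<in> Hlt N \<Longrightarrow> g \<in> Hlt N \<Longrightarrow> (\<lambda>\<zeta>. f \<zeta> - g \<zeta>) \<in> Hlt N"
  by (auto simp: Hlt_def L2_diff fourier_coeff_diff)
lemma Hlt_scale: "f \<in> Hlt N \<Longrightarrow> (\<lambda>\<zeta>. c *s f \<zeta>) \<in> Hlt N"
  by (auto simp: Hlt_def L2_scale fourier_coeff_scale)
lemma Hlt_zero [simp]: "(\<lambda>_. 0) \<in> Hlt N"
  by (simp add: Hlt_def fourier_coeff_const)
lemma Hlt_shift: "f \<in> Hlt N \<Longrightarrow> (\<lambda>\<zeta>. \<zeta> powi k *s f \<zeta>) \<in> Hlt (N + k)"
  by (auto simp: Hlt_def L2_shift fourier_coeff_shift)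
lemma Hlt_monomial: "n < N \<Longrightarrow> (\<lambda>\<zeta>. \<zeta> powi n *s c) \<in> Hlt N"
  by (simp add: Hlt_def fourier_coeff_monomial)
lemma Hlt_cong_AE: "f \<in> Hlt N \<Longrightarrow> AE \<zeta> in \<mu>. f \<zeta> = g \<zeta> \<Longrightarrow> g \<in> borel_measurable \<mu> \<Longrightarrow> g \<in> Hlt N"
  using fourier_coeff_cong_AE[of f g] by (auto simp: Hlt_def intro: L2_cong_AE)

lemma Hge_Hlt_zero: "f \<in> Hge N \<Longrightarrow> f \<in> Hlt N \<Longrightarrow> AE \<zeta> in \<mu>. f \<zeta> = 0"
  by (rule L2_fourier_unique) (auto simp: Hge_def Hlt_def not_less[symmetric])

lemma Hge_closed:
  assumes s: "\<And>n. s n \<in> Hge N" and g: "g \<in> L2" and lim: "(\<lambda>n. L2_norm (\<lambda>\<zeta>. s n \<zeta> - g \<zeta>)) \<longlonglongrightarrow> 0"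
  shows "g \<in> Hge N"
proof -
  have "fourier_coeff g k $ i = 0" if "k < N" for k i
    using fourier_coeff_tendsto[OF HgeD(1)[OF s] g lim, of k i] HgeD(2)[OF s that]
    by (simp add: LIMSEQ_const_iff)
  then show ?thesis using g by (simp add: Hge_def vec_eq_iff)
qed

subsection \<open>Polynomials\<close>

text \<open>Scalar polynomials without terms of degree less than \<open>k\<close>, and polynomials with vector coefficients.\<close>

inductive_set apoly :: "nat \<Rightarrow> (complex \<Rightarrow> complex) set" for k where
  apoly_power: "k \<le> n \<Longrightarrow> (\<lambda>\<zeta>. \<zeta> ^ n) \<in> apoly k"
| apoly_add: "p \<in> apoly k \<Longrightarrow> q \<in> apoly k \<Longrightarrow> (\<lambda>\<zeta>. p \<zeta> + q \<zeta>) \<in> apoly k"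
| apoly_scale: "p \<in> apoly k \<Longrightarrow> (\<lambda>\<zeta>. c * p \<zeta>) \<in> apoly k"

lemma apoly_shift: "p \<in> apoly k \<Longrightarrow> (\<lambda>\<zeta>. \<zeta> ^ j * p \<zeta>) \<in> apoly k"
proof (induction rule: apoly.induct)
  case (apoly_power n)
  then show ?case using apoly.apoly_power[of k "j + n"] by (simp add: power_add)
next
  case (apoly_add p q)
  then show ?case using apoly.apoly_add by (simp add: distrib_left)
next
  case (apoly_scale p c)
  then show ?case using apoly.apoly_scale by (simp add: mult.left_commute)
qed

lemma apoly_mult_Hge: "p \<in> apoly k \<Longrightarrow> f \<in> Hge N \<Longrightarrow> (\<lambda>\<zeta>. p \<zeta> *s f \<zeta>) \<in> Hge (N + int k)"
proof (induction rule: apoly.induct)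
  case (apoly_power n)
  then show ?case using Hge_shift[of f N "int n"] Hge_mono[of "N + int k" "N + int n"] by auto
next
  case (apoly_add p q)
  then show ?case using Hge_add[of "\<lambda>\<zeta>. p \<zeta> *s f \<zeta>" "N + int k" "\<lambda>\<zeta>. q \<zeta> *s f \<zeta>"]
    by (simp add: vector_sadd_rdistrib)
next
  case (apoly_scale p c)
  then show ?case using Hge_scale[of "\<lambda>\<zeta>. p \<zeta> *s f \<zeta>" "N + int k" c] by (simp add: vector_smult_assoc)
qed

inductive_set vpoly :: "(complex \<Rightarrow> complex ^ 'r) set" where
  vpoly_power: "(\<lambda>\<zeta>. \<zeta> ^ n *s c) \<in> vpoly"
| vpoly_add: "p \<in> vpoly \<Longrightarrow> q \<in> vpoly \<Longrightarrow> (\<lambda>\<zeta>. p \<zeta> + q \<zeta>) \<in> vpoly"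

lemma vpoly_scale: "p \<in> vpoly \<Longrightarrow> (\<lambda>\<zeta>. c *s p \<zeta>) \<in> vpoly"
proof (induction rule: vpoly.induct)
  case (vpoly_power n d)
  then show ?case using vpoly.vpoly_power[of n "c *s d"] by (simp add: vector_smult_assoc mult.commute)
next
  case (vpoly_add p q)
  then show ?case using vpoly.vpoly_add by (simp add: vector_add_ldistrib)
qed

lemma vpoly_Hge: "p \<in> vpoly \<Longrightarrow> p \<in> Hge 0"
proof (induction rule: vpoly.induct)
  case (vpoly_power n c)
  then show ?case using Hge_monomial[of 0 "int n" c] by simp
qed (rule Hge_add)

text \<open>
  The projection is constructed as that onto the closure of the polynomials; \<open>vpoly_dense\<close> then shows
  that this closure is all of \<open>Hge 0\<close>.
\<close>

lemma Hge_Hlt_decomposition_aux: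
  assumes f: "f \<in> L2"
  shows "\<exists>g\<in>Hge 0. (\<lambda>\<zeta>. f \<zeta> - g \<zeta>) \<in> Hlt 0 \<and> (\<exists>s. (\<forall>n. s n \<in> vpoly) \<and> (\<lambda>n. L2_norm (\<lambda>\<zeta>. s n \<zeta> - g \<zeta>)) \<longlonglongrightarrow> 0)"
proof -
  have "\<exists>g\<in>L2. \<exists>s. (\<forall>n. s n \<in> vpoly) \<and> (\<lambda>n. L2_norm (\<lambda>\<zeta>. s n \<zeta> - g \<zeta>)) \<longlonglongrightarrow> 0 \<and>
     (\<forall>h\<in>vpoly. L2_inner (\<lambda>\<zeta>. f \<zeta> - g \<zeta>) h = 0)"
    by (rule L2_projection[OF _ _ vpoly_add vpoly_scale f]) (use vpoly_power vpoly_Hge HgeD(1) in blast)+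
  then obtain g s where g: "g \<in> L2" and s: "\<And>n. s n \<in> vpoly" "(\<lambda>n. L2_norm (\<lambda>\<zeta>. s n \<zeta> - g \<zeta>)) \<longlonglongrightarrow> 0"
    and o: "\<And>h. h \<in> vpoly \<Longrightarrow> L2_inner (\<lambda>\<zeta>. f \<zeta> - g \<zeta>) h = 0" by blast
  have "g \<in> Hge 0" by (rule Hge_closed[OF vpoly_Hge[OF s(1)] g s(2)])
  moreover have "fourier_coeff (\<lambda>\<zeta>. f \<zeta> - g \<zeta>) n = 0" if "0 \<le> n" for n
    using o[OF vpoly_power[of "nat n"]] that
    by (subst fourier_coeff_eq_0_iff) (auto simp: L2_diff f g power_int_def)
  then have "(\<lambda>\<zeta>. f \<zeta> - g \<zeta>) \<in> Hlt 0" by (simp add: Hlt_def L2_diff f g)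
  ultimately show ?thesis using s by blast
qed

lemma vpoly_dense:
  assumes f: "f \<in> Hge 0"
  shows "\<exists>s. (\<forall>n. s n \<in> vpoly) \<and> (\<lambda>n. L2_norm (\<lambda>\<zeta>. s n \<zeta> - f \<zeta>)) \<longlonglongrightarrow> 0"
proof -
  obtain g s where g: "g \<in> Hge 0" "(\<lambda>\<zeta>. f \<zeta> - g \<zeta>) \<in> Hlt 0"
    and s: "\<And>n. s n \<in> vpoly" "(\<lambda>n. L2_norm (\<lambda>\<zeta>. s n \<zeta> - g \<zeta>)) \<longlonglongrightarrow> 0"
    using Hge_Hlt_decomposition_aux[OF HgeD(1)[OF f]] by blast
  have "AE \<zeta> in \<mu>. f \<zeta> - g \<zeta> = 0" by (rule Hge_Hlt_zero[OF Hge_diff[OF f g(1)] g(2)])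
  then have "L2_norm (\<lambda>\<zeta>. s n \<zeta> - f \<zeta>) = L2_norm (\<lambda>\<zeta>. s n \<zeta> - g \<zeta>)" for n
    by (intro L2_norm_cong_AE)
       (use HgeD(1)[OF f] HgeD(1)[OF g(1)] HgeD(1)[OF vpoly_Hge[OF s(1)]] in \<open>auto elim: eventually_mono\<close>)
  then show ?thesis using s by (intro exI[of _ s]) simp
qed

lemma Hlt_orthogonal_Hge:
  assumes f: "f \<in> Hlt N" and g: "g \<in> Hge N" shows "L2_inner f g = 0" "L2_inner g f = 0"
proof -
  have 0: "L2_inner f g = 0" if f: "f \<in> Hlt 0" and g: "g \<in> Hge 0" for f g :: "complex \<Rightarrow> complex ^ 'a"
  proof -
    obtain s where s: "\<And>n. s n \<in> vpoly" "(\<lambda>n. L2_norm (\<lambda>\<zeta>. s n \<zeta> - g \<zeta>)) \<longlonglongrightarrow> 0"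
      using vpoly_dense[OF g] by blast
    have fL: "f \<in> L2" and gL: "g \<in> L2" and sL: "s n \<in> L2" for n
      using f g s(1) vpoly_Hge HgeD(1) HltD(1) by blast+
    have p: "L2_inner p f = 0" if "p \<in> vpoly" for p
      using that
    proof (induction rule: vpoly.induct)
      case (vpoly_power n c)
      have "cdot (fourier_coeff f (int n)) c = 0" using HltD(2)[OF f, of "int n"] by simp
      then have "L2_inner f (\<lambda>\<zeta>. \<zeta> ^ n *s c) = 0" using fourier_coeff_inner[OF fL, of "int n" c] by simp
      then show ?case by (metis L2_inner_cnj complex_cnj_zero)
    next
      case (vpoly_add p q)
      then show ?case
        using L2_inner_add_left[OF HgeD(1)[OF vpoly_Hge[OF vpoly_add.hyps(1)]] HgeD(1)[OF vpoly_Hge[OF vpoly_add.hyps(2)]] fL]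
        by simp
    qed
    have "(\<lambda>n. L2_inner (s n) f) \<longlonglongrightarrow> L2_inner g f" by (rule L2_inner_tendsto[OF sL gL fL s(2)])
    then have "L2_inner g f = 0" using p[OF s(1)] by (simp add: LIMSEQ_const_iff)
    then show ?thesis by (metis L2_inner_cnj complex_cnj_zero)
  qed
  show "L2_inner f g = 0"
    using 0[OF Hlt_shift[OF f, of "-N", simplified] Hge_shift[OF g, of "-N", simplified]]
      L2_shift_inner[of "-N" f g] by simp
  then show "L2_inner g f = 0" by (metis L2_inner_cnj complex_cnj_zero)
qed

lemma H2_minus_eq_Hlt: "H2_minus = Hlt 0"
proof
  show "H2_minus \<subseteq> Hlt 0"
  proof
    fix f assume f: "f \<in> H2_minus"
    then have fL: "f \<in> L2" by (simp add: H2_minus_def)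
    have "fourier_coeff f n = 0" if "0 \<le> n" for n
      using f that by (subst fourier_coeff_eq_0_iff[OF fL]) (auto simp: H2_minus_def H2_eq_Hge Hge_monomial)
    then show "f \<in> Hlt 0" using fL by (simp add: Hlt_def)
  qed
  show "Hlt 0 \<subseteq> H2_minus"
    using Hlt_orthogonal_Hge HltD(1) by (auto simp: H2_minus_def H2_eq_Hge)
qed

lemma P_plus_spec:
  assumes f: "f \<in> L2" shows "P_plus f \<in> Hge 0" "(\<lambda>\<zeta>. f \<zeta> - P_plus f \<zeta>) \<in> Hlt 0"
proof -
  obtain g where g: "g \<in> Hge 0" "(\<lambda>\<zeta>. f \<zeta> - g \<zeta>) \<in> Hlt 0"
    using Hge_Hlt_decomposition_aux[OF f] by blast
  have "P_plus f \<in> H2 \<and> (\<forall>h\<in>H2. L2_inner (\<lambda>\<zeta>. f \<zeta> - P_plus f \<zeta>) h = 0)"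
    unfolding P_plus_def orth_proj_def
    by (rule someI[of _ g]) (use g Hlt_orthogonal_Hge in \<open>auto simp: H2_eq_Hge\<close>)
  then show "P_plus f \<in> Hge 0" "(\<lambda>\<zeta>. f \<zeta> - P_plus f \<zeta>) \<in> Hlt 0"
    unfolding H2_minus_eq_Hlt[symmetric] H2_minus_def by (auto simp: H2_eq_Hge L2_diff f HgeD(1))
qed

lemma P_minus_spec:
  assumes f: "f \<in> L2" shows "P_minus f \<in> Hlt 0" "(\<lambda>\<zeta>. f \<zeta> - P_minus f \<zeta>) \<in> Hge 0"
proof -
  let ?g = "\<lambda>\<zeta>. f \<zeta> - P_plus f \<zeta>"
  have "P_minus f \<in> H2_minus \<and> (\<forall>h\<in>H2_minus. L2_inner (\<lambda>\<zeta>. f \<zeta> - P_minus f \<zeta>) h = 0)"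
    unfolding P_minus_def orth_proj_def
    by (rule someI[of _ ?g]) (use P_plus_spec[OF f] Hlt_orthogonal_Hge in \<open>auto simp: H2_minus_eq_Hlt\<close>)
  then have P: "P_minus f \<in> Hlt 0" "\<And>h. h \<in> Hlt 0 \<Longrightarrow> L2_inner (\<lambda>\<zeta>. f \<zeta> - P_minus f \<zeta>) h = 0"
    by (auto simp: H2_minus_eq_Hlt)
  have dL: "(\<lambda>\<zeta>. f \<zeta> - P_minus f \<zeta>) \<in> L2" by (intro L2_diff f HltD(1)[OF P(1)])
  show "P_minus f \<in> Hlt 0" by (rule P)
  have "fourier_coeff (\<lambda>\<zeta>. f \<zeta> - P_minus f \<zeta>) n = 0" if "n < 0" for n
    using P(2)[OF Hlt_monomial[OF that]] by (subst fourier_coeff_eq_0_iff[OF dL]) auto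
  then show "(\<lambda>\<zeta>. f \<zeta> - P_minus f \<zeta>) \<in> Hge 0" using dL by (simp add: Hge_def)
qed

lemma Hge_Hlt_unique:
  assumes "p \<in> Hge N" "q \<in> Hge N" "(\<lambda>\<zeta>. f \<zeta> - p \<zeta>) \<in> Hlt N" "(\<lambda>\<zeta>. f \<zeta> - q \<zeta>) \<in> Hlt N"
  shows "AE \<zeta> in \<mu>. p \<zeta> = q \<zeta>"
proof -
  have "(\<lambda>\<zeta>. (f \<zeta> - q \<zeta>) - (f \<zeta> - p \<zeta>)) \<in> Hlt N" by (intro Hlt_diff assms)
  then have "(\<lambda>\<zeta>. p \<zeta> - q \<zeta>) \<in> Hlt N" by simp
  from Hge_Hlt_zero[OF Hge_diff[OF assms(1,2)] this] show ?thesis by simp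
qed

lemma P_plus_unique:
  assumes "f \<in> L2" "p \<in> Hge 0" "(\<lambda>\<zeta>. f \<zeta> - p \<zeta>) \<in> Hlt 0" shows "AE \<zeta> in \<mu>. P_plus f \<zeta> = p \<zeta>"
  by (rule Hge_Hlt_unique[OF P_plus_spec(1)[OF assms(1)] assms(2) P_plus_spec(2)[OF assms(1)] assms(3)])

lemma P_minus_eq: assumes f: "f \<in> L2" shows "AE \<zeta> in \<mu>. P_minus f \<zeta> = f \<zeta> - P_plus f \<zeta>"
proof -
  have "AE \<zeta> in \<mu>. P_plus f \<zeta> = f \<zeta> - P_minus f \<zeta>"
    by (rule P_plus_unique[OF f P_minus_spec(2)[OF f]]) (use P_minus_spec(1)[OF f] in simp)
  then show ?thesis by eventually_elim simp
qed

lemma L2_norm_Hge_Hlt: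
  assumes "p \<in> Hge N" "q \<in> Hlt N"
  shows "(L2_norm (\<lambda>\<zeta>. p \<zeta> + q \<zeta>))\<^sup>2 = (L2_norm p)\<^sup>2 + (L2_norm q)\<^sup>2"
  using L2_norm_add_sq[OF HgeD(1)[OF assms(1)] HltD(1)[OF assms(2)]] Hlt_orthogonal_Hge(1)[OF assms(2,1)] by simp

lemma P_plus_minus_norm:
  assumes f: "f \<in> L2" shows "(L2_norm f)\<^sup>2 = (L2_norm (P_plus f))\<^sup>2 + (L2_norm (P_minus f))\<^sup>2"
proof -
  have [measurable]: "P_minus f \<in> borel_measurable \<mu>" "P_plus f \<in> borel_measurable \<mu>" "f \<in> borel_measurable \<mu>"
    using L2_measurable HltD(1)[OF P_minus_spec(1)[OF f]] HgeD(1)[OF P_plus_spec(1)[OF f]] f by blast+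
  have "L2_norm (P_minus f) = L2_norm (\<lambda>\<zeta>. f \<zeta> - P_plus f \<zeta>)"
    by (rule L2_norm_cong_AE) (use P_minus_eq[OF f] in \<open>auto elim: eventually_mono\<close>)
  then show ?thesis using L2_norm_Hge_Hlt[OF P_plus_spec[OF f]] by simp
qed

lemma P_plus_add:
  assumes "f \<in> L2" "g \<in> L2" shows "AE \<zeta> in \<mu>. P_plus (\<lambda>\<zeta>. f \<zeta> + g \<zeta>) \<zeta> = P_plus f \<zeta> + P_plus g \<zeta>"
proof (rule P_plus_unique)
  show "(\<lambda>\<zeta>. f \<zeta> + g \<zeta> - (P_plus f \<zeta> + P_plus g \<zeta>)) \<in> Hlt 0"
    using Hlt_add[OF P_plus_spec(2)[OF assms(1)] P_plus_spec(2)[OF assms(2)]] by (simp add: algebra_simps)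
qed (intro L2_add Hge_add P_plus_spec assms)+

lemma P_plus_diff:
  assumes "f \<in> L2" "g \<in> L2" shows "AE \<zeta> in \<mu>. P_plus (\<lambda>\<zeta>. f \<zeta> - g \<zeta>) \<zeta> = P_plus f \<zeta> - P_plus g \<zeta>"
proof (rule P_plus_unique)
  show "(\<lambda>\<zeta>. f \<zeta> - g \<zeta> - (P_plus f \<zeta> - P_plus g \<zeta>)) \<in> Hlt 0"
    using Hlt_diff[OF P_plus_spec(2)[OF assms(1)] P_plus_spec(2)[OF assms(2)]] by (simp add: algebra_simps)
qed (intro L2_diff Hge_diff P_plus_spec assms)+

lemma P_plus_scale:
  assumes "f \<in> L2" shows "AE \<zeta> in \<mu>. P_plus (\<lambda>\<zeta>. c *s f \<zeta>) \<zeta> = c *s P_plus f \<zeta>"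
proof (rule P_plus_unique)
  show "(\<lambda>\<zeta>. c *s f \<zeta> - c *s P_plus f \<zeta>) \<in> Hlt 0"
    using Hlt_scale[OF P_plus_spec(2)[OF assms(1)], of c] by (simp add: vector_ssub_ldistrib)
qed (intro L2_scale Hge_scale P_plus_spec assms)+

subsection \<open>Products of analytic functions\<close>

text \<open>Entrywise complex conjugation.\<close>

definition vcnj :: "complex ^ 'r \<Rightarrow> complex ^ 'r" where "vcnj x = (\<chi> i. cnj (x $ i))"

lemma vcnj_nth [simp]: "vcnj x $ i = cnj (x $ i)" by (simp add: vcnj_def)
lemma norm_vcnj [simp]: "norm (vcnj x) = norm x" by (simp add: norm_vec_def L2_set_def)
lemma vcnj_measurable [measurable (raw)]: "f \<in> borel_measurable M \<Longrightarrow> (\<lambda>x. vcnj (f x)) \<in> borel_measurable M"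
  unfolding vcnj_def by measurable
lemma L2_vcnj: "f \<in> L2 \<Longrightarrow> (\<lambda>\<zeta>. vcnj (f \<zeta>)) \<in> L2"
  by (rule L2_bound[OF _ L2_integrable]) auto

lemma fourier_coeff_vcnj: assumes "f \<in> L2" shows "fourier_coeff (\<lambda>\<zeta>. vcnj (f \<zeta>)) n = vcnj (fourier_coeff f (- n))"
proof -
  have "fcoef (\<lambda>\<zeta>. cnj (f \<zeta> $ i)) n = cnj (fcoef (\<lambda>\<zeta>. f \<zeta> $ i) (- n))" for i
    unfolding fcoef_def Bochner_Integration.integral_cnj[symmetric]
    by (rule Bochner_Integration.integral_cong) (auto simp: cnj_base_powi_circle)
  then show ?thesis by (simp add: vec_eq_iff fourier_coeff_nth assms L2_vcnj)
qed

text \<open>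
  The bilinear product of \<open>h\<close> and \<open>k\<close> is only integrable, but its Fourier coefficients are inner products
  of \<open>k\<close> with shifts of the conjugate of \<open>h\<close>.
\<close>

lemma fcoef_product_zero:
  assumes h: "h \<in> Hge a" and k: "k \<in> Hge b" and n: "n < a + b"
  shows "fcoef (\<lambda>\<zeta>. \<Sum>i\<in>UNIV. h \<zeta> $ i * k \<zeta> $ i) n = 0"
proof -
  have "(\<lambda>\<zeta>. vcnj (h \<zeta>)) \<in> Hlt (1 - a)"
    using HgeD(2)[OF h] by (auto simp: Hlt_def L2_vcnj HgeD(1)[OF h] fourier_coeff_vcnj vec_eq_iff)
  then have "(\<lambda>\<zeta>. \<zeta> powi n *s vcnj (h \<zeta>)) \<in> Hlt (1 - a + n)" by (rule Hlt_shift)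
  moreover have "1 - a + n \<le> b" using n by simp
  ultimately have "(\<lambda>\<zeta>. \<zeta> powi n *s vcnj (h \<zeta>)) \<in> Hlt b" using Hlt_mono by blast
  from Hlt_orthogonal_Hge(2)[OF this k] have "L2_inner k (\<lambda>\<zeta>. \<zeta> powi n *s vcnj (h \<zeta>)) = 0" .
  moreover have "L2_inner k (\<lambda>\<zeta>. \<zeta> powi n *s vcnj (h \<zeta>)) = fcoef (\<lambda>\<zeta>. \<Sum>i\<in>UNIV. h \<zeta> $ i * k \<zeta> $ i) n"
    unfolding L2_inner_def fcoef_def
    by (rule Bochner_Integration.integral_cong) (auto simp: cnj_base_powi_circle sum_distrib_left mult_ac)
  ultimately show ?thesis by simp
qed

text \<open>Bounded analytic scalar functions, given by their boundary values.\<close>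

definition bdd_analytic :: "(complex \<Rightarrow> complex) \<Rightarrow> bool" where
  "bdd_analytic f \<longleftrightarrow> f \<in> borel_measurable \<mu> \<and> (\<exists>b. AE \<zeta> in \<mu>. norm (f \<zeta>) \<le> b) \<and> (\<forall>n<0. fcoef f n = 0)"

lemma bdd_analytic_integrable: "bdd_analytic f \<Longrightarrow> integrable \<mu> f"
  unfolding bdd_analytic_def by (auto intro: circle.integrable_const_bound)

lemma bdd_analytic_axis: assumes "bdd_analytic f" shows "(\<lambda>\<zeta>. f \<zeta> *s axis i 1) \<in> Hge 0"
proof -
  have [measurable]: "f \<in> borel_measurable \<mu>" using assms by (simp add: bdd_analytic_def)
  obtain b where "AE \<zeta> in \<mu>. norm (f \<zeta>) \<le> b" using assms by (auto simp: bdd_analytic_def)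
  then have L: "(\<lambda>\<zeta>. f \<zeta> *s axis i 1) \<in> L2" by (intro L2_mult_bounded) auto
  have "fourier_coeff (\<lambda>\<zeta>. f \<zeta> *s axis i 1) n $ j = 0" if "n < 0" for n j
    using assms that unfolding fourier_coeff_nth[OF L]
    by (cases "j = i") (auto simp: bdd_analytic_def axis_def fcoef_def)
  then show ?thesis using L by (simp add: Hge_def vec_eq_iff)
qed

text \<open>
  On bounded analytic functions integration over the circle is multiplicative, being evaluation at the
  origin. The products are read as bilinear products of vectors of length one.
\<close>

lemma bdd_analytic_mult:
  assumes f: "bdd_analytic f" and g: "bdd_analytic g"
  shows "bdd_analytic (\<lambda>\<zeta>. f \<zeta> * g \<zeta>)" "(LINT \<zeta>|\<mu>. f \<zeta> * g \<zeta>) = (LINT \<zeta>|\<mu>. f \<zeta>) * (LINT \<zeta>|\<mu>. g \<zeta>)"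
proof -
  have prod: "(\<Sum>i\<in>(UNIV :: 1 set). (f \<zeta> *s axis 1 1) $ i * (g \<zeta> *s axis 1 1) $ i) = f \<zeta> * g \<zeta>" for f g :: "complex \<Rightarrow> complex" and \<zeta>
    by simp
  obtain b b' where b: "AE \<zeta> in \<mu>. norm (f \<zeta>) \<le> b" and b': "AE \<zeta> in \<mu>. norm (g \<zeta>) \<le> b'"
    using f g by (auto simp: bdd_analytic_def)
  have [measurable]: "f \<in> borel_measurable \<mu>" "g \<in> borel_measurable \<mu>" using f g by (auto simp: bdd_analytic_def)
  have bb: "AE \<zeta> in \<mu>. norm (f \<zeta> * g \<zeta>) \<le> b * b'"
    using b b' by eventually_elim (auto simp: norm_mult intro!: mult_mono order_trans[OF norm_ge_zero])
  have "fcoef (\<lambda>\<zeta>. f \<zeta> * g \<zeta>) n = 0" if "n < 0" for n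
    using fcoef_product_zero[OF bdd_analytic_axis[OF f, of "1::1"] bdd_analytic_axis[OF g, of "1::1"], of n] that
    unfolding prod by simp
  then show "bdd_analytic (\<lambda>\<zeta>. f \<zeta> * g \<zeta>)" unfolding bdd_analytic_def using bb by auto
  define c where "c = (LINT \<zeta>|\<mu>. f \<zeta>)"
  let ?f = "\<lambda>\<zeta>. (f \<zeta> - c) *s axis (1::1) 1"
  have fi: "integrable \<mu> f" and gi: "integrable \<mu> g" using f g by (auto intro: bdd_analytic_integrable)
  have fgi: "integrable \<mu> (\<lambda>\<zeta>. f \<zeta> * g \<zeta>)" by (rule circle.integrable_const_bound[OF bb]) simp
  have F0: "?f \<in> Hge 0"
    using Hge_diff[OF bdd_analytic_axis[OF f, of "1::1"] Hge_const[of "c *s axis 1 1"]] by (simp add: vector_sub_rdistrib)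
  have "fourier_coeff ?f 0 $ i = 0" for i
    unfolding fourier_coeff_nth[OF HgeD(1)[OF F0]] using fi circle.prob_space
    by (simp add: fcoef_def c_def axis_def)
  then have "fourier_coeff ?f 0 = 0" by (simp add: vec_eq_iff)
  then have "?f \<in> Hge 1" using F0 by (auto simp: Hge_def) (metis int_one_le_iff_zero_less linorder_neqE_linordered_idom not_le)
  from fcoef_product_zero[OF this bdd_analytic_axis[OF g, of "1::1"], of 0]
  have "(LINT \<zeta>|\<mu>. (f \<zeta> - c) * g \<zeta>) = 0" unfolding prod by (simp add: fcoef_def)
  then show "(LINT \<zeta>|\<mu>. f \<zeta> * g \<zeta>) = (LINT \<zeta>|\<mu>. f \<zeta>) * (LINT \<zeta>|\<mu>. g \<zeta>)"
    using fgi gi by (simp add: left_diff_distrib c_def)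
qed

lemma bdd_analytic_const: "bdd_analytic (\<lambda>_. 1)"
  unfolding bdd_analytic_def
proof (intro conjI allI impI exI[of _ 1])
  fix n :: int assume "n < 0"
  then show "fcoef (\<lambda>_. 1) n = 0" unfolding fcoef_def mult_1_right by (simp only: integral_circle_powi) simp
qed auto

lemma bdd_analytic_prod:
  assumes "finite I" "\<And>i. i \<in> I \<Longrightarrow> bdd_analytic (f i)"
  shows "bdd_analytic (\<lambda>\<zeta>. \<Prod>i\<in>I. f i \<zeta>) \<and> (LINT \<zeta>|\<mu>. (\<Prod>i\<in>I. f i \<zeta>)) = (\<Prod>i\<in>I. LINT \<zeta>|\<mu>. f i \<zeta>)"
  using assms
proof (induction I rule: finite_induct)
  case empty
  then show ?case using bdd_analytic_const circle.prob_space by simp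
next
  case (insert i I)
  then show ?case using bdd_analytic_mult[of "f i" "\<lambda>\<zeta>. \<Prod>i\<in>I. f i \<zeta>"] by simp
qed

lemma integral_det_bdd_analytic:
  fixes g :: "complex \<Rightarrow> complex ^ 'r ^ 'r"
  assumes "\<And>i j. bdd_analytic (\<lambda>\<zeta>. g \<zeta> $ i $ j)"
  shows "(LINT \<zeta>|\<mu>. det (g \<zeta>)) = det (\<chi> i j. LINT \<zeta>|\<mu>. g \<zeta> $ i $ j)"
proof -
  have P: "bdd_analytic (\<lambda>\<zeta>. \<Prod>i\<in>UNIV. g \<zeta> $ i $ p i) \<and> (LINT \<zeta>|\<mu>. (\<Prod>i\<in>UNIV. g \<zeta> $ i $ p i)) = (\<Prod>i\<in>UNIV. LINT \<zeta>|\<mu>. g \<zeta> $ i $ p i)" for p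
    by (rule bdd_analytic_prod) (use assms in auto)
  then have "integrable \<mu> (\<lambda>\<zeta>. \<Prod>i\<in>UNIV. g \<zeta> $ i $ p i)" for p by (blast intro: bdd_analytic_integrable)
  with P show ?thesis unfolding det_def by (subst Bochner_Integration.integral_sum) auto
qed

subsection \<open>Analytic functions of constant modulus\<close>

text \<open>
  An argument of Szego and Helson: the projection of \<open>h\<close> to the orthogonal complement of the span of
  \<open>\<zeta> h, \<zeta>\<^sup>2 h, \<dots>\<close> has constant modulus, because it is orthogonal to its own multiples by
  \<open>\<zeta>, \<zeta>\<^sup>2, \<dots>\<close>. It is a limit of multiples of \<open>h\<close> by scalar polynomials with constant term one, so it
  vanishes wherever \<open>h\<close> does and has the same mean.
\<close>

lemma constant_modulus_multiple:
  fixes h :: "complex \<Rightarrow> complex ^ 'r"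
  assumes h: "h \<in> Hge 0" and h0: "fourier_coeff h 0 \<noteq> 0"
  obtains g \<phi> c where "g \<in> Hge 0" "0 < c" "AE \<zeta> in \<mu>. norm (g \<zeta>) = c" "fourier_coeff g 0 = fourier_coeff h 0"
    "AE \<zeta> in \<mu>. (\<lambda>n. \<phi> n \<zeta> *s h \<zeta>) \<longlonglongrightarrow> g \<zeta>"
proof -
  have hL: "h \<in> L2" by (rule HgeD(1)[OF h])
  define V where "V = {\<lambda>\<zeta>. p \<zeta> *s h \<zeta> | p. p \<in> apoly 1}"
  have V1: "v \<in> Hge 1" if "v \<in> V" for v using that apoly_mult_Hge[OF _ h, of _ 1] by (auto simp: V_def)
  have "\<exists>g\<in>L2. \<exists>s. (\<forall>n. s n \<in> V) \<and> (\<lambda>n. L2_norm (\<lambda>\<zeta>. s n \<zeta> - g \<zeta>)) \<longlonglongrightarrow> 0 \<and>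
     (\<forall>v\<in>V. L2_inner (\<lambda>\<zeta>. h \<zeta> - g \<zeta>) v = 0)"
  proof (rule L2_projection[OF _ _ _ _ hL])
    show "V \<subseteq> L2" using V1 HgeD(1) by blast
    show "V \<noteq> {}" using apoly_power[of 1 1] unfolding V_def by blast
    show "(\<lambda>\<zeta>. x \<zeta> + y \<zeta>) \<in> V" if xy: "x \<in> V" "y \<in> V" for x y
    proof -
      obtain p q where "x = (\<lambda>\<zeta>. p \<zeta> *s h \<zeta>)" "p \<in> apoly 1" "y = (\<lambda>\<zeta>. q \<zeta> *s h \<zeta>)" "q \<in> apoly 1"
        using xy unfolding V_def by blast
      then show ?thesis unfolding V_def using apoly_add[of p 1 q]
        by (auto intro!: exI[of _ "\<lambda>\<zeta>. p \<zeta> + q \<zeta>"] simp: vector_sadd_rdistrib)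
    qed
    show "(\<lambda>\<zeta>. c *s x \<zeta>) \<in> V" if xV: "x \<in> V" for c x
    proof -
      obtain p where "x = (\<lambda>\<zeta>. p \<zeta> *s h \<zeta>)" "p \<in> apoly 1" using xV unfolding V_def by blast
      then show ?thesis unfolding V_def using apoly_scale[of p 1 c]
        by (auto intro!: exI[of _ "\<lambda>\<zeta>. c * p \<zeta>"] simp: vector_smult_assoc)
    qed
  qed
  then obtain g0 s where g0: "g0 \<in> L2" and s: "\<And>n. s n \<in> V" "(\<lambda>n. L2_norm (\<lambda>\<zeta>. s n \<zeta> - g0 \<zeta>)) \<longlonglongrightarrow> 0"
    and orth: "\<And>v. v \<in> V \<Longrightarrow> L2_inner (\<lambda>\<zeta>. h \<zeta> - g0 \<zeta>) v = 0" by blast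
  have sL: "s n \<in> L2" for n using V1[OF s(1)] by (rule HgeD(1))
  obtain p where p: "\<And>n. s n = (\<lambda>\<zeta>. p n \<zeta> *s h \<zeta>)" "\<And>n. p n \<in> apoly 1"
    using s(1) unfolding V_def mem_Collect_eq by metis
  define g where "g \<zeta> = h \<zeta> - g0 \<zeta>" for \<zeta>
  have gL: "g \<in> L2" unfolding g_def by (intro L2_diff hL g0)
  have g01: "g0 \<in> Hge 1" by (rule Hge_closed[OF V1[OF s(1)] g0 s(2)])
  have gH: "g \<in> Hge 0" unfolding g_def by (intro Hge_diff h Hge_mono[OF _ g01]) simp
  have gc: "fourier_coeff g 0 = fourier_coeff h 0"
    unfolding g_def using fourier_coeff_diff[OF hL g0] HgeD(2)[OF g01, of 0] by simp
  have self_orth: "L2_inner g (\<lambda>\<zeta>. \<zeta> powi int j *s g \<zeta>) = 0" if j: "1 \<le> j" for j :: nat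
  proof -
    have inV: "(\<lambda>\<zeta>. \<zeta> powi int j *s (h \<zeta> - s n \<zeta>)) \<in> V" for n
    proof -
      have "(\<lambda>\<zeta>. \<zeta> ^ j + (-1) * (\<zeta> ^ j * p n \<zeta>)) \<in> apoly 1"
        by (intro apoly_add apoly_scale apoly_shift apoly_power p j)
      moreover have "(\<lambda>\<zeta>. \<zeta> powi int j *s (h \<zeta> - s n \<zeta>)) = (\<lambda>\<zeta>. (\<zeta> ^ j + (-1) * (\<zeta> ^ j * p n \<zeta>)) *s h \<zeta>)"
        by (simp add: p(1) fun_eq_iff vec_eq_iff algebra_simps)
      ultimately show ?thesis unfolding V_def mem_Collect_eq by (intro exI conjI)
    qed
    have L: "(\<lambda>\<zeta>. \<zeta> powi int j *s (h \<zeta> - s n \<zeta>)) \<in> L2" for n by (intro L2_shift L2_diff hL sL)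
    have "(\<lambda>n. L2_inner (\<lambda>\<zeta>. \<zeta> powi int j *s (h \<zeta> - s n \<zeta>)) g) \<longlonglongrightarrow> L2_inner (\<lambda>\<zeta>. \<zeta> powi int j *s g \<zeta>) g"
    proof (rule L2_inner_tendsto[OF L L2_shift[OF gL] gL])
      have "L2_norm (\<lambda>\<zeta>. \<zeta> powi int j *s (h \<zeta> - s n \<zeta>) - \<zeta> powi int j *s g \<zeta>) = L2_norm (\<lambda>\<zeta>. s n \<zeta> - g0 \<zeta>)" for n
      proof -
        have "(\<lambda>\<zeta>. \<zeta> powi int j *s (h \<zeta> - s n \<zeta>) - \<zeta> powi int j *s g \<zeta>) = (\<lambda>\<zeta>. \<zeta> powi int j *s (g0 \<zeta> - s n \<zeta>))"
          unfolding g_def by (simp add: fun_eq_iff vec_eq_iff algebra_simps)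
        then show ?thesis by (simp only: L2_norm_shift L2_norm_minus_commute[of g0])
      qed
      then show "(\<lambda>n. L2_norm (\<lambda>\<zeta>. \<zeta> powi int j *s (h \<zeta> - s n \<zeta>) - \<zeta> powi int j *s g \<zeta>)) \<longlonglongrightarrow> 0" using s(2) by simp
    qed
    moreover have "L2_inner (\<lambda>\<zeta>. \<zeta> powi int j *s (h \<zeta> - s n \<zeta>)) g = 0" for n
      using orth[OF inV] unfolding g_def by (metis L2_inner_cnj complex_cnj_zero)
    ultimately have "L2_inner (\<lambda>\<zeta>. \<zeta> powi int j *s g \<zeta>) g = 0" by (simp add: LIMSEQ_const_iff)
    then show ?thesis by (metis L2_inner_cnj complex_cnj_zero)
  qed
  have fc: "fcoef (\<lambda>\<zeta>. of_real ((norm (g \<zeta>))\<^sup>2)) n = L2_inner g (\<lambda>\<zeta>. \<zeta> powi n *s g \<zeta>)" for n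
    unfolding fcoef_def L2_inner_cdot
    by (rule Bochner_Integration.integral_cong) (auto simp: cdot_scale_right cnj_base_powi_circle cdot_self)
  have fc0: "fcoef (\<lambda>\<zeta>. of_real ((norm (g \<zeta>))\<^sup>2)) n = 0" if "n \<noteq> 0" for n
  proof (cases "n > 0")
    case True
    then show ?thesis using self_orth[of "nat n"] unfolding fc by simp
  next
    case False
    have "L2_inner g (\<lambda>\<zeta>. \<zeta> powi n *s g \<zeta>) = cnj (L2_inner g (\<lambda>\<zeta>. \<zeta> powi (- n) *s g \<zeta>))"
      unfolding L2_inner_cnj by (rule L2_shift_inner_right)
    then show ?thesis using self_orth[of "nat (- n)"] False that unfolding fc by simp
  qed
  define c2 where "c2 = (L2_norm g)\<^sup>2"
  have gi: "integrable \<mu> (\<lambda>\<zeta>. complex_of_real ((norm (g \<zeta>))\<^sup>2))"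
    by (rule integrable_of_real[OF L2_integrable[OF gL]])
  have "AE \<zeta> in \<mu>. of_real ((norm (g \<zeta>))\<^sup>2) - complex_of_real c2 = 0"
  proof (rule fourier_unique)
    show "integrable \<mu> (\<lambda>\<zeta>. of_real ((norm (g \<zeta>))\<^sup>2) - complex_of_real c2)"
      by (rule Bochner_Integration.integrable_diff[OF gi]) simp
    fix n
    have "fcoef (\<lambda>\<zeta>. of_real ((norm (g \<zeta>))\<^sup>2) - complex_of_real c2) n
        = fcoef (\<lambda>\<zeta>. of_real ((norm (g \<zeta>))\<^sup>2)) n - (LINT \<zeta>|\<mu>. \<zeta> powi (- n) * complex_of_real c2)"
      unfolding fcoef_def right_diff_distrib
      by (rule Bochner_Integration.integral_diff[OF integrable_powi[OF gi] integrable_powi]) simp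
    also have "(LINT \<zeta>|\<mu>. \<zeta> powi (- n) * complex_of_real c2) = (if n = 0 then 1 else 0) * complex_of_real c2"
      unfolding integral_mult_left_zero integral_circle_powi by simp
    also have "fcoef (\<lambda>\<zeta>. of_real ((norm (g \<zeta>))\<^sup>2)) n = (if n = 0 then 1 else 0) * complex_of_real c2"
    proof (cases "n = 0")
      case True
      have "fcoef (\<lambda>\<zeta>. of_real ((norm (g \<zeta>))\<^sup>2)) 0 = L2_inner g g" unfolding fc by simp
      then show ?thesis using L2_inner_self[of g] True unfolding c2_def by simp
    qed (use fc0 in simp)
    finally show "fcoef (\<lambda>\<zeta>. of_real ((norm (g \<zeta>))\<^sup>2) - complex_of_real c2) n = 0" by simp
  qed
  then have "AE \<zeta> in \<mu>. (norm (g \<zeta>))\<^sup>2 = c2"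
    by eventually_elim (simp only: right_minus_eq of_real_eq_iff)
  then have nc: "AE \<zeta> in \<mu>. norm (g \<zeta>) = L2_norm g"
    by eventually_elim (simp add: c2_def power2_eq_iff_nonneg)
  have "L2_norm g \<noteq> 0"
  proof
    assume "L2_norm g = 0"
    then have "AE \<zeta> in \<mu>. g \<zeta> = 0" using L2_norm_eq_0[OF gL] by simp
    then have "fourier_coeff g 0 = fourier_coeff (\<lambda>_. 0) 0" by (intro fourier_coeff_cong_AE) (use gL in auto)
    then show False using h0 gc by (simp add: fourier_coeff_const)
  qed
  then have cpos: "0 < L2_norm g" by (simp add: less_le)
  obtain \<rho> where \<rho>: "AE \<zeta> in \<mu>. (\<lambda>n. s (\<rho> n) \<zeta>) \<longlonglongrightarrow> g0 \<zeta>"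
    using L2_AE_subsequence[OF sL g0 s(2)] by blast
  have "AE \<zeta> in \<mu>. (\<lambda>n. (1 - p (\<rho> n) \<zeta>) *s h \<zeta>) \<longlonglongrightarrow> g \<zeta>"
    using \<rho>
  proof eventually_elim
    case (elim \<zeta>)
    have "(\<lambda>n. h \<zeta> - s (\<rho> n) \<zeta>) \<longlonglongrightarrow> h \<zeta> - g0 \<zeta>" by (intro tendsto_intros elim)
    then show ?case by (simp add: g_def p(1) vector_sub_rdistrib)
  qed
  then show thesis by (rule that[OF gH cpos nc gc])
qed

text \<open>
  After division by a power of \<open>\<zeta>\<close> the function has nonzero mean, and it has a multiple of constant modulus.
\<close>

lemma H2_nonzero_AE:
  assumes f: "f \<in> Hge 0" and nz: "\<not> (AE \<zeta> in \<mu>. f \<zeta> = 0)"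
  shows "AE \<zeta> in \<mu>. f \<zeta> \<noteq> 0"
proof -
  have fL: "f \<in> L2" by (rule HgeD(1)[OF f])
  have ex: "\<exists>m::nat. fourier_coeff f (int m) \<noteq> 0"
  proof (rule ccontr)
    assume n: "\<not> (\<exists>m::nat. fourier_coeff f (int m) \<noteq> 0)"
    have "fourier_coeff f k = 0" for k
    proof (cases "k < 0")
      case False
      then show ?thesis using n by (metis int_nat_eq not_less)
    qed (use HgeD(2)[OF f] in auto)
    then show False using L2_fourier_unique[OF fL] nz by blast
  qed
  define m where "m = (LEAST m::nat. fourier_coeff f (int m) \<noteq> 0)"
  have m: "fourier_coeff f (int m) \<noteq> 0" unfolding m_def using ex by (rule LeastI_ex)
  have lt: "fourier_coeff f (int k) = 0" if "k < m" for k using not_less_Least[of k] that unfolding m_def by blast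
  let ?h = "\<lambda>\<zeta>. \<zeta> powi (- int m) *s f \<zeta>"
  have "fourier_coeff f k = 0" if "k < int m" for k
  proof (cases "k < 0")
    case False
    then show ?thesis using lt[of "nat k"] that by simp
  qed (use HgeD(2)[OF f] in auto)
  then have "f \<in> Hge (int m)" using fL by (simp add: Hge_def)
  then have hH: "?h \<in> Hge 0" using Hge_shift[of f "int m" "- int m"] by simp
  have "fourier_coeff ?h 0 \<noteq> 0" using m fourier_coeff_shift[OF fL, of "- int m" 0] by simp
  then obtain g \<phi> c where g: "0 < c" "AE \<zeta> in \<mu>. norm (g \<zeta>) = c" "AE \<zeta> in \<mu>. (\<lambda>n. \<phi> n \<zeta> *s ?h \<zeta>) \<longlonglongrightarrow> g \<zeta>"
    by (rule constant_modulus_multiple[OF hH])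
  show ?thesis
    using g(2,3)
  proof eventually_elim
    case (elim \<zeta>)
    show ?case
    proof
      assume "f \<zeta> = 0"
      then have "(\<lambda>n::nat. 0) \<longlonglongrightarrow> g \<zeta>" using elim(2) by simp
      then have "g \<zeta> = 0" by (simp add: LIMSEQ_const_iff)
      then show False using elim(1) g(1) by simp
    qed
  qed
qed

section \<open>Toeplitz operators whose Hankel operator has small essential norm\<close>

lemma linear_op_add:
  "linear_op S S' K \<Longrightarrow> f \<in> S \<Longrightarrow> g \<in> S \<Longrightarrow> AE \<zeta> in \<mu>. K (\<lambda>\<zeta>. f \<zeta> + g \<zeta>) \<zeta> = K f \<zeta> + K g \<zeta>"
  unfolding linear_op_def by blast

lemma linear_op_scale:
  "linear_op S S' K \<Longrightarrow> f \<in> S \<Longrightarrow> AE \<zeta> in \<mu>. K (\<lambda>\<zeta>. c *s f \<zeta>) \<zeta> = c *s K f \<zeta>"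
  unfolding linear_op_def by blast

lemma toeplitz_zU: "toeplitz (\<lambda>\<zeta>. map_matrix ((*) \<zeta>) (U \<zeta>)) f = toeplitz U (\<lambda>\<zeta>. \<zeta> *s f \<zeta>)"
  unfolding toeplitz_def map_matrix_mult_vec matrix_vector_scale ..

context
  fixes U :: "complex \<Rightarrow> complex ^ 'r ^ 'r"
  assumes U_meas [measurable]: "U \<in> borel_measurable \<mu>" and U_unitary: "AE \<zeta> in \<mu>. unitary_matrix (U \<zeta>)"
begin

lemma U_Linf: "U \<in> Linf" by (rule unitary_Linf[OF U_meas U_unitary])

lemma U_L2: "f \<in> L2 \<Longrightarrow> (\<lambda>\<zeta>. U \<zeta> *v f \<zeta>) \<in> L2" by (rule Linf_mult_L2[OF U_Linf])

lemma toeplitz_Hge: "f \<in> L2 \<Longrightarrow> toeplitz U f \<in> Hge 0"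
  unfolding toeplitz_def by (rule P_plus_spec(1)[OF U_L2])

lemma toeplitz_L2: "f \<in> L2 \<Longrightarrow> toeplitz U f \<in> L2"
  by (rule HgeD(1)[OF toeplitz_Hge])

lemma toeplitz_diff:
  "\<lbrakk>f \<in> L2; g \<in> L2\<rbrakk> \<Longrightarrow> AE \<zeta> in \<mu>. toeplitz U (\<lambda>\<zeta>. f \<zeta> - g \<zeta>) \<zeta> = toeplitz U f \<zeta> - toeplitz U g \<zeta>"
  unfolding toeplitz_def matrix_vector_mult_diff_distrib by (intro P_plus_diff U_L2)

lemma toeplitz_add:
  "\<lbrakk>f \<in> L2; g \<in> L2\<rbrakk> \<Longrightarrow> AE \<zeta> in \<mu>. toeplitz U (\<lambda>\<zeta>. f \<zeta> + g \<zeta>) \<zeta> = toeplitz U f \<zeta> + toeplitz U g \<zeta>"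
  unfolding toeplitz_def matrix_vector_right_distrib by (intro P_plus_add U_L2)

lemma toeplitz_scale:
  "f \<in> L2 \<Longrightarrow> AE \<zeta> in \<mu>. toeplitz U (\<lambda>\<zeta>. c *s f \<zeta>) \<zeta> = c *s toeplitz U f \<zeta>"
  unfolding toeplitz_def matrix_vector_scale by (intro P_plus_scale U_L2)

lemma toeplitz_hankel_norm:
  "f \<in> L2 \<Longrightarrow> (L2_norm f)\<^sup>2 = (L2_norm (toeplitz U f))\<^sup>2 + (L2_norm (hankel U f))\<^sup>2"
  using P_plus_minus_norm[OF U_L2] unitary_L2_norm[OF U_meas U_unitary]
  by (simp add: toeplitz_def hankel_def)

lemma toeplitz_norm_le: "f \<in> L2 \<Longrightarrow> L2_norm (toeplitz U f) \<le> L2_norm f"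
proof (rule power2_le_imp_le)
  assume "f \<in> L2"
  from toeplitz_hankel_norm[OF this] show "(L2_norm (toeplitz U f))\<^sup>2 \<le> (L2_norm f)\<^sup>2" by simp
qed simp

lemma hankel_scale:
  assumes f: "f \<in> L2" shows "AE \<zeta> in \<mu>. hankel U (\<lambda>\<zeta>. c *s f \<zeta>) \<zeta> = c *s hankel U f \<zeta>"
proof -
  have "AE \<zeta> in \<mu>. hankel U (\<lambda>\<zeta>. c *s f \<zeta>) \<zeta> = U \<zeta> *v (c *s f \<zeta>) - toeplitz U (\<lambda>\<zeta>. c *s f \<zeta>) \<zeta>"
    unfolding hankel_def toeplitz_def by (rule P_minus_eq[OF U_L2[OF L2_scale[OF f]]])
  moreover have "AE \<zeta> in \<mu>. hankel U f \<zeta> = U \<zeta> *v f \<zeta> - toeplitz U f \<zeta>"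
    unfolding hankel_def toeplitz_def by (rule P_minus_eq[OF U_L2[OF f]])
  ultimately show ?thesis
    using toeplitz_scale[OF f, of c] by eventually_elim (simp add: matrix_vector_scale vector_ssub_ldistrib)
qed

lemma hankel_Hlt: "f \<in> L2 \<Longrightarrow> hankel U f \<in> Hlt 0"
  unfolding hankel_def by (rule P_minus_spec(1)[OF U_L2])

text \<open>
  The operator norm is defined through the closed unit ball; the estimate is rescaled to vectors of
  arbitrary length.
\<close>

lemma hankel_compact_perturbation:
  assumes ess: "ess_norm H2 H2_minus (hankel U) < 1"
  obtains K q where "compact_op (H2 :: (complex \<Rightarrow> complex ^ 'r) set) H2_minus K" "0 \<le> q" "q < 1"
    "\<And>f. f \<in> H2 \<Longrightarrow> L2_norm (\<lambda>\<zeta>. hankel U f \<zeta> - K f \<zeta>) \<le> q * L2_norm f"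
proof -
  obtain K where K: "compact_op (H2 :: (complex \<Rightarrow> complex ^ 'r) set) H2_minus K"
    and lt: "L2_op_norm H2 (\<lambda>f \<zeta>. hankel U f \<zeta> - K f \<zeta>) < 1"
    using ess unfolding ess_norm_def INF_less_iff by auto
  obtain q where q: "L2_op_norm H2 (\<lambda>f \<zeta>. hankel U f \<zeta> - K f \<zeta>) < ereal q" "q < 1"
    using ereal_dense2[OF lt] by auto
  have unit: "L2_norm (\<lambda>\<zeta>. hankel U f \<zeta> - K f \<zeta>) \<le> q" if "f \<in> H2" "L2_norm f \<le> 1" for f
  proof -
    have "ereal (L2_norm (\<lambda>\<zeta>. hankel U f \<zeta> - K f \<zeta>)) \<le> L2_op_norm H2 (\<lambda>f \<zeta>. hankel U f \<zeta> - K f \<zeta>)"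
      unfolding L2_op_norm_def by (rule SUP_upper) (use that in auto)
    also have "\<dots> < ereal q" by (rule q)
    finally show ?thesis by simp
  qed
  have "(\<lambda>_. 0 :: complex ^ 'r) \<in> H2" unfolding H2_eq_Hge by (rule Hge_zero)
  from order_trans[OF L2_norm_nonneg unit[OF this]] have q0: "0 \<le> q" by simp
  have linK: "linear_op (H2 :: (complex \<Rightarrow> complex ^ 'r) set) H2_minus K" using K by (simp add: compact_op_def)
  have scaled: "L2_norm (\<lambda>\<zeta>. hankel U f \<zeta> - K f \<zeta>) \<le> q * t" if f: "f \<in> H2" and t: "0 < t" "L2_norm f \<le> t" for f t
  proof -
    let ?c = "complex_of_real t" let ?f = "\<lambda>\<zeta>. inverse ?c *s f \<zeta>"
    have fL: "f \<in> L2" using f by (simp add: H2_def)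
    have f': "?f \<in> H2" using f unfolding H2_eq_Hge by (rule Hge_scale)
    have fL': "?f \<in> L2" using f' by (simp add: H2_def)
    have c: "(\<lambda>\<zeta>. ?c *s ?f \<zeta>) = f" using t by (simp add: vector_smult_assoc)
    have "AE \<zeta> in \<mu>. K f \<zeta> = ?c *s K ?f \<zeta>"
      using linear_op_scale[OF linK f', of ?c] unfolding c .
    moreover have "AE \<zeta> in \<mu>. hankel U f \<zeta> = ?c *s hankel U ?f \<zeta>"
      using hankel_scale[OF fL', of ?c] unfolding c .
    ultimately have e: "AE \<zeta> in \<mu>. hankel U f \<zeta> - K f \<zeta> = ?c *s (hankel U ?f \<zeta> - K ?f \<zeta>)"
      by eventually_elim (simp add: vector_ssub_ldistrib)
    have [measurable]: "K g \<in> borel_measurable \<mu>" if "g \<in> H2" for g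
      using that linK by (auto simp: linear_op_def H2_minus_def)
    have [measurable]: "hankel U g \<in> borel_measurable \<mu>" if "g \<in> L2" for g
      by (rule L2_measurable[OF HltD(1)[OF hankel_Hlt[OF that]]])
    have "L2_norm (\<lambda>\<zeta>. hankel U f \<zeta> - K f \<zeta>) = L2_norm (\<lambda>\<zeta>. ?c *s (hankel U ?f \<zeta> - K ?f \<zeta>))"
      by (rule L2_norm_cong_AE) (use e f fL f' fL' in \<open>auto elim: eventually_mono\<close>)
    also have "\<dots> = t * L2_norm (\<lambda>\<zeta>. hankel U ?f \<zeta> - K ?f \<zeta>)"
      unfolding L2_norm_scale using t by simp
    also have "\<dots> \<le> t * q"
    proof (rule mult_left_mono[OF unit[OF f']])
      show "L2_norm ?f \<le> 1" 
      proof -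
        have "norm (inverse ?c) = inverse t" using t by (simp add: norm_inverse)
        moreover have "inverse t * L2_norm f \<le> inverse t * t" using t by (intro mult_left_mono) auto
        ultimately show ?thesis unfolding L2_norm_scale using t by simp
      qed
    qed (use t in simp)
    finally show ?thesis by (simp add: mult.commute)
  qed
  have "L2_norm (\<lambda>\<zeta>. hankel U f \<zeta> - K f \<zeta>) \<le> q * L2_norm f" if f: "f \<in> H2" for f
  proof (rule field_le_epsilon)
    fix e :: real assume e: "0 < e"
    have "L2_norm (\<lambda>\<zeta>. hankel U f \<zeta> - K f \<zeta>) \<le> q * (L2_norm f + e)"
      by (rule scaled[OF f]) (use e L2_norm_nonneg[of f] in \<open>auto intro: add_nonneg_pos\<close>)
    also have "\<dots> \<le> q * L2_norm f + e" using e q q0 mult_left_le_one_le[of e q] by (simp add: algebra_simps)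
    finally show "L2_norm (\<lambda>\<zeta>. hankel U f \<zeta> - K f \<zeta>) \<le> q * L2_norm f + e" .
  qed
  then show thesis by (rule that[OF K q0 q(2)])
qed

text \<open>
  The operator \<open>toeplitz U\<close> is proper on bounded sets: if \<open>K\<close> is compact and \<open>H - K\<close> has norm at most
  \<open>q < 1\<close>, then \<open>(1 - q) * L2_norm d\<close> is at most the sum of the norms of \<open>T d\<close> and \<open>K d\<close>, and both are small
  for the differences \<open>d\<close> of a subsequence.
\<close>

lemma toeplitz_proper:
  assumes ess: "ess_norm H2 H2_minus (hankel U) < 1"
    and f: "\<And>n::nat. f n \<in> Hge 0" and B: "\<And>n. L2_norm (f n) \<le> B"
    and g: "g \<in> L2" and lim: "(\<lambda>n. L2_norm (\<lambda>\<zeta>. toeplitz U (f n) \<zeta> - g \<zeta>)) \<longlonglongrightarrow> 0"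
  obtains \<rho> k where "strict_mono (\<rho> :: nat \<Rightarrow> nat)" "k \<in> Hge 0" "(\<lambda>n. L2_norm (\<lambda>\<zeta>. f (\<rho> n) \<zeta> - k \<zeta>)) \<longlonglongrightarrow> 0"
    "AE \<zeta> in \<mu>. toeplitz U k \<zeta> = g \<zeta>"
proof -
  obtain K q where K: "compact_op (H2 :: (complex \<Rightarrow> complex ^ 'r) set) H2_minus K" and q: "0 \<le> q" "q < 1"
    and near: "\<And>f. f \<in> H2 \<Longrightarrow> L2_norm (\<lambda>\<zeta>. hankel U f \<zeta> - K f \<zeta>) \<le> q * L2_norm f"
    using hankel_compact_perturbation[OF ess] by blast
  have linK: "linear_op (H2 :: (complex \<Rightarrow> complex ^ 'r) set) H2_minus K" using K by (simp add: compact_op_def)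
  have KL: "K h \<in> L2" if "h \<in> H2" for h
    using that linK by (auto simp: linear_op_def H2_minus_def)
  have fL: "f n \<in> L2" for n by (rule HgeD(1)[OF f])
  \<comment> \<open>Compactness is a statement about sequences in the unit ball, hence the factor.\<close>
  define c where "c = complex_of_real (\<bar>B\<bar> + 1)"
  have c0: "c \<noteq> 0" unfolding c_def of_real_eq_0_iff by simp
  have c1: "norm c = \<bar>B\<bar> + 1" unfolding c_def norm_of_real by simp
  define f' where "f' n \<zeta> = inverse c *s f n \<zeta>" for n \<zeta>
  have f'H: "f' n \<in> H2" for n unfolding H2_eq_Hge f'_def by (rule Hge_scale[OF f])
  have f'L: "f' n \<in> L2" for n using f'H by (simp add: H2_def)
  have "L2_norm (f' n) \<le> 1" for n
  proof -
    have "L2_norm (f' n) = L2_norm (f n) / (\<bar>B\<bar> + 1)"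
      unfolding f'_def L2_norm_scale norm_inverse c1 by (simp add: field_simps)
    also have "\<dots> \<le> 1" using B[of n] by (subst divide_le_eq_1_pos) auto
    finally show ?thesis .
  qed
  then obtain \<rho> w where \<rho>: "strict_mono (\<rho> :: nat \<Rightarrow> nat)" and w: "w \<in> H2_minus"
    and Kw: "(\<lambda>n. L2_norm (\<lambda>\<zeta>. K (f' (\<rho> n)) \<zeta> - w \<zeta>)) \<longlonglongrightarrow> 0"
    using K f'H unfolding compact_op_def by blast
  have wL: "w \<in> L2" using w by (simp add: H2_minus_def)
  have TL: "toeplitz U h \<in> L2" if "h \<in> L2" for h by (rule toeplitz_L2[OF that])
  let ?t = "\<lambda>n. L2_norm (\<lambda>\<zeta>. toeplitz U (f (\<rho> n)) \<zeta> - g \<zeta>)"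
  let ?w = "\<lambda>n. L2_norm (\<lambda>\<zeta>. K (f' (\<rho> n)) \<zeta> - w \<zeta>)"
  have t_lim: "?t \<longlonglongrightarrow> 0" using LIMSEQ_subseq_LIMSEQ[OF lim \<rho>] by (simp add: o_def)
  have main: "(1 - q) * L2_norm (\<lambda>\<zeta>. f (\<rho> m) \<zeta> - f (\<rho> n) \<zeta>) \<le> (?t m + ?t n) + (\<bar>B\<bar> + 1) * (?w m + ?w n)" for m n
  proof -
    define d where "d \<zeta> = f (\<rho> m) \<zeta> - f (\<rho> n) \<zeta>" for \<zeta>
    have dH: "d \<in> H2" unfolding H2_eq_Hge d_def by (intro Hge_diff f)
    have dL: "d \<in> L2" using dH by (simp add: H2_def)
    have "L2_norm (toeplitz U d) = L2_norm (\<lambda>\<zeta>. toeplitz U (f (\<rho> m)) \<zeta> - toeplitz U (f (\<rho> n)) \<zeta>)"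
    proof (rule L2_norm_cong_AE)
      show "AE \<zeta> in \<mu>. norm (toeplitz U d \<zeta>) = norm (toeplitz U (f (\<rho> m)) \<zeta> - toeplitz U (f (\<rho> n)) \<zeta>)"
        unfolding d_def using toeplitz_diff[OF fL fL, of "\<rho> m" "\<rho> n"] by eventually_elim simp
      show "toeplitz U d \<in> borel_measurable \<mu>" using TL[OF dL] by auto
      show "(\<lambda>\<zeta>. toeplitz U (f (\<rho> m)) \<zeta> - toeplitz U (f (\<rho> n)) \<zeta>) \<in> borel_measurable \<mu>"
        using L2_diff[OF TL[OF fL] TL[OF fL]] by auto
    qed
    also have "\<dots> \<le> ?t m + ?t n"
      using L2_norm_triangle_diff[OF TL[OF fL] g TL[OF fL], of "\<rho> m" "\<rho> n"]
      by (simp add: L2_norm_minus_commute[of g])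
    finally have 1: "L2_norm (toeplitz U d) \<le> ?t m + ?t n" .
    have "d = (\<lambda>\<zeta>. c *s (f' (\<rho> m) \<zeta> + (-1) *s f' (\<rho> n) \<zeta>))"
      using c0 by (simp add: d_def f'_def fun_eq_iff vec_eq_iff field_simps)
    moreover have m1: "(\<lambda>\<zeta>. (-1) *s f' (\<rho> n) \<zeta>) \<in> H2"
      using f'H unfolding H2_eq_Hge by (rule Hge_scale)
    moreover have m2: "(\<lambda>\<zeta>. f' (\<rho> m) \<zeta> + (-1) *s f' (\<rho> n) \<zeta>) \<in> H2"
      using f'H m1 unfolding H2_eq_Hge by (rule Hge_add)
    ultimately have Kd: "AE \<zeta> in \<mu>. K d \<zeta> = c *s K (\<lambda>\<zeta>. f' (\<rho> m) \<zeta> + (-1) *s f' (\<rho> n) \<zeta>) \<zeta>"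
      using linear_op_scale[OF linK m2, of c] by (simp only:)
    have "AE \<zeta> in \<mu>. K (\<lambda>\<zeta>. f' (\<rho> m) \<zeta> + (-1) *s f' (\<rho> n) \<zeta>) \<zeta> = K (f' (\<rho> m)) \<zeta> + K (\<lambda>\<zeta>. (-1) *s f' (\<rho> n) \<zeta>) \<zeta>"
      by (rule linear_op_add[OF linK f'H m1])
    moreover have "AE \<zeta> in \<mu>. K (\<lambda>\<zeta>. (-1) *s f' (\<rho> n) \<zeta>) \<zeta> = (-1) *s K (f' (\<rho> n)) \<zeta>"
      by (rule linear_op_scale[OF linK f'H])
    ultimately have Kd': "AE \<zeta> in \<mu>. K d \<zeta> = c *s (K (f' (\<rho> m)) \<zeta> - K (f' (\<rho> n)) \<zeta>)"
      using Kd by eventually_elim (simp add: vector_sneg_minus1[symmetric])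
    have "L2_norm (K d) = L2_norm (\<lambda>\<zeta>. c *s (K (f' (\<rho> m)) \<zeta> - K (f' (\<rho> n)) \<zeta>))"
    proof (rule L2_norm_cong_AE)
      show "AE \<zeta> in \<mu>. norm (K d \<zeta>) = norm (c *s (K (f' (\<rho> m)) \<zeta> - K (f' (\<rho> n)) \<zeta>))"
        using Kd' by eventually_elim simp
      show "K d \<in> borel_measurable \<mu>" using KL[OF dH] by auto
      show "(\<lambda>\<zeta>. c *s (K (f' (\<rho> m)) \<zeta> - K (f' (\<rho> n)) \<zeta>)) \<in> borel_measurable \<mu>"
        using L2_scale[OF L2_diff[OF KL[OF f'H] KL[OF f'H]]] by auto
    qed
    also have "\<dots> \<le> (\<bar>B\<bar> + 1) * (?w m + ?w n)"
      using L2_norm_triangle_diff[OF KL[OF f'H] wL KL[OF f'H], of "\<rho> m" "\<rho> n"]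
      unfolding L2_norm_scale c1 by (intro mult_left_mono) (auto simp: L2_norm_minus_commute[of w])
    finally have 2: "L2_norm (K d) \<le> (\<bar>B\<bar> + 1) * (?w m + ?w n)" .
    have HL: "hankel U d \<in> L2" by (rule HltD(1)[OF hankel_Hlt[OF dL]])
    have "L2_norm (hankel U d) \<le> L2_norm (K d) + q * L2_norm d"
      using L2_norm_le_add_diff[OF HL KL[OF dH]] near[OF dH] by simp
    moreover have "L2_norm d \<le> L2_norm (toeplitz U d) + L2_norm (hankel U d)"
      by (rule power2_le_imp_le) (use toeplitz_hankel_norm[OF dL] in \<open>auto simp: power2_sum\<close>)
    ultimately have "(1 - q) * L2_norm d \<le> L2_norm (toeplitz U d) + L2_norm (K d)"
      by (simp add: algebra_simps)
    then show ?thesis using 1 2 unfolding d_def[abs_def] by linarith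
  qed
  have "\<exists>k\<in>L2. (\<lambda>n. L2_norm (\<lambda>\<zeta>. f (\<rho> n) \<zeta> - k \<zeta>)) \<longlonglongrightarrow> 0"
  proof (rule L2_complete[OF fL])
    fix e :: real assume e: "0 < e"
    have "(\<lambda>n. ?t n + (\<bar>B\<bar> + 1) * ?w n) \<longlonglongrightarrow> 0 + (\<bar>B\<bar> + 1) * 0"
      by (intro tendsto_intros t_lim Kw)
    moreover have "0 < (1 - q) * e / 2" using e q by simp
    ultimately have "eventually (\<lambda>n. ?t n + (\<bar>B\<bar> + 1) * ?w n < (1 - q) * e / 2) sequentially"
      by (intro order_tendstoD(2)) auto
    then obtain N where N: "\<And>n. n \<ge> N \<Longrightarrow> ?t n + (\<bar>B\<bar> + 1) * ?w n < (1 - q) * e / 2"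
      by (auto simp: eventually_sequentially)
    show "\<exists>N. \<forall>m\<ge>N. \<forall>n\<ge>N. L2_norm (\<lambda>\<zeta>. f (\<rho> m) \<zeta> - f (\<rho> n) \<zeta>) < e"
    proof (intro exI[of _ N] allI impI)
      fix m n assume "m \<ge> N" "n \<ge> N"
      then have "(1 - q) * L2_norm (\<lambda>\<zeta>. f (\<rho> m) \<zeta> - f (\<rho> n) \<zeta>) < (1 - q) * e"
        using main[of m n] N[of m] N[of n] by (simp add: distrib_left)
      then show "L2_norm (\<lambda>\<zeta>. f (\<rho> m) \<zeta> - f (\<rho> n) \<zeta>) < e" using q by simp
    qed
  qed
  then obtain k where kL: "k \<in> L2" and k: "(\<lambda>n. L2_norm (\<lambda>\<zeta>. f (\<rho> n) \<zeta> - k \<zeta>)) \<longlonglongrightarrow> 0" by blast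
  have kH: "k \<in> Hge 0" by (rule Hge_closed[OF f kL k])
  have "L2_norm (\<lambda>\<zeta>. toeplitz U k \<zeta> - g \<zeta>) \<le> L2_norm (\<lambda>\<zeta>. f (\<rho> n) \<zeta> - k \<zeta>) + ?t n" for n
  proof -
    have "L2_norm (\<lambda>\<zeta>. toeplitz U k \<zeta> - toeplitz U (f (\<rho> n)) \<zeta>) = L2_norm (toeplitz U (\<lambda>\<zeta>. k \<zeta> - f (\<rho> n) \<zeta>))"
    proof (rule L2_norm_cong_AE)
      show "AE \<zeta> in \<mu>. norm (toeplitz U k \<zeta> - toeplitz U (f (\<rho> n)) \<zeta>) = norm (toeplitz U (\<lambda>\<zeta>. k \<zeta> - f (\<rho> n) \<zeta>) \<zeta>)"
        using toeplitz_diff[OF kL fL, of "\<rho> n"] by eventually_elim simp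
      show "(\<lambda>\<zeta>. toeplitz U k \<zeta> - toeplitz U (f (\<rho> n)) \<zeta>) \<in> borel_measurable \<mu>"
        using L2_diff[OF TL[OF kL] TL[OF fL]] by auto
      show "toeplitz U (\<lambda>\<zeta>. k \<zeta> - f (\<rho> n) \<zeta>) \<in> borel_measurable \<mu>" using TL[OF L2_diff[OF kL fL]] by auto
    qed
    also have "\<dots> \<le> L2_norm (\<lambda>\<zeta>. f (\<rho> n) \<zeta> - k \<zeta>)"
      using toeplitz_norm_le[OF L2_diff[OF kL fL], of "\<rho> n"] by (simp add: L2_norm_minus_commute[of k])
    finally show ?thesis using L2_norm_triangle_diff[OF TL[OF kL] TL[OF fL] g, of "\<rho> n"] by simp
  qed
  moreover have "(\<lambda>n. L2_norm (\<lambda>\<zeta>. f (\<rho> n) \<zeta> - k \<zeta>) + ?t n) \<longlonglongrightarrow> 0"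
    using tendsto_add[OF k t_lim] by simp
  ultimately have "L2_norm (\<lambda>\<zeta>. toeplitz U k \<zeta> - g \<zeta>) \<le> 0" by (intro LIMSEQ_le_const) auto
  then have "L2_norm (\<lambda>\<zeta>. toeplitz U k \<zeta> - g \<zeta>) = 0" using L2_norm_nonneg by (intro antisym)
  then have "AE \<zeta> in \<mu>. toeplitz U k \<zeta> = g \<zeta>"
    using L2_norm_eq_0[OF L2_diff[OF TL[OF kL] g]] by simp
  then show thesis by (rule that[OF \<rho> kH k])
qed

text \<open>
  Hence it is bounded below modulo its kernel, on every closed subspace \<open>Hge N\<close> of \<open>H2\<close>: otherwise unit
  vectors orthogonal to the kernel would have images tending to zero, and a limit of a subsequence would be
  a unit vector that belongs to the kernel and is orthogonal to it.
\<close>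

lemma toeplitz_bounded_below:
  assumes ess: "ess_norm H2 H2_minus (hankel U) < 1" and N: "0 \<le> N"
  obtains C where "0 < C" "\<And>k. k \<in> Hge N \<Longrightarrow> \<exists>e\<in>Hge N. (AE \<zeta> in \<mu>. toeplitz U e \<zeta> = 0) \<and>
     L2_norm (\<lambda>\<zeta>. k \<zeta> - e \<zeta>) \<le> C * L2_norm (toeplitz U k)"
proof -
  define Ker where "Ker = {e \<in> Hge N. AE \<zeta> in \<mu>. toeplitz U e \<zeta> = 0}"
  have Ker_L2: "Ker \<subseteq> L2" using HgeD(1) by (auto simp: Ker_def)
  have "AE \<zeta> in \<mu>. toeplitz U (\<lambda>_. 0) \<zeta> = 0"
    using toeplitz_scale[of "\<lambda>_. 0" 0] by simp
  then have Ker0: "(\<lambda>_. 0) \<in> Ker" by (simp add: Ker_def)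
  have Ker_add: "(\<lambda>\<zeta>. x \<zeta> + y \<zeta>) \<in> Ker" if "x \<in> Ker" "y \<in> Ker" for x y
  proof -
    have "AE \<zeta> in \<mu>. toeplitz U x \<zeta> = 0" "AE \<zeta> in \<mu>. toeplitz U y \<zeta> = 0" "x \<in> L2" "y \<in> L2"
      using that Ker_L2 by (auto simp: Ker_def)
    then have "AE \<zeta> in \<mu>. toeplitz U (\<lambda>\<zeta>. x \<zeta> + y \<zeta>) \<zeta> = 0"
      using toeplitz_add[of x y] by (auto elim!: eventually_elim2[OF eventually_conj])
    then show ?thesis using that Hge_add by (auto simp: Ker_def)
  qed
  have Ker_scale: "(\<lambda>\<zeta>. c *s x \<zeta>) \<in> Ker" if "x \<in> Ker" for c x
  proof -
    have "AE \<zeta> in \<mu>. toeplitz U x \<zeta> = 0" "x \<in> L2" using that Ker_L2 by (auto simp: Ker_def)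
    then have "AE \<zeta> in \<mu>. toeplitz U (\<lambda>\<zeta>. c *s x \<zeta>) \<zeta> = 0"
      using toeplitz_scale[of x c] by (auto elim!: eventually_elim2)
    then show ?thesis using that Hge_scale by (auto simp: Ker_def)
  qed
  have Ker_closed: "g \<in> Ker" if s: "\<And>n. s n \<in> Ker" and g: "g \<in> L2" and lim: "(\<lambda>n. L2_norm (\<lambda>\<zeta>. s n \<zeta> - g \<zeta>)) \<longlonglongrightarrow> 0" for s g
  proof -
    have sH: "s n \<in> Hge N" for n using s by (simp add: Ker_def)
    have sL: "s n \<in> L2" for n by (rule HgeD(1)[OF sH])
    have "L2_norm (toeplitz U g) \<le> L2_norm (\<lambda>\<zeta>. s n \<zeta> - g \<zeta>)" for n
    proof -
      have s0: "AE \<zeta> in \<mu>. toeplitz U (s n) \<zeta> = 0" using s[of n] by (simp add: Ker_def)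
      have "L2_norm (toeplitz U g) = L2_norm (toeplitz U (\<lambda>\<zeta>. s n \<zeta> - g \<zeta>))"
      proof (rule L2_norm_cong_AE)
        show "AE \<zeta> in \<mu>. norm (toeplitz U g \<zeta>) = norm (toeplitz U (\<lambda>\<zeta>. s n \<zeta> - g \<zeta>) \<zeta>)"
          using toeplitz_diff[OF sL g, of n] s0 by eventually_elim simp
        show "toeplitz U g \<in> borel_measurable \<mu>" using toeplitz_L2[OF g] by auto
        show "toeplitz U (\<lambda>\<zeta>. s n \<zeta> - g \<zeta>) \<in> borel_measurable \<mu>" using toeplitz_L2[OF L2_diff[OF sL g]] by auto
      qed
      also have "\<dots> \<le> L2_norm (\<lambda>\<zeta>. s n \<zeta> - g \<zeta>)" by (rule toeplitz_norm_le[OF L2_diff[OF sL g]])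
      finally show ?thesis .
    qed
    then have "L2_norm (toeplitz U g) \<le> 0" using lim by (intro LIMSEQ_le_const) auto
    then have "L2_norm (toeplitz U g) = 0" using L2_norm_nonneg by (intro antisym)
    then show ?thesis using Hge_closed[OF sH g lim] L2_norm_eq_0[OF toeplitz_L2[OF g]] by (simp add: Ker_def)
  qed
  have "\<exists>C>0. \<forall>u\<in>Hge N. (\<forall>e\<in>Ker. L2_inner u e = 0) \<longrightarrow> L2_norm u \<le> C * L2_norm (toeplitz U u)"
  proof (rule ccontr)
    assume "\<not> ?thesis"
    then have "\<exists>u. u \<in> Hge N \<and> (\<forall>e\<in>Ker. L2_inner u e = 0) \<and> real (Suc n) * L2_norm (toeplitz U u) < L2_norm u" for n
      by (metis not_le of_nat_0_less_iff zero_less_Suc)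
    from choice[OF allI[OF this]] obtain u where "\<forall>n. u n \<in> Hge N \<and> (\<forall>e\<in>Ker. L2_inner (u n) e = 0) \<and>
        real (Suc n) * L2_norm (toeplitz U (u n)) < L2_norm (u n)" ..
    then have u: "\<And>n::nat. u n \<in> Hge N" "\<And>n e. e \<in> Ker \<Longrightarrow> L2_inner (u n) e = 0"
      "\<And>n. real (Suc n) * L2_norm (toeplitz U (u n)) < L2_norm (u n)" by blast+
    have uL: "u n \<in> L2" for n by (rule HgeD(1)[OF u(1)])
    have pos: "0 < L2_norm (u n)" for n
      using u(3)[of n] by (meson L2_norm_nonneg le_less_trans mult_nonneg_nonneg of_nat_0_le_iff)
    define v where "v n \<zeta> = complex_of_real (inverse (L2_norm (u n))) *s u n \<zeta>" for n \<zeta>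
    have vH: "v n \<in> Hge N" for n unfolding v_def by (rule Hge_scale[OF u(1)])
    have vL: "v n \<in> L2" for n by (rule HgeD(1)[OF vH])
    have v1: "L2_norm (v n) = 1" for n
      unfolding v_def L2_norm_scale norm_of_real using pos[of n] by simp
    have Tv: "L2_norm (toeplitz U (v n)) \<le> 1 / real (Suc n)" for n
    proof -
      have "L2_norm (toeplitz U (v n)) = L2_norm (\<lambda>\<zeta>. complex_of_real (inverse (L2_norm (u n))) *s toeplitz U (u n) \<zeta>)"
      proof (rule L2_norm_cong_AE)
        show "AE \<zeta> in \<mu>. norm (toeplitz U (v n) \<zeta>) = norm (complex_of_real (inverse (L2_norm (u n))) *s toeplitz U (u n) \<zeta>)"
          unfolding v_def using toeplitz_scale[OF uL, of "complex_of_real (inverse (L2_norm (u n)))" n] by eventually_elim simp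
        show "toeplitz U (v n) \<in> borel_measurable \<mu>" using toeplitz_L2[OF vL] by auto
        show "(\<lambda>\<zeta>. complex_of_real (inverse (L2_norm (u n))) *s toeplitz U (u n) \<zeta>) \<in> borel_measurable \<mu>"
          using L2_scale[OF toeplitz_L2[OF uL]] by auto
      qed
      also have "\<dots> = L2_norm (toeplitz U (u n)) / L2_norm (u n)"
        unfolding L2_norm_scale norm_of_real using pos[of n] by (simp add: divide_inverse mult.commute)
      also have "\<dots> \<le> 1 / real (Suc n)"
        using u(3)[of n] pos[of n] by (simp add: field_simps del: of_nat_Suc)
      finally show ?thesis .
    qed
    have lim: "(\<lambda>n. L2_norm (\<lambda>\<zeta>. toeplitz U (v n) \<zeta> - 0)) \<longlonglongrightarrow> 0"
      by (rule Lim_null_comparison[OF _ LIMSEQ_Suc[OF lim_1_over_n]]) (use Tv in simp)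
    have v0: "v n \<in> Hge 0" for n by (rule Hge_mono[OF N vH])
    obtain \<rho> k where k: "k \<in> Hge 0" "(\<lambda>n. L2_norm (\<lambda>\<zeta>. v (\<rho> n) \<zeta> - k \<zeta>)) \<longlonglongrightarrow> 0" "AE \<zeta> in \<mu>. toeplitz U k \<zeta> = 0"
      by (rule toeplitz_proper[OF ess v0 _ L2_const lim, of 1]) (use v1 in auto)
    have kL: "k \<in> L2" by (rule HgeD(1)[OF k(1)])
    have "k \<in> Hge N" by (rule Hge_closed[OF vH kL k(2)])
    then have kK: "k \<in> Ker" using k(3) by (simp add: Ker_def)
    have "(\<lambda>n. L2_inner (v (\<rho> n)) k) \<longlonglongrightarrow> L2_inner k k" by (rule L2_inner_tendsto[OF vL kL kL k(2)])
    moreover have "L2_inner (v n) k = 0" for n unfolding v_def L2_inner_scale_left using u(2)[OF kK] by simp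
    ultimately have "L2_inner k k = 0" by (simp add: LIMSEQ_const_iff)
    then have "L2_norm k = 0" by (simp add: L2_inner_self)
    moreover have "1 \<le> L2_norm k + L2_norm (\<lambda>\<zeta>. v (\<rho> n) \<zeta> - k \<zeta>)" for n
      using L2_norm_le_add_diff[OF vL kL, of "\<rho> n"] v1 by simp
    ultimately have "(1::real) \<le> 0" using k(2) by (intro LIMSEQ_le_const[OF k(2)]) auto
    then show False by simp
  qed
  then obtain C where C: "0 < C" "\<And>u. u \<in> Hge N \<Longrightarrow> (\<And>e. e \<in> Ker \<Longrightarrow> L2_inner u e = 0) \<Longrightarrow> L2_norm u \<le> C * L2_norm (toeplitz U u)"
    by blast
  show thesis
  proof (rule that[OF C(1)])
    fix k :: "complex \<Rightarrow> complex ^ 'r" assume k: "k \<in> Hge N"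
    have kL: "k \<in> L2" by (rule HgeD(1)[OF k])
    obtain e s where e: "e \<in> L2" and s: "\<And>n. s n \<in> Ker" "(\<lambda>n. L2_norm (\<lambda>\<zeta>. s n \<zeta> - e \<zeta>)) \<longlonglongrightarrow> 0"
      and o: "\<And>h. h \<in> Ker \<Longrightarrow> L2_inner (\<lambda>\<zeta>. k \<zeta> - e \<zeta>) h = 0"
      using L2_projection[OF Ker_L2 _ Ker_add Ker_scale kL] Ker0 by blast
    have "e \<in> Ker" by (rule Ker_closed[OF s(1) e s(2)])
    then have eH: "e \<in> Hge N" and e0: "AE \<zeta> in \<mu>. toeplitz U e \<zeta> = 0" by (auto simp: Ker_def)
    have "L2_norm (\<lambda>\<zeta>. k \<zeta> - e \<zeta>) \<le> C * L2_norm (toeplitz U (\<lambda>\<zeta>. k \<zeta> - e \<zeta>))"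
      by (rule C(2)[OF Hge_diff[OF k eH] o])
    also have "L2_norm (toeplitz U (\<lambda>\<zeta>. k \<zeta> - e \<zeta>)) = L2_norm (toeplitz U k)"
    proof (rule L2_norm_cong_AE)
      show "AE \<zeta> in \<mu>. norm (toeplitz U (\<lambda>\<zeta>. k \<zeta> - e \<zeta>) \<zeta>) = norm (toeplitz U k \<zeta>)"
        using toeplitz_diff[OF kL e] e0 by eventually_elim simp
      show "toeplitz U (\<lambda>\<zeta>. k \<zeta> - e \<zeta>) \<in> borel_measurable \<mu>" using toeplitz_L2[OF L2_diff[OF kL e]] by auto
      show "toeplitz U k \<in> borel_measurable \<mu>" using toeplitz_L2[OF kL] by auto
    qed
    finally show "\<exists>e\<in>Hge N. (AE \<zeta> in \<mu>. toeplitz U e \<zeta> = 0) \<and> L2_norm (\<lambda>\<zeta>. k \<zeta> - e \<zeta>) \<le> C * L2_norm (toeplitz U k)"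
      using eH e0 by blast
  qed
qed

text \<open>
  Approximate preimages of \<open>g\<close> in \<open>z H2\<close> can be corrected by kernel elements so that they stay bounded, and
  then a subsequence converges to an exact preimage.
\<close>

lemma dense_range_imp_surj:
  assumes ess: "ess_norm H2 H2_minus (hankel U) < 1"
    and dense: "dense_range H2 H2 (toeplitz (\<lambda>\<zeta>. map_matrix ((*) \<zeta>) (U \<zeta>)))" and g: "g \<in> Hge 0"
  shows "\<exists>k\<in>Hge 1. AE \<zeta> in \<mu>. toeplitz U k \<zeta> = g \<zeta>"
proof -
  have gL: "g \<in> L2" by (rule HgeD(1)[OF g])
  obtain C where C: "0 < C" "\<And>k. k \<in> Hge 1 \<Longrightarrow> \<exists>e\<in>Hge 1. (AE \<zeta> in \<mu>. toeplitz U e \<zeta> = 0) \<and>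
     L2_norm (\<lambda>\<zeta>. k \<zeta> - e \<zeta>) \<le> C * L2_norm (toeplitz U k)"
    using toeplitz_bounded_below[OF ess, of 1] by auto
  have "\<exists>u. u \<in> Hge 1 \<and> L2_norm (\<lambda>\<zeta>. toeplitz U u \<zeta> - g \<zeta>) < 1 / real (Suc n) \<and> L2_norm u \<le> C * (L2_norm g + 1)" for n
  proof -
    obtain f where f: "f \<in> H2" "L2_norm (\<lambda>\<zeta>. toeplitz U (\<lambda>\<zeta>. \<zeta> *s f \<zeta>) \<zeta> - g \<zeta>) < 1 / real (Suc n)"
      using dense[unfolded dense_range_def toeplitz_zU, rule_format, of g "1 / real (Suc n)"] g
      by (auto simp: H2_eq_Hge simp del: of_nat_Suc)
    define k where "k \<zeta> = \<zeta> *s f \<zeta>" for \<zeta>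
    have k: "k \<in> Hge 1" unfolding k_def using Hge_shift[of f 0 1] f(1) by (simp add: H2_eq_Hge)
    have kL: "k \<in> L2" by (rule HgeD(1)[OF k])
    have fk: "L2_norm (\<lambda>\<zeta>. toeplitz U k \<zeta> - g \<zeta>) < 1 / real (Suc n)" using f(2) unfolding k_def .
    obtain e where e: "e \<in> Hge 1" "AE \<zeta> in \<mu>. toeplitz U e \<zeta> = 0" "L2_norm (\<lambda>\<zeta>. k \<zeta> - e \<zeta>) \<le> C * L2_norm (toeplitz U k)"
      using C(2)[OF k] by blast
    have eL: "e \<in> L2" by (rule HgeD(1)[OF e(1)])
    have "L2_norm (\<lambda>\<zeta>. toeplitz U (\<lambda>\<zeta>. k \<zeta> - e \<zeta>) \<zeta> - g \<zeta>) = L2_norm (\<lambda>\<zeta>. toeplitz U k \<zeta> - g \<zeta>)"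
    proof (rule L2_norm_cong_AE)
      show "AE \<zeta> in \<mu>. norm (toeplitz U (\<lambda>\<zeta>. k \<zeta> - e \<zeta>) \<zeta> - g \<zeta>) = norm (toeplitz U k \<zeta> - g \<zeta>)"
        using toeplitz_diff[OF kL eL] e(2) by eventually_elim simp
      show "(\<lambda>\<zeta>. toeplitz U (\<lambda>\<zeta>. k \<zeta> - e \<zeta>) \<zeta> - g \<zeta>) \<in> borel_measurable \<mu>"
        using L2_diff[OF toeplitz_L2[OF L2_diff[OF kL eL]] gL] by auto
      show "(\<lambda>\<zeta>. toeplitz U k \<zeta> - g \<zeta>) \<in> borel_measurable \<mu>"
        using L2_diff[OF toeplitz_L2[OF kL] gL] by auto
    qed
    moreover have "L2_norm (toeplitz U k) \<le> L2_norm g + 1"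
    proof -
      have "1 / real (Suc n) \<le> 1" by simp
      then show ?thesis using L2_norm_le_add_diff[OF toeplitz_L2[OF kL] gL] fk by linarith
    qed
    then have "C * L2_norm (toeplitz U k) \<le> C * (L2_norm g + 1)" using C(1) by (intro mult_left_mono) auto
    ultimately show ?thesis using Hge_diff[OF k e(1)] e(3) fk by (intro exI[of _ "\<lambda>\<zeta>. k \<zeta> - e \<zeta>"]) auto
  qed
  from choice[OF allI[OF this]] obtain u where
    uu: "\<forall>n. u n \<in> Hge 1 \<and> L2_norm (\<lambda>\<zeta>. toeplitz U (u n) \<zeta> - g \<zeta>) < 1 / real (Suc n) \<and> L2_norm (u n) \<le> C * (L2_norm g + 1)" ..
  have u: "u n \<in> Hge 1" "L2_norm (\<lambda>\<zeta>. toeplitz U (u n) \<zeta> - g \<zeta>) < 1 / real (Suc n)"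
    "L2_norm (u n) \<le> C * (L2_norm g + 1)" for n :: nat using uu by (simp_all only:)
  have lim: "(\<lambda>n. L2_norm (\<lambda>\<zeta>. toeplitz U (u n) \<zeta> - g \<zeta>)) \<longlonglongrightarrow> 0"
    by (rule Lim_null_comparison[OF _ LIMSEQ_Suc[OF lim_1_over_n]])
       (rule always_eventually, rule allI, use u(2) in \<open>simp add: less_imp_le del: of_nat_Suc\<close>)
  have u0: "u n \<in> Hge 0" for n by (rule Hge_mono[OF _ u(1)]) simp
  obtain \<rho> k where k: "k \<in> Hge 0" "(\<lambda>n. L2_norm (\<lambda>\<zeta>. u (\<rho> n) \<zeta> - k \<zeta>)) \<longlonglongrightarrow> 0" "AE \<zeta> in \<mu>. toeplitz U k \<zeta> = g \<zeta>"
    by (rule toeplitz_proper[OF ess u0 u(3) gL lim]) auto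
  have "k \<in> Hge 1" by (rule Hge_closed[OF u(1) HgeD(1)[OF k(1)] k(2)])
  with k(3) show ?thesis by blast
qed

end

section \<open>Weighted Nehari theorem\<close>

lemma Linf_const [simp]: "(\<lambda>\<zeta>. A) \<in> Linf"
  by (rule LinfI[where C="op_norm A"]) (auto intro: op_norm_bound)

lemma norm_axis_complex: "norm (axis i 1 :: complex ^ 'r) = 1"
proof -
  have "of_real ((norm (axis i 1 :: complex ^ 'r))\<^sup>2) = (1::complex)"
    unfolding cdot_self[symmetric] cdot_axis by (simp add: axis_def)
  then have "(norm (axis i 1 :: complex ^ 'r))\<^sup>2 = 1" by (metis of_real_eq_1_iff)
  then show ?thesis by (simp add: power2_eq_1_iff)
qed

lemma fourier_coeff_const_matrix:
  fixes A :: "complex ^ 'r ^ 'r"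
  assumes f: "f \<in> L2" shows "fourier_coeff (\<lambda>\<zeta>. A *v f \<zeta>) n = A *v fourier_coeff f n"
proof -
  have L: "(\<lambda>\<zeta>. A *v f \<zeta>) \<in> L2" by (rule Linf_mult_L2[OF Linf_const f])
  have "cdot (fourier_coeff (\<lambda>\<zeta>. A *v f \<zeta>) n) x = cdot (A *v fourier_coeff f n) x" for x
    unfolding fourier_coeff_inner[OF L] cdot_adjoint fourier_coeff_inner[OF f] L2_inner_cdot
    by (simp add: cdot_adjoint matrix_vector_scale)
  from this[of "axis _ 1"] show ?thesis by (simp add: cdot_axis vec_eq_iff)
qed

lemma Hge_const_matrix:
  fixes A :: "complex ^ 'r ^ 'r"
  shows "f \<in> Hge N \<Longrightarrow> (\<lambda>\<zeta>. A *v f \<zeta>) \<in> Hge N"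
  by (auto simp: Hge_def fourier_coeff_const_matrix intro: Linf_mult_L2[OF Linf_const])

lemma cdot_expand_right: "cdot x s = (\<Sum>i\<in>UNIV. cnj (s $ i) * cdot x (axis i 1))"
  unfolding cdot_axis by (simp add: cdot_def mult.commute)

lemma L2_inner_expand_right:
  assumes "f \<in> L2" shows "L2_inner f (\<lambda>_. s) = (\<Sum>i\<in>UNIV. cnj (s $ i) * L2_inner f (\<lambda>_. axis i 1))"
  unfolding L2_inner_cdot cdot_expand_right[of _ s]
  by (subst Bochner_Integration.integral_sum) (auto intro!: integrable_cdot assms)

lemma L2_inner_expand_matrix:
  assumes V: "V \<in> Linf" and l: "l \<in> L2"
  shows "L2_inner (\<lambda>\<zeta>. V \<zeta> *v s) l = (\<Sum>i\<in>UNIV. s $ i * L2_inner (\<lambda>\<zeta>. V \<zeta> *v axis i 1) l)"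
proof -
  have "(\<lambda>\<zeta>. V \<zeta> *v s) = (\<lambda>\<zeta>. \<Sum>i\<in>UNIV. s $ i *s (V \<zeta> *v axis i 1))"
  proof
    fix \<zeta>
    have "V \<zeta> *v s = V \<zeta> *v (\<Sum>i\<in>UNIV. s $ i *s axis i 1)" by (simp only: basis_expansion)
    also have "\<dots> = (\<Sum>i\<in>UNIV. V \<zeta> *v (s $ i *s axis i 1))"
      by (rule linear_sum[OF bounded_linear.linear[OF bounded_linear_matrix]])
    finally show "V \<zeta> *v s = (\<Sum>i\<in>UNIV. s $ i *s (V \<zeta> *v axis i 1))" by (simp only: matrix_vector_scale)
  qed
  then show ?thesis
    using L2_inner_sum_left[of UNIV "\<lambda>i \<zeta>. s $ i *s (V \<zeta> *v axis i 1)" l]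
    by (simp add: L2_scale Linf_mult_L2[OF V] l L2_inner_scale_left)
qed

text \<open>
  Positivity of the form that expresses the estimate
  \<open>norm (P_minus (V k))\<^sup>2 \<le> \<langle>\<Lambda> k, k\<rangle>\<close> for \<open>k\<close> in the Hardy space. The pair \<open>(k, l)\<close> has the square norm
  \<open>\<langle>\<Lambda> k, k\<rangle> + \<langle>l, l\<rangle> + 2 Re \<langle>V k, l\<rangle>\<close>.
\<close>

definition hankel_dominated :: "(complex \<Rightarrow> complex ^ 'r ^ 'r) \<Rightarrow> (complex \<Rightarrow> complex ^ 'r ^ 'r) \<Rightarrow> bool" where
  "hankel_dominated \<Lambda> V \<longleftrightarrow> (\<forall>k\<in>Hge 0. \<forall>l\<in>Hlt 0.
     0 \<le> Re (L2_inner (\<lambda>\<zeta>. \<Lambda> \<zeta> *v k \<zeta>) k) + (L2_norm l)\<^sup>2 + 2 * Re (L2_inner (\<lambda>\<zeta>. V \<zeta> *v k \<zeta>) l))"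

lemma L2_inner_const: "L2_inner (\<lambda>_. x) (\<lambda>_. y) = cdot x y"
  unfolding L2_inner_cdot using circle.prob_space by simp

text \<open>
  The one-step extension: a constant matrix \<open>C\<close> can be chosen as the zeroth Fourier coefficient of the
  approximant so that the estimate survives a shift. The missing entries of \<open>V - C\<close> are provided by the
  completion lemma.
\<close>

lemma hankel_dominated_step:
  assumes \<Lambda>: "\<Lambda> \<in> Linf" and sa: "AE \<zeta> in \<mu>. adjoint_matrix (\<Lambda> \<zeta>) = \<Lambda> \<zeta>" and V: "V \<in> Linf"
    and pos: "hankel_dominated \<Lambda> V"
  shows "\<exists>C. hankel_dominated \<Lambda> (\<lambda>\<zeta>. map_matrix ((*) (cnj \<zeta>)) (V \<zeta> - C))"
proof -
  define LL where "LL k = (\<lambda>\<zeta>. \<Lambda> \<zeta> *v k \<zeta>)" for k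
  define VV where "VV k = (\<lambda>\<zeta>. V \<zeta> *v k \<zeta>)" for k
  have LL_L2: "LL k \<in> L2" if "k \<in> L2" for k unfolding LL_def by (rule Linf_mult_L2[OF \<Lambda> that])
  have VV_L2: "VV k \<in> L2" if "k \<in> L2" for k unfolding VV_def by (rule Linf_mult_L2[OF V that])
  have LL_add: "LL (\<lambda>\<zeta>. k \<zeta> + k' \<zeta>) = (\<lambda>\<zeta>. LL k \<zeta> + LL k' \<zeta>)" for k k' by (simp add: LL_def matrix_vector_right_distrib)
  have VV_add: "VV (\<lambda>\<zeta>. k \<zeta> + k' \<zeta>) = (\<lambda>\<zeta>. VV k \<zeta> + VV k' \<zeta>)" for k k' by (simp add: VV_def matrix_vector_right_distrib)
  have LL_scale: "LL (\<lambda>\<zeta>. c *s k \<zeta>) = (\<lambda>\<zeta>. c *s LL k \<zeta>)" for k c by (simp add: LL_def matrix_vector_scale)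
  have VV_scale: "VV (\<lambda>\<zeta>. c *s k \<zeta>) = (\<lambda>\<zeta>. c *s VV k \<zeta>)" for k c by (simp add: VV_def matrix_vector_scale)
  have LL_sym: "L2_inner (LL k) k' = cnj (L2_inner (LL k') k)" if k: "k \<in> L2" "k' \<in> L2" for k k'
  proof -
    have "L2_inner (LL k) k' = (LINT \<zeta>|\<mu>. cdot (k \<zeta>) (adjoint_matrix (\<Lambda> \<zeta>) *v k' \<zeta>))"
      unfolding L2_inner_cdot LL_def cdot_adjoint ..
    also have "\<dots> = (LINT \<zeta>|\<mu>. cdot (k \<zeta>) (\<Lambda> \<zeta> *v k' \<zeta>))"
    proof (rule integral_cong_AE)
      have [measurable]: "\<Lambda> \<in> borel_measurable \<mu>" "k \<in> borel_measurable \<mu>" "k' \<in> borel_measurable \<mu>"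
        using LinfD(1)[OF \<Lambda>] k by auto
      show "(\<lambda>\<zeta>. cdot (k \<zeta>) (adjoint_matrix (\<Lambda> \<zeta>) *v k' \<zeta>)) \<in> borel_measurable \<mu>" by measurable
      show "(\<lambda>\<zeta>. cdot (k \<zeta>) (\<Lambda> \<zeta> *v k' \<zeta>)) \<in> borel_measurable \<mu>" by measurable
      show "AE \<zeta> in \<mu>. cdot (k \<zeta>) (adjoint_matrix (\<Lambda> \<zeta>) *v k' \<zeta>) = cdot (k \<zeta>) (\<Lambda> \<zeta> *v k' \<zeta>)"
        using sa by eventually_elim simp
    qed
    also have "\<dots> = L2_inner k (LL k')" unfolding L2_inner_cdot LL_def ..
    finally show ?thesis by (simp add: L2_inner_cnj)
  qed
  have P: "0 \<le> Re (L2_inner (LL k) k) + (L2_norm l)\<^sup>2 + 2 * Re (L2_inner (VV k) l)" if "k \<in> Hge 0" "l \<in> Hlt 0" for k l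
    using pos that unfolding hankel_dominated_def LL_def VV_def by blast
  \<comment> \<open>The given part of the form: \<open>k\<close> without constant term and \<open>l\<close> in \<open>Hlt 0\<close>. The new vectors are the
      constants \<open>s\<close> in the first and \<open>t\<close> in the second component. Adjoining only \<open>s\<close> is the hypothesis,
      adjoining only \<open>t\<close> is the hypothesis after division by \<open>\<zeta>\<close>.\<close>
  define S where "S = (Hge 1 :: (complex \<Rightarrow> complex ^ 'a) set) \<times> (Hlt 0 :: (complex \<Rightarrow> complex ^ 'a) set)"
  define B where "B p q = L2_inner (LL (fst p)) (fst q) + L2_inner (snd p) (snd q)
      + L2_inner (VV (fst p)) (snd q) + cnj (L2_inner (VV (fst q)) (snd p))" for p q
  define ad where "ad p q = (\<lambda>\<zeta>. fst p \<zeta> + fst q \<zeta> :: complex ^ 'a, \<lambda>\<zeta>. snd p \<zeta> + snd q \<zeta> :: complex ^ 'a)"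
    for p q :: "(complex \<Rightarrow> complex ^ 'a) \<times> (complex \<Rightarrow> complex ^ 'a)"
  define sc where "sc c p = (\<lambda>\<zeta>. c *s fst p \<zeta> :: complex ^ 'a, \<lambda>\<zeta>. c *s snd p \<zeta> :: complex ^ 'a)"
    for c and p :: "(complex \<Rightarrow> complex ^ 'a) \<times> (complex \<Rightarrow> complex ^ 'a)"
  have SD: "fst p \<in> Hge 1" "snd p \<in> Hlt 0" "fst p \<in> L2" "snd p \<in> L2" if "p \<in> S" for p
    using that HgeD(1) HltD(1) by (auto simp: S_def)
  have H10: "k \<in> Hge 0" if "k \<in> Hge 1" for k :: "complex \<Rightarrow> complex ^ 'a" by (rule Hge_mono[OF _ that]) simp
  have B_self: "Re (B p p) = Re (L2_inner (LL (fst p)) (fst p)) + (L2_norm (snd p))\<^sup>2 + 2 * Re (L2_inner (VV (fst p)) (snd p))" for p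
    by (simp add: B_def L2_inner_self)
  interpret S: semi_inner S ad sc B
  proof
    show "S \<noteq> {}" unfolding S_def using Hge_zero Hlt_zero by blast
    show "ad x y \<in> S" if "x \<in> S" "y \<in> S" for x y
      using that by (auto simp: S_def ad_def intro: Hge_add Hlt_add)
    show "sc c x \<in> S" if "x \<in> S" for c x
      using that by (auto simp: S_def sc_def intro: Hge_scale Hlt_scale)
    show "B (ad x y) z = B x z + B y z" if "x \<in> S" "y \<in> S" "z \<in> S" for x y z
      using SD(3,4)[OF that(1)] SD(3,4)[OF that(2)] SD(3,4)[OF that(3)]
      by (simp add: B_def ad_def LL_add VV_add L2_inner_add_left L2_inner_add_right LL_L2 VV_L2)
    show "B (sc c x) z = c * B x z" if "x \<in> S" "z \<in> S" for c x z
      by (simp add: B_def sc_def LL_scale VV_scale L2_inner_scale_left L2_inner_scale_right algebra_simps)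
    show "B y x = cnj (B x y)" if "x \<in> S" "y \<in> S" for x y
      using LL_sym[OF SD(3)[OF that(2)] SD(3)[OF that(1)]] by (simp add: B_def L2_inner_cnj)
    show "0 \<le> Re (B x x)" if "x \<in> S" for x
      unfolding B_self by (rule P) (use SD[OF that] H10 in auto)
  qed
  define \<alpha> where "\<alpha> i p = L2_inner (LL (fst p)) (\<lambda>_. axis i 1) + cnj (L2_inner (VV (\<lambda>_. axis i 1)) (snd p))" for i p
  define \<beta> where "\<beta> j p = L2_inner (VV (fst p)) (\<lambda>_. axis j 1) + L2_inner (snd p) (\<lambda>_. axis j 1)" for j p
  define a where "a s = Re (L2_inner (LL (\<lambda>_. s)) (\<lambda>_. s))" for s
  define b where "b t = (norm t)\<^sup>2" for t :: "complex ^ 'a"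
  have \<alpha>s: "(\<Sum>i\<in>UNIV. cnj (s $ i) * \<alpha> i p) = L2_inner (LL (fst p)) (\<lambda>_. s) + cnj (L2_inner (VV (\<lambda>_. s)) (snd p))" if "p \<in> S" for s p
    unfolding \<alpha>_def L2_inner_expand_right[OF LL_L2[OF SD(3)[OF that]], of s]
    using L2_inner_expand_matrix[OF V SD(4)[OF that], of s]
    by (simp add: VV_def distrib_left sum.distrib)
  have \<beta>t: "(\<Sum>j\<in>UNIV. cnj (t $ j) * \<beta> j p) = L2_inner (VV (fst p)) (\<lambda>_. t) + L2_inner (snd p) (\<lambda>_. t)" if "p \<in> S" for t p
    unfolding \<beta>_def L2_inner_expand_right[OF VV_L2[OF SD(3)[OF that]], of t] L2_inner_expand_right[OF SD(4)[OF that], of t]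
    by (simp add: distrib_left sum.distrib)
  have "\<exists>\<gamma> :: complex ^ 'a ^ 'a. \<forall>s t. \<forall>y\<in>S. 0 \<le> Re (B y y) + a s + b t
      + 2 * Re (\<Sum>i\<in>UNIV. cnj (s $ i) * \<alpha> i y) + 2 * Re (\<Sum>j\<in>UNIV. cnj (t $ j) * \<beta> j y)
      + 2 * Re (\<Sum>i\<in>UNIV. \<Sum>j\<in>UNIV. s $ i * cnj (t $ j) * \<gamma> $ i $ j)"
  proof (rule S.psd_completion)
    show "\<alpha> i (ad x y) = \<alpha> i x + \<alpha> i y" if "x \<in> S" "y \<in> S" for i x y
      using SD(3,4)[OF that(1)] SD(3,4)[OF that(2)]
      by (simp add: \<alpha>_def ad_def LL_add L2_inner_add_left L2_inner_add_right LL_L2 VV_L2)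
    show "\<alpha> i (sc c x) = c * \<alpha> i x" if "x \<in> S" for i c x
      by (simp add: \<alpha>_def sc_def LL_scale L2_inner_scale_left L2_inner_scale_right algebra_simps)
    show "\<beta> i (ad x y) = \<beta> i x + \<beta> i y" if "x \<in> S" "y \<in> S" for i x y
      using SD(3,4)[OF that(1)] SD(3,4)[OF that(2)]
      by (simp add: \<beta>_def ad_def VV_add L2_inner_add_left VV_L2)
    show "\<beta> i (sc c x) = c * \<beta> i x" if "x \<in> S" for i c x
      by (simp add: \<beta>_def sc_def VV_scale L2_inner_scale_left algebra_simps)
  next
    fix s y assume y: "y \<in> S"
    let ?k = "fst y" and ?l = "snd y"
    have kL: "?k \<in> L2" and lL: "?l \<in> L2" using SD[OF y] by auto
    have "0 \<le> Re (L2_inner (LL (\<lambda>\<zeta>. ?k \<zeta> + s)) (\<lambda>\<zeta>. ?k \<zeta> + s)) + (L2_norm ?l)\<^sup>2 + 2 * Re (L2_inner (VV (\<lambda>\<zeta>. ?k \<zeta> + s)) ?l)"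
      by (rule P) (use SD[OF y] H10 in \<open>auto intro: Hge_add\<close>)
    also have "L2_inner (LL (\<lambda>\<zeta>. ?k \<zeta> + s)) (\<lambda>\<zeta>. ?k \<zeta> + s) =
        L2_inner (LL ?k) ?k + L2_inner (LL ?k) (\<lambda>_. s) + L2_inner (LL (\<lambda>_. s)) ?k + L2_inner (LL (\<lambda>_. s)) (\<lambda>_. s)"
      using kL by (simp add: LL_add L2_inner_add_left L2_inner_add_right LL_L2 L2_add)
    also have "L2_inner (LL (\<lambda>_. s)) ?k = cnj (L2_inner (LL ?k) (\<lambda>_. s))" using LL_sym[OF L2_const kL] .
    also have "L2_inner (VV (\<lambda>\<zeta>. ?k \<zeta> + s)) ?l = L2_inner (VV ?k) ?l + L2_inner (VV (\<lambda>_. s)) ?l"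
      using kL lL by (simp add: VV_add L2_inner_add_left VV_L2)
    finally show "0 \<le> Re (B y y) + 2 * Re (\<Sum>i\<in>UNIV. cnj (s $ i) * \<alpha> i y) + a s"
      unfolding \<alpha>s[OF y] B_self a_def by simp
  next
    fix t y assume y: "y \<in> S"
    let ?k = "fst y" and ?l = "snd y"
    have kL: "?k \<in> L2" and lL: "?l \<in> L2" using SD[OF y] by auto
    let ?k1 = "\<lambda>\<zeta>. \<zeta> powi (-1) *s ?k \<zeta>" and ?l1 = "\<lambda>\<zeta>. \<zeta> powi (-1) *s (?l \<zeta> + t)"
    have k1: "?k1 \<in> Hge 0" using Hge_shift[OF SD(1)[OF y], of "-1"] by simp
    have "(\<lambda>\<zeta>. ?l \<zeta> + t) \<in> Hlt 1"
      using Hlt_mono[OF _ SD(2)[OF y], of 1] Hlt_monomial[of 0 1 t] by (intro Hlt_add) auto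
    then have l1: "?l1 \<in> Hlt 0" using Hlt_shift[of _ 1 "-1"] by fastforce
    have "0 \<le> Re (L2_inner (LL ?k1) ?k1) + (L2_norm ?l1)\<^sup>2 + 2 * Re (L2_inner (VV ?k1) ?l1)"
      by (rule P[OF k1 l1])
    also have "LL ?k1 = (\<lambda>\<zeta>. \<zeta> powi (-1) *s LL ?k \<zeta>)" by (simp add: LL_def matrix_vector_scale)
    also have "VV ?k1 = (\<lambda>\<zeta>. \<zeta> powi (-1) *s VV ?k \<zeta>)" by (simp add: VV_def matrix_vector_scale)
    also have "L2_norm ?l1 = L2_norm (\<lambda>\<zeta>. ?l \<zeta> + t)" by (rule L2_norm_shift)
    also have "L2_inner (\<lambda>\<zeta>. \<zeta> powi (-1) *s LL ?k \<zeta>) ?k1 = L2_inner (LL ?k) ?k" by (rule L2_shift_inner)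
    also have "L2_inner (\<lambda>\<zeta>. \<zeta> powi (-1) *s VV ?k \<zeta>) ?l1 = L2_inner (VV ?k) (\<lambda>\<zeta>. ?l \<zeta> + t)" by (rule L2_shift_inner)
    also have "\<dots> = L2_inner (VV ?k) ?l + L2_inner (VV ?k) (\<lambda>_. t)"
      using kL lL by (simp add: L2_inner_add_right VV_L2)
    also have "(L2_norm (\<lambda>\<zeta>. ?l \<zeta> + t))\<^sup>2 = (L2_norm ?l)\<^sup>2 + 2 * Re (L2_inner ?l (\<lambda>_. t)) + (norm t)\<^sup>2"
    proof -
      have "Re (L2_inner (\<lambda>_. t) ?l) = Re (L2_inner ?l (\<lambda>_. t))" by (metis L2_inner_cnj cnj.sel(1))
      moreover have "(L2_norm (\<lambda>_::complex. t))\<^sup>2 = (norm t)\<^sup>2" unfolding L2_norm_sq using circle.prob_space by simp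
      ultimately show ?thesis using L2_norm_add_sq[OF lL L2_const, of t] by simp
    qed
    finally show "0 \<le> Re (B y y) + 2 * Re (\<Sum>j\<in>UNIV. cnj (t $ j) * \<beta> j y) + b t"
      unfolding \<beta>t[OF y] B_self b_def by simp
  qed
  then obtain \<gamma> :: "complex ^ 'a ^ 'a" where \<gamma>: "\<And>s t y. y \<in> S \<Longrightarrow> 0 \<le> Re (B y y) + a s + b t
      + 2 * Re (\<Sum>i\<in>UNIV. cnj (s $ i) * \<alpha> i y) + 2 * Re (\<Sum>j\<in>UNIV. cnj (t $ j) * \<beta> j y)
      + 2 * Re (\<Sum>i\<in>UNIV. \<Sum>j\<in>UNIV. s $ i * cnj (t $ j) * \<gamma> $ i $ j)" by blast
  \<comment> \<open>Subtracting \<open>C\<close> changes the inner products of the constants \<open>s\<close> and \<open>t\<close> to the completed ones.\<close>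
  define C where "C = (\<chi> j i. L2_inner (VV (\<lambda>_. axis i 1)) (\<lambda>_. axis j 1) - \<gamma> $ i $ j)"
  have "0 \<le> Re (L2_inner (LL k) k) + (L2_norm l)\<^sup>2 + 2 * Re (L2_inner (\<lambda>\<zeta>. map_matrix ((*) (cnj \<zeta>)) (V \<zeta> - C) *v k \<zeta>) l)"
    if k: "k \<in> Hge 0" and l: "l \<in> Hlt 0" for k l
  proof -
    have kL: "k \<in> L2" and lL: "l \<in> L2" using k l HgeD(1) HltD(1) by blast+
    define s where "s = fourier_coeff k 0"
    define k' where "k' = (\<lambda>\<zeta>. k \<zeta> - s)"
    define zl where "zl = (\<lambda>\<zeta>. \<zeta> powi 1 *s l \<zeta>)"
    have zlL: "zl \<in> L2" unfolding zl_def by (rule L2_shift[OF lL])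
    have zlH: "zl \<in> Hlt 1" unfolding zl_def using Hlt_shift[OF l, of 1] by simp
    define t where "t = fourier_coeff zl 0"
    define l' where "l' = (\<lambda>\<zeta>. zl \<zeta> - t)"
    have k'L: "k' \<in> L2" unfolding k'_def by (intro L2_diff kL L2_const)
    have l'L: "l' \<in> L2" unfolding l'_def by (intro L2_diff zlL L2_const)
    have fk': "fourier_coeff k' n = (if n = 0 then 0 else fourier_coeff k n)" for n
      unfolding k'_def by (simp add: fourier_coeff_diff[OF kL L2_const] fourier_coeff_const s_def)
    have k'H: "k' \<in> Hge 1" using k k'L by (simp add: Hge_def fk')
    have fl': "fourier_coeff l' n = (if n = 0 then 0 else fourier_coeff zl n)" for n
      unfolding l'_def by (simp add: fourier_coeff_diff[OF zlL L2_const] fourier_coeff_const t_def)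
    have l'H: "l' \<in> Hlt 0" using zlH l'L by (simp add: Hlt_def fl')
    have keq: "k = (\<lambda>\<zeta>. k' \<zeta> + s)" by (simp add: k'_def)
    have zleq: "zl = (\<lambda>\<zeta>. l' \<zeta> + t)" by (simp add: l'_def)
    define y where "y = (k', l')"
    have y: "y \<in> S" using k'H l'H by (simp add: S_def y_def)
    have yf [simp]: "fst y = k'" "snd y = l'" by (simp_all add: y_def)
    have e1: "L2_inner (LL k) k = L2_inner (LL k') k' + L2_inner (LL k') (\<lambda>_. s) + cnj (L2_inner (LL k') (\<lambda>_. s)) + L2_inner (LL (\<lambda>_. s)) (\<lambda>_. s)"
      unfolding keq using k'L LL_sym[OF L2_const k'L, of s]
      by (simp add: LL_add L2_inner_add_left L2_inner_add_right LL_L2 L2_add)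
    have l't: "L2_inner l' (\<lambda>_. t) = 0" "L2_inner (\<lambda>_. t) l' = 0"
      using Hlt_orthogonal_Hge[OF l'H Hge_const] by auto
    have "L2_norm l = L2_norm zl" unfolding zl_def by (rule L2_norm_shift[symmetric])
    also have "(L2_norm zl)\<^sup>2 = (L2_norm l')\<^sup>2 + (norm t)\<^sup>2"
    proof -
      have "(L2_norm (\<lambda>_::complex. t))\<^sup>2 = (norm t)\<^sup>2" unfolding L2_norm_sq using circle.prob_space by simp
      then show ?thesis unfolding zleq using L2_norm_add_sq[OF l'L L2_const, of t] l't by simp
    qed
    finally have e2: "(L2_norm l)\<^sup>2 = (L2_norm l')\<^sup>2 + (norm t)\<^sup>2" .
    let ?CC = "\<lambda>k \<zeta>. C *v k \<zeta> :: complex ^ 'a"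
    have CL: "?CC f \<in> L2" if "f \<in> L2" for f by (rule Linf_mult_L2[OF Linf_const that])
    have "L2_inner (\<lambda>\<zeta>. map_matrix ((*) (cnj \<zeta>)) (V \<zeta> - C) *v k \<zeta>) l = L2_inner (\<lambda>\<zeta>. VV k \<zeta> - C *v k \<zeta>) zl"
      unfolding L2_inner_cdot zl_def VV_def map_matrix_mult_vec cdot_scale_left cdot_scale_right matrix_vector_mult_diff_rdistrib
      by simp
    also have "\<dots> = L2_inner (VV k) zl - L2_inner (?CC k) zl"
      by (rule L2_inner_diff_left) (intro VV_L2 CL kL zlL)+
    also have "L2_inner (VV k) zl = L2_inner (VV k') l' + L2_inner (VV (\<lambda>_. s)) l' + L2_inner (VV k') (\<lambda>_. t) + L2_inner (VV (\<lambda>_. s)) (\<lambda>_. t)"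
      unfolding keq zleq using k'L l'L
      by (simp add: VV_add L2_inner_add_left L2_inner_add_right VV_L2 L2_add)
    also have "L2_inner (?CC k) zl = cdot (C *v s) t"
    proof -
      have "L2_inner (?CC k) zl = L2_inner (?CC k) l' + L2_inner (?CC k) (\<lambda>_. t)"
        unfolding zleq by (rule L2_inner_add_right) (intro CL kL l'L L2_const)+
      also have "L2_inner (?CC k) l' = 0" by (rule Hlt_orthogonal_Hge(2)[OF l'H Hge_const_matrix[OF k]])
      also have "L2_inner (?CC k) (\<lambda>_. t) = L2_inner (?CC k') (\<lambda>_. t) + L2_inner (\<lambda>_. C *v s) (\<lambda>_. t)"
        unfolding keq matrix_vector_right_distrib by (rule L2_inner_add_left) (intro CL k'L L2_const)+
      also have "L2_inner (?CC k') (\<lambda>_. t) = 0"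
        by (rule Hlt_orthogonal_Hge(2)[OF _ Hge_const_matrix[OF k'H]]) (use Hlt_monomial[of 0 1 t] in simp)
      finally show ?thesis by (simp add: L2_inner_const)
    qed
    also have "cdot (C *v s) t = L2_inner (VV (\<lambda>_. s)) (\<lambda>_. t) - (\<Sum>i\<in>UNIV. \<Sum>j\<in>UNIV. s $ i * cnj (t $ j) * \<gamma> $ i $ j)"
    proof -
      let ?v = "\<lambda>i j. L2_inner (VV (\<lambda>_. axis i 1)) (\<lambda>_. axis j 1)"
      have "cdot (C *v s) t = (\<Sum>j\<in>UNIV. \<Sum>i\<in>UNIV. s $ i * cnj (t $ j) * (?v i j - \<gamma> $ i $ j))"
        unfolding cdot_def matrix_vector_mult_def C_def vec_lambda_beta sum_distrib_right
        by (intro sum.cong refl) (simp add: mult_ac)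
      also have "\<dots> = (\<Sum>i\<in>UNIV. \<Sum>j\<in>UNIV. s $ i * cnj (t $ j) * (?v i j - \<gamma> $ i $ j))" by (rule sum.swap)
      also have "\<dots> = (\<Sum>i\<in>UNIV. \<Sum>j\<in>UNIV. s $ i * cnj (t $ j) * ?v i j) - (\<Sum>i\<in>UNIV. \<Sum>j\<in>UNIV. s $ i * cnj (t $ j) * \<gamma> $ i $ j)"
        by (simp add: right_diff_distrib sum_subtractf)
      also have "(\<Sum>i\<in>UNIV. \<Sum>j\<in>UNIV. s $ i * cnj (t $ j) * ?v i j) = L2_inner (VV (\<lambda>_. s)) (\<lambda>_. t)"
        using L2_inner_expand_matrix[OF V L2_const, of s t] L2_inner_expand_right[OF VV_L2[OF L2_const], of _ t]
        by (simp add: VV_def sum_distrib_left mult.assoc)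
      finally show ?thesis .
    qed
    finally have e3: "L2_inner (\<lambda>\<zeta>. map_matrix ((*) (cnj \<zeta>)) (V \<zeta> - C) *v k \<zeta>) l =
      L2_inner (VV k') l' + L2_inner (VV (\<lambda>_. s)) l' + L2_inner (VV k') (\<lambda>_. t) + (\<Sum>i\<in>UNIV. \<Sum>j\<in>UNIV. s $ i * cnj (t $ j) * \<gamma> $ i $ j)"
      by simp
    show ?thesis
      using \<gamma>[OF y, of s t] unfolding e1 e2 e3 \<alpha>s[OF y] \<beta>t[OF y] B_self a_def b_def yf l't by simp
  qed
  then show ?thesis unfolding hankel_dominated_def LL_def by blast
qed

lemma L2_norm_polynomial:
  "(L2_norm (\<lambda>\<zeta>. \<Sum>j=m..<n. \<zeta> powi int j *s c j))\<^sup>2 = (\<Sum>j=m..<n. (norm (c j))\<^sup>2)"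
proof (induction n)
  case (Suc n)
  show ?case
  proof (cases "m \<le> n")
    case True
    have lt: "(\<lambda>\<zeta>. \<Sum>j=m..<k. \<zeta> powi int j *s c j) \<in> Hlt (int k)" for k
    proof (induction k)
      case (Suc k)
      show ?case
      proof (cases "m \<le> k")
        case True
        have "(\<lambda>\<zeta>. (\<Sum>j=m..<k. \<zeta> powi int j *s c j) + \<zeta> powi int k *s c k) \<in> Hlt (int (Suc k))"
          by (rule Hlt_add[OF Hlt_mono[OF _ Suc] Hlt_monomial]) auto
        then show ?thesis using True by simp
      qed simp
    qed simp
    have "(L2_norm (\<lambda>\<zeta>. \<zeta> powi int n *s c n + (\<Sum>j=m..<n. \<zeta> powi int j *s c j)))\<^sup>2
      = (L2_norm (\<lambda>\<zeta>. \<zeta> powi int n *s c n))\<^sup>2 + (L2_norm (\<lambda>\<zeta>. \<Sum>j=m..<n. \<zeta> powi int j *s c j))\<^sup>2"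
      by (rule L2_norm_Hge_Hlt[OF Hge_monomial lt]) simp
    also have "(L2_norm (\<lambda>\<zeta>. \<zeta> powi int n *s c n))\<^sup>2 = (norm (c n))\<^sup>2"
      unfolding L2_norm_shift L2_norm_sq using circle.prob_space by simp
    finally show ?thesis using True Suc.IH by (simp add: add.commute del: power_int_of_nat)
  qed simp
qed simp

lemma polynomial_Hlt: "(\<lambda>\<zeta>. \<Sum>j<n. \<zeta> powi int j *s c j) \<in> Hlt (int n)"
proof (induction n)
  case (Suc k)
  have "(\<lambda>\<zeta>. (\<Sum>j<k. \<zeta> powi int j *s c j) + \<zeta> powi int k *s c k) \<in> Hlt (int (Suc k))"
    by (rule Hlt_add[OF Hlt_mono[OF _ Suc] Hlt_monomial]) auto
  then show ?case by simp
qed simp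

lemma polynomial_Hge: "(\<lambda>\<zeta>. \<Sum>j<n. \<zeta> powi int j *s c j) \<in> Hge 0"
proof (induction n)
  case (Suc k)
  have "(\<lambda>\<zeta>. (\<Sum>j<k. \<zeta> powi int j *s c j) + \<zeta> powi int k *s c k) \<in> Hge 0"
    by (rule Hge_add[OF Suc Hge_monomial]) auto
  then show ?case by simp
qed simp

lemma Re_scale: "Re (of_real r * z) = r * Re z"
  by simp

lemma L2_norm_sum_le:
  assumes "\<And>i. i \<in> I \<Longrightarrow> f i \<in> L2"
  shows "L2_norm (\<lambda>\<zeta>. \<Sum>i\<in>I. f i \<zeta>) \<le> (\<Sum>i\<in>I. L2_norm (f i))"
  using assms
proof (induction I rule: infinite_finite_induct)
  case (insert i I)
  have "L2_norm (\<lambda>\<zeta>. f i \<zeta> + (\<Sum>i\<in>I. f i \<zeta>)) \<le> L2_norm (f i) + L2_norm (\<lambda>\<zeta>. \<Sum>i\<in>I. f i \<zeta>)"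
    by (rule L2_norm_triangle) (use insert.prems in \<open>auto intro: L2_sum\<close>)
  then show ?case using insert by fastforce
qed auto

lemma matrix_vector_columns: "A *v x = (\<Sum>i\<in>UNIV. x $ i *s (A *v axis i 1))" for A :: "complex ^ 'n ^ 'm"
proof -
  have "A *v x = A *v (\<Sum>i\<in>UNIV. x $ i *s axis i 1)" by (simp only: basis_expansion)
  also have "\<dots> = (\<Sum>i\<in>UNIV. A *v (x $ i *s axis i 1))"
    by (rule linear_sum[OF bounded_linear.linear[OF bounded_linear_matrix]])
  finally show ?thesis by (simp only: matrix_vector_scale)
qed

text \<open>
  Each entry extends to the disk by its Poisson integral.
\<close>

lemma Hinf_of_columns:
  assumes F: "\<And>i. (\<lambda>\<zeta>. F \<zeta> *v axis i 1) \<in> Hge 0" and [measurable]: "F \<in> borel_measurable \<mu>"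
    and b: "AE \<zeta> in \<mu>. \<forall>x. norm (F \<zeta> *v x) \<le> b * norm x"
  shows "F \<in> Hinf"
proof -
  have entry: "F \<zeta> $ i $ j = (F \<zeta> *v axis j 1) $ i" for \<zeta> i j
    by (simp add: matrix_vector_mult_def axis_def if_distrib[of "\<lambda>y. _ * y"] cong: if_cong)
  have eb: "AE \<zeta> in \<mu>. norm (F \<zeta> $ i $ j) \<le> b" for i j
    using b
  proof eventually_elim
    case (elim \<zeta>)
    have "norm (F \<zeta> $ i $ j) \<le> norm (F \<zeta> *v axis j 1)" unfolding entry by (rule Finite_Cartesian_Product.norm_nth_le)
    also have "\<dots> \<le> b * norm (axis j 1 :: complex ^ 'a)" using elim by blast
    finally show ?case by (simp add: norm_axis_complex)
  qed
  have "\<exists>G. G holomorphic_on ball 0 1 \<and> (\<forall>z\<in>ball 0 1. norm (G z) \<le> b) \<and>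
     (AE \<zeta> in \<mu>. ((\<lambda>t. G (of_real t * \<zeta>)) \<longlongrightarrow> F \<zeta> $ i $ j) (at_left 1))" for i j
  proof (rule bounded_analytic_boundary[OF _ eb])
    fix n :: int assume "n < 0"
    then show "fcoef (\<lambda>\<zeta>. F \<zeta> $ i $ j) n = 0"
      unfolding entry fourier_coeff_nth[OF HgeD(1)[OF F], symmetric] using HgeD(2)[OF F] by simp
  qed measurable
  from choice2[OF this] obtain G where "\<forall>i j. G i j holomorphic_on ball 0 1 \<and> (\<forall>z\<in>ball 0 1. norm (G i j z) \<le> b) \<and>
     (AE \<zeta> in \<mu>. ((\<lambda>t. G i j (of_real t * \<zeta>)) \<longlongrightarrow> F \<zeta> $ i $ j) (at_left 1))" ..
  then have G: "\<And>i j. G i j holomorphic_on ball 0 1" "\<And>i j z. z \<in> ball 0 1 \<Longrightarrow> norm (G i j z) \<le> b"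
    "\<And>i j. AE \<zeta> in \<mu>. ((\<lambda>t. G i j (of_real t * \<zeta>)) \<longlongrightarrow> F \<zeta> $ i $ j) (at_left 1)"
    by simp_all
  define GG where "GG z = (\<chi> i j. G i j z)" for z
  have "F \<in> Linf" by (rule LinfI[OF _ b]) measurable
  moreover have "(\<lambda>z. GG z $ i $ j) holomorphic_on ball 0 1" for i j using G(1) by (simp add: GG_def)
  moreover have "bounded (GG ` ball 0 1)"
  proof (rule boundedI)
    fix x assume "x \<in> GG ` ball 0 1"
    then obtain z where z: "z \<in> ball 0 1" "x = GG z" by blast
    have "norm x \<le> (\<Sum>i\<in>UNIV. norm (x $ i))" by (simp add: norm_vec_def L2_set_le_sum)
    also have "\<dots> \<le> (\<Sum>i\<in>UNIV. \<Sum>j\<in>UNIV. norm (x $ i $ j))" by (intro sum_mono) (simp add: norm_vec_def L2_set_le_sum)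
    also have "\<dots> \<le> (\<Sum>i\<in>(UNIV::'a set). \<Sum>j\<in>(UNIV::'a set). b)" 
      by (intro sum_mono) (use G(2)[OF z(1)] in \<open>simp add: z(2) GG_def\<close>)
    finally show "norm x \<le> (\<Sum>i\<in>(UNIV::'a set). \<Sum>j\<in>(UNIV::'a set). b)" .
  qed
  moreover have "AE \<zeta> in \<mu>. ((\<lambda>t. GG (of_real t * \<zeta>)) \<longlongrightarrow> F \<zeta>) (at_left 1)"
  proof -
    have "AE \<zeta> in \<mu>. \<forall>i\<in>UNIV. \<forall>j\<in>UNIV. ((\<lambda>t. G i j (of_real t * \<zeta>)) \<longlongrightarrow> F \<zeta> $ i $ j) (at_left 1)"
      by (intro AE_finite_allI finite G(3))
    then show ?thesis by eventually_elim (auto simp: GG_def intro!: vec_tendstoI)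
  qed
  ultimately show ?thesis unfolding Hinf_def by blast
qed

text \<open>
  The theorem of Nehari with a weight, for pointwise contractions \<open>U\<close> and \<open>\<Lambda>\<close> with \<open>\<Lambda>\<close> selfadjoint: there is
  an approximant of \<open>U\<close> in \<open>Hinf\<close> whose error is pointwise dominated by \<open>\<Lambda>\<close>, provided that the Hankel operator is dominated by multiplication with \<open>\<Lambda>\<close>. Iterating
  the one-step extension produces matrices \<open>V n = \<zeta>\<^sup>-\<^sup>n (U - S n)\<close>, where \<open>S n\<close> are the partial sums of the
  Fourier series of \<open>F\<close>.
\<close>

theorem weighted_nehari:
  fixes U \<Lambda> :: "complex \<Rightarrow> complex ^ 'r ^ 'r"
  assumes U: "U \<in> Linf" "AE \<zeta> in \<mu>. \<forall>x. norm (U \<zeta> *v x) \<le> norm x"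
    and \<Lambda>: "\<Lambda> \<in> Linf" "AE \<zeta> in \<mu>. adjoint_matrix (\<Lambda> \<zeta>) = \<Lambda> \<zeta>" "AE \<zeta> in \<mu>. \<forall>x. norm (\<Lambda> \<zeta> *v x) \<le> norm x"
    and dom: "hankel_dominated \<Lambda> U"
  shows "\<exists>F\<in>Hinf. AE \<zeta> in \<mu>. \<forall>x. (norm ((U \<zeta> - F \<zeta>) *v x))\<^sup>2 \<le> Re (cdot (\<Lambda> \<zeta> *v x) x)"
proof -
  have "\<exists>V. \<forall>n. (V n \<in> Linf \<and> hankel_dominated \<Lambda> (V n) \<and> (n = 0 \<longrightarrow> V n = U)) \<and>
      (\<exists>C. V (Suc n) = (\<lambda>\<zeta>. map_matrix ((*) (cnj \<zeta>)) (V n \<zeta> - C)))"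
  proof (rule dependent_nat_choice)
    show "\<exists>V. V \<in> Linf \<and> hankel_dominated \<Lambda> V \<and> ((0::nat) = 0 \<longrightarrow> V = U)" using U dom by blast
    fix V and n :: nat assume V: "V \<in> Linf \<and> hankel_dominated \<Lambda> V \<and> (n = 0 \<longrightarrow> V = U)"
    then obtain C where C: "hankel_dominated \<Lambda> (\<lambda>\<zeta>. map_matrix ((*) (cnj \<zeta>)) (V \<zeta> - C))"
      using hankel_dominated_step[OF \<Lambda>(1,2)] by blast
    have [measurable]: "V \<in> borel_measurable \<mu>" using V LinfD(1) by blast
    obtain B where B: "AE \<zeta> in \<mu>. \<forall>x. norm (V \<zeta> *v x) \<le> B * norm x" using V LinfD(2) by blast
    have "(\<lambda>\<zeta>. map_matrix ((*) (cnj \<zeta>)) (V \<zeta> - C)) \<in> Linf"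
    proof (rule LinfI[where C="B + op_norm C"])
      show "AE \<zeta> in \<mu>. \<forall>x. norm (map_matrix ((*) (cnj \<zeta>)) (V \<zeta> - C) *v x) \<le> (B + op_norm C) * norm x"
        using B AE_circle_norm
      proof eventually_elim
        case (elim \<zeta>)
        show ?case
        proof
          fix x
          have "norm (V \<zeta> *v x - C *v x) \<le> B * norm x + op_norm C * norm x"
            by (rule order_trans[OF norm_triangle_ineq4]) (use elim op_norm_bound in \<open>auto intro: add_mono\<close>)
          then show "norm (map_matrix ((*) (cnj \<zeta>)) (V \<zeta> - C) *v x) \<le> (B + op_norm C) * norm x"
            unfolding map_matrix_mult_vec matrix_vector_mult_diff_rdistrib norm_smult_vec
            using elim by (simp add: distrib_right)
        qed
      qed
    qed measurable
    with C show "\<exists>W. (W \<in> Linf \<and> hankel_dominated \<Lambda> W \<and> (Suc n = 0 \<longrightarrow> W = U)) \<and>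
        (\<exists>C. W = (\<lambda>\<zeta>. map_matrix ((*) (cnj \<zeta>)) (V \<zeta> - C)))" by blast
  qed
  then obtain V C where "\<And>n::nat. V n \<in> Linf" and Vdom: "\<And>n. hankel_dominated \<Lambda> (V n)" and V0: "V 0 = U"
    and VS: "\<And>n. V (Suc n) = (\<lambda>\<zeta>. map_matrix ((*) (cnj \<zeta>)) (V n \<zeta> - C n))"
    by metis
  define S where "S n x \<zeta> = (\<Sum>j<n. \<zeta> powi int j *s (C j *v x))" for n x \<zeta>
  have rel: "\<zeta> powi int n *s (V n \<zeta> *v x) = U \<zeta> *v x - S n x \<zeta>" if \<zeta>: "norm \<zeta> = 1" for n \<zeta> x
  proof (induction n)
    case (Suc n)
    have "\<zeta> * cnj \<zeta> = 1" using \<zeta> by (simp add: complex_norm_square[symmetric])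
    moreover have "\<zeta> powi int (Suc n) = \<zeta> powi int n * \<zeta>" by (simp only: power_int_of_nat power_Suc2)
    ultimately have "\<zeta> powi int (Suc n) * cnj \<zeta> = \<zeta> powi int n" by (simp only: mult.assoc mult_1_right)
    then have "\<zeta> powi int (Suc n) *s (V (Suc n) \<zeta> *v x) = \<zeta> powi int n *s (V n \<zeta> *v x - C n *v x)"
      by (simp add: VS map_matrix_mult_vec vector_smult_assoc matrix_vector_mult_diff_rdistrib del: power_int_of_nat)
    also have "\<dots> = U \<zeta> *v x - S (Suc n) x \<zeta>"
      using Suc by (simp add: vector_ssub_ldistrib S_def algebra_simps del: power_int_of_nat)
    finally show ?case .
  qed (simp add: V0 S_def)
  have U_L2: "(\<lambda>\<zeta>. U \<zeta> *v f \<zeta>) \<in> L2" if "f \<in> L2" for f by (rule Linf_mult_L2[OF U(1) that])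
  have L_L2: "(\<lambda>\<zeta>. \<Lambda> \<zeta> *v f \<zeta>) \<in> L2" if "f \<in> L2" for f by (rule Linf_mult_L2[OF \<Lambda>(1) that])
  \<comment> \<open>After \<open>n\<close> steps the inequality holds for \<open>l\<close> in \<open>Hlt n\<close>.\<close>
  have I: "0 \<le> Re (L2_inner (\<lambda>\<zeta>. \<Lambda> \<zeta> *v k \<zeta>) k) + (L2_norm l)\<^sup>2 + 2 * Re (L2_inner (\<lambda>\<zeta>. U \<zeta> *v k \<zeta> - S n (k \<zeta>) \<zeta>) l)"
    if k: "k \<in> Hge 0" and l: "l \<in> Hlt (int n)" for k l n
  proof -
    let ?l = "\<lambda>\<zeta>. \<zeta> powi (- int n) *s l \<zeta>"
    have "?l \<in> Hlt 0" using Hlt_shift[OF l, of "- int n"] by simp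
    then have "0 \<le> Re (L2_inner (\<lambda>\<zeta>. \<Lambda> \<zeta> *v k \<zeta>) k) + (L2_norm ?l)\<^sup>2 + 2 * Re (L2_inner (\<lambda>\<zeta>. V n \<zeta> *v k \<zeta>) ?l)"
      using Vdom[of n] k unfolding hankel_dominated_def by blast
    also have "L2_norm ?l = L2_norm l" by (rule L2_norm_shift)
    also have "L2_inner (\<lambda>\<zeta>. V n \<zeta> *v k \<zeta>) ?l = L2_inner (\<lambda>\<zeta>. \<zeta> powi int n *s (V n \<zeta> *v k \<zeta>)) l"
      using L2_shift_inner_right[of "\<lambda>\<zeta>. V n \<zeta> *v k \<zeta>" "- int n" l] by simp
    also have "\<dots> = L2_inner (\<lambda>\<zeta>. U \<zeta> *v k \<zeta> - S n (k \<zeta>) \<zeta>) l"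
      unfolding L2_inner_cdot by (rule Bochner_Integration.integral_cong[OF refl]) (subst rel, simp_all)
    finally show ?thesis .
  qed
  have SH: "S n x \<in> Hge 0" "S n x \<in> Hlt (int n)" for n x
    unfolding S_def[abs_def] by (rule polynomial_Hge, rule polynomial_Hlt)
  have SL: "S n x \<in> L2" for n x by (rule HgeD(1)[OF SH(1)])
  \<comment> \<open>Testing with \<open>k = x\<close> and \<open>l = S n x\<close> bounds the partial sums, so the series converges in the mean.\<close>
  have S_bound: "(L2_norm (S n x))\<^sup>2 \<le> 6 * (norm x)\<^sup>2" for n x
  proof -
    let ?x = "\<lambda>_::complex. x"
    have nx: "L2_norm ?x = norm x" unfolding L2_norm_def using circle.prob_space by simp
    have "0 \<le> Re (L2_inner (\<lambda>\<zeta>. \<Lambda> \<zeta> *v x) ?x) + (L2_norm (S n x))\<^sup>2 + 2 * Re (L2_inner (\<lambda>\<zeta>. U \<zeta> *v x - S n x \<zeta>) (S n x))"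
      using I[OF Hge_const SH(2), of x n x] .
    also have "L2_inner (\<lambda>\<zeta>. U \<zeta> *v x - S n x \<zeta>) (S n x) = L2_inner (\<lambda>\<zeta>. U \<zeta> *v x) (S n x) - L2_inner (S n x) (S n x)"
      by (rule L2_inner_diff_left) (intro U_L2 SL L2_const)+
    also have "L2_inner (S n x) (S n x) = of_real ((L2_norm (S n x))\<^sup>2)" by (rule L2_inner_self)
    finally have "(L2_norm (S n x))\<^sup>2 \<le> Re (L2_inner (\<lambda>\<zeta>. \<Lambda> \<zeta> *v x) ?x) + 2 * Re (L2_inner (\<lambda>\<zeta>. U \<zeta> *v x) (S n x))" by simp
    moreover have "Re (L2_inner (\<lambda>\<zeta>. \<Lambda> \<zeta> *v x) ?x) \<le> norm x * norm x"
    proof -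
      have "Re (L2_inner (\<lambda>\<zeta>. \<Lambda> \<zeta> *v x) ?x) \<le> L2_norm (\<lambda>\<zeta>. \<Lambda> \<zeta> *v x) * L2_norm ?x"
        using L2_Cauchy_Schwarz[OF L_L2[OF L2_const] L2_const, of x x] complex_Re_le_cmod order_trans by blast
      also have "\<dots> \<le> norm x * norm x" unfolding nx
        using Linf_norm_le[OF \<Lambda>(1,3) L2_const, of x] unfolding nx by (intro mult_right_mono) auto
      finally show ?thesis .
    qed
    moreover have "Re (L2_inner (\<lambda>\<zeta>. U \<zeta> *v x) (S n x)) \<le> norm x * L2_norm (S n x)"
    proof -
      have "Re (L2_inner (\<lambda>\<zeta>. U \<zeta> *v x) (S n x)) \<le> L2_norm (\<lambda>\<zeta>. U \<zeta> *v x) * L2_norm (S n x)"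
        using L2_Cauchy_Schwarz[OF U_L2[OF L2_const] SL, of x n x] complex_Re_le_cmod order_trans by blast
      also have "\<dots> \<le> norm x * L2_norm (S n x)"
        using Linf_norm_le[OF U L2_const, of x] unfolding nx by (intro mult_right_mono) auto
      finally show ?thesis .
    qed
    moreover have "0 \<le> (L2_norm (S n x) - 2 * norm x)\<^sup>2" by simp
    ultimately show ?thesis by (simp add: power2_eq_square algebra_simps)
  qed
  have ex: "\<exists>f\<in>Hge 0. (\<lambda>n. L2_norm (\<lambda>\<zeta>. S n x \<zeta> - f \<zeta>)) \<longlonglongrightarrow> 0" for x
  proof -
    define a where "a j = (norm (C j *v x))\<^sup>2" for j
    have part: "(L2_norm (\<lambda>\<zeta>. \<Sum>j=m..<n. \<zeta> powi int j *s (C j *v x)))\<^sup>2 = (\<Sum>j=m..<n. a j)" for m n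
      unfolding a_def by (rule L2_norm_polynomial)
    have "(\<Sum>j<n. a j) \<le> 6 * (norm x)\<^sup>2" for n
      using S_bound[of n x] part[of 0 n] unfolding S_def[abs_def] by (simp add: atLeast0LessThan del: power_int_of_nat)
    then have "summable a" by (intro summableI_nonneg_bounded[where x="6 * (norm x)\<^sup>2"]) (auto simp: a_def)
    have dist: "L2_norm (\<lambda>\<zeta>. S m x \<zeta> - S n x \<zeta>) = sqrt (\<Sum>j=n..<m. a j)" if "n \<le> m" for m n
    proof -
      have "(\<lambda>\<zeta>. S m x \<zeta> - S n x \<zeta>) = (\<lambda>\<zeta>. \<Sum>j=n..<m. \<zeta> powi int j *s (C j *v x))"
        unfolding S_def lessThan_atLeast0 using that by (simp add: sum_diff_nat_ivl del: power_int_of_nat)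
      then have "(L2_norm (\<lambda>\<zeta>. S m x \<zeta> - S n x \<zeta>))\<^sup>2 = (\<Sum>j=n..<m. a j)" using part[of n m] by (simp only:)
      then show ?thesis by (intro real_sqrt_unique[symmetric]) simp_all
    qed
    have "\<exists>f\<in>L2. (\<lambda>n. L2_norm (\<lambda>\<zeta>. S n x \<zeta> - f \<zeta>)) \<longlonglongrightarrow> 0"
    proof (rule L2_complete[OF SL])
      fix e :: real assume e: "0 < e"
      then obtain N where N: "\<And>m n. m \<ge> N \<Longrightarrow> norm (sum a {m..<n}) < e\<^sup>2"
        using \<open>summable a\<close> unfolding summable_Cauchy by (metis zero_less_power)
      have small: "L2_norm (\<lambda>\<zeta>. S m x \<zeta> - S n x \<zeta>) < e" if "n \<ge> N" "n \<le> m" for m n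
      proof -
        have "sum a {n..<m} < e\<^sup>2" using N[OF that(1), of m] by simp
        then show ?thesis unfolding dist[OF that(2)] using e real_sqrt_less_mono[of _ "e\<^sup>2"] by fastforce
      qed
      show "\<exists>N. \<forall>m\<ge>N. \<forall>n\<ge>N. L2_norm (\<lambda>\<zeta>. S m x \<zeta> - S n x \<zeta>) < e"
      proof (intro exI[of _ N] allI impI)
        fix m n assume "m \<ge> N" "n \<ge> N"
        then show "L2_norm (\<lambda>\<zeta>. S m x \<zeta> - S n x \<zeta>) < e"
          using small[of n m] small[of m n] L2_norm_minus_commute[of "S m x" "S n x"] by (cases "n \<le> m") auto
      qed
    qed
    then obtain h where h: "h \<in> L2" "(\<lambda>n. L2_norm (\<lambda>\<zeta>. S n x \<zeta> - h \<zeta>)) \<longlonglongrightarrow> 0" by blast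
    have "h \<in> Hge 0" by (rule Hge_closed[OF SH(1) h])
    with h(2) show ?thesis by blast
  qed
  define f where "f i = (SOME f. f \<in> Hge 0 \<and> (\<lambda>n. L2_norm (\<lambda>\<zeta>. S n (axis i 1) \<zeta> - f \<zeta>)) \<longlonglongrightarrow> 0)" for i :: 'r
  have f: "f i \<in> Hge 0" "(\<lambda>n. L2_norm (\<lambda>\<zeta>. S n (axis i 1) \<zeta> - f i \<zeta>)) \<longlonglongrightarrow> 0" for i
    using someI_ex[OF ex[of "axis i 1", unfolded Bex_def]] unfolding f_def by auto
  have fL: "f i \<in> L2" for i by (rule HgeD(1)[OF f(1)])
  have [measurable]: "f i \<in> borel_measurable \<mu>" for i using fL by auto
  have [measurable]: "U \<in> borel_measurable \<mu>" "\<Lambda> \<in> borel_measurable \<mu>" using U(1) \<Lambda>(1) LinfD(1) by auto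
  define F where "F \<zeta> = (\<chi> a i. f i \<zeta> $ a)" for \<zeta>
  have F_meas [measurable]: "F \<in> borel_measurable \<mu>" unfolding F_def[abs_def] by measurable
  have Fx: "F \<zeta> *v x = (\<Sum>i\<in>UNIV. x $ i *s f i \<zeta>)" for \<zeta> x
    by (simp add: vec_eq_iff matrix_vector_mult_def F_def mult.commute)
  have Fax: "F \<zeta> *v axis i 1 = f i \<zeta>" for \<zeta> i
    by (simp add: vec_eq_iff matrix_vector_mult_def F_def axis_def if_distrib[of "\<lambda>y. _ * y"] cong: if_cong)
  have FxL: "(\<lambda>\<zeta>. F \<zeta> *v x) \<in> L2" for x unfolding Fx by (intro L2_sum L2_scale fL)
  have Sx: "S n x \<zeta> = (\<Sum>i\<in>UNIV. x $ i *s S n (axis i 1) \<zeta>)" for n x \<zeta>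
  proof -
    have "S n x \<zeta> = (\<Sum>j<n. \<zeta> powi int j *s (\<Sum>i\<in>UNIV. x $ i *s (C j *v axis i 1)))"
      unfolding S_def matrix_vector_columns[of _ x] ..
    also have "\<dots> = (\<Sum>j<n. \<Sum>i\<in>UNIV. x $ i *s (\<zeta> powi int j *s (C j *v axis i 1)))"
      by (simp add: vec_eq_iff sum_distrib_left mult_ac del: power_int_of_nat)
    also have "\<dots> = (\<Sum>i\<in>UNIV. \<Sum>j<n. x $ i *s (\<zeta> powi int j *s (C j *v axis i 1)))" by (rule sum.swap)
    also have "\<dots> = (\<Sum>i\<in>UNIV. x $ i *s S n (axis i 1) \<zeta>)"
      unfolding S_def by (simp add: vec_eq_iff sum_distrib_left mult.assoc del: power_int_of_nat)
    finally show ?thesis .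
  qed
  have S_lim: "(\<lambda>n. L2_norm (\<lambda>\<zeta>. S n x \<zeta> - F \<zeta> *v x)) \<longlonglongrightarrow> 0" for x
  proof (rule Lim_null_comparison)
    have "L2_norm (\<lambda>\<zeta>. S n x \<zeta> - F \<zeta> *v x) \<le> (\<Sum>i\<in>UNIV. norm (x $ i) * L2_norm (\<lambda>\<zeta>. S n (axis i 1) \<zeta> - f i \<zeta>))" for n
    proof -
      have "(\<lambda>\<zeta>. S n x \<zeta> - F \<zeta> *v x) = (\<lambda>\<zeta>. \<Sum>i\<in>UNIV. x $ i *s (S n (axis i 1) \<zeta> - f i \<zeta>))"
        unfolding Sx[of n x] Fx by (simp add: vector_ssub_ldistrib sum_subtractf)
      moreover have "L2_norm (\<lambda>\<zeta>. \<Sum>i\<in>UNIV. x $ i *s (S n (axis i 1) \<zeta> - f i \<zeta>)) \<le>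
          (\<Sum>i\<in>UNIV. L2_norm (\<lambda>\<zeta>. x $ i *s (S n (axis i 1) \<zeta> - f i \<zeta>)))"
        by (rule L2_norm_sum_le) (intro L2_scale L2_diff SL fL)
      ultimately show ?thesis unfolding L2_norm_scale by (simp only:)
    qed
    then show "eventually (\<lambda>n. norm (L2_norm (\<lambda>\<zeta>. S n x \<zeta> - F \<zeta> *v x)) \<le> (\<Sum>i\<in>UNIV. norm (x $ i) * L2_norm (\<lambda>\<zeta>. S n (axis i 1) \<zeta> - f i \<zeta>))) sequentially"
      by simp
    have "(\<lambda>n. \<Sum>i\<in>UNIV. norm (x $ i) * L2_norm (\<lambda>\<zeta>. S n (axis i 1) \<zeta> - f i \<zeta>)) \<longlonglongrightarrow> (\<Sum>i\<in>UNIV. norm (x $ i) * 0)"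
      by (intro tendsto_intros f)
    then show "(\<lambda>n. \<Sum>i\<in>UNIV. norm (x $ i) * L2_norm (\<lambda>\<zeta>. S n (axis i 1) \<zeta> - f i \<zeta>)) \<longlonglongrightarrow> 0" by simp
  qed
  \<comment> \<open>Testing with \<open>k = e x\<close> and \<open>l = e y\<close>, where \<open>e\<close> is an arbitrary scalar polynomial, localizes the
      inequality: it holds pointwise for constant vectors \<open>x\<close> and \<open>y\<close>. The choice \<open>y = - (U - F) x\<close> gives the claim.\<close>
  define G where "G x y \<zeta> = Re (cdot (\<Lambda> \<zeta> *v x) x) + (norm y)\<^sup>2 + 2 * Re (cdot (U \<zeta> *v x - F \<zeta> *v x) y)" for x y \<zeta>
  have G_int: "integrable \<mu> (G x y)" for x y
    unfolding G_def[abs_def]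
    by (intro Bochner_Integration.integrable_add integrable_mult_right integrable_Re integrable_cdot L2_diff U_L2 L_L2 FxL L2_const) simp
  have "AE \<zeta> in \<mu>. 0 \<le> G x y \<zeta>" for x y
  proof (rule nonneg_by_squares[OF G_int])
    fix c :: "nat \<Rightarrow> complex" and N
    define e where "e \<zeta> = (\<Sum>n<N. c n * \<zeta>^n)" for \<zeta>
    have e_meas [measurable]: "e \<in> borel_measurable \<mu>" unfolding e_def[abs_def] by measurable
    have e_vec: "(\<lambda>\<zeta>. e \<zeta> *s z) = (\<lambda>\<zeta>. \<Sum>n<N. \<zeta> powi int n *s (c n *s z))" for z :: "complex ^ 'r"
      by (simp add: e_def vec_eq_iff fun_eq_iff sum_distrib_left mult_ac)
    define b where "b = (\<Sum>n<N. norm (c n))"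
    have e_bound: "AE \<zeta> in \<mu>. norm (e \<zeta>) \<le> b"
    proof (rule AE_I2)
      fix \<zeta> assume "\<zeta> \<in> space \<mu>"
      then show "norm (e \<zeta>) \<le> b" unfolding e_def b_def
        by (intro order_trans[OF norm_sum] sum_mono) (simp add: norm_mult norm_power)
    qed
    have eL: "(\<lambda>\<zeta>. e \<zeta> *s h \<zeta>) \<in> L2" if "h \<in> L2" for h :: "complex \<Rightarrow> complex ^ 'r"
      by (rule L2_mult_bounded[OF e_meas e_bound that])
    have b0: "0 \<le> b" unfolding b_def by (rule sum_nonneg) simp
    have e_norm: "L2_norm (\<lambda>\<zeta>. e \<zeta> *s h \<zeta>) \<le> b * L2_norm h" if h: "h \<in> L2" for h :: "complex \<Rightarrow> complex ^ 'r"
    proof (rule power2_le_imp_le)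
      have "(LINT \<zeta>|\<mu>. (norm (e \<zeta> *s h \<zeta>))\<^sup>2) \<le> (LINT \<zeta>|\<mu>. b\<^sup>2 * (norm (h \<zeta>))\<^sup>2)"
      proof (rule integral_mono_AE[OF L2_integrable[OF eL[OF h]]])
        show "integrable \<mu> (\<lambda>\<zeta>. b\<^sup>2 * (norm (h \<zeta>))\<^sup>2)" using L2_integrable[OF h] by simp
        show "AE \<zeta> in \<mu>. (norm (e \<zeta> *s h \<zeta>))\<^sup>2 \<le> b\<^sup>2 * (norm (h \<zeta>))\<^sup>2"
          using e_bound by eventually_elim (auto simp: norm_smult_vec power_mult_distrib intro!: mult_right_mono power_mono)
      qed
      then show "(L2_norm (\<lambda>\<zeta>. e \<zeta> *s h \<zeta>))\<^sup>2 \<le> (b * L2_norm h)\<^sup>2"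
        unfolding power_mult_distrib L2_norm_sq by simp
    qed (use b0 in simp)
    let ?k = "\<lambda>\<zeta>. e \<zeta> *s x" and ?l = "\<lambda>\<zeta>. e \<zeta> *s y"
    have kH: "?k \<in> Hge 0" unfolding e_vec by (rule polynomial_Hge)
    have kL: "?k \<in> L2" and lL: "?l \<in> L2" by (intro eL L2_const)+
    have pos: "0 \<le> Re (L2_inner (\<lambda>\<zeta>. \<Lambda> \<zeta> *v ?k \<zeta>) ?k) + (L2_norm ?l)\<^sup>2
        + 2 * Re (L2_inner (\<lambda>\<zeta>. U \<zeta> *v ?k \<zeta>) ?l - L2_inner (\<lambda>\<zeta>. e \<zeta> *s S n x \<zeta>) ?l)" if n: "n \<ge> N" for n
    proof -
      have "?l \<in> Hlt (int N)" unfolding e_vec by (rule polynomial_Hlt)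
      then have "?l \<in> Hlt (int n)" using n by (intro Hlt_mono[of "int N" "int n"]) auto
      moreover have "S n (?k \<zeta>) \<zeta> = e \<zeta> *s S n x \<zeta>" for \<zeta>
        unfolding S_def by (simp add: matrix_vector_scale vec_eq_iff sum_distrib_left mult_ac del: power_int_of_nat)
      ultimately have "0 \<le> Re (L2_inner (\<lambda>\<zeta>. \<Lambda> \<zeta> *v ?k \<zeta>) ?k) + (L2_norm ?l)\<^sup>2
        + 2 * Re (L2_inner (\<lambda>\<zeta>. U \<zeta> *v ?k \<zeta> - e \<zeta> *s S n x \<zeta>) ?l)"
        using I[OF kH, of ?l n] by simp
      then show ?thesis using L2_inner_diff_left[OF U_L2[OF kL] eL[OF SL] lL, of n x] by simp
    qed
    have "(\<lambda>n. L2_inner (\<lambda>\<zeta>. e \<zeta> *s S n x \<zeta>) ?l) \<longlonglongrightarrow> L2_inner (\<lambda>\<zeta>. e \<zeta> *s (F \<zeta> *v x)) ?l"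
    proof (rule L2_inner_tendsto[OF eL[OF SL] eL[OF FxL] lL])
      show "(\<lambda>n. L2_norm (\<lambda>\<zeta>. e \<zeta> *s S n x \<zeta> - e \<zeta> *s (F \<zeta> *v x))) \<longlonglongrightarrow> 0"
      proof (rule Lim_null_comparison)
        show "eventually (\<lambda>n. norm (L2_norm (\<lambda>\<zeta>. e \<zeta> *s S n x \<zeta> - e \<zeta> *s (F \<zeta> *v x))) \<le> b * L2_norm (\<lambda>\<zeta>. S n x \<zeta> - F \<zeta> *v x)) sequentially"
          unfolding vector_ssub_ldistrib[symmetric] real_norm_def abs_of_nonneg[OF L2_norm_nonneg]
          using e_norm[OF L2_diff[OF SL FxL]] by (intro always_eventually allI)
        show "(\<lambda>n. b * L2_norm (\<lambda>\<zeta>. S n x \<zeta> - F \<zeta> *v x)) \<longlonglongrightarrow> 0" using tendsto_mult_right_zero[OF S_lim] .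
      qed
    qed
    then have "(\<lambda>n. Re (L2_inner (\<lambda>\<zeta>. \<Lambda> \<zeta> *v ?k \<zeta>) ?k) + (L2_norm ?l)\<^sup>2
        + 2 * Re (L2_inner (\<lambda>\<zeta>. U \<zeta> *v ?k \<zeta>) ?l - L2_inner (\<lambda>\<zeta>. e \<zeta> *s S n x \<zeta>) ?l)) \<longlonglongrightarrow>
       Re (L2_inner (\<lambda>\<zeta>. \<Lambda> \<zeta> *v ?k \<zeta>) ?k) + (L2_norm ?l)\<^sup>2
        + 2 * Re (L2_inner (\<lambda>\<zeta>. U \<zeta> *v ?k \<zeta>) ?l - L2_inner (\<lambda>\<zeta>. e \<zeta> *s (F \<zeta> *v x)) ?l)"
      by (intro tendsto_intros)
    then have "0 \<le> Re (L2_inner (\<lambda>\<zeta>. \<Lambda> \<zeta> *v ?k \<zeta>) ?k) + (L2_norm ?l)\<^sup>2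
        + 2 * Re (L2_inner (\<lambda>\<zeta>. U \<zeta> *v ?k \<zeta>) ?l - L2_inner (\<lambda>\<zeta>. e \<zeta> *s (F \<zeta> *v x)) ?l)"
      using pos by (intro LIMSEQ_le_const) auto
    also have "\<dots> = Re (L2_inner (\<lambda>\<zeta>. \<Lambda> \<zeta> *v ?k \<zeta>) ?k + L2_inner ?l ?l
        + 2 * L2_inner (\<lambda>\<zeta>. U \<zeta> *v ?k \<zeta> - e \<zeta> *s (F \<zeta> *v x)) ?l)"
      using L2_inner_diff_left[OF U_L2[OF kL] eL[OF FxL] lL, of x] by (simp add: L2_inner_self)
    also have "\<dots> = Re (LINT \<zeta>|\<mu>. cdot (\<Lambda> \<zeta> *v ?k \<zeta>) (?k \<zeta>) + cdot (?l \<zeta>) (?l \<zeta>)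
        + 2 * cdot (U \<zeta> *v ?k \<zeta> - e \<zeta> *s (F \<zeta> *v x)) (?l \<zeta>))"
      unfolding L2_inner_cdot
      using integrable_cdot[OF L_L2[OF kL] kL] integrable_cdot[OF lL lL] integrable_cdot[OF L2_diff[OF U_L2[OF kL] eL[OF FxL]] lL]
      by simp
    also have "\<dots> = (LINT \<zeta>|\<mu>. Re (cdot (\<Lambda> \<zeta> *v ?k \<zeta>) (?k \<zeta>) + cdot (?l \<zeta>) (?l \<zeta>)
        + 2 * cdot (U \<zeta> *v ?k \<zeta> - e \<zeta> *s (F \<zeta> *v x)) (?l \<zeta>)))"
      using integrable_cdot[OF L_L2[OF kL] kL] integrable_cdot[OF lL lL] integrable_cdot[OF L2_diff[OF U_L2[OF kL] eL[OF FxL]] lL]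
      by (intro integral_Re[symmetric]) simp
    also have "\<dots> = (LINT \<zeta>|\<mu>. (norm (e \<zeta>))\<^sup>2 * G x y \<zeta>)"
    proof (rule Bochner_Integration.integral_cong[OF refl])
      fix \<zeta>
      have ee: "e \<zeta> * cnj (e \<zeta>) = of_real ((norm (e \<zeta>))\<^sup>2)" using complex_norm_square[of "e \<zeta>"] by simp
      have sc: "cdot (e \<zeta> *s p) (e \<zeta> *s q) = of_real ((norm (e \<zeta>))\<^sup>2) * cdot p q" for p q :: "complex ^ 'r"
        unfolding cdot_scale_left cdot_scale_right ee[symmetric] by (simp add: mult_ac)
      have "cdot (\<Lambda> \<zeta> *v ?k \<zeta>) (?k \<zeta>) + cdot (?l \<zeta>) (?l \<zeta>) + 2 * cdot (U \<zeta> *v ?k \<zeta> - e \<zeta> *s (F \<zeta> *v x)) (?l \<zeta>) =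
        of_real ((norm (e \<zeta>))\<^sup>2) * (cdot (\<Lambda> \<zeta> *v x) x + of_real ((norm y)\<^sup>2) + 2 * cdot (U \<zeta> *v x - F \<zeta> *v x) y)"
        unfolding matrix_vector_scale vector_ssub_ldistrib[symmetric] sc cdot_self[of y] by (simp add: distrib_left)
      then show "Re (cdot (\<Lambda> \<zeta> *v ?k \<zeta>) (?k \<zeta>) + cdot (?l \<zeta>) (?l \<zeta>) + 2 * cdot (U \<zeta> *v ?k \<zeta> - e \<zeta> *s (F \<zeta> *v x)) (?l \<zeta>))
        = (norm (e \<zeta>))\<^sup>2 * G x y \<zeta>"
        by (simp only: Re_scale) (simp add: G_def Re_scale[of 2, simplified])
    qed
    finally show "0 \<le> (LINT w|\<mu>. (norm (\<Sum>n<N. c n * w^n))\<^sup>2 * G x y w)" unfolding e_def .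
  qed
  note Gpos = this
  obtain D :: "(complex ^ 'r) set" where D: "countable D" "\<And>X. open X \<Longrightarrow> X \<noteq> {} \<Longrightarrow> \<exists>d\<in>D. d \<in> X"
    using countable_dense_setE by blast
  have D_seq: "\<exists>s. (\<forall>n. s n \<in> D) \<and> s \<longlonglongrightarrow> x" for x
  proof -
    have "x \<in> closure D"
      unfolding closure_approachable
    proof (intro allI impI)
      fix e :: real assume "0 < e"
      then show "\<exists>y\<in>D. dist y x < e" using D(2)[of "ball x e"] by (auto simp: dist_commute)
    qed
    then show ?thesis by (simp add: closure_sequential)
  qed
  have "AE \<zeta> in \<mu>. \<forall>x\<in>D. \<forall>y\<in>D. 0 \<le> G x y \<zeta>"
    unfolding AE_ball_countable[OF D(1)] using Gpos by blast
  then have bound: "AE \<zeta> in \<mu>. \<forall>x. (norm ((U \<zeta> - F \<zeta>) *v x))\<^sup>2 \<le> Re (cdot (\<Lambda> \<zeta> *v x) x)"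
  proof (rule AE_mp, intro AE_I2 impI allI)
    fix \<zeta> x assume pos: "\<forall>x\<in>D. \<forall>y\<in>D. 0 \<le> G x y \<zeta>"
    have all: "0 \<le> G x y \<zeta>" for x y
    proof -
      obtain s t where s: "\<And>n. s n \<in> D" "s \<longlonglongrightarrow> x" and t: "\<And>n. t n \<in> D" "t \<longlonglongrightarrow> y"
        using D_seq[of x] D_seq[of y] by blast
      have mv: "(\<lambda>n. A *v s n) \<longlonglongrightarrow> A *v x" for A :: "complex ^ 'r ^ 'r"
        by (rule bounded_linear.tendsto[OF bounded_linear_matrix s(2)])
      have cd: "(\<lambda>n. cdot (p n) (q n)) \<longlonglongrightarrow> cdot p' q'" if "p \<longlonglongrightarrow> p'" "q \<longlonglongrightarrow> q'" for p q and p' q' :: "complex ^ 'r"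
        unfolding cdot_def by (intro tendsto_intros that)
      have "(\<lambda>n. G (s n) (t n) \<zeta>) \<longlonglongrightarrow> G x y \<zeta>"
        unfolding G_def by (intro tendsto_intros tendsto_Re cd mv s t)
      then show ?thesis using pos s(1) t(1) by (intro LIMSEQ_le_const) auto
    qed
    let ?w = "U \<zeta> *v x - F \<zeta> *v x"
    have "cdot ?w (- ?w) = - of_real ((norm ?w)\<^sup>2)"
      using cdot_scale_right[of ?w "-1" ?w] by (simp add: cdot_self vector_sneg_minus1[symmetric])
    then have "Re (cdot ?w (- ?w)) = - (norm ?w)\<^sup>2" by simp
    then show "(norm ((U \<zeta> - F \<zeta>) *v x))\<^sup>2 \<le> Re (cdot (\<Lambda> \<zeta> *v x) x)"
      using all[of x "- ?w"] unfolding G_def by (simp add: matrix_vector_mult_diff_rdistrib del: norm_minus_cancel)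
        (simp add: norm_minus_commute)
  qed
  have "AE \<zeta> in \<mu>. \<forall>x. norm (F \<zeta> *v x) \<le> 2 * norm x"
    using bound U(2) \<Lambda>(3)
  proof eventually_elim
    case (elim \<zeta>)
    show ?case
    proof
      fix x
      have "(norm ((U \<zeta> - F \<zeta>) *v x))\<^sup>2 \<le> Re (cdot (\<Lambda> \<zeta> *v x) x)" using elim by blast
      also have "\<dots> \<le> norm (\<Lambda> \<zeta> *v x) * norm x" using norm_cdot_le complex_Re_le_cmod order_trans by blast
      also have "\<dots> \<le> (norm x)\<^sup>2" unfolding power2_eq_square using elim by (intro mult_right_mono) auto
      finally have "norm ((U \<zeta> - F \<zeta>) *v x) \<le> norm x" by (rule power2_le_imp_le) simp
      moreover have "norm (U \<zeta> *v x) \<le> norm x" using elim by blast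
      moreover have "F \<zeta> *v x = U \<zeta> *v x - (U \<zeta> - F \<zeta>) *v x" by (simp add: matrix_vector_mult_diff_rdistrib)
      ultimately show "norm (F \<zeta> *v x) \<le> 2 * norm x"
        using norm_triangle_ineq4[of "U \<zeta> *v x" "(U \<zeta> - F \<zeta>) *v x"] by simp
    qed
  qed
  then have "F \<in> Hinf" by (intro Hinf_of_columns F_meas) (simp add: Fax f(1))
  then show ?thesis using bound by blast
qed

section \<open>Bounded analytic matrix functions as multipliers\<close>

text \<open>
  On a circle of radius \<open>t < 1\<close> the negative coefficients vanish because of the power series; then
  dominated convergence.
\<close>

lemma boundary_fcoef_negative:
  assumes G: "G holomorphic_on ball 0 1" and b: "\<And>z. z \<in> ball 0 1 \<Longrightarrow> norm (G z) \<le> b"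
    and lim: "AE \<zeta> in \<mu>. ((\<lambda>t. G (of_real t * \<zeta>)) \<longlongrightarrow> f \<zeta>) (at_left 1)"
    and [measurable]: "f \<in> borel_measurable \<mu>" and n: "n < 0"
  shows "fcoef f n = 0"
proof -
  have meas: "(\<lambda>\<zeta>. G (of_real t * \<zeta>)) \<in> borel_measurable \<mu>" if "0 \<le> t" "t < 1" for t
  proof (rule continuous_circle_measurable)
    have "continuous_on (ball 0 1) G" by (rule holomorphic_on_imp_continuous_on[OF G])
    then show "continuous_on (sphere 0 1) (\<lambda>\<zeta>. G (of_real t * \<zeta>))"
      by (rule continuous_on_compose2) (use that in \<open>auto intro!: continuous_intros simp: norm_mult\<close>)
  qed
  have zero: "(LINT \<zeta>|\<mu>. \<zeta> powi (- n) * G (of_real t * \<zeta>)) = 0" if t: "0 < t" "t < 1" for t :: real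
  proof -
    define a where "a k = (deriv ^^ k) G 0 / fact k" for k
    have ser: "(\<lambda>k. a k * z ^ k) sums G z" if "norm z < 1" for z
      using holomorphic_power_series[OF G, of z] that unfolding a_def by simp
    have abs: "summable (\<lambda>k. norm (a k * of_real t ^ k))"
    proof (rule powser_insidea)
      show "summable (\<lambda>k. a k * complex_of_real ((1 + t)/2) ^ k)"
        using ser[of "complex_of_real ((1 + t)/2)"] t unfolding norm_of_real by (auto simp: sums_iff)
      show "norm (complex_of_real t) < norm (complex_of_real ((1 + t) / 2))" using t unfolding norm_of_real by simp
    qed
    define p where "p k \<zeta> = \<zeta> powi (- n) * (a k * (of_real t * \<zeta>) ^ k)" for k \<zeta>
    have p_norm: "norm (p k \<zeta>) = norm (a k * of_real t ^ k)" if "norm \<zeta> = 1" for k \<zeta>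
      using that unfolding p_def by (simp add: norm_mult norm_power norm_power_int power_mult_distrib)
    have p_meas: "p k \<in> borel_measurable \<mu>" for k unfolding p_def[abs_def] by measurable
    have p_int: "integrable \<mu> (p k)" for k
      by (rule circle.integrable_const_bound[OF _ p_meas, where B="norm (a k * of_real t ^ k)"])
         (rule AE_I2, use p_norm in simp)
    have "(\<lambda>k. LINT \<zeta>|\<mu>. p k \<zeta>) sums (LINT \<zeta>|\<mu>. (\<Sum>k. p k \<zeta>))"
    proof (rule sums_integral[OF p_int])
      show "AE \<zeta> in \<mu>. summable (\<lambda>k. norm (p k \<zeta>))"
        by (rule AE_I2) (use abs p_norm in simp)
      have "(LINT \<zeta>|\<mu>. norm (p k \<zeta>)) = norm (a k * of_real t ^ k)" for k
      proof -
        have "(LINT \<zeta>|\<mu>. norm (p k \<zeta>)) = (LINT \<zeta>|\<mu>. norm (a k * of_real t ^ k))"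
          by (rule Bochner_Integration.integral_cong) (use p_norm in auto)
        then show ?thesis using circle.prob_space by simp
      qed
      then show "summable (\<lambda>k. LINT \<zeta>|\<mu>. norm (p k \<zeta>))" using abs by simp
    qed
    moreover have "(LINT \<zeta>|\<mu>. p k \<zeta>) = 0" for k
    proof -
      have "(LINT \<zeta>|\<mu>. p k \<zeta>) = (LINT \<zeta>|\<mu>. (a k * of_real t ^ k) * \<zeta> powi (int k - n))"
      proof (rule Bochner_Integration.integral_cong[OF refl])
        fix \<zeta> assume "\<zeta> \<in> space \<mu>"
        then have "norm \<zeta> = 1" by simp
        from powi_add_circle[OF this, of "int k" "- n"]
        show "p k \<zeta> = (a k * of_real t ^ k) * \<zeta> powi (int k - n)"
          unfolding p_def by (simp add: power_mult_distrib mult_ac)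
      qed
      also have "\<dots> = (a k * of_real t ^ k) * (LINT \<zeta>|\<mu>. \<zeta> powi (int k - n))" by simp
      also have "\<dots> = 0" using n by (simp only: integral_circle_powi) simp
      finally show ?thesis .
    qed
    ultimately have "(LINT \<zeta>|\<mu>. (\<Sum>k. p k \<zeta>)) = 0" using sums_unique2[OF sums_zero] by simp
    moreover have "(LINT \<zeta>|\<mu>. (\<Sum>k. p k \<zeta>)) = (LINT \<zeta>|\<mu>. \<zeta> powi (- n) * G (of_real t * \<zeta>))"
    proof (rule Bochner_Integration.integral_cong[OF refl])
      fix \<zeta> assume "\<zeta> \<in> space \<mu>"
      then have "norm (of_real t * \<zeta>) < 1" using t by (simp add: norm_mult)
      from sums_mult[OF ser[OF this], of "\<zeta> powi (- n)"]
      show "(\<Sum>k. p k \<zeta>) = \<zeta> powi (- n) * G (of_real t * \<zeta>)"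
        unfolding p_def by (rule sums_unique[symmetric])
    qed
    ultimately show ?thesis by simp
  qed
  define t where "t k = 1 - 1 / real (Suc (Suc k))" for k
  have t01: "0 < t k" "t k < 1" for k by (simp_all add: t_def)
  have "t \<longlonglongrightarrow> 1 - 0" unfolding t_def
    by (intro tendsto_diff tendsto_const LIMSEQ_Suc[OF LIMSEQ_Suc[OF lim_1_over_n]])
  then have t_lim: "filterlim t (at_left 1) sequentially"
    unfolding filterlim_at using t01 by (auto simp: less_imp_neq)
  have "(\<lambda>k. LINT \<zeta>|\<mu>. \<zeta> powi (- n) * G (of_real (t k) * \<zeta>)) \<longlonglongrightarrow> (LINT \<zeta>|\<mu>. \<zeta> powi (- n) * f \<zeta>)"
  proof (rule integral_dominated_convergence[where w="\<lambda>_. b"])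
    show "AE \<zeta> in \<mu>. (\<lambda>k. \<zeta> powi (- n) * G (of_real (t k) * \<zeta>)) \<longlonglongrightarrow> \<zeta> powi (- n) * f \<zeta>"
      using lim by eventually_elim (intro tendsto_mult tendsto_const, rule filterlim_compose[OF _ t_lim])
    show "AE \<zeta> in \<mu>. norm (\<zeta> powi (- n) * G (of_real (t k) * \<zeta>)) \<le> b" for k
    proof (rule AE_I2)
      fix \<zeta> assume "\<zeta> \<in> space \<mu>"
      then have "norm \<zeta> = 1" by simp
      moreover have "norm (G (of_real (t k) * \<zeta>)) \<le> b"
        by (rule b) (use t01[of k] \<open>norm \<zeta> = 1\<close> in \<open>simp add: norm_mult\<close>)
      ultimately show "norm (\<zeta> powi (- n) * G (of_real (t k) * \<zeta>)) \<le> b"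
        by (simp only: norm_mult norm_powi_circle)
    qed
    show "(\<lambda>\<zeta>. \<zeta> powi (- n) * G (of_real (t k) * \<zeta>)) \<in> borel_measurable \<mu>" for k
      using meas[of "t k"] t01[of k] by (intro borel_measurable_times powi_measurable) auto
  qed measurable
  then show ?thesis using zero[OF t01] unfolding fcoef_def by (simp add: LIMSEQ_const_iff)
qed

text \<open>
  The entries of the product are bilinear products of a row of \<open>F\<close> and \<open>f\<close>.
\<close>

lemma Hinf_mult_H2:
  assumes F: "F \<in> Hinf" and f: "f \<in> Hge 0"
  shows "(\<lambda>\<zeta>. F \<zeta> *v f \<zeta>) \<in> Hge 0"
proof -
  have FL: "F \<in> Linf" using F by (simp add: Hinf_def)
  have [measurable]: "F \<in> borel_measurable \<mu>" by (rule LinfD(1)[OF FL])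
  have fL: "f \<in> L2" by (rule HgeD(1)[OF f])
  have FfL: "(\<lambda>\<zeta>. F \<zeta> *v f \<zeta>) \<in> L2" by (rule Linf_mult_L2[OF FL fL])
  obtain G where G: "\<And>i j. (\<lambda>z. G z $ i $ j) holomorphic_on ball 0 1" "bounded (G ` ball 0 1)"
    "AE \<zeta> in \<mu>. ((\<lambda>t. G (of_real t * \<zeta>)) \<longlongrightarrow> F \<zeta>) (at_left 1)"
    using F unfolding Hinf_def by blast
  obtain b where b: "\<And>z. z \<in> ball 0 1 \<Longrightarrow> norm (G z) \<le> b"
    using G(2) unfolding bounded_iff by blast
  have entry: "fcoef (\<lambda>\<zeta>. F \<zeta> $ i $ j) n = 0" if "n < 0" for i j n
  proof (rule boundary_fcoef_negative[OF G(1) _ _ _ that])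
    show "norm (G z $ i $ j) \<le> b" if "z \<in> ball 0 1" for z
      using b[OF that] Finite_Cartesian_Product.norm_nth_le[of "G z" i] Finite_Cartesian_Product.norm_nth_le[of "G z $ i" j] by simp
    show "AE \<zeta> in \<mu>. ((\<lambda>t. G (of_real t * \<zeta>) $ i $ j) \<longlongrightarrow> F \<zeta> $ i $ j) (at_left 1)"
      using G(3) by eventually_elim (intro tendsto_vec_nth)
  qed measurable
  obtain C where C: "0 \<le> C" "AE \<zeta> in \<mu>. \<forall>x. norm (F \<zeta> *v x) \<le> C * norm x" using LinfD(2)[OF FL] by blast
  have row: "(\<lambda>\<zeta>. \<chi> j. F \<zeta> $ i $ j) \<in> Hge 0" for i
  proof -
    have "AE \<zeta> in \<mu>. norm (\<chi> j. F \<zeta> $ i $ j) \<le> (\<Sum>j\<in>(UNIV::'a set). C)"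
      using C(2)
    proof eventually_elim
      case (elim \<zeta>)
      have "norm (\<chi> j. F \<zeta> $ i $ j) \<le> (\<Sum>j\<in>UNIV. norm (F \<zeta> $ i $ j))"
        by (simp add: norm_vec_def L2_set_le_sum)
      also have "\<dots> \<le> (\<Sum>j\<in>(UNIV::'a set). C)"
      proof (rule sum_mono)
        fix j
        have "F \<zeta> $ i $ j = (F \<zeta> *v axis j 1) $ i"
          by (simp add: matrix_vector_mult_def axis_def if_distrib[of "\<lambda>y. _ * y"] cong: if_cong)
        then have "norm (F \<zeta> $ i $ j) \<le> norm (F \<zeta> *v axis j 1)" by (simp add: Finite_Cartesian_Product.norm_nth_le)
        also have "\<dots> \<le> C * norm (axis j 1 :: complex ^ 'a)" using elim by blast
        finally show "norm (F \<zeta> $ i $ j) \<le> C" by (simp add: norm_axis_complex)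
      qed
      finally show ?case .
    qed
    then have "(\<lambda>\<zeta>. \<chi> j. F \<zeta> $ i $ j) \<in> L2" by (rule L2_bounded[rotated]) measurable
    then show ?thesis by (simp add: Hge_def vec_eq_iff fourier_coeff_nth entry)
  qed
  have "fourier_coeff (\<lambda>\<zeta>. F \<zeta> *v f \<zeta>) n $ i = 0" if "n < 0" for n i
    unfolding fourier_coeff_nth[OF FfL] using fcoef_product_zero[OF row[of i] f, of n] that
    by (simp add: matrix_vector_mult_def)
  then show ?thesis using FfL by (simp add: Hge_def vec_eq_iff)
qed

section \<open>Singular values\<close>

lemma sing_val_bdd: "bdd_below {op_norm (A - B) |B. rank B \<le> j}"
  by (rule bdd_belowI[of _ 0]) auto

lemma rank_zero: "rank (0 :: complex ^ 'n ^ 'm) = 0"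
proof -
  have "rows (0 :: complex ^ 'n ^ 'm) \<subseteq> {0}" by (auto simp: rows_def row_def vec_eq_iff)
  then show ?thesis unfolding row_rank_def_gen by (simp add: vec.dim_eq_0)
qed

lemma sing_val_nonempty: "{op_norm (A - B) |B. rank B \<le> j} \<noteq> {}"
  for A :: "complex ^ 'n ^ 'm"
proof -
  have "op_norm (A - 0) \<in> {op_norm (A - B) |B. rank B \<le> j}"
    unfolding mem_Collect_eq by (intro exI[of _ 0] conjI refl) (simp add: rank_zero)
  then show ?thesis by blast
qed

lemma sing_val_le: "rank B \<le> j \<Longrightarrow> sing_val j A \<le> op_norm (A - B)"
  unfolding sing_val_def by (rule cInf_lower[OF _ sing_val_bdd]) blast

lemma sing_val_le_op_norm: "sing_val j A \<le> op_norm A" for A :: "complex ^ 'n ^ 'm"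
  using sing_val_le[of "0 :: complex ^ 'n ^ 'm" j A] by (simp add: rank_zero)

lemma le_sing_val: "(\<And>B. rank B \<le> j \<Longrightarrow> c \<le> op_norm (A - B)) \<Longrightarrow> c \<le> sing_val j A" for A :: "complex ^ 'n ^ 'm"
  unfolding sing_val_def by (rule cInf_greatest[OF sing_val_nonempty]) blast

lemma op_norm_minus_commute: "op_norm (A - B) = op_norm (B - A)"
  using op_norm_uminus[of "A - B"] by simp

text \<open>
  Hence singular values are continuous, and measurable functions of the matrix.
\<close>

lemma sing_val_lipschitz: "sing_val j A \<le> sing_val j A' + op_norm (A - A')" for A A' :: "complex ^ 'n ^ 'm"
proof -
  have "sing_val j A - op_norm (A - A') \<le> sing_val j A'"
  proof (rule le_sing_val)
    fix B :: "complex ^ 'n ^ 'm" assume "rank B \<le> j"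
    then have "sing_val j A \<le> op_norm (A - B)" by (rule sing_val_le)
    also have "\<dots> \<le> op_norm (A - A') + op_norm (A' - B)" using op_norm_triangle[of "A - A'" "A' - B"] by simp
    finally show "sing_val j A - op_norm (A - A') \<le> op_norm (A' - B)" by simp
  qed
  then show ?thesis by simp
qed

lemma op_norm_le_norm: "op_norm A \<le> norm A * (\<Sum>i\<in>(UNIV::'m::finite set). \<Sum>j\<in>(UNIV::'n::finite set). 1)" for A :: "complex ^ 'n ^ 'm"
proof (rule op_norm_le)
  fix x :: "complex ^ 'n"
  have "norm (A *v x) \<le> (\<Sum>i\<in>UNIV. norm ((A *v x) $ i))" by (simp add: norm_vec_def L2_set_le_sum)
  also have "\<dots> \<le> (\<Sum>i\<in>(UNIV::'m set). \<Sum>j\<in>(UNIV::'n set). norm A * norm x)"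
  proof (rule sum_mono)
    fix i
    have "norm ((A *v x) $ i) \<le> (\<Sum>j\<in>UNIV. norm (A $ i $ j * x $ j))"
      unfolding matrix_vector_mult_def vec_lambda_beta by (rule norm_sum)
    also have "\<dots> \<le> (\<Sum>j\<in>(UNIV::'n set). norm A * norm x)"
    proof (rule sum_mono)
      fix j
      have "norm (A $ i $ j) \<le> norm A"
        using Finite_Cartesian_Product.norm_nth_le[of A i] Finite_Cartesian_Product.norm_nth_le[of "A $ i" j] by simp
      then show "norm (A $ i $ j * x $ j) \<le> norm A * norm x"
        unfolding norm_mult by (intro mult_mono Finite_Cartesian_Product.norm_nth_le) auto
    qed
    finally show "norm ((A *v x) $ i) \<le> (\<Sum>j\<in>(UNIV::'n set). norm A * norm x)" .
  qed
  also have "\<dots> = norm A * (\<Sum>i\<in>(UNIV::'m set). \<Sum>j\<in>(UNIV::'n set). 1) * norm x" by simp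
  finally show "norm (A *v x) \<le> norm A * (\<Sum>i\<in>(UNIV::'m set). \<Sum>j\<in>(UNIV::'n set). 1) * norm x" .
qed

lemma continuous_by_op_norm:
  fixes \<phi> :: "complex ^ 'n ^ 'm \<Rightarrow> real"
  assumes "\<And>A A'. \<phi> A \<le> \<phi> A' + op_norm (A - A')"
  shows "continuous_on UNIV \<phi>"
proof -
  define M where "M = (\<Sum>i\<in>(UNIV::'m set). \<Sum>j\<in>(UNIV::'n set). 1 :: real)"
  have "\<bar>\<phi> A - \<phi> A'\<bar> \<le> norm (A - A') * M" for A A'
  proof -
    have "\<bar>\<phi> A - \<phi> A'\<bar> \<le> op_norm (A - A')"
      using assms[of A A'] assms[of A' A] op_norm_minus_commute[of A A'] by (simp add: abs_le_iff)
    also have "\<dots> \<le> norm (A - A') * M" unfolding M_def by (rule op_norm_le_norm)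
    finally show ?thesis .
  qed
  note bound = this
  have "((\<lambda>A'. \<phi> A' - \<phi> A) \<longlongrightarrow> 0) (at A)" for A
  proof (rule Lim_null_comparison[where g="\<lambda>A'. norm (A' - A) * M"])
    have "((\<lambda>A'. norm (A' - A) * M) \<longlongrightarrow> norm (A - A) * M) (at A)" by (intro tendsto_intros)
    then show "((\<lambda>A'. norm (A' - A) * M) \<longlongrightarrow> 0) (at A)" by simp
    show "eventually (\<lambda>A'. norm (\<phi> A' - \<phi> A) \<le> norm (A' - A) * M) (at A)"
      unfolding real_norm_def by (intro always_eventually allI bound)
  qed
  then have "(\<phi> \<longlongrightarrow> \<phi> A) (at A)" for A by (rule LIM_zero_cancel)
  then show ?thesis by (simp add: continuous_on_def)
qed

lemma op_norm_measurable [measurable (raw)]: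
  fixes A :: "'a \<Rightarrow> complex ^ 'n ^ 'm"
  assumes "A \<in> borel_measurable M" shows "(\<lambda>x. op_norm (A x)) \<in> borel_measurable M"
proof -
  have "continuous_on UNIV (op_norm :: complex ^ 'n ^ 'm \<Rightarrow> real)"
    by (rule continuous_by_op_norm) (metis add.commute diff_add_cancel op_norm_triangle)
  from measurable_compose[OF assms borel_measurable_continuous_onI[OF this]] show ?thesis .
qed

lemma sing_val_measurable [measurable (raw)]:
  fixes A :: "'a \<Rightarrow> complex ^ 'n ^ 'm"
  assumes "A \<in> borel_measurable M" shows "(\<lambda>x. sing_val j (A x)) \<in> borel_measurable M"
proof -
  have "continuous_on UNIV (sing_val j :: complex ^ 'n ^ 'm \<Rightarrow> real)"
    by (rule continuous_by_op_norm) (rule sing_val_lipschitz)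
  from measurable_compose[OF assms borel_measurable_continuous_onI[OF this]] show ?thesis .
qed

lemma rank_less_iff: "rank B < CARD('n) \<longleftrightarrow> (\<exists>x. x \<noteq> 0 \<and> B *v x = 0)" for B :: "complex ^ 'n ^ 'm"
proof -
  have "rank B = CARD('n) \<longleftrightarrow> vec.span (rows B) = UNIV"
    unfolding row_rank_def_gen using vec.dim_eq_full[of "rows B"]
    by (simp add: vec.dimension_def card_cart_basis)
  also have "\<dots> \<longleftrightarrow> (\<forall>x. B *v x = 0 \<longrightarrow> x = 0)"
    unfolding matrix_left_invertible_span_rows_gen[symmetric] matrix_left_invertible_ker ..
  finally have "rank B = CARD('n) \<longleftrightarrow> (\<forall>x. B *v x = 0 \<longrightarrow> x = 0)" .
  moreover have "rank B \<le> CARD('n)"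
    unfolding row_rank_def_gen using vec.dim_subset_UNIV[of "rows B"] by (simp add: vec.dimension_def card_cart_basis)
  ultimately show ?thesis by auto
qed

lemma sing_val_unitary:
  fixes A :: "complex ^ 'n ^ 'n"
  assumes A: "unitary_matrix A" and j: "j < CARD('n)" shows "1 \<le> sing_val j A"
proof (rule le_sing_val)
  fix B :: "complex ^ 'n ^ 'n" assume "rank B \<le> j"
  then have "rank B < CARD('n)" using j by simp
  then obtain x where x: "x \<noteq> 0" "B *v x = 0" using rank_less_iff by blast
  have "norm x = norm ((A - B) *v x)" using unitary_norm[OF A, of x] x(2) by (simp add: matrix_vector_mult_diff_rdistrib)
  also have "\<dots> \<le> op_norm (A - B) * norm x" by (rule op_norm_bound)
  finally show "1 \<le> op_norm (A - B)" using x(1) by simp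
qed

lemma op_norm_unitary: "unitary_matrix A \<Longrightarrow> op_norm A \<le> 1"
  by (rule op_norm_le) (simp add: unitary_norm)

lemma one_le_op_norm_unitary:
  fixes A :: "complex ^ 'n ^ 'n"
  assumes "unitary_matrix A" shows "1 \<le> op_norm A"
  by (rule order_trans[OF sing_val_unitary[OF assms zero_less_card_finite] sing_val_le_op_norm])

text \<open>
  The matrix \<open>B\<close> agrees with \<open>W\<close> on the orthogonal complement of the unit vector \<open>x\<close> and annihilates \<open>x\<close>.
\<close>

lemma last_sing_val_le:
  fixes W :: "complex ^ 'n ^ 'n"
  assumes x: "norm x = 1" shows "sing_val (CARD('n) - 1) W \<le> norm (W *v x)"
proof -
  define B where "B = W - (\<chi> a b. (W *v x) $ a * cnj (x $ b))"
  have WB: "(W - B) *v y = cdot y x *s (W *v x)" for y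
  proof -
    have "W - B = (\<chi> a b. (W *v x) $ a * cnj (x $ b))" by (simp add: B_def)
    moreover have "(\<chi> a b. p $ a * cnj (x $ b)) *v y = cdot y x *s p" for p :: "complex ^ 'n"
      by (simp add: vec_eq_iff matrix_vector_mult_def cdot_def sum_distrib_right sum_distrib_left mult_ac)
    ultimately show ?thesis by simp
  qed
  have "B *v x = W *v x - (W - B) *v x" by (simp add: matrix_vector_mult_diff_rdistrib)
  also have "\<dots> = 0" unfolding WB using x by (simp add: cdot_self)
  finally have "B *v x = 0" .
  moreover have "x \<noteq> 0" using x by auto
  ultimately have "rank B < CARD('n)" using rank_less_iff by blast
  then have "sing_val (CARD('n) - 1) W \<le> op_norm (W - B)" by (intro sing_val_le) simp
  also have "\<dots> \<le> norm (W *v x)"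
  proof (rule op_norm_le)
    fix y
    have "norm ((W - B) *v y) = norm (cdot y x) * norm (W *v x)" unfolding WB by (rule norm_smult_vec)
    also have "\<dots> \<le> norm y * norm x * norm (W *v x)" by (intro mult_right_mono norm_cdot_le) simp
    finally show "norm ((W - B) *v y) \<le> norm (W *v x) * norm y" using x by (simp add: mult.commute)
  qed
  finally show ?thesis .
qed

section \<open>Dense range and trivial kernel\<close>

text \<open>The Toeplitz operator whose symbol is the adjoint of \<open>\<zeta> U(\<zeta>)\<close>.\<close>

abbreviation toeplitz_adj :: "(complex \<Rightarrow> complex ^ 'r ^ 'r) \<Rightarrow> (complex \<Rightarrow> complex ^ 'r) \<Rightarrow> (complex \<Rightarrow> complex ^ 'r)" where
  "toeplitz_adj U \<equiv> toeplitz (\<lambda>\<zeta>. map_matrix ((*) (cnj \<zeta>)) (adjoint_matrix (U \<zeta>)))"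

context
  fixes U :: "complex \<Rightarrow> complex ^ 'r ^ 'r"
  assumes U_meas [measurable]: "U \<in> borel_measurable \<mu>" and U_unitary: "AE \<zeta> in \<mu>. unitary_matrix (U \<zeta>)"
begin

lemma adjoint_Linf: "(\<lambda>\<zeta>. adjoint_matrix (U \<zeta>)) \<in> Linf"
  by (rule unitary_Linf) (use U_unitary in \<open>auto elim: eventually_mono simp: unitary_adjoint\<close>)

lemma adjoint_L2: "f \<in> L2 \<Longrightarrow> (\<lambda>\<zeta>. adjoint_matrix (U \<zeta>) *v f \<zeta>) \<in> L2"
  by (rule Linf_mult_L2[OF adjoint_Linf])

lemma zbar_adjoint:
  "norm \<zeta> = 1 \<Longrightarrow> map_matrix ((*) (cnj \<zeta>)) (adjoint_matrix (U \<zeta>)) *v x = \<zeta> powi (-1) *s (adjoint_matrix (U \<zeta>) *v x)"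
  unfolding map_matrix_mult_vec using cnj_base_powi_circle[of \<zeta> 1] by simp

lemma zbar_adjoint_L2:
  assumes f: "f \<in> L2" shows "(\<lambda>\<zeta>. map_matrix ((*) (cnj \<zeta>)) (adjoint_matrix (U \<zeta>)) *v f \<zeta>) \<in> L2"
proof (rule L2_cong_AE[OF L2_shift[OF adjoint_L2[OF f], of "-1"]])
  have [measurable]: "f \<in> borel_measurable \<mu>" using f by auto
  show "AE \<zeta> in \<mu>. \<zeta> powi (-1) *s (adjoint_matrix (U \<zeta>) *v f \<zeta>) = map_matrix ((*) (cnj \<zeta>)) (adjoint_matrix (U \<zeta>)) *v f \<zeta>"
    using AE_circle_norm by eventually_elim (simp only: zbar_adjoint)
  show "(\<lambda>\<zeta>. map_matrix ((*) (cnj \<zeta>)) (adjoint_matrix (U \<zeta>)) *v f \<zeta>) \<in> borel_measurable \<mu>" by measurable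
qed

lemma toeplitz_adj_Hge: "f \<in> L2 \<Longrightarrow> toeplitz_adj U f \<in> Hge 0"
  unfolding toeplitz_def by (rule P_plus_spec(1)[OF zbar_adjoint_L2])

lemma toeplitz_zU_Hge: "k \<in> L2 \<Longrightarrow> toeplitz U (\<lambda>\<zeta>. \<zeta> *s k \<zeta>) \<in> Hge 0"
  using toeplitz_Hge[OF U_meas U_unitary L2_shift[of k 1]] by simp

lemma toeplitz_adjoint_relation:
  assumes f: "f \<in> Hge 0" and k: "k \<in> Hge 0"
  shows "L2_inner (toeplitz_adj U f) k = L2_inner f (toeplitz U (\<lambda>\<zeta>. \<zeta> *s k \<zeta>))"
proof -
  have fL: "f \<in> L2" and kL: "k \<in> L2" using f k HgeD(1) by blast+
  have zkL: "(\<lambda>\<zeta>. \<zeta> *s k \<zeta>) \<in> L2" using L2_shift[OF kL, of 1] by simp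
  let ?a = "\<lambda>\<zeta>. map_matrix ((*) (cnj \<zeta>)) (adjoint_matrix (U \<zeta>)) *v f \<zeta>"
  let ?b = "\<lambda>\<zeta>. U \<zeta> *v (\<zeta> *s k \<zeta>)"
  have aL: "?a \<in> L2" by (rule zbar_adjoint_L2[OF fL])
  have bL: "?b \<in> L2" by (rule U_L2[OF U_meas U_unitary zkL])
  have "L2_inner ?a k - L2_inner (P_plus ?a) k = 0"
    using Hlt_orthogonal_Hge(1)[OF P_plus_spec(2)[OF aL] k]
      L2_inner_diff_left[OF aL HgeD(1)[OF P_plus_spec(1)[OF aL]] kL] by simp
  then have 1: "L2_inner (toeplitz_adj U f) k = L2_inner ?a k" unfolding toeplitz_def by simp
  have "L2_inner f ?b - L2_inner f (P_plus ?b) = 0"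
    using Hlt_orthogonal_Hge(2)[OF P_plus_spec(2)[OF bL] f]
      L2_inner_diff_right[OF bL HgeD(1)[OF P_plus_spec(1)[OF bL]] fL] by simp
  then have 2: "L2_inner f (toeplitz U (\<lambda>\<zeta>. \<zeta> *s k \<zeta>)) = L2_inner f ?b" unfolding toeplitz_def by simp
  have "cdot (map_matrix ((*) (cnj \<zeta>)) (adjoint_matrix (U \<zeta>)) *v f \<zeta>) (k \<zeta>) = cdot (f \<zeta>) (U \<zeta> *v (\<zeta> *s k \<zeta>))" for \<zeta>
    unfolding map_matrix_mult_vec matrix_vector_scale cdot_scale_left cdot_scale_right cdot_adjoint by simp
  then have "L2_inner ?a k = L2_inner f ?b" unfolding L2_inner_cdot by (simp only:)
  then show ?thesis using 1 2 by (simp only:)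
qed

lemma dense_range_iff_trivial_kernel:
  "dense_range H2 H2 (toeplitz (\<lambda>\<zeta>. map_matrix ((*) \<zeta>) (U \<zeta>))) \<longleftrightarrow> trivial_kernel H2 (toeplitz_adj U)"
proof
  assume dense: "dense_range H2 H2 (toeplitz (\<lambda>\<zeta>. map_matrix ((*) \<zeta>) (U \<zeta>)))"
  show "trivial_kernel H2 (toeplitz_adj U)"
    unfolding trivial_kernel_def
  proof (intro ballI impI)
    fix f :: "complex \<Rightarrow> complex ^ 'r" assume "f \<in> H2" and f0: "AE \<zeta> in \<mu>. toeplitz_adj U f \<zeta> = 0"
    then have f: "f \<in> Hge 0" by (simp add: H2_eq_Hge)
    have fL: "f \<in> L2" by (rule HgeD(1)[OF f])
    have orth: "L2_inner f (toeplitz U (\<lambda>\<zeta>. \<zeta> *s k \<zeta>)) = 0" if k: "k \<in> Hge 0" for k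
    proof -
      have "L2_inner (toeplitz_adj U f) k = L2_inner (\<lambda>_. 0) k"
        by (rule L2_inner_cong_AE) (use f0 HgeD(1)[OF k] HgeD(1)[OF toeplitz_adj_Hge[OF fL]] in auto)
      then show ?thesis using toeplitz_adjoint_relation[OF f k] by simp
    qed
    have "L2_norm f \<le> e" if e: "0 < e" for e
    proof -
      obtain k where k: "k \<in> Hge 0" "L2_norm (\<lambda>\<zeta>. toeplitz U (\<lambda>\<zeta>. \<zeta> *s k \<zeta>) \<zeta> - f \<zeta>) < e"
        using dense[unfolded dense_range_def toeplitz_zU, rule_format, of f e] f e by (auto simp: H2_eq_Hge)
      let ?T = "toeplitz U (\<lambda>\<zeta>. \<zeta> *s k \<zeta>)"
      have TL: "?T \<in> L2" by (rule HgeD(1)[OF toeplitz_zU_Hge[OF HgeD(1)[OF k(1)]]])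
      have "of_real ((L2_norm f)\<^sup>2) = - L2_inner f (\<lambda>\<zeta>. ?T \<zeta> - f \<zeta>)"
        using L2_inner_diff_right[OF TL fL fL] orth[OF k(1)] by (simp add: L2_inner_self)
      also have "norm \<dots> \<le> L2_norm f * L2_norm (\<lambda>\<zeta>. ?T \<zeta> - f \<zeta>)"
        using L2_Cauchy_Schwarz[OF fL L2_diff[OF TL fL]] by simp
      finally have "(L2_norm f)\<^sup>2 \<le> L2_norm f * L2_norm (\<lambda>\<zeta>. ?T \<zeta> - f \<zeta>)"
        by (simp only: norm_of_real abs_power2)
      also have "\<dots> \<le> L2_norm f * e" using k(2) by (intro mult_left_mono) auto
      finally show ?thesis using e by (cases "L2_norm f = 0") (auto simp: power2_eq_square less_le)
    qed
    then have "L2_norm f \<le> 0" by (metis dense_ge)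
    then have "L2_norm f = 0" using L2_norm_nonneg by (intro antisym)
    then show "AE \<zeta> in \<mu>. f \<zeta> = 0" using L2_norm_eq_0[OF fL] by simp
  qed
next
  assume triv: "trivial_kernel H2 (toeplitz_adj U)"
  show "dense_range H2 H2 (toeplitz (\<lambda>\<zeta>. map_matrix ((*) \<zeta>) (U \<zeta>)))"
    unfolding dense_range_def toeplitz_zU
  proof (intro ballI allI impI)
    fix g :: "complex \<Rightarrow> complex ^ 'r" and \<epsilon> :: real assume "g \<in> H2" and \<epsilon>: "0 < \<epsilon>"
    then have g: "g \<in> Hge 0" by (simp add: H2_eq_Hge)
    have gL: "g \<in> L2" by (rule HgeD(1)[OF g])
    let ?T = "\<lambda>k. toeplitz U (\<lambda>\<zeta>. \<zeta> *s k \<zeta>)"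
    \<comment> \<open>The range, saturated under equality almost everywhere. The component of \<open>g\<close> orthogonal to it lies in
        the kernel of the adjoint.\<close>
    define V where "V = {v \<in> L2. \<exists>k\<in>Hge 0. AE \<zeta> in \<mu>. v \<zeta> = ?T k \<zeta>}"
    have zL: "(\<lambda>\<zeta>. \<zeta> *s k \<zeta>) \<in> L2" if "k \<in> Hge 0" for k :: "complex \<Rightarrow> complex ^ 'r"
      using L2_shift[OF HgeD(1)[OF that], of 1] by simp
    have TV: "?T k \<in> V" if "k \<in> Hge 0" for k
      using that HgeD(1)[OF toeplitz_zU_Hge[OF HgeD(1)[OF that]]] by (auto simp: V_def)
    have "\<exists>g0\<in>L2. \<exists>s. (\<forall>n. s n \<in> V) \<and> (\<lambda>n. L2_norm (\<lambda>\<zeta>. s n \<zeta> - g0 \<zeta>)) \<longlonglongrightarrow> 0 \<and>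
     (\<forall>h\<in>V. L2_inner (\<lambda>\<zeta>. g \<zeta> - g0 \<zeta>) h = 0)"
    proof (rule L2_projection[OF _ _ _ _ gL])
      show "V \<subseteq> L2" by (auto simp: V_def)
      show "V \<noteq> {}" using TV[OF Hge_zero] by blast
      show "(\<lambda>\<zeta>. x \<zeta> + y \<zeta>) \<in> V" if xy: "x \<in> V" "y \<in> V" for x y
      proof -
        obtain k l where k: "k \<in> Hge 0" "AE \<zeta> in \<mu>. x \<zeta> = ?T k \<zeta>" and l: "l \<in> Hge 0" "AE \<zeta> in \<mu>. y \<zeta> = ?T l \<zeta>"
          using xy unfolding V_def by blast
        have "AE \<zeta> in \<mu>. ?T (\<lambda>\<zeta>. k \<zeta> + l \<zeta>) \<zeta> = ?T k \<zeta> + ?T l \<zeta>"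
          unfolding vector_add_ldistrib by (rule toeplitz_add[OF U_meas U_unitary zL[OF k(1)] zL[OF l(1)]])
        then have "AE \<zeta> in \<mu>. x \<zeta> + y \<zeta> = ?T (\<lambda>\<zeta>. k \<zeta> + l \<zeta>) \<zeta>"
          using k(2) l(2) by eventually_elim (simp only:)
        moreover have "(\<lambda>\<zeta>. x \<zeta> + y \<zeta>) \<in> L2" using xy by (intro L2_add) (auto simp: V_def)
        ultimately show ?thesis
          unfolding V_def mem_Collect_eq by (intro conjI bexI[OF _ Hge_add[OF k(1) l(1)]])
      qed
      show "(\<lambda>\<zeta>. c *s x \<zeta>) \<in> V" if xV: "x \<in> V" for c x
      proof -
        obtain k where k: "k \<in> Hge 0" "AE \<zeta> in \<mu>. x \<zeta> = ?T k \<zeta>" using xV unfolding V_def by blast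
        have "(\<lambda>\<zeta>. \<zeta> *s (c *s k \<zeta>)) = (\<lambda>\<zeta>. c *s (\<zeta> *s k \<zeta>))" by (simp add: vector_smult_assoc mult.commute)
        then have "AE \<zeta> in \<mu>. ?T (\<lambda>\<zeta>. c *s k \<zeta>) \<zeta> = c *s ?T k \<zeta>"
          using toeplitz_scale[OF U_meas U_unitary zL[OF k(1)], of c] by (simp only:)
        then have "AE \<zeta> in \<mu>. c *s x \<zeta> = ?T (\<lambda>\<zeta>. c *s k \<zeta>) \<zeta>" using k(2) by eventually_elim (simp only:)
        moreover have "(\<lambda>\<zeta>. c *s x \<zeta>) \<in> L2" using xV by (intro L2_scale) (auto simp: V_def)
        ultimately show ?thesis
          unfolding V_def mem_Collect_eq by (intro conjI bexI[OF _ Hge_scale[OF k(1)]])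
      qed
    qed
    then obtain g0 s where g0: "g0 \<in> L2" and s: "\<And>n. s n \<in> V" "(\<lambda>n. L2_norm (\<lambda>\<zeta>. s n \<zeta> - g0 \<zeta>)) \<longlonglongrightarrow> 0"
      and o: "\<And>h. h \<in> V \<Longrightarrow> L2_inner (\<lambda>\<zeta>. g \<zeta> - g0 \<zeta>) h = 0" by blast
    have sH: "s n \<in> Hge 0" for n
    proof -
      obtain k where k: "k \<in> Hge 0" "AE \<zeta> in \<mu>. s n \<zeta> = ?T k \<zeta>" and sL: "s n \<in> L2" using s(1)[of n] unfolding V_def by blast
      show ?thesis
        by (rule Hge_cong_AE[OF toeplitz_zU_Hge[OF HgeD(1)[OF k(1)]]]) (use k(2) sL in auto)
    qed
    have g0H: "g0 \<in> Hge 0" by (rule Hge_closed[OF sH g0 s(2)])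
    let ?d = "\<lambda>\<zeta>. g \<zeta> - g0 \<zeta>"
    have dH: "?d \<in> Hge 0" by (rule Hge_diff[OF g g0H])
    have AH: "toeplitz_adj U ?d \<in> Hge 0" by (rule toeplitz_adj_Hge[OF HgeD(1)[OF dH]])
    have "L2_inner (toeplitz_adj U ?d) (toeplitz_adj U ?d) = 0"
      using toeplitz_adjoint_relation[OF dH AH] o[OF TV[OF AH]] by simp
    then have "L2_norm (toeplitz_adj U ?d) = 0" by (simp add: L2_inner_self)
    then have "AE \<zeta> in \<mu>. toeplitz_adj U ?d \<zeta> = 0" using L2_norm_eq_0[OF HgeD(1)[OF AH]] by simp
    then have d0: "AE \<zeta> in \<mu>. ?d \<zeta> = 0" using triv dH unfolding trivial_kernel_def H2_eq_Hge by blast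
    have "eventually (\<lambda>n. L2_norm (\<lambda>\<zeta>. s n \<zeta> - g0 \<zeta>) < \<epsilon>) sequentially"
      using order_tendstoD(2)[OF s(2) \<epsilon>] .
    then obtain n where n: "L2_norm (\<lambda>\<zeta>. s n \<zeta> - g0 \<zeta>) < \<epsilon>" by (auto simp: eventually_sequentially)
    obtain k where k: "k \<in> Hge 0" "AE \<zeta> in \<mu>. s n \<zeta> = ?T k \<zeta>" using s(1)[of n] unfolding V_def by blast
    have "L2_norm (\<lambda>\<zeta>. ?T k \<zeta> - g \<zeta>) = L2_norm (\<lambda>\<zeta>. s n \<zeta> - g0 \<zeta>)"
    proof (rule L2_norm_cong_AE)
      show "AE \<zeta> in \<mu>. norm (?T k \<zeta> - g \<zeta>) = norm (s n \<zeta> - g0 \<zeta>)" using k(2) d0 by eventually_elim simp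
      show "(\<lambda>\<zeta>. ?T k \<zeta> - g \<zeta>) \<in> borel_measurable \<mu>"
        using L2_diff[OF HgeD(1)[OF toeplitz_zU_Hge[OF HgeD(1)[OF k(1)]]] gL] by auto
      show "(\<lambda>\<zeta>. s n \<zeta> - g0 \<zeta>) \<in> borel_measurable \<mu>" using L2_diff[OF HgeD(1)[OF sH] g0] by auto
    qed
    then have "L2_norm (\<lambda>\<zeta>. ?T k \<zeta> - g \<zeta>) < \<epsilon>" using n by (simp only:)
    then show "\<exists>f\<in>H2. L2_norm (\<lambda>\<zeta>. ?T f \<zeta> - g \<zeta>) < \<epsilon>" unfolding H2_eq_Hge using k(1) by (rule bexI)
  qed
qed

section \<open>Surjectivity forces the best approximant to vanish\<close>

text \<open>
  The conclusion says that \<open>F\<close> vanishes on a set of positive measure.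
\<close>

lemma approximant_zero:
  assumes surj: "\<And>g. g \<in> Hge 0 \<Longrightarrow> \<exists>k\<in>Hge 1. AE \<zeta> in \<mu>. toeplitz U k \<zeta> = g \<zeta>"
    and F: "F \<in> Hinf" and le: "AE \<zeta> in \<mu>. \<forall>x. norm ((U \<zeta> - F \<zeta>) *v x) \<le> norm x"
  shows "\<not> (AE \<zeta> in \<mu>. F \<zeta> \<noteq> 0)"
proof
  assume F0: "AE \<zeta> in \<mu>. F \<zeta> \<noteq> 0"
  have FL: "F \<in> Linf" using F by (simp add: Hinf_def)
  have [measurable]: "F \<in> borel_measurable \<mu>" by (rule LinfD(1)[OF FL])
  have "\<exists>k. k \<in> Hge 1 \<and> (AE \<zeta> in \<mu>. toeplitz U k \<zeta> = axis j 1)" for j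
    using surj[OF Hge_const[of "axis j 1"]] by blast
  from choice[OF allI[OF this]] obtain k where "\<forall>j. k j \<in> Hge 1 \<and> (AE \<zeta> in \<mu>. toeplitz U (k j) \<zeta> = axis j 1)" ..
  then have k: "k j \<in> Hge 1" "AE \<zeta> in \<mu>. toeplitz U (k j) \<zeta> = axis j 1" for j by blast+
  have kL: "k j \<in> L2" for j by (rule HgeD(1)[OF k(1)])
  define v where "v j = (\<lambda>\<zeta>. U \<zeta> *v k j \<zeta>)" for j
  have vL: "v j \<in> L2" for j unfolding v_def by (rule U_L2[OF U_meas U_unitary kL])
  have v_Hlt: "(\<lambda>\<zeta>. v j \<zeta> - axis j 1) \<in> Hlt 0" for j
  proof (rule Hlt_cong_AE)
    show "(\<lambda>\<zeta>. v j \<zeta> - toeplitz U (k j) \<zeta>) \<in> Hlt 0"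
      unfolding v_def toeplitz_def by (rule P_plus_spec(2)[OF U_L2[OF U_meas U_unitary kL]])
    show "AE \<zeta> in \<mu>. v j \<zeta> - toeplitz U (k j) \<zeta> = v j \<zeta> - axis j 1" using k(2)[of j] by eventually_elim simp
    show "(\<lambda>\<zeta>. v j \<zeta> - axis j 1) \<in> borel_measurable \<mu>" using L2_diff[OF vL L2_const] by auto
  qed
  have v_coeff: "fourier_coeff (v j) n = (if n = 0 then axis j 1 else 0)" if "0 \<le> n" for j n
    using HltD(2)[OF v_Hlt that, of j] by (simp add: fourier_coeff_diff[OF vL L2_const] fourier_coeff_const)
  \<comment> \<open>\<open>k j\<close> divided by \<open>\<zeta>\<close> is a maximizing vector of the Hankel operator, so the approximant annihilates it.\<close>
  have Fk: "AE \<zeta> in \<mu>. F \<zeta> *v k j \<zeta> = 0" for j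
  proof -
    define f where "f = (\<lambda>\<zeta>. \<zeta> powi (-1) *s k j \<zeta>)"
    have f: "f \<in> Hge 0" unfolding f_def using Hge_shift[OF k(1)[of j], of "-1"] by simp
    have fL: "f \<in> L2" by (rule HgeD(1)[OF f])
    have "v j \<in> Hlt 1" using vL v_coeff by (auto simp: Hlt_def)
    then have "(\<lambda>\<zeta>. \<zeta> powi (-1) *s v j \<zeta>) \<in> Hlt 0" using Hlt_shift[of "v j" 1 "-1"] by simp
    then have UfH: "(\<lambda>\<zeta>. U \<zeta> *v f \<zeta>) \<in> Hlt 0" unfolding f_def v_def matrix_vector_scale .
    have FfH: "(\<lambda>\<zeta>. F \<zeta> *v f \<zeta>) \<in> Hge 0" by (rule Hinf_mult_H2[OF F f])
    have FfL: "(\<lambda>\<zeta>. F \<zeta> *v f \<zeta>) \<in> L2" by (rule HgeD(1)[OF FfH])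
    have mFH: "(\<lambda>\<zeta>. (-1) *s (F \<zeta> *v f \<zeta>)) \<in> Hge 0" by (rule Hge_scale[OF FfH])
    have "(L2_norm (\<lambda>\<zeta>. F \<zeta> *v f \<zeta>))\<^sup>2 + (L2_norm (\<lambda>\<zeta>. U \<zeta> *v f \<zeta>))\<^sup>2
        = (L2_norm (\<lambda>\<zeta>. (-1) *s (F \<zeta> *v f \<zeta>) + U \<zeta> *v f \<zeta>))\<^sup>2"
      unfolding L2_norm_Hge_Hlt[OF mFH UfH] L2_norm_scale by simp
    also have "(\<lambda>\<zeta>. (-1) *s (F \<zeta> *v f \<zeta>) + U \<zeta> *v f \<zeta>) = (\<lambda>\<zeta>. (U \<zeta> - F \<zeta>) *v f \<zeta>)"
      by (simp add: matrix_vector_mult_diff_rdistrib vector_sneg_minus1[symmetric])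
    also have "(L2_norm (\<lambda>\<zeta>. (U \<zeta> - F \<zeta>) *v f \<zeta>))\<^sup>2 \<le> (L2_norm f)\<^sup>2"
    proof (rule power_mono[OF _ L2_norm_nonneg])
      show "L2_norm (\<lambda>\<zeta>. (U \<zeta> - F \<zeta>) *v f \<zeta>) \<le> L2_norm f"
    proof (rule Linf_norm_le[OF _ le fL])
      show "(\<lambda>\<zeta>. U \<zeta> - F \<zeta>) \<in> Linf"
        by (rule LinfI[where C=1]) (use le in auto)
    qed
    qed
    also have "L2_norm f = L2_norm (\<lambda>\<zeta>. U \<zeta> *v f \<zeta>)" by (rule unitary_L2_norm[OF U_meas U_unitary fL, symmetric])
    finally have "(L2_norm (\<lambda>\<zeta>. F \<zeta> *v f \<zeta>))\<^sup>2 \<le> 0" by simp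
    then have "AE \<zeta> in \<mu>. F \<zeta> *v f \<zeta> = 0" using L2_norm_eq_0[OF FfL] by simp
    then show ?thesis
      using AE_circle_norm
    proof eventually_elim
      case (elim \<zeta>)
      have "\<zeta> powi (-1) \<noteq> 0" using elim(2) by (auto simp: power_int_minus)
      then show ?case using elim(1) unfolding f_def matrix_vector_scale by (simp only: vector_mul_eq_0) simp
    qed
  qed
  \<comment> \<open>The conjugate of the matrix with columns \<open>v j\<close>, stored as one vector of \<open>H2\<close> so that all its entries
      are multiplied by the same scalar function.\<close>
  define N where "N = (\<lambda>\<zeta>. \<chi> p. cnj (v (snd p) \<zeta> $ fst p) :: complex ^ ('r \<times> 'r))"
  have [measurable]: "v j \<in> borel_measurable \<mu>" for j using vL by auto
  have N_meas [measurable]: "N \<in> borel_measurable \<mu>" unfolding N_def by measurable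
  have NL: "N \<in> L2"
  proof (rule L2_bound[OF N_meas])
    show "integrable \<mu> (\<lambda>\<zeta>. \<Sum>p\<in>(UNIV :: ('r \<times> 'r) set). (norm (v (snd p) \<zeta>))\<^sup>2)"
      by (intro Bochner_Integration.integrable_sum L2_integrable vL)
    show "AE \<zeta> in \<mu>. (norm (N \<zeta>))\<^sup>2 \<le> (\<Sum>p\<in>(UNIV :: ('r \<times> 'r) set). (norm (v (snd p) \<zeta>))\<^sup>2)"
      unfolding norm_vec_sq[of "N _"]
      by (intro AE_I2 sum_mono) (simp add: N_def Finite_Cartesian_Product.norm_nth_le power_mono)
  qed
  have N_coeff: "fourier_coeff N n $ p = cnj (fourier_coeff (v (snd p)) (- n) $ fst p)" for n p
  proof -
    have "fourier_coeff N n $ p = fcoef (\<lambda>\<zeta>. vcnj (v (snd p) \<zeta>) $ fst p) n"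
      unfolding fourier_coeff_nth[OF NL] by (simp add: N_def)
    also have "\<dots> = fourier_coeff (\<lambda>\<zeta>. vcnj (v (snd p) \<zeta>)) n $ fst p"
      by (rule fourier_coeff_nth[OF L2_vcnj[OF vL], symmetric])
    finally show ?thesis by (simp add: fourier_coeff_vcnj[OF vL])
  qed
  have NH: "N \<in> Hge 0" using NL by (simp add: Hge_def vec_eq_iff N_coeff v_coeff)
  have N0: "fourier_coeff N 0 $ p = (if fst p = snd p then 1 else 0)" for p
    unfolding N_coeff by (simp add: v_coeff axis_def)
  have "fourier_coeff N 0 \<noteq> 0"
  proof
    assume "fourier_coeff N 0 = 0"
    then show False using N0[of "(undefined, undefined)"] by simp
  qed
  then obtain g \<phi> c where g: "g \<in> Hge 0" "0 < c" "AE \<zeta> in \<mu>. norm (g \<zeta>) = c" "fourier_coeff g 0 = fourier_coeff N 0"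
    "AE \<zeta> in \<mu>. (\<lambda>n. \<phi> n \<zeta> *s N \<zeta>) \<longlonglongrightarrow> g \<zeta>"
    by (rule constant_modulus_multiple[OF NH])
  have gL: "g \<in> L2" by (rule HgeD(1)[OF g(1)])
  define M where "M \<zeta> = (\<chi> i j. g \<zeta> $ (i, j))" for \<zeta>
  have M_an: "bdd_analytic (\<lambda>\<zeta>. M \<zeta> $ i $ j)" for i j
    unfolding bdd_analytic_def
  proof (intro conjI allI impI exI[of _ c])
    show "(\<lambda>\<zeta>. M \<zeta> $ i $ j) \<in> borel_measurable \<mu>" unfolding M_def using gL by simp measurable
    show "AE \<zeta> in \<mu>. norm (M \<zeta> $ i $ j) \<le> c"
      using g(3) by eventually_elim (metis M_def Finite_Cartesian_Product.norm_nth_le vec_lambda_beta)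
    fix n :: int assume "n < 0"
    then show "fcoef (\<lambda>\<zeta>. M \<zeta> $ i $ j) n = 0"
      using HgeD(2)[OF g(1), of n] fourier_coeff_nth[OF gL, of n "(i, j)"] by (simp add: M_def)
  qed
  have "(LINT \<zeta>|\<mu>. det (M \<zeta>)) = det (\<chi> i j. LINT \<zeta>|\<mu>. M \<zeta> $ i $ j)"
    by (rule integral_det_bdd_analytic[OF M_an])
  also have "(\<chi> i j. LINT \<zeta>|\<mu>. M \<zeta> $ i $ j) = mat 1"
  proof -
    have "(LINT \<zeta>|\<mu>. M \<zeta> $ i $ j) = fourier_coeff g 0 $ (i, j)" for i j
      unfolding fourier_coeff_nth[OF gL] by (simp add: M_def fcoef_def)
    then show ?thesis by (simp add: g(4) N0 mat_def)
  qed
  finally have det1: "(LINT \<zeta>|\<mu>. det (M \<zeta>)) = 1" by simp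
  have all_k: "AE \<zeta> in \<mu>. \<forall>j\<in>UNIV. F \<zeta> *v k j \<zeta> = 0" by (intro AE_finite_allI finite Fk)
  have "AE \<zeta> in \<mu>. det (M \<zeta>) = 0"
    using F0 all_k g(5) U_unitary
  proof eventually_elim
    case (elim \<zeta>)
    show ?case
    proof (rule ccontr)
      assume d: "det (M \<zeta>) \<noteq> 0"
      \<comment> \<open>If \<open>det (M \<zeta>) \<noteq> 0\<close>, the matrix \<open>R\<close>, which annihilates the columns \<open>v j \<zeta>\<close>, is zero, and so
          is \<open>F \<zeta>\<close>.\<close>
      define R where "R = F \<zeta> ** adjoint_matrix (U \<zeta>)"
      have Rv: "R *v v j \<zeta> = 0" for j
      proof -
        have "R *v v j \<zeta> = F \<zeta> *v (adjoint_matrix (U \<zeta>) ** U \<zeta> *v k j \<zeta>)"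
          by (simp add: R_def v_def matrix_vector_mul_assoc matrix_mul_assoc)
        then show ?thesis using elim(2,4) by (simp add: unitary_matrix_def)
      qed
      have zero: "(\<Sum>l\<in>UNIV. cnj (R $ i $ l) * M \<zeta> $ l $ j) = 0" for i j
      proof -
        have "(\<lambda>n. \<Sum>l\<in>UNIV. cnj (R $ i $ l) * (\<phi> n \<zeta> *s N \<zeta>) $ (l, j)) \<longlonglongrightarrow> (\<Sum>l\<in>UNIV. cnj (R $ i $ l) * g \<zeta> $ (l, j))"
          by (intro tendsto_intros tendsto_vec_nth elim(3))
        moreover have "(\<Sum>l\<in>UNIV. cnj (R $ i $ l) * (\<phi> n \<zeta> *s N \<zeta>) $ (l, j)) = 0" for n
        proof -
          have "(\<Sum>l\<in>UNIV. cnj (R $ i $ l) * (\<phi> n \<zeta> *s N \<zeta>) $ (l, j)) = \<phi> n \<zeta> * cnj ((R *v v j \<zeta>) $ i)"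
            by (simp add: N_def matrix_vector_mult_def sum_distrib_left mult_ac)
          then show ?thesis by (simp add: Rv)
        qed
        ultimately show ?thesis by (simp add: M_def LIMSEQ_const_iff)
      qed
      define R' where "R' = map_matrix cnj R"
      have "R' ** M \<zeta> = 0"
        using zero by (simp add: vec_eq_iff matrix_matrix_mult_def R'_def)
      moreover obtain B where "M \<zeta> ** B = mat 1"
        using d invertible_det_nz[of "M \<zeta>"] unfolding invertible_def by blast
      moreover have "R' ** M \<zeta> ** B = R' ** (M \<zeta> ** B)" by (rule matrix_mul_assoc[symmetric])
      moreover have "(0 :: complex ^ 'r ^ 'r) ** B = 0" by (simp add: vec_eq_iff matrix_matrix_mult_def)
      ultimately have "R' = 0" by simp
      then have "R = 0" by (simp add: R'_def vec_eq_iff)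
      then have "F \<zeta> ** adjoint_matrix (U \<zeta>) ** U \<zeta> = 0" by (simp add: R_def)
      moreover have "(0 :: complex ^ 'r ^ 'r) ** U \<zeta> = 0" by (simp add: vec_eq_iff matrix_matrix_mult_def)
      moreover have "F \<zeta> ** adjoint_matrix (U \<zeta>) ** U \<zeta> = F \<zeta>"
        using elim(4) by (simp add: unitary_matrix_def matrix_mul_assoc[symmetric])
      ultimately have "F \<zeta> = 0" by simp
      then show False using elim(1) by simp
    qed
  qed
  then have "(LINT \<zeta>|\<mu>. det (M \<zeta>)) = 0" by (rule integral_eq_zero_AE)
  then show False using det1 by simp
qed

section \<open>Very badly approximable unitary-valued functions\<close>

lemma measurable_ereal_sing_val [measurable]:
  assumes [measurable]: "F \<in> borel_measurable \<mu>"
  shows "(\<lambda>\<zeta>. ereal (sing_val j (U \<zeta> - F \<zeta>))) \<in> borel_measurable \<mu>"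
    "(\<lambda>\<zeta>. ereal (op_norm (U \<zeta> - F \<zeta>))) \<in> borel_measurable \<mu>"
  by measurable

lemma esssup_le_iff:
  assumes "f \<in> borel_measurable \<mu>" shows "esssup \<mu> f \<le> (c::ereal) \<longleftrightarrow> (AE \<zeta> in \<mu>. f \<zeta> \<le> c)"
proof
  assume "esssup \<mu> f \<le> c"
  then show "AE \<zeta> in \<mu>. f \<zeta> \<le> c" using esssup_AE[of f \<mu>] by (auto elim: eventually_mono order_trans)
qed (rule esssup_I[OF assms])

lemma zero_Hinf: "(\<lambda>_. 0 :: complex ^ 'r ^ 'r) \<in> Hinf"
proof -
  have "(\<lambda>_. 0 :: complex ^ 'r ^ 'r) \<in> Linf" by (rule Linf_const)
  moreover have "bounded ((\<lambda>_. 0 :: complex ^ 'r ^ 'r) ` ball (0::complex) 1)"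
    by (rule bounded_subset[of "{0}"]) auto
  ultimately show ?thesis unfolding Hinf_def by (auto intro!: exI[of _ "\<lambda>_. 0"])
qed

lemma Hinf_measurable: "F \<in> Hinf \<Longrightarrow> F \<in> borel_measurable \<mu>"
  using LinfD(1) by (auto simp: Hinf_def)

lemma op_norm_le_one_iff: "op_norm A \<le> 1 \<longleftrightarrow> (\<forall>x. norm (A *v x) \<le> norm x)"
proof
  assume "op_norm A \<le> 1"
  then show "\<forall>x. norm (A *v x) \<le> norm x"
    using op_norm_bound[of A] mult_right_mono[of "op_norm A" 1 "norm _"] order_trans by fastforce
qed (simp add: op_norm_le)

lemma esssup_op_norm_U: "esssup \<mu> (\<lambda>\<zeta>. ereal (op_norm (U \<zeta> - 0))) \<le> 1"
  by (rule esssup_I) (use U_unitary in \<open>auto elim: eventually_mono simp: op_norm_unitary\<close>)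

lemma Omega_Hinf: "F \<in> Omega \<Phi> j \<Longrightarrow> F \<in> Omega \<Phi> 0"
  by (induction j) auto

text \<open>
  Where \<open>F\<close> vanishes, \<open>U - F\<close> is unitary and has all its singular values equal to one; so one is a lower
  bound for all the quantities to be minimized, and zero attains it.
\<close>

lemma very_badly_approximable_if:
  assumes zero: "\<And>F. F \<in> Hinf \<Longrightarrow> AE \<zeta> in \<mu>. op_norm (U \<zeta> - F \<zeta>) \<le> 1 \<Longrightarrow> \<not> (AE \<zeta> in \<mu>. F \<zeta> \<noteq> 0)"
  shows "very_badly_approximable U"
proof -
  \<comment> \<open>The functional \<open>s\<close> stands for the operator norm or one of the singular values.\<close>
  have low: "1 \<le> esssup \<mu> (\<lambda>\<zeta>. ereal (s (U \<zeta> - F \<zeta>)))"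
    if F: "F \<in> Hinf" "AE \<zeta> in \<mu>. op_norm (U \<zeta> - F \<zeta>) \<le> 1"
      and s: "\<And>A. unitary_matrix A \<Longrightarrow> 1 \<le> s A"
    for F and s :: "complex ^ 'r ^ 'r \<Rightarrow> real"
  proof (rule ccontr)
    let ?f = "\<lambda>\<zeta>. ereal (s (U \<zeta> - F \<zeta>))"
    assume "\<not> 1 \<le> esssup \<mu> ?f"
    then have "esssup \<mu> ?f < 1" by simp
    then have "AE \<zeta> in \<mu>. s (U \<zeta> - F \<zeta>) < 1"
      using esssup_AE[of ?f \<mu>] by (auto elim!: eventually_mono dest: le_less_trans)
    then have "AE \<zeta> in \<mu>. F \<zeta> \<noteq> 0"
      using U_unitary
    proof eventually_elim
      case (elim \<zeta>)
      show ?case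
      proof
        assume "F \<zeta> = 0"
        then show False using elim(1) s[OF elim(2)] by simp
      qed
    qed
    then show False using zero[OF F] by blast
  qed
  have U1: "AE \<zeta> in \<mu>. op_norm (U \<zeta> - 0) \<le> 1"
    using U_unitary by eventually_elim (simp add: op_norm_unitary)
  have Om0: "(\<lambda>_. 0) \<in> Omega U 0"
    unfolding Omega.simps mem_Collect_eq
  proof (intro conjI ballI zero_Hinf)
    fix G assume G: "G \<in> (Hinf :: (complex \<Rightarrow> complex ^ 'r ^ 'r) set)"
    show "esssup \<mu> (\<lambda>\<zeta>. ereal (op_norm (U \<zeta> - 0))) \<le> esssup \<mu> (\<lambda>\<zeta>. ereal (op_norm (U \<zeta> - G \<zeta>)))"
    proof (rule ccontr)
      assume "\<not> ?thesis"
      then have lt: "esssup \<mu> (\<lambda>\<zeta>. ereal (op_norm (U \<zeta> - G \<zeta>))) < 1"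
        using esssup_op_norm_U by (auto simp: not_le intro: less_le_trans)
      then have "AE \<zeta> in \<mu>. op_norm (U \<zeta> - G \<zeta>) \<le> 1"
        using esssup_AE[of "\<lambda>\<zeta>. ereal (op_norm (U \<zeta> - G \<zeta>))" \<mu>]
        by (auto elim!: eventually_mono dest: le_less_trans simp: less_imp_le)
      then have "1 \<le> esssup \<mu> (\<lambda>\<zeta>. ereal (op_norm (U \<zeta> - G \<zeta>)))"
        by (rule low[OF G]) (rule one_le_op_norm_unitary)
      then show False using lt by simp
    qed
  qed
  have "(\<lambda>_. 0) \<in> Omega U j" if "j < CARD('r)" for j
    using that
  proof (induction j)
    case (Suc j)
    have "esssup \<mu> (\<lambda>\<zeta>. ereal (sing_val (Suc j) (U \<zeta> - 0))) \<le> esssup \<mu> (\<lambda>\<zeta>. ereal (sing_val (Suc j) (U \<zeta> - G \<zeta>)))"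
      if G: "G \<in> Omega U j" for G
    proof -
      have "G \<in> Omega U 0" by (rule Omega_Hinf[OF G])
      then have GH: "G \<in> Hinf" and "esssup \<mu> (\<lambda>\<zeta>. ereal (op_norm (U \<zeta> - G \<zeta>))) \<le> esssup \<mu> (\<lambda>\<zeta>. ereal (op_norm (U \<zeta> - 0)))"
        using zero_Hinf by auto
      then have "esssup \<mu> (\<lambda>\<zeta>. ereal (op_norm (U \<zeta> - G \<zeta>))) \<le> 1" using esssup_op_norm_U order_trans by blast
      then have "AE \<zeta> in \<mu>. op_norm (U \<zeta> - G \<zeta>) \<le> 1"
        using esssup_le_iff[OF measurable_ereal_sing_val(2)[OF Hinf_measurable[OF GH]], of 1] by simp
      then have "1 \<le> esssup \<mu> (\<lambda>\<zeta>. ereal (sing_val (Suc j) (U \<zeta> - G \<zeta>)))"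
        by (rule low[OF GH]) (rule sing_val_unitary[OF _ Suc.prems])
      moreover have "esssup \<mu> (\<lambda>\<zeta>. ereal (sing_val (Suc j) (U \<zeta> - 0))) \<le> 1"
      proof (rule esssup_I)
        show "(\<lambda>\<zeta>. ereal (sing_val (Suc j) (U \<zeta> - 0))) \<in> borel_measurable \<mu>"
          by (rule measurable_ereal_sing_val(1)) simp
        show "AE \<zeta> in \<mu>. ereal (sing_val (Suc j) (U \<zeta> - 0)) \<le> 1"
          using U1 by eventually_elim (use sing_val_le_op_norm order_trans in fastforce)
      qed
      ultimately show ?thesis by (rule order_trans[rotated])
    qed
    then show ?case using Suc by simp
  qed (rule Om0)
  then show ?thesis unfolding very_badly_approximable_def superoptimal_def by simp
qed

text \<open>
  If zero is superoptimal, the optimal values are all one, so \<open>F\<close> survives every stage but the last, where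
  it does better than zero. For \<open>CARD('r) = 1\<close> the last stage is that of the operator norm.
\<close>

lemma not_very_badly_approximable:
  assumes F: "F \<in> Hinf" and le: "AE \<zeta> in \<mu>. op_norm (U \<zeta> - F \<zeta>) \<le> 1"
    and q: "q < 1" "AE \<zeta> in \<mu>. sing_val (CARD('r) - 1) (U \<zeta> - F \<zeta>) \<le> q"
  shows "\<not> very_badly_approximable U"
proof
  assume "very_badly_approximable U"
  then have 0: "(\<lambda>_. 0) \<in> Omega U (CARD('r) - 1)" by (simp add: very_badly_approximable_def superoptimal_def)
  have Fm [measurable]: "F \<in> borel_measurable \<mu>" by (rule Hinf_measurable[OF F])
  have lowU: "1 \<le> esssup \<mu> (\<lambda>\<zeta>. ereal (s (U \<zeta> - 0)))" if s: "\<And>A. unitary_matrix A \<Longrightarrow> 1 \<le> s A"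
    for s :: "complex ^ 'r ^ 'r \<Rightarrow> real"
  proof -
    have "AE \<zeta> in \<mu>. 1 \<le> esssup \<mu> (\<lambda>\<zeta>. ereal (s (U \<zeta> - 0)))"
      using esssup_AE[of "\<lambda>\<zeta>. ereal (s (U \<zeta> - 0))" \<mu>] U_unitary
    proof eventually_elim
      case (elim \<zeta>)
      have "1 \<le> ereal (s (U \<zeta> - 0))" using s[OF elim(2)] by simp
      also note elim(1)
      finally show ?case .
    qed
    then show ?thesis by simp
  qed
  have Fle: "esssup \<mu> (\<lambda>\<zeta>. ereal (op_norm (U \<zeta> - F \<zeta>))) \<le> 1"
    by (rule esssup_I[OF measurable_ereal_sing_val(2)[OF Fm]]) (use le in simp)
  have Fj: "esssup \<mu> (\<lambda>\<zeta>. ereal (sing_val j (U \<zeta> - F \<zeta>))) \<le> 1" for j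
  proof (rule esssup_I[OF measurable_ereal_sing_val(1)[OF Fm]])
    show "AE \<zeta> in \<mu>. ereal (sing_val j (U \<zeta> - F \<zeta>)) \<le> 1"
      using le by eventually_elim (use sing_val_le_op_norm order_trans in fastforce)
  qed
  have Om: "(\<lambda>_. 0) \<in> Omega U j \<Longrightarrow> j < CARD('r) \<Longrightarrow> F \<in> Omega U j" for j
  proof (induction j)
    case 0
    have "esssup \<mu> (\<lambda>\<zeta>. ereal (op_norm (U \<zeta> - F \<zeta>))) \<le> esssup \<mu> (\<lambda>\<zeta>. ereal (op_norm (U \<zeta> - G \<zeta>)))" if G: "G \<in> Hinf" for G
    proof -
      have "1 \<le> esssup \<mu> (\<lambda>\<zeta>. ereal (op_norm (U \<zeta> - 0)))" by (rule lowU) (rule one_le_op_norm_unitary)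
      also have "\<dots> \<le> esssup \<mu> (\<lambda>\<zeta>. ereal (op_norm (U \<zeta> - G \<zeta>)))" using 0 G by simp
      finally show ?thesis using Fle order_trans by blast
    qed
    then show ?case using F by simp
  next
    case (Suc j)
    have "esssup \<mu> (\<lambda>\<zeta>. ereal (sing_val (Suc j) (U \<zeta> - F \<zeta>))) \<le> esssup \<mu> (\<lambda>\<zeta>. ereal (sing_val (Suc j) (U \<zeta> - G \<zeta>)))"
      if G: "G \<in> Omega U j" for G
    proof -
      have "1 \<le> esssup \<mu> (\<lambda>\<zeta>. ereal (sing_val (Suc j) (U \<zeta> - 0)))"
        by (rule lowU) (rule sing_val_unitary[OF _ Suc.prems(2)])
      also have "\<dots> \<le> esssup \<mu> (\<lambda>\<zeta>. ereal (sing_val (Suc j) (U \<zeta> - G \<zeta>)))" using Suc.prems(1) G by simp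
      finally show ?thesis using Fj order_trans by blast
    qed
    moreover have "F \<in> Omega U j" using Suc by simp
    ultimately show ?case by simp
  qed
  have last: "esssup \<mu> (\<lambda>\<zeta>. ereal (sing_val (CARD('r) - 1) (U \<zeta> - F \<zeta>))) \<le> ereal q"
    by (rule esssup_I[OF measurable_ereal_sing_val(1)[OF Fm]]) (use q(2) in simp)
  have cd: "CARD('r) - 1 < CARD('r)" by simp
  show False
  proof (cases "CARD('r) - 1")
    case 0
    have "sing_val 0 A = op_norm A" for A :: "complex ^ 'r ^ 'r"
    proof (rule antisym[OF sing_val_le_op_norm le_sing_val])
      fix B :: "complex ^ 'r ^ 'r" assume "rank B \<le> 0"
      then have "rows B \<subseteq> {0}" by (simp add: row_rank_def_gen vec.dim_eq_0)
      then have "row i B = 0" for i unfolding rows_def by blast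
      then have "B = 0" by (simp add: row_def vec_eq_iff)
      then show "op_norm A \<le> op_norm (A - B)" by simp
    qed
    then have "esssup \<mu> (\<lambda>\<zeta>. ereal (op_norm (U \<zeta> - F \<zeta>))) \<le> ereal q" using last 0 by simp
    moreover have "esssup \<mu> (\<lambda>\<zeta>. ereal (op_norm (U \<zeta> - 0))) \<le> esssup \<mu> (\<lambda>\<zeta>. ereal (op_norm (U \<zeta> - F \<zeta>)))"
      using Omega_Hinf[OF \<open>(\<lambda>_. 0) \<in> Omega U (CARD('r) - 1)\<close>] F by simp
    moreover have "1 \<le> esssup \<mu> (\<lambda>\<zeta>. ereal (op_norm (U \<zeta> - 0)))" by (rule lowU) (rule one_le_op_norm_unitary)
    ultimately have "1 \<le> ereal q" using order_trans by blast
    then show False using q(1) by simp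
  next
    case (Suc j)
    have zero_Suc: "(\<lambda>_. 0) \<in> Omega U (Suc j)" using 0 unfolding Suc .
    then have "(\<lambda>_. 0) \<in> Omega U j" by simp
    then have "F \<in> Omega U j" by (rule Om) (use Suc cd in simp)
    then have "esssup \<mu> (\<lambda>\<zeta>. ereal (sing_val (Suc j) (U \<zeta> - 0))) \<le> esssup \<mu> (\<lambda>\<zeta>. ereal (sing_val (Suc j) (U \<zeta> - F \<zeta>)))"
      using zero_Suc by simp
    also have "\<dots> \<le> ereal q" using last unfolding Suc .
    finally have le_q: "esssup \<mu> (\<lambda>\<zeta>. ereal (sing_val (Suc j) (U \<zeta> - 0))) \<le> ereal q" .
    have "1 \<le> esssup \<mu> (\<lambda>\<zeta>. ereal (sing_val (Suc j) (U \<zeta> - 0)))"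
      by (rule lowU) (rule sing_val_unitary, assumption, use Suc cd in simp)
    then have "1 \<le> ereal q" using le_q order_trans by blast
    then show False using q(1) by simp
  qed
qed

text \<open>
  The function \<open>w = U\<^sup>* f\<close> provides a direction in which the Hankel operator can be dominated by less than
  the identity: the kernel of \<open>T\<close>, on which the Hankel operator is isometric, is orthogonal to it.
\<close>

lemma kernel_gives_approximant:
  assumes ess: "ess_norm H2 H2_minus (hankel U) < 1"
    and f: "f \<in> Hge 0" and Af: "AE \<zeta> in \<mu>. toeplitz_adj U f \<zeta> = 0" and fnz: "\<not> (AE \<zeta> in \<mu>. f \<zeta> = 0)"
  obtains F q where "F \<in> Hinf" "q < 1" "AE \<zeta> in \<mu>. op_norm (U \<zeta> - F \<zeta>) \<le> 1"
    "AE \<zeta> in \<mu>. sing_val (CARD('r) - 1) (U \<zeta> - F \<zeta>) \<le> q"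
proof -
  have fL: "f \<in> L2" by (rule HgeD(1)[OF f])
  have [measurable]: "f \<in> borel_measurable \<mu>" using fL by auto
  define w where "w = (\<lambda>\<zeta>. adjoint_matrix (U \<zeta>) *v f \<zeta>)"
  have wL: "w \<in> L2" unfolding w_def by (rule adjoint_L2[OF fL])
  have [measurable]: "w \<in> borel_measurable \<mu>" using wL by auto
  have zw: "(\<lambda>\<zeta>. \<zeta> powi (-1) *s w \<zeta>) \<in> Hlt 0"
  proof (rule Hlt_cong_AE[OF P_plus_spec(2)[OF zbar_adjoint_L2[OF fL]]])
    show "AE \<zeta> in \<mu>. map_matrix ((*) (cnj \<zeta>)) (adjoint_matrix (U \<zeta>)) *v f \<zeta> -
        P_plus (\<lambda>\<zeta>. map_matrix ((*) (cnj \<zeta>)) (adjoint_matrix (U \<zeta>)) *v f \<zeta>) \<zeta> = \<zeta> powi (-1) *s w \<zeta>"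
      using Af AE_circle_norm unfolding toeplitz_def
    proof eventually_elim
      case (elim \<zeta>)
      show ?case unfolding elim(1) zbar_adjoint[OF elim(2)] w_def by simp
    qed
  qed measurable
  have "(\<lambda>\<zeta>. \<zeta> powi 1 *s (\<zeta> powi (-1) *s w \<zeta>)) \<in> Hlt 1" using Hlt_shift[OF zw, of 1] by simp
  then have wH: "w \<in> Hlt 1"
  proof (rule Hlt_cong_AE)
    show "AE \<zeta> in \<mu>. \<zeta> powi 1 *s (\<zeta> powi (-1) *s w \<zeta>) = w \<zeta>"
      using AE_circle_norm
    proof eventually_elim
      case (elim \<zeta>)
      then have "\<zeta> \<noteq> 0" by auto
      then show ?case by (simp add: vector_smult_assoc power_int_minus)
    qed
  qed measurable
  have hH: "(\<lambda>\<zeta>. vcnj (w \<zeta>)) \<in> Hge 0"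
    using HltD(2)[OF wH] by (auto simp: Hge_def L2_vcnj[OF wL] fourier_coeff_vcnj[OF wL] vec_eq_iff)
  have w_nz: "AE \<zeta> in \<mu>. w \<zeta> \<noteq> 0"
    using H2_nonzero_AE[OF f fnz] U_unitary
  proof eventually_elim
    case (elim \<zeta>)
    have "norm (w \<zeta>) = norm (f \<zeta>)" unfolding w_def by (rule unitary_norm[OF unitary_adjoint[OF elim(2)]])
    then show ?case using elim(1) by auto
  qed
  \<comment> \<open>Kernel vectors of \<open>toeplitz U\<close> are pointwise orthogonal to \<open>w\<close>: their product with \<open>w\<close> is both
      analytic and antianalytic without constant term.\<close>
  have ker_orth: "AE \<zeta> in \<mu>. cdot (e \<zeta>) (w \<zeta>) = 0" if e: "e \<in> Hge 0" and Te: "AE \<zeta> in \<mu>. toeplitz U e \<zeta> = 0" for e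
  proof (rule fourier_unique)
    have eL: "e \<in> L2" by (rule HgeD(1)[OF e])
    have UeL: "(\<lambda>\<zeta>. U \<zeta> *v e \<zeta>) \<in> L2" by (rule U_L2[OF U_meas U_unitary eL])
    show "integrable \<mu> (\<lambda>\<zeta>. cdot (e \<zeta>) (w \<zeta>))" by (rule integrable_cdot[OF eL wL])
    have UeH: "(\<lambda>\<zeta>. U \<zeta> *v e \<zeta>) \<in> Hlt 0"
      by (rule Hlt_cong_AE[OF P_plus_spec(2)[OF UeL]])
         (use Te UeL in \<open>auto elim: eventually_mono simp: toeplitz_def\<close>)
    fix n :: int
    show "fcoef (\<lambda>\<zeta>. cdot (e \<zeta>) (w \<zeta>)) n = 0"
    proof (cases "n < 0")
      case True
      then show ?thesis
        using fcoef_product_zero[OF e hH, of n] by (simp add: cdot_def)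
    next
      case False
      have "fcoef (\<lambda>\<zeta>. cdot (e \<zeta>) (w \<zeta>)) n = L2_inner (\<lambda>\<zeta>. U \<zeta> *v e \<zeta>) (\<lambda>\<zeta>. \<zeta> powi n *s f \<zeta>)"
        unfolding fcoef_def L2_inner_cdot w_def cdot_adjoint[symmetric] cdot_scale_right
        by (rule Bochner_Integration.integral_cong) (auto simp: cnj_base_powi_circle)
      also have "\<dots> = 0"
        by (rule Hlt_orthogonal_Hge(1)[OF UeH]) (use Hge_mono[OF _ Hge_shift[OF f, of n], of 0] False in simp)
      finally show ?thesis .
    qed
  qed
  define u where "u = (\<lambda>\<zeta>. complex_of_real (inverse (norm (w \<zeta>))) *s w \<zeta>)"
  have u_meas [measurable]: "u \<in> borel_measurable \<mu>" unfolding u_def by measurable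
  have u_le: "norm (u \<zeta>) \<le> 1" for \<zeta>
    unfolding u_def norm_smult_vec norm_of_real by (cases "w \<zeta> = 0") auto
  have u_one: "AE \<zeta> in \<mu>. norm (u \<zeta>) = 1"
    using w_nz by eventually_elim (simp only: u_def norm_smult_vec norm_of_real, simp)
  have cdot_u: "cdot x (u \<zeta>) = of_real (inverse (norm (w \<zeta>))) * cdot x (w \<zeta>)" for x \<zeta>
    unfolding u_def cdot_scale_right by simp
  obtain C where C: "0 < C" "\<And>k. k \<in> Hge 0 \<Longrightarrow> \<exists>e\<in>Hge 0. (AE \<zeta> in \<mu>. toeplitz U e \<zeta> = 0) \<and>
     L2_norm (\<lambda>\<zeta>. k \<zeta> - e \<zeta>) \<le> C * L2_norm (toeplitz U k)"
    using toeplitz_bounded_below[OF U_meas U_unitary ess, of 0] by auto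
  \<comment> \<open>Since \<open>u\<close> is orthogonal to the kernel vector \<open>e\<close> close to \<open>k\<close>, the norm of \<open>\<langle>k, u\<rangle>\<close> is at most
      \<open>\<parallel>k - e\<parallel> \<le> C \<parallel>T k\<parallel>\<close>; hence \<open>\<delta> \<le> 1 / C\<^sup>2\<close> makes \<open>\<delta> \<parallel>\<langle>k, u\<rangle>\<parallel>\<^sup>2\<close> at most
      \<open>\<parallel>T k\<parallel>\<^sup>2 = \<parallel>k\<parallel>\<^sup>2 - \<parallel>H k\<parallel>\<^sup>2\<close>.\<close>
  define \<delta> where "\<delta> = min 1 (1 / C\<^sup>2)"
  have \<delta>: "0 < \<delta>" "\<delta> \<le> 1" "\<delta> * C\<^sup>2 \<le> 1" using C(1) by (auto simp: \<delta>_def min_def field_simps)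
  define \<Lambda> where "\<Lambda> \<zeta> = (\<chi> a b. (if a = b then 1 else 0) - of_real \<delta> * (u \<zeta> $ a * cnj (u \<zeta> $ b)))" for \<zeta>
  have \<Lambda>x: "\<Lambda> \<zeta> *v x = x - (of_real \<delta> * cdot x (u \<zeta>)) *s u \<zeta>" for \<zeta> x
  proof -
    have "(\<Lambda> \<zeta> *v x) $ a = (x - (of_real \<delta> * cdot x (u \<zeta>)) *s u \<zeta>) $ a" for a
    proof -
      have "(\<Lambda> \<zeta> *v x) $ a = (\<Sum>b\<in>UNIV. (if a = b then x $ b else 0)) - (\<Sum>b\<in>UNIV. of_real \<delta> * (u \<zeta> $ a * cnj (u \<zeta> $ b)) * x $ b)"
        unfolding matrix_vector_mult_def \<Lambda>_def vec_lambda_beta sum_subtractf[symmetric]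
        by (intro sum.cong refl) (simp add: algebra_simps)
      also have "(\<Sum>b\<in>UNIV. (if a = b then x $ b else 0)) = x $ a" by simp
      also have "(\<Sum>b\<in>UNIV. of_real \<delta> * (u \<zeta> $ a * cnj (u \<zeta> $ b)) * x $ b) = of_real \<delta> * cdot x (u \<zeta>) * u \<zeta> $ a"
        by (simp add: cdot_def sum_distrib_left sum_distrib_right mult_ac)
      finally show ?thesis by simp
    qed
    then show ?thesis unfolding vec_eq_iff by (rule allI)
  qed
  have \<Lambda>_form: "Re (cdot (\<Lambda> \<zeta> *v x) x) = (norm x)\<^sup>2 - \<delta> * (norm (cdot x (u \<zeta>)))\<^sup>2" for \<zeta> x
  proof -
    have "cdot x (u \<zeta>) * cdot (u \<zeta>) x = of_real ((norm (cdot x (u \<zeta>)))\<^sup>2)"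
      unfolding cdot_cnj[of x "u \<zeta>", symmetric] by (rule complex_norm_square[symmetric])
    then have "cdot (\<Lambda> \<zeta> *v x) x = of_real ((norm x)\<^sup>2) - of_real (\<delta> * (norm (cdot x (u \<zeta>)))\<^sup>2)"
      unfolding \<Lambda>x cdot_diff_left cdot_scale_left cdot_self by (simp only: of_real_mult mult.assoc)
    then show ?thesis by (simp only: of_real_diff[symmetric] Re_complex_of_real)
  qed
  have \<Lambda>_contr: "norm (\<Lambda> \<zeta> *v x) \<le> norm x" for \<zeta> x
  proof (rule power2_le_imp_le)
    let ?c = "cdot x (u \<zeta>)"
    have "of_real ((norm (\<Lambda> \<zeta> *v x))\<^sup>2) = cdot (\<Lambda> \<zeta> *v x) x - cnj (of_real \<delta> * ?c) * cdot (\<Lambda> \<zeta> *v x) (u \<zeta>)"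
      unfolding cdot_self[symmetric] by (subst (2) \<Lambda>x) (simp only: cdot_diff_right cdot_scale_right)
    also have "cdot (\<Lambda> \<zeta> *v x) (u \<zeta>) = of_real (1 - \<delta> * (norm (u \<zeta>))\<^sup>2) * ?c"
      unfolding \<Lambda>x cdot_diff_left cdot_scale_left cdot_self by (simp add: algebra_simps)
    also have "cnj (of_real \<delta> * ?c) * (of_real (1 - \<delta> * (norm (u \<zeta>))\<^sup>2) * ?c) = of_real (\<delta> * (1 - \<delta> * (norm (u \<zeta>))\<^sup>2) * (norm ?c)\<^sup>2)"
      using complex_norm_square[of ?c] by simp
    finally have "(norm (\<Lambda> \<zeta> *v x))\<^sup>2 = Re (cdot (\<Lambda> \<zeta> *v x) x) - \<delta> * (1 - \<delta> * (norm (u \<zeta>))\<^sup>2) * (norm ?c)\<^sup>2"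
      by (metis Re_complex_of_real minus_complex.sel(1))
    also have "\<dots> \<le> (norm x)\<^sup>2"
    proof -
      have "(norm (u \<zeta>))\<^sup>2 \<le> 1" using u_le[of \<zeta>] by (simp add: power_le_one)
      then have "\<delta> * (norm (u \<zeta>))\<^sup>2 \<le> 1 * 1" using \<delta> by (intro mult_mono) auto
      then have "0 \<le> \<delta> * (1 - \<delta> * (norm (u \<zeta>))\<^sup>2) * (norm ?c)\<^sup>2" using \<delta> by (intro mult_nonneg_nonneg) auto
      moreover have "0 \<le> \<delta> * (norm ?c)\<^sup>2" using \<delta> by simp
      ultimately show ?thesis unfolding \<Lambda>_form by simp
    qed
    finally show "(norm (\<Lambda> \<zeta> *v x))\<^sup>2 \<le> (norm x)\<^sup>2" .
  qed simp
  have \<Lambda>_meas [measurable]: "\<Lambda> \<in> borel_measurable \<mu>" unfolding \<Lambda>_def[abs_def] by measurable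
  have \<Lambda>_Linf: "\<Lambda> \<in> Linf" by (rule LinfI[OF \<Lambda>_meas, of 1]) (simp add: \<Lambda>_contr)
  have \<Lambda>_adj: "adjoint_matrix (\<Lambda> \<zeta>) = \<Lambda> \<zeta>" for \<zeta>
    by (simp add: adjoint_matrix_def transpose_def \<Lambda>_def vec_eq_iff mult.commute)
  have dom: "hankel_dominated \<Lambda> U"
    unfolding hankel_dominated_def
  proof (intro ballI)
    fix k l :: "complex \<Rightarrow> complex ^ 'r" assume k: "k \<in> Hge 0" and l: "l \<in> Hlt 0"
    have kL: "k \<in> L2" and lL: "l \<in> L2" using k l HgeD(1) HltD(1) by blast+
    have [measurable]: "k \<in> borel_measurable \<mu>" using kL by auto
    have UkL: "(\<lambda>\<zeta>. U \<zeta> *v k \<zeta>) \<in> L2" by (rule U_L2[OF U_meas U_unitary kL])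
    obtain e where e: "e \<in> Hge 0" "AE \<zeta> in \<mu>. toeplitz U e \<zeta> = 0" "L2_norm (\<lambda>\<zeta>. k \<zeta> - e \<zeta>) \<le> C * L2_norm (toeplitz U k)"
      using C(2)[OF k] by blast
    have eL: "e \<in> L2" by (rule HgeD(1)[OF e(1)])
    have dL: "(\<lambda>\<zeta>. k \<zeta> - e \<zeta>) \<in> L2" by (rule L2_diff[OF kL eL])
    have cu: "(norm (cdot x (u \<zeta>)))\<^sup>2 \<le> (norm x)\<^sup>2" for x \<zeta>
    proof (rule power_mono)
      have "norm (cdot x (u \<zeta>)) \<le> norm x * norm (u \<zeta>)" by (rule norm_cdot_le)
      also have "\<dots> \<le> norm x * 1" using u_le by (intro mult_left_mono) auto
      finally show "norm (cdot x (u \<zeta>)) \<le> norm x" by simp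
    qed simp
    have cu_int: "integrable \<mu> (\<lambda>\<zeta>. (norm (cdot (k \<zeta>) (u \<zeta>)))\<^sup>2)"
      by (rule Bochner_Integration.integrable_bound[OF L2_integrable[OF kL]]) (auto simp: cu)
    have "(LINT \<zeta>|\<mu>. (norm (cdot (k \<zeta>) (u \<zeta>)))\<^sup>2) \<le> (LINT \<zeta>|\<mu>. (norm (k \<zeta> - e \<zeta>))\<^sup>2)"
    proof (rule integral_mono_AE[OF cu_int L2_integrable[OF dL]])
      show "AE \<zeta> in \<mu>. (norm (cdot (k \<zeta>) (u \<zeta>)))\<^sup>2 \<le> (norm (k \<zeta> - e \<zeta>))\<^sup>2"
        using ker_orth[OF e(1,2)]
      proof eventually_elim
        case (elim \<zeta>)
        have "cdot (k \<zeta>) (u \<zeta>) = cdot (k \<zeta> - e \<zeta>) (u \<zeta>)" unfolding cdot_u cdot_diff_left elim by simp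
        then show ?case using cu[of "k \<zeta> - e \<zeta>" \<zeta>] by simp
      qed
    qed
    also have "\<dots> = (L2_norm (\<lambda>\<zeta>. k \<zeta> - e \<zeta>))\<^sup>2" by (rule L2_norm_sq[symmetric])
    also have "\<dots> \<le> (C * L2_norm (toeplitz U k))\<^sup>2" using e(3) by (intro power_mono) auto
    finally have "\<delta> * (LINT \<zeta>|\<mu>. (norm (cdot (k \<zeta>) (u \<zeta>)))\<^sup>2) \<le> \<delta> * (C * L2_norm (toeplitz U k))\<^sup>2"
      using \<delta> by (intro mult_left_mono) auto
    also have "\<dots> = (\<delta> * C\<^sup>2) * (L2_norm (toeplitz U k))\<^sup>2" by (simp add: power_mult_distrib)
    also have "\<dots> \<le> 1 * (L2_norm (toeplitz U k))\<^sup>2" using \<delta> by (intro mult_right_mono) auto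
    finally have small: "\<delta> * (LINT \<zeta>|\<mu>. (norm (cdot (k \<zeta>) (u \<zeta>)))\<^sup>2) \<le> (L2_norm (toeplitz U k))\<^sup>2" by simp
    have LkL: "(\<lambda>\<zeta>. \<Lambda> \<zeta> *v k \<zeta>) \<in> L2" by (rule Linf_mult_L2[OF \<Lambda>_Linf kL])
    have "Re (L2_inner (\<lambda>\<zeta>. \<Lambda> \<zeta> *v k \<zeta>) k) = (LINT \<zeta>|\<mu>. Re (cdot (\<Lambda> \<zeta> *v k \<zeta>) (k \<zeta>)))"
      unfolding L2_inner_cdot by (rule integral_Re[OF integrable_cdot[OF LkL kL], symmetric])
    also have "\<dots> = (L2_norm k)\<^sup>2 - \<delta> * (LINT \<zeta>|\<mu>. (norm (cdot (k \<zeta>) (u \<zeta>)))\<^sup>2)"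
      unfolding \<Lambda>_form L2_norm_sq using L2_integrable[OF kL] cu_int by simp
    finally have form: "(L2_norm (hankel U k))\<^sup>2 \<le> Re (L2_inner (\<lambda>\<zeta>. \<Lambda> \<zeta> *v k \<zeta>) k)"
      using small toeplitz_hankel_norm[OF U_meas U_unitary kL] by simp
    have HL: "hankel U k \<in> L2" by (rule HltD(1)[OF hankel_Hlt[OF U_meas U_unitary kL]])
    have "L2_inner (\<lambda>\<zeta>. U \<zeta> *v k \<zeta> - hankel U k \<zeta>) l = 0"
      unfolding hankel_def by (rule Hlt_orthogonal_Hge(2)[OF l P_minus_spec(2)[OF UkL]])
    then have "L2_inner (\<lambda>\<zeta>. U \<zeta> *v k \<zeta>) l = L2_inner (hankel U k) l"
      using L2_inner_diff_left[OF UkL HL lL] by simp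
    moreover have "- Re (L2_inner (hankel U k) l) \<le> L2_norm (hankel U k) * L2_norm l"
      using L2_Cauchy_Schwarz[OF HL lL] abs_Re_le_cmod[of "L2_inner (hankel U k) l"] by linarith
    moreover have "0 \<le> (L2_norm (hankel U k) - L2_norm l)\<^sup>2" by simp
    ultimately show "0 \<le> Re (L2_inner (\<lambda>\<zeta>. \<Lambda> \<zeta> *v k \<zeta>) k) + (L2_norm l)\<^sup>2 + 2 * Re (L2_inner (\<lambda>\<zeta>. U \<zeta> *v k \<zeta>) l)"
      using form by (simp add: power2_diff)
  qed
  have "AE \<zeta> in \<mu>. \<forall>x. norm (U \<zeta> *v x) \<le> norm x"
    using U_unitary by eventually_elim (simp add: unitary_norm)
  from weighted_nehari[OF U_Linf[OF U_meas U_unitary] this \<Lambda>_Linf _ _ dom]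
  obtain F where F: "F \<in> Hinf" and Fle: "AE \<zeta> in \<mu>. \<forall>x. (norm ((U \<zeta> - F \<zeta>) *v x))\<^sup>2 \<le> Re (cdot (\<Lambda> \<zeta> *v x) x)"
    by (auto simp: \<Lambda>_adj \<Lambda>_contr)
  have 1: "AE \<zeta> in \<mu>. op_norm (U \<zeta> - F \<zeta>) \<le> 1"
    using Fle
  proof eventually_elim
    case (elim \<zeta>)
    have "norm ((U \<zeta> - F \<zeta>) *v x) \<le> 1 * norm x" for x
    proof (rule power2_le_imp_le)
      have "0 \<le> \<delta> * (norm (cdot x (u \<zeta>)))\<^sup>2" using \<delta> by simp
      then show "(norm ((U \<zeta> - F \<zeta>) *v x))\<^sup>2 \<le> (1 * norm x)\<^sup>2"
        using spec[OF elim, of x] unfolding \<Lambda>_form mult_1 by linarith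
    qed simp
    then show ?case by (rule op_norm_le)
  qed
  have 2: "AE \<zeta> in \<mu>. sing_val (CARD('r) - 1) (U \<zeta> - F \<zeta>) \<le> sqrt (1 - \<delta>)"
    using Fle u_one
  proof eventually_elim
    case (elim \<zeta>)
    have "cdot (u \<zeta>) (u \<zeta>) = 1" using elim(2) by (simp add: cdot_self)
    then have "(norm ((U \<zeta> - F \<zeta>) *v u \<zeta>))\<^sup>2 \<le> 1 - \<delta>"
      using spec[OF elim(1), of "u \<zeta>"] elim(2) unfolding \<Lambda>_form by simp
    then have "norm ((U \<zeta> - F \<zeta>) *v u \<zeta>) \<le> sqrt (1 - \<delta>)" by (rule real_le_rsqrt)
    then show ?case using last_sing_val_le[OF elim(2), of "U \<zeta> - F \<zeta>"] by simp
  qed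
  have "sqrt (1 - \<delta>) < 1" using \<delta> by simp
  then show thesis by (rule that[OF F _ 1 2])
qed

end

theorem theorem10p1:
  fixes U :: "complex \<Rightarrow> complex ^ 'r ^ 'r"
  assumes "U \<in> borel_measurable circle_measure"
    and "AE \<zeta> in circle_measure. unitary_matrix (U \<zeta>)"
    and "ess_norm H2 H2_minus (hankel U) < 1"
  shows "(very_badly_approximable U \<longleftrightarrow>
            dense_range H2 H2 (toeplitz (\<lambda>\<zeta>. map_matrix ((*) \<zeta>) (U \<zeta>)))) \<and>
         (dense_range H2 H2 (toeplitz (\<lambda>\<zeta>. map_matrix ((*) \<zeta>) (U \<zeta>))) \<longleftrightarrow>
            trivial_kernel H2 (toeplitz (\<lambda>\<zeta>. map_matrix ((*) (cnj \<zeta>)) (adjoint_matrix (U \<zeta>)))))"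
proof -
  note U = assms(1,2)
  have "very_badly_approximable U"
    if dense: "dense_range H2 H2 (toeplitz (\<lambda>\<zeta>. map_matrix ((*) \<zeta>) (U \<zeta>)))"
  proof (rule very_badly_approximable_if[OF U])
    fix F assume F: "F \<in> Hinf" "AE \<zeta> in \<mu>. op_norm (U \<zeta> - F \<zeta>) \<le> 1"
    show "\<not> (AE \<zeta> in \<mu>. F \<zeta> \<noteq> 0)"
      by (rule approximant_zero[OF U dense_range_imp_surj[OF U assms(3) dense] F(1)])
         (use F(2) in \<open>simp_all add: op_norm_le_one_iff[OF U]\<close>)
  qed
  moreover have "trivial_kernel H2 (toeplitz_adj U)" if "very_badly_approximable U"
  proof (rule ccontr)
    assume "\<not> trivial_kernel H2 (toeplitz_adj U)"
    then obtain f where f: "f \<in> Hge 0" "AE \<zeta> in \<mu>. toeplitz_adj U f \<zeta> = 0" "\<not> (AE \<zeta> in \<mu>. f \<zeta> = 0)"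
      unfolding trivial_kernel_def H2_eq_Hge by blast
    obtain F q where "F \<in> Hinf" "q < 1" "AE \<zeta> in \<mu>. op_norm (U \<zeta> - F \<zeta>) \<le> 1"
      "AE \<zeta> in \<mu>. sing_val (CARD('r) - 1) (U \<zeta> - F \<zeta>) \<le> q"
      by (rule kernel_gives_approximant[OF U assms(3) f])
    then show False using not_very_badly_approximable[OF U] that by blast
  qed
  ultimately show ?thesis using dense_range_iff_trivial_kernel[OF U] by blast
qed

end
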